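(* Let $k$ be a field containing a primitive fourth root of unity $\mathfrak q$, and let $H_{\mathfrak q}(16)=k[C_2]\otimes H_{\mathfrak q}(8)$ with algebra generators $g_1,g_2,x$. The only pair $(\sigma,v)$, with $\sigma:H_{\mathfrak q}(16)\to k$ an algebra morphism and $v\in H_{\mathfrak q}(16)$, satisfying $$\sigma(v)=-1,\quad\varepsilon(v)=1,\quad\Delta(v)=\sigma(y^1x^3X^2)\,x^1X^1vy^2\otimes x^2vX^3y^3,$$ and $\sigma(h_2)h_1v=\sigma(h_1)vh_2$ for all $h\in H_{\mathfrak q}(16)$, is given by the $k$-algebra morphism $\sigma$ determined by $\sigma(g_1)=1$, $\sigma(g_2)=-1$, $\sigma(x)=0$, and the element $v=g_2$. Furthermore, $H_{\mathfrak q}(16)(\theta)_{\sigma,v}$ is a $32$-dimensional quasi-Hopf algebra isomorphic to the tensor product quasi-Hopf algebra of $H_4$ and $H_{\mathfrak q}(8)$.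
   Context: A quasi-Hopf algebra is $(H,\Delta,\varepsilon,\Phi,S,\alpha,\beta)$ where $H$ is a unital associative algebra, $\Phi\in H^{\otimes3}$ is invertible, $\Delta,\varepsilon$ are algebra maps with $(\mathrm{id}\otimes\Delta)\Delta(h)=\Phi(\Delta\otimes\mathrm{id})(\Delta(h))\Phi^{-1}$, $(\mathrm{id}\otimes\varepsilon)\Delta=\mathrm{id}=(\varepsilon\otimes\mathrm{id})\Delta$, $(\mathrm{id}\otimes\varepsilon\otimes\mathrm{id})(\Phi)=1\otimes1$, $(1\otimes\Phi)(\mathrm{id}\otimes\Delta\otimes\mathrm{id})(\Phi)(\Phi\otimes1)=(\mathrm{id}\otimes\mathrm{id}\otimes\Delta)(\Phi)(\Delta\otimes\mathrm{id}\otimes\mathrm{id})(\Phi)$, $S$ is an algebra anti-morphism, $\alpha,\beta\in H$, with $S(h_1)\alpha h_2=\varepsilon(h)\alpha$, $h_1\beta S(h_2)=\varepsilon(h)\beta$, $X^1\beta S(X^2)\alpha X^3=1$, $S(x^1)\alpha x^2\beta S(x^3)=1$. Notation: $\Delta(h)=h_1\otimes h_2$, $\Phi=X^1\otimes X^2\otimes X^3$, $\Phi^{-1}=x^1\otimes x^2\otimes x^3=y^1\otimes y^2\otimes y^3$ (summation understood; different letters are independent copies; in these formulas $x^i$ are tensor components of $\Phi^{-1}$, not the generator $x$). $H_{\mathfrak q}(8)$ is the unital algebra generated by $g_1,x$ with relations $g_1^2=1$, $x^4=0$, $g_1x=-xg_1$; with $p_\pm=\frac12(1\pm g_1)$, its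 quasi-Hopf structure is $\Phi=1-2p_-\otimes p_-\otimes p_-$, $\Delta(g_1)=g_1\otimes g_1$, $\varepsilon(g_1)=1$, $S(g_1)=g_1$, $\Delta(x)=x\otimes(p_++\mathfrak qp_-)+1\otimes p_+x+g_1\otimes p_-x$, $\varepsilon(x)=0$, $S(x)=-x(p_++\mathfrak qp_-)$, $\alpha=g_1$, $\beta=1$. In $H_{\mathfrak q}(16)=k[C_2]\otimes H_{\mathfrak q}(8)$, $g_2$ is the grouplike generator of $C_2$ ($g_2^2=1$, $g_2$ commutes with $H_{\mathfrak q}(8)$, which is a quasi-Hopf subalgebra with the same $\Phi,\alpha,\beta$). For a quasi-Hopf algebra $H$ and $(\sigma,v)$ satisfying the displayed conditions over $H$, $H(\theta)_{\sigma,v}$ is the unital algebra generated by $\theta$ and $H$ with relations $\theta^2=0$, $h\theta=\sigma(h_1)\theta h_2$, with $H$ a quasi-Hopf subalgebra (same $\Phi,\alpha,\beta$), $\varepsilon(\theta)=0$, $\Delta(\theta)=\sigma(X^2x^1)X^1vx^2\otimes\theta X^3x^3+\sigma(x^1)\theta x^2\otimes x^3$, $S(\theta)=-\sigma(X^2x^1_2)S(X^1x^1_1v)\alpha\theta X^3x^2\beta S(x^3)$. $H_4$ is Sweedler's Hopf algebra: generators $g,x$, relations $g^2=1$, $x^2=0$, $xg=-gx$, $\Delta(g)=g\otimes g$, $\Delta(x)=g\otimes x+x\otimes1$, $\varepsilon(g)=1$, $\varepsilon(x)=0$, $S(g)=g$, $S(x)=-gx$. *)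

theory Defs
  imports "HOL-Algebra.Algebra" "HOL-Library.Poly_Mapping"
begin

section \<open>Algebras over a field\<close>

text \<open>
  The ground field is a type \<open>'k\<close> of class \<^class>\<open>field\<close>; \<open>scalars\<close> is this field as a record, and
  serves both as the coefficient ring and as the one-dimensional algebra. The locale
  \<^locale>\<open>algebra\<close> of the library is restricted to commutative algebras, hence \<open>k_algebra\<close>.
\<close>

definition scalars :: "('k::field, 'k) module" where
  "scalars = \<lparr>carrier = UNIV, monoid.mult = (*), one = 1, ring.zero = 0, add = (+), smult = (*)\<rparr>"

definition k_algebra :: "('k::field, 'a, 'm) module_scheme \<Rightarrow> bool" where
  "k_algebra A \<longleftrightarrow> ring A \<and> module scalars A \<and>
     (\<forall>c. \<forall>a\<in>carrier A. \<forall>b\<in>carrier A.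
        (c \<odot>\<^bsub>A\<^esub> a) \<otimes>\<^bsub>A\<^esub> b = c \<odot>\<^bsub>A\<^esub> (a \<otimes>\<^bsub>A\<^esub> b) \<and>
        a \<otimes>\<^bsub>A\<^esub> (c \<odot>\<^bsub>A\<^esub> b) = c \<odot>\<^bsub>A\<^esub> (a \<otimes>\<^bsub>A\<^esub> b))"

definition alg_hom ::
    "('k::field, 'a, 'm) module_scheme \<Rightarrow> ('k, 'b, 'n) module_scheme \<Rightarrow> ('a \<Rightarrow> 'b) set" where
  "alg_hom A B = {f \<in> ring_hom A B. \<forall>c. \<forall>a\<in>carrier A. f (c \<odot>\<^bsub>A\<^esub> a) = c \<odot>\<^bsub>B\<^esub> f a}"

definition op_alg :: "('k, 'a, 'm) module_scheme \<Rightarrow> ('k, 'a, 'm) module_scheme" where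
  "op_alg A = A\<lparr>monoid.mult := \<lambda>a b. b \<otimes>\<^bsub>A\<^esub> a\<rparr>"

definition has_dimension :: "('k::field, 'a, 'm) module_scheme \<Rightarrow> nat \<Rightarrow> bool" where
  "has_dimension A n \<longleftrightarrow> (\<exists>B \<subseteq> carrier A. finite B \<and> card B = n \<and>
     (\<forall>a\<in>carrier A. \<exists>!c. c \<in> B \<rightarrow>\<^sub>E UNIV \<and> a = (\<Oplus>\<^bsub>A\<^esub>b\<in>B. c b \<odot>\<^bsub>A\<^esub> b)))"

section \<open>Free and quotient constructions\<close>

definition monoid_algebra :: "('m, 'r) monoid_scheme \<Rightarrow> ('k::field, 'm \<Rightarrow>\<^sub>0 'k) module" where
  "monoid_algebra M =
     \<lparr>carrier = {f. Poly_Mapping.keys f \<subseteq> carrier M},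
      monoid.mult = (\<lambda>f g. \<Sum>a\<in>Poly_Mapping.keys f. \<Sum>b\<in>Poly_Mapping.keys g.
                Poly_Mapping.single (a \<otimes>\<^bsub>M\<^esub> b) (Poly_Mapping.lookup f a * Poly_Mapping.lookup g b)),
      one = Poly_Mapping.single \<one>\<^bsub>M\<^esub> 1,
      ring.zero = 0,
      add = (+),
      smult = (\<lambda>c. Poly_Mapping.map ((*) c))\<rparr>"

abbreviation mon :: "'m \<Rightarrow> ('m \<Rightarrow>\<^sub>0 'k::field)" where
  "mon m \<equiv> Poly_Mapping.single m 1"

definition lin_ext ::
    "('k::field, 'b, 'n) module_scheme \<Rightarrow> ('m \<Rightarrow> 'b) \<Rightarrow> ('m \<Rightarrow>\<^sub>0 'k) \<Rightarrow> 'b" where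
  "lin_ext B \<phi> f = (\<Oplus>\<^bsub>B\<^esub>m\<in>Poly_Mapping.keys f. Poly_Mapping.lookup f m \<odot>\<^bsub>B\<^esub> \<phi> m)"

definition quot_algebra ::
    "('k::field, 'a, 'm) module_scheme \<Rightarrow> 'a set \<Rightarrow> ('k, 'a set) module" where
  "quot_algebra A I =
     \<lparr>carrier = carrier (A Quot I), monoid.mult = monoid.mult (A Quot I), one = monoid.one (A Quot I),
      ring.zero = ring.zero (A Quot I), add = ring.add (A Quot I),
      smult = (\<lambda>c U. \<Union>u\<in>U. I +>\<^bsub>A\<^esub> (c \<odot>\<^bsub>A\<^esub> u))\<rparr>"

text \<open>
  Presentations: the algebra with generators \<open>V\<close> and relators \<open>R\<close> is the quotient of the free
  algebra on \<open>V\<close> (words as basis) by the two-sided ideal generated by \<open>R\<close>.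
  \<open>pres_lift C f\<close> is the algebra morphism into \<open>C\<close> that extends an assignment \<open>f\<close> of the
  generators; it is meaningful exactly if \<open>f\<close> respects the relators.
\<close>

definition free_alg :: "'g set \<Rightarrow> ('k::field, 'g list \<Rightarrow>\<^sub>0 'k) module" where
  "free_alg V = monoid_algebra \<lparr>carrier = lists V, monoid.mult = (@), one = []\<rparr>"

definition pres_alg ::
    "'g set \<Rightarrow> ('g list \<Rightarrow>\<^sub>0 'k::field) set \<Rightarrow> ('k, ('g list \<Rightarrow>\<^sub>0 'k) set) module" where
  "pres_alg V R = quot_algebra (free_alg V) (Idl\<^bsub>free_alg V\<^esub> R)"

definition pres_gen ::
    "'g set \<Rightarrow> ('g list \<Rightarrow>\<^sub>0 'k::field) set \<Rightarrow> 'g \<Rightarrow> ('g list \<Rightarrow>\<^sub>0 'k) set" where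
  "pres_gen V R g = (Idl\<^bsub>free_alg V\<^esub> R) +>\<^bsub>free_alg V\<^esub> mon [g]"

definition pres_lift ::
    "('k::field, 'b, 'n) module_scheme \<Rightarrow> ('g \<Rightarrow> 'b) \<Rightarrow> ('g list \<Rightarrow>\<^sub>0 'k) set \<Rightarrow> 'b" where
  "pres_lift C f U = the_elem (lin_ext C (\<lambda>w. foldr (\<lambda>g y. f g \<otimes>\<^bsub>C\<^esub> y) w \<one>\<^bsub>C\<^esub>) ` U)"

section \<open>Tensor products\<close>

text \<open>
  \<open>A \<otimes> B\<close> is the free vector space on \<open>carrier A \<times> carrier B\<close> modulo the subspace spanned by the
  bilinearity relations; the product is induced from \<open>(a, b)(a', b') = (aa', bb')\<close>.
\<close>

inductive_set bilin ::
    "('k::field, 'a, 'm) module_scheme \<Rightarrow> ('k, 'b, 'n) module_scheme \<Rightarrow> ('a \<times> 'b \<Rightarrow>\<^sub>0 'k) set"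
  for A B where
  zero: "0 \<in> bilin A B"
| plus: "u \<in> bilin A B \<Longrightarrow> w \<in> bilin A B \<Longrightarrow> u + w \<in> bilin A B"
| scale: "u \<in> bilin A B \<Longrightarrow> Poly_Mapping.map ((*) c) u \<in> bilin A B"
| add_left: "a \<in> carrier A \<Longrightarrow> a' \<in> carrier A \<Longrightarrow> b \<in> carrier B \<Longrightarrow>
    mon (a \<oplus>\<^bsub>A\<^esub> a', b) - mon (a, b) - mon (a', b) \<in> bilin A B"
| add_right: "a \<in> carrier A \<Longrightarrow> b \<in> carrier B \<Longrightarrow> b' \<in> carrier B \<Longrightarrow>
    mon (a, b \<oplus>\<^bsub>B\<^esub> b') - mon (a, b) - mon (a, b') \<in> bilin A B"
| smult_left: "a \<in> carrier A \<Longrightarrow> b \<in> carrier B \<Longrightarrow>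
    mon (c \<odot>\<^bsub>A\<^esub> a, b) - Poly_Mapping.single (a, b) c \<in> bilin A B"
| smult_right: "a \<in> carrier A \<Longrightarrow> b \<in> carrier B \<Longrightarrow>
    mon (a, c \<odot>\<^bsub>B\<^esub> b) - Poly_Mapping.single (a, b) c \<in> bilin A B"

type_synonym ('k, 'a, 'b) tensor = "('a \<times> 'b \<Rightarrow>\<^sub>0 'k) set"

definition tensor_alg ::
    "('k::field, 'a, 'm) module_scheme \<Rightarrow> ('k, 'b, 'n) module_scheme \<Rightarrow>
     ('k, ('k, 'a, 'b) tensor) module" where
  "tensor_alg A B = quot_algebra (monoid_algebra (A \<times>\<times> B)) (bilin A B)"

definition tens ::
    "('k::field, 'a, 'm) module_scheme \<Rightarrow> ('k, 'b, 'n) module_scheme \<Rightarrow>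
     'a \<Rightarrow> 'b \<Rightarrow> ('k, 'a, 'b) tensor" where
  "tens A B a b = bilin A B +>\<^bsub>monoid_algebra (A \<times>\<times> B)\<^esub> mon (a, b)"

text \<open>
  Sweedler notation: for \<open>t = \<Sum>a \<otimes> b\<close> and bilinear \<open>f\<close> with values in \<open>C\<close>, \<open>lift2 C t f\<close> is
  \<open>\<Sum>f a b\<close>. Threefold tensors are nested to the right, and \<open>lift3\<close> is the trilinear analogue.
\<close>

definition lift2 ::
    "('k::field, 'c, 'n) module_scheme \<Rightarrow> ('k, 'a, 'b) tensor \<Rightarrow> ('a \<Rightarrow> 'b \<Rightarrow> 'c) \<Rightarrow> 'c" where
  "lift2 C t f = the_elem (lin_ext C (\<lambda>(a, b). f a b) ` t)"

definition lift3 ::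
    "('k::field, 'd, 'n) module_scheme \<Rightarrow> ('k, 'a, ('k, 'b, 'c) tensor) tensor \<Rightarrow>
     ('a \<Rightarrow> 'b \<Rightarrow> 'c \<Rightarrow> 'd) \<Rightarrow> 'd" where
  "lift3 C t f = lift2 C t (\<lambda>a u. lift2 C u (\<lambda>b c. f a b c))"

type_synonym ('k, 'a) tensor2 = "('k, 'a, 'a) tensor"
type_synonym ('k, 'a) tensor3 = "('k, 'a, ('k, 'a) tensor2) tensor"
type_synonym ('k, 'a) tensor4 = "('k, 'a, ('k, 'a) tensor3) tensor"

definition T2 :: "('k::field, 'a, 'm) module_scheme \<Rightarrow> ('k, ('k, 'a) tensor2) module" where
  "T2 A = tensor_alg A A"

definition T3 :: "('k::field, 'a, 'm) module_scheme \<Rightarrow> ('k, ('k, 'a) tensor3) module" where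
  "T3 A = tensor_alg A (T2 A)"

definition T4 :: "('k::field, 'a, 'm) module_scheme \<Rightarrow> ('k, ('k, 'a) tensor4) module" where
  "T4 A = tensor_alg A (T3 A)"

definition t2 :: "('k::field, 'a, 'm) module_scheme \<Rightarrow> 'a \<Rightarrow> 'a \<Rightarrow> ('k, 'a) tensor2" where
  "t2 A a b = tens A A a b"

definition t3 :: "('k::field, 'a, 'm) module_scheme \<Rightarrow> 'a \<Rightarrow> 'a \<Rightarrow> 'a \<Rightarrow> ('k, 'a) tensor3" where
  "t3 A a b c = tens A (T2 A) a (t2 A b c)"

definition t4 ::
    "('k::field, 'a, 'm) module_scheme \<Rightarrow> 'a \<Rightarrow> 'a \<Rightarrow> 'a \<Rightarrow> 'a \<Rightarrow> ('k, 'a) tensor4" where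
  "t4 A a b c d = tens A (T3 A) a (t3 A b c d)"

section \<open>Quasi-Hopf algebras\<close>

record (overloaded) ('k::zero, 'a) quasi_hopf = "('k, 'a) module" +
  comult :: "'a \<Rightarrow> ('k, 'a) tensor2"
  counit :: "'a \<Rightarrow> 'k"
  reassoc :: "('k, 'a) tensor3"
  antipode :: "'a \<Rightarrow> 'a"
  alpha :: 'a
  beta :: 'a

definition with_structure ::
    "('k::zero, 'a) module \<Rightarrow> ('a \<Rightarrow> ('k, 'a) tensor2) \<Rightarrow> ('a \<Rightarrow> 'k) \<Rightarrow> ('k, 'a) tensor3 \<Rightarrow>
     ('a \<Rightarrow> 'a) \<Rightarrow> 'a \<Rightarrow> 'a \<Rightarrow> ('k, 'a) quasi_hopf" where
  "with_structure A \<Delta> \<epsilon> \<Phi> S \<alpha> \<beta> = module.extend A (quasi_hopf.fields \<Delta> \<epsilon> \<Phi> S \<alpha> \<beta>)"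

definition reassoc_inv :: "('k::field, 'a) quasi_hopf \<Rightarrow> ('k, 'a) tensor3" where
  "reassoc_inv H = inv\<^bsub>T3 H\<^esub> (reassoc H)"

definition quasi_hopf_algebra :: "('k::field, 'a) quasi_hopf \<Rightarrow> bool" where
  "quasi_hopf_algebra H \<longleftrightarrow>
    (let \<Delta> = comult H; \<epsilon> = counit H; \<Phi> = reassoc H; S = antipode H;
         \<alpha> = alpha H; \<beta> = beta H in
     k_algebra H \<and>
     \<Delta> \<in> alg_hom H (T2 H) \<and>
     \<epsilon> \<in> alg_hom H scalars \<and>
     \<Phi> \<in> Units (T3 H) \<and>
     \<comment> \<open>\<open>(id \<otimes> \<Delta>)(\<Delta>(h)) = \<Phi> (\<Delta> \<otimes> id)(\<Delta>(h)) inv \<Phi>\<close>\<close>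
     (\<forall>h\<in>carrier H.
        lift2 (T3 H) (\<Delta> h) (\<lambda>a b. tens H (T2 H) a (\<Delta> b)) =
        \<Phi> \<otimes>\<^bsub>T3 H\<^esub>
          lift2 (T3 H) (\<Delta> h) (\<lambda>a b. lift2 (T3 H) (\<Delta> a) (\<lambda>a1 a2. t3 H a1 a2 b))
        \<otimes>\<^bsub>T3 H\<^esub> reassoc_inv H) \<and>
     (\<forall>h\<in>carrier H.
        lift2 H (\<Delta> h) (\<lambda>a b. \<epsilon> b \<odot>\<^bsub>H\<^esub> a) = h \<and>
        lift2 H (\<Delta> h) (\<lambda>a b. \<epsilon> a \<odot>\<^bsub>H\<^esub> b) = h) \<and>
     lift3 (T2 H) \<Phi> (\<lambda>X1 X2 X3. \<epsilon> X2 \<odot>\<^bsub>T2 H\<^esub> t2 H X1 X3) = t2 H \<one>\<^bsub>H\<^esub> \<one>\<^bsub>H\<^esub> \<and>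
     \<comment> \<open>\<open>(1 \<otimes> \<Phi>) (id \<otimes> \<Delta> \<otimes> id)(\<Phi>) (\<Phi> \<otimes> 1) = (id \<otimes> id \<otimes> \<Delta>)(\<Phi>) (\<Delta> \<otimes> id \<otimes> id)(\<Phi>)\<close>\<close>
     tens H (T3 H) \<one>\<^bsub>H\<^esub> \<Phi>
       \<otimes>\<^bsub>T4 H\<^esub>
         lift3 (T4 H) \<Phi> (\<lambda>X1 X2 X3. lift2 (T4 H) (\<Delta> X2) (\<lambda>a b. t4 H X1 a b X3))
       \<otimes>\<^bsub>T4 H\<^esub> lift3 (T4 H) \<Phi> (\<lambda>X1 X2 X3. t4 H X1 X2 X3 \<one>\<^bsub>H\<^esub>)
     = lift3 (T4 H) \<Phi> (\<lambda>X1 X2 X3. lift2 (T4 H) (\<Delta> X3) (\<lambda>a b. t4 H X1 X2 a b))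
       \<otimes>\<^bsub>T4 H\<^esub>
         lift3 (T4 H) \<Phi> (\<lambda>X1 X2 X3. lift2 (T4 H) (\<Delta> X1) (\<lambda>a b. t4 H a b X2 X3)) \<and>
     S \<in> alg_hom H (op_alg H) \<and>
     \<alpha> \<in> carrier H \<and> \<beta> \<in> carrier H \<and>
     (\<forall>h\<in>carrier H.
        lift2 H (\<Delta> h) (\<lambda>a b. S a \<otimes>\<^bsub>H\<^esub> \<alpha> \<otimes>\<^bsub>H\<^esub> b) = \<epsilon> h \<odot>\<^bsub>H\<^esub> \<alpha> \<and>
        lift2 H (\<Delta> h) (\<lambda>a b. a \<otimes>\<^bsub>H\<^esub> \<beta> \<otimes>\<^bsub>H\<^esub> S b) = \<epsilon> h \<odot>\<^bsub>H\<^esub> \<beta>) \<and>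
     lift3 H \<Phi> (\<lambda>X1 X2 X3. X1 \<otimes>\<^bsub>H\<^esub> \<beta> \<otimes>\<^bsub>H\<^esub> S X2 \<otimes>\<^bsub>H\<^esub> \<alpha> \<otimes>\<^bsub>H\<^esub> X3) = \<one>\<^bsub>H\<^esub> \<and>
     lift3 H (reassoc_inv H)
       (\<lambda>x1 x2 x3. S x1 \<otimes>\<^bsub>H\<^esub> \<alpha> \<otimes>\<^bsub>H\<^esub> x2 \<otimes>\<^bsub>H\<^esub> \<beta> \<otimes>\<^bsub>H\<^esub> S x3) = \<one>\<^bsub>H\<^esub>)"

definition quasi_hopf_iso ::
    "('k::field, 'a) quasi_hopf \<Rightarrow> ('k, 'b) quasi_hopf \<Rightarrow> ('a \<Rightarrow> 'b) set" where
  "quasi_hopf_iso H K = {f \<in> alg_hom H K. bij_betw f (carrier H) (carrier K) \<and>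
     (\<forall>h\<in>carrier H.
        comult K (f h) = lift2 (T2 K) (comult H h) (\<lambda>a b. t2 K (f a) (f b)) \<and>
        counit K (f h) = counit H h \<and>
        antipode K (f h) = f (antipode H h)) \<and>
     reassoc K = lift3 (T3 K) (reassoc H) (\<lambda>X1 X2 X3. t3 K (f X1) (f X2) (f X3)) \<and>
     alpha K = f (alpha H) \<and> beta K = f (beta H)}"

definition quasi_hopf_isomorphic ::
    "('k::field, 'a) quasi_hopf \<Rightarrow> ('k, 'b) quasi_hopf \<Rightarrow> bool" where
  "quasi_hopf_isomorphic H K \<longleftrightarrow> quasi_hopf_iso H K \<noteq> {}"

definition quasi_hopf_tensor ::
    "('k::field, 'a) quasi_hopf \<Rightarrow> ('k, 'b) quasi_hopf \<Rightarrow>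
     ('k, ('k, 'a, 'b) tensor) quasi_hopf" where
  "quasi_hopf_tensor H K =
    (let T = tensor_alg H K in
     with_structure T
       (\<lambda>u. lift2 (T2 T) u (\<lambda>h k.
          lift2 (T2 T) (comult H h) (\<lambda>h1 h2. lift2 (T2 T) (comult K k) (\<lambda>k1 k2.
            t2 T (tens H K h1 k1) (tens H K h2 k2)))))
       (\<lambda>u. lift2 scalars u (\<lambda>h k. counit H h * counit K k))
       (lift3 (T3 T) (reassoc H) (\<lambda>X1 X2 X3. lift3 (T3 T) (reassoc K) (\<lambda>Y1 Y2 Y3.
          t3 T (tens H K X1 Y1) (tens H K X2 Y2) (tens H K X3 Y3))))
       (\<lambda>u. lift2 T u (\<lambda>h k. tens H K (antipode H h) (antipode K k)))
       (tens H K (alpha H) (alpha K))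
       (tens H K (beta H) (beta K)))"

section \<open>The algebras $k[C_2]$, $H_4$, $H_q(8)$ and $H_q(16)$\<close>

text \<open>A Hopf algebra is the case of trivial reassociator and \<open>\<alpha> = \<beta> = 1\<close>.\<close>

definition group_hopf :: "'g monoid \<Rightarrow> ('k::field, 'g \<Rightarrow>\<^sub>0 'k) quasi_hopf" where
  "group_hopf G =
    (let A = monoid_algebra G in
     with_structure A
       (lin_ext (T2 A) (\<lambda>g. t2 A (mon g) (mon g)))
       (lin_ext scalars (\<lambda>g. 1))
       \<one>\<^bsub>T3 A\<^esub>
       (lin_ext A (\<lambda>g. mon (inv\<^bsub>G\<^esub> g)))
       \<one>\<^bsub>A\<^esub> \<one>\<^bsub>A\<^esub>)"

definition kC2 :: "('k::field, int \<Rightarrow>\<^sub>0 'k) quasi_hopf" where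
  "kC2 = group_hopf (integer_mod_group 2)"

datatype gen = Gen_g | Gen_x

definition sweedler_rels :: "(gen list \<Rightarrow>\<^sub>0 'k::field) set" where
  "sweedler_rels =
    {mon [Gen_g, Gen_g] - mon [], mon [Gen_x, Gen_x], mon [Gen_x, Gen_g] + mon [Gen_g, Gen_x]}"

definition sweedler :: "('k::field, (gen list \<Rightarrow>\<^sub>0 'k) set) quasi_hopf" where
  "sweedler =
    (let A = pres_alg UNIV sweedler_rels;
         g = pres_gen UNIV sweedler_rels Gen_g;
         x = pres_gen UNIV sweedler_rels Gen_x in
     with_structure A
       (pres_lift (T2 A) (\<lambda>s. case s of
           Gen_g \<Rightarrow> t2 A g g
         | Gen_x \<Rightarrow> t2 A g x \<oplus>\<^bsub>T2 A\<^esub> t2 A x \<one>\<^bsub>A\<^esub>))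
       (pres_lift scalars (\<lambda>s. case s of Gen_g \<Rightarrow> 1 | Gen_x \<Rightarrow> 0))
       \<one>\<^bsub>T3 A\<^esub>
       (pres_lift (op_alg A) (\<lambda>s. case s of Gen_g \<Rightarrow> g | Gen_x \<Rightarrow> \<ominus>\<^bsub>A\<^esub> (g \<otimes>\<^bsub>A\<^esub> x)))
       \<one>\<^bsub>A\<^esub> \<one>\<^bsub>A\<^esub>)"

definition H8_rels :: "(gen list \<Rightarrow>\<^sub>0 'k::field) set" where
  "H8_rels =
    {mon [Gen_g, Gen_g] - mon [], mon [Gen_x, Gen_x, Gen_x, Gen_x],
     mon [Gen_g, Gen_x] + mon [Gen_x, Gen_g]}"

definition H8 :: "'k::field \<Rightarrow> ('k, (gen list \<Rightarrow>\<^sub>0 'k) set) quasi_hopf" where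
  "H8 q =
    (let A = pres_alg UNIV H8_rels;
         g = pres_gen UNIV H8_rels Gen_g;
         x = pres_gen UNIV H8_rels Gen_x;
         pp = (1 / 2) \<odot>\<^bsub>A\<^esub> (\<one>\<^bsub>A\<^esub> \<oplus>\<^bsub>A\<^esub> g);
         pm = (1 / 2) \<odot>\<^bsub>A\<^esub> (\<one>\<^bsub>A\<^esub> \<ominus>\<^bsub>A\<^esub> g) in
     with_structure A
       (pres_lift (T2 A) (\<lambda>s. case s of
           Gen_g \<Rightarrow> t2 A g g
         | Gen_x \<Rightarrow> t2 A x (pp \<oplus>\<^bsub>A\<^esub> q \<odot>\<^bsub>A\<^esub> pm)
                 \<oplus>\<^bsub>T2 A\<^esub> t2 A \<one>\<^bsub>A\<^esub> (pp \<otimes>\<^bsub>A\<^esub> x)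
                 \<oplus>\<^bsub>T2 A\<^esub> t2 A g (pm \<otimes>\<^bsub>A\<^esub> x)))
       (pres_lift scalars (\<lambda>s. case s of Gen_g \<Rightarrow> 1 | Gen_x \<Rightarrow> 0))
       (\<one>\<^bsub>T3 A\<^esub> \<ominus>\<^bsub>T3 A\<^esub> (2 \<odot>\<^bsub>T3 A\<^esub> t3 A pm pm pm))
       (pres_lift (op_alg A) (\<lambda>s. case s of
           Gen_g \<Rightarrow> g
         | Gen_x \<Rightarrow> \<ominus>\<^bsub>A\<^esub> (x \<otimes>\<^bsub>A\<^esub> (pp \<oplus>\<^bsub>A\<^esub> q \<odot>\<^bsub>A\<^esub> pm))))
       g \<one>\<^bsub>A\<^esub>)"

definition H16 :: "'k::field \<Rightarrow> ('k, ('k, int \<Rightarrow>\<^sub>0 'k, (gen list \<Rightarrow>\<^sub>0 'k) set) tensor) quasi_hopf" where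
  "H16 q = quasi_hopf_tensor kC2 (H8 q)"

definition g1 :: "'k::field \<Rightarrow> ('k, int \<Rightarrow>\<^sub>0 'k, (gen list \<Rightarrow>\<^sub>0 'k) set) tensor" where
  "g1 q = tens kC2 (H8 q) \<one>\<^bsub>kC2\<^esub> (pres_gen UNIV H8_rels Gen_g)"

definition g2 :: "'k::field \<Rightarrow> ('k, int \<Rightarrow>\<^sub>0 'k, (gen list \<Rightarrow>\<^sub>0 'k) set) tensor" where
  "g2 q = tens kC2 (H8 q) (mon 1) \<one>\<^bsub>H8 q\<^esub>"

definition x16 :: "'k::field \<Rightarrow> ('k, int \<Rightarrow>\<^sub>0 'k, (gen list \<Rightarrow>\<^sub>0 'k) set) tensor" where
  "x16 q = tens kC2 (H8 q) \<one>\<^bsub>kC2\<^esub> (pres_gen UNIV H8_rels Gen_x)"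

section \<open>The extension $H(\theta)_{\sigma,v}$\<close>

text \<open>
  Algebra morphisms to \<open>k\<close>, taken extensional (\<^const>\<open>undefined\<close> off the carrier) so that equality
  of morphisms is equality of functions.
\<close>

definition characters :: "('k::field, 'a) quasi_hopf \<Rightarrow> ('a \<Rightarrow> 'k) set" where
  "characters H = alg_hom H scalars \<inter> extensional (carrier H)"

definition theta_datum :: "('k::field, 'a) quasi_hopf \<Rightarrow> ('a \<Rightarrow> 'k) \<Rightarrow> 'a \<Rightarrow> bool" where
  "theta_datum H \<sigma> v \<longleftrightarrow>
     \<sigma> v = -1 \<and> counit H v = 1 \<and>
     comult H v =
       lift3 (T2 H) (reassoc_inv H) (\<lambda>x1 x2 x3.
         lift3 (T2 H) (reassoc_inv H) (\<lambda>y1 y2 y3.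
           lift3 (T2 H) (reassoc H) (\<lambda>X1 X2 X3.
             \<sigma> (y1 \<otimes>\<^bsub>H\<^esub> x3 \<otimes>\<^bsub>H\<^esub> X2) \<odot>\<^bsub>T2 H\<^esub>
               t2 H (x1 \<otimes>\<^bsub>H\<^esub> X1 \<otimes>\<^bsub>H\<^esub> v \<otimes>\<^bsub>H\<^esub> y2) (x2 \<otimes>\<^bsub>H\<^esub> v \<otimes>\<^bsub>H\<^esub> X3 \<otimes>\<^bsub>H\<^esub> y3)))) \<and>
     (\<forall>h\<in>carrier H.
        lift2 H (comult H h) (\<lambda>a b. \<sigma> b \<odot>\<^bsub>H\<^esub> (a \<otimes>\<^bsub>H\<^esub> v)) =
        lift2 H (comult H h) (\<lambda>a b. \<sigma> a \<odot>\<^bsub>H\<^esub> (v \<otimes>\<^bsub>H\<^esub> b)))"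

text \<open>
  Generators: \<open>None\<close> for \<open>\<theta>\<close> and \<open>Some h\<close> for each \<open>h\<close> in \<open>H\<close>. The first four families of relators
  reproduce the algebra structure of \<open>H\<close>. In the last one \<open>\<sigma>(h\<^sub>1)\<theta>h\<^sub>2\<close> is written \<open>\<theta>(\<sigma>(h\<^sub>1)h\<^sub>2)\<close>, with
  the Sweedler sum evaluated in \<open>H\<close>: in the free algebra \<open>Some\<close> is not yet linear.
\<close>

definition theta_gens :: "('k::field, 'a) quasi_hopf \<Rightarrow> 'a option set" where
  "theta_gens H = insert None (Some ` carrier H)"

definition theta_rels ::
    "('k::field, 'a) quasi_hopf \<Rightarrow> ('a \<Rightarrow> 'k) \<Rightarrow> ('a option list \<Rightarrow>\<^sub>0 'k) set" where
  "theta_rels H \<sigma> =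
     {mon [Some (a \<oplus>\<^bsub>H\<^esub> b)] - mon [Some a] - mon [Some b] | a b. a \<in> carrier H \<and> b \<in> carrier H} \<union>
     {mon [Some (c \<odot>\<^bsub>H\<^esub> a)] - Poly_Mapping.single [Some a] c | c a. a \<in> carrier H} \<union>
     {mon [Some (a \<otimes>\<^bsub>H\<^esub> b)] - mon [Some a, Some b] | a b. a \<in> carrier H \<and> b \<in> carrier H} \<union>
     {mon [Some \<one>\<^bsub>H\<^esub>] - mon []} \<union>
     {mon [None, None]} \<union>
     {mon [Some h, None] - mon [None, Some (lift2 H (comult H h) (\<lambda>a b. \<sigma> a \<odot>\<^bsub>H\<^esub> b))]
       | h. h \<in> carrier H}"

definition theta_ext ::
    "('k::field, 'a) quasi_hopf \<Rightarrow> ('a \<Rightarrow> 'k) \<Rightarrow> 'a \<Rightarrow>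
     ('k, ('a option list \<Rightarrow>\<^sub>0 'k) set) quasi_hopf" where
  "theta_ext H \<sigma> v =
    (let D = pres_alg (theta_gens H) (theta_rels H \<sigma>);
         \<theta> = pres_gen (theta_gens H) (theta_rels H \<sigma>) None;
         \<iota> = (\<lambda>h. pres_gen (theta_gens H) (theta_rels H \<sigma>) (Some h));
         S = antipode H; \<alpha> = alpha H; \<beta> = beta H in
     with_structure D
       (pres_lift (T2 D) (\<lambda>s. case s of
           Some h \<Rightarrow> lift2 (T2 D) (comult H h) (\<lambda>a b. t2 D (\<iota> a) (\<iota> b))
         | None \<Rightarrow>
             lift3 (T2 D) (reassoc H) (\<lambda>X1 X2 X3.
               lift3 (T2 D) (reassoc_inv H) (\<lambda>x1 x2 x3.
                 \<sigma> (X2 \<otimes>\<^bsub>H\<^esub> x1) \<odot>\<^bsub>T2 D\<^esub>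
                   t2 D (\<iota> (X1 \<otimes>\<^bsub>H\<^esub> v \<otimes>\<^bsub>H\<^esub> x2)) (\<theta> \<otimes>\<^bsub>D\<^esub> \<iota> (X3 \<otimes>\<^bsub>H\<^esub> x3))))
             \<oplus>\<^bsub>T2 D\<^esub>
             lift3 (T2 D) (reassoc_inv H) (\<lambda>x1 x2 x3.
               \<sigma> x1 \<odot>\<^bsub>T2 D\<^esub> t2 D (\<theta> \<otimes>\<^bsub>D\<^esub> \<iota> x2) (\<iota> x3))))
       (pres_lift scalars (\<lambda>s. case s of Some h \<Rightarrow> counit H h | None \<Rightarrow> 0))
       (lift3 (T3 D) (reassoc H) (\<lambda>X1 X2 X3. t3 D (\<iota> X1) (\<iota> X2) (\<iota> X3)))
       (pres_lift (op_alg D) (\<lambda>s. case s of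
           Some h \<Rightarrow> \<iota> (S h)
         | None \<Rightarrow>
             \<ominus>\<^bsub>D\<^esub> lift3 D (reassoc H) (\<lambda>X1 X2 X3.
               lift3 D (reassoc_inv H) (\<lambda>x1 x2 x3.
                 lift2 D (comult H x1) (\<lambda>x11 x12.
                   \<sigma> (X2 \<otimes>\<^bsub>H\<^esub> x12) \<odot>\<^bsub>D\<^esub>
                     (\<iota> (S (X1 \<otimes>\<^bsub>H\<^esub> x11 \<otimes>\<^bsub>H\<^esub> v) \<otimes>\<^bsub>H\<^esub> \<alpha>) \<otimes>\<^bsub>D\<^esub> \<theta>
                       \<otimes>\<^bsub>D\<^esub> \<iota> (X3 \<otimes>\<^bsub>H\<^esub> x2 \<otimes>\<^bsub>H\<^esub> \<beta> \<otimes>\<^bsub>H\<^esub> S x3)))))))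
       (\<iota> \<alpha>) (\<iota> \<beta>))"

end

theory Submission
  imports Defs
begin

text \<open>
  The quasi-Hopf algebras \<open>H\<^sub>q(8)\<close>, \<open>H\<^sub>q(16)\<close>, \<open>H\<^sub>q(16)(\<theta>)\<close> and \<open>H\<^sub>4 \<otimes> H\<^sub>q(8)\<close> share one pattern. They contain
  orthogonal idempotents \<open>e + f = 1\<close> (the elements \<open>p\<^sub>+\<close>, \<open>p\<^sub>-\<close>) exchanged by a generator \<open>x\<close>, with
  reassociator \<open>1 - 2 f \<otimes> f \<otimes> f\<close>; this is the locale \<open>qh_core\<close>. The remaining generators are a grouplike
  involution \<open>u\<close> that commutes with \<open>e\<close>, \<open>f\<close>, \<open>x\<close> and a skew-primitive \<open>\<theta>\<close> of square zero that anticommutes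
  with \<open>u\<close>. Every axiom says that two algebra morphisms (or a twisted variant of them) agree, so it
  suffices to verify it on \<open>f\<close>, \<open>x\<close>, \<open>u\<close>, \<open>\<theta>\<close>, and identities in tensor powers are compared after
  multiplication by tensors of \<open>e\<close> and \<open>f\<close>, where the reassociator becomes a sign. This gives
  \<open>quasi_hopf_algebra_generated\<close>.

  Uniqueness of the pair. A character \<open>\<tau>\<close> of \<open>H\<^sub>q(16)\<close> kills \<open>x\<close> and takes a value \<open>0\<close> or \<open>1\<close> on \<open>f\<close>. Under
  \<open>\<tau> \<otimes> \<tau>\<close> the equation for \<open>\<Delta>(v)\<close> becomes \<open>1 = (1 - 2 \<tau>(f))\<^sup>3\<close>, whence \<open>\<tau>(f) = 0\<close>, that is \<open>\<tau>(g\<^sub>1) = 1\<close>.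
  Then all reassociators in the equation disappear: \<open>v\<close> is grouplike and commutes with \<open>f\<close> and \<open>x\<close>. The two
  projections \<open>H\<^sub>q(16) \<rightarrow> H\<^sub>q(8)\<close> with \<open>g\<^sub>2 \<mapsto> 1\<close> and \<open>g\<^sub>2 \<mapsto> -1\<close> send \<open>v\<close> to elements \<open>w\<^sub>+\<close>, \<open>w\<^sub>-\<close> with
  \<open>\<Delta>(w\<^sub>+) = w\<^sub>+ \<otimes> w\<^sub>+ = w\<^sub>- \<otimes> w\<^sub>-\<close>. A central grouplike element of \<open>H\<^sub>q(8)\<close> is \<open>1\<close>
  (\<open>H8_central_grouplike\<close>), so \<open>w\<^sub>+ = 1\<close>, and \<open>\<tau>(v) = -1\<close> forces \<open>\<tau>(g\<^sub>2) = -1\<close> and \<open>w\<^sub>- = -1\<close>. Together this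
  is \<open>v = g\<^sub>2\<close> (\<open>datum_unique\<close>).

  Isomorphism and dimension. For this pair the coproduct of \<open>\<theta>\<close> collapses to \<open>g\<^sub>2 \<otimes> \<theta> + \<theta> \<otimes> 1\<close>, and the
  relation \<open>h\<theta> = \<sigma>(h\<^sub>1)\<theta>h\<^sub>2\<close> says that \<open>\<theta>\<close> commutes with \<open>H\<^sub>q(8)\<close> and anticommutes with \<open>g\<^sub>2\<close>. Thus \<open>g\<^sub>2\<close> and \<open>\<theta>\<close>
  generate a copy of \<open>H\<^sub>4\<close> that commutes with \<open>H\<^sub>q(8)\<close>. The universal properties of the presentation and of
  the tensor product give mutually inverse morphisms, which also transport the basis of
  \<open>H\<^sub>4 \<otimes> H\<^sub>q(8)\<close>, of size \<open>4 \<cdot> 8\<close>, to the extension.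
\<close>

section \<open>Algebras, linear maps and generators\<close>

lemma scalars_simps [simp]:
  "carrier scalars = UNIV" "\<one>\<^bsub>scalars\<^esub> = 1" "\<zero>\<^bsub>scalars\<^esub> = 0"
  "a \<otimes>\<^bsub>scalars\<^esub> b = a * b" "a \<oplus>\<^bsub>scalars\<^esub> b = a + b" "a \<odot>\<^bsub>scalars\<^esub> b = a * b"
  by (simp_all add: scalars_def)

lemma cring_scalars: "cring (scalars :: ('k::field, 'k) module)"
proof (rule cringI)
  show "abelian_group (scalars :: ('k, 'k) module)"
    by (rule abelian_groupI) (auto simp: algebra_simps intro: exI[of _ "- x" for x])
  show "comm_monoid (scalars :: ('k, 'k) module)"
    by (rule comm_monoidI) (auto simp: algebra_simps)
qed (auto simp: algebra_simps)

lemma k_algebraI: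
  fixes A (structure)
  assumes "ring A" and "\<And>c a. a \<in> carrier A \<Longrightarrow> c \<odot> a \<in> carrier A"
    and "\<And>c d a. a \<in> carrier A \<Longrightarrow> (c + d) \<odot> a = c \<odot> a \<oplus> d \<odot> a"
    and "\<And>c a b. a \<in> carrier A \<Longrightarrow> b \<in> carrier A \<Longrightarrow> c \<odot> (a \<oplus> b) = c \<odot> a \<oplus> c \<odot> b"
    and "\<And>c d a. a \<in> carrier A \<Longrightarrow> (c * d) \<odot> a = c \<odot> (d \<odot> a)"
    and "\<And>a. a \<in> carrier A \<Longrightarrow> 1 \<odot> a = a"
    and "\<And>c a b. a \<in> carrier A \<Longrightarrow> b \<in> carrier A \<Longrightarrow> (c \<odot> a) \<otimes> b = c \<odot> (a \<otimes> b)"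
    and "\<And>c a b. a \<in> carrier A \<Longrightarrow> b \<in> carrier A \<Longrightarrow> a \<otimes> (c \<odot> b) = c \<odot> (a \<otimes> b)"
  shows "k_algebra A"
proof -
  have "module scalars A"
    by (rule moduleI) (use assms in \<open>auto simp: cring_scalars ring_def\<close>)
  then show ?thesis unfolding k_algebra_def using assms by auto
qed

text \<open>Of the theory of rings only the elementary laws are taken over. Each algebra below comes with its tensor
  powers, and in all of them little more than associativity and distributivity is used.\<close>

locale kalg =
  fixes A :: "('k::field, 'a, 'm) module_scheme" (structure)
  assumes k_alg: "k_algebra A"
begin

lemma ring_axioms: "ring A"
  using k_alg by (simp add: k_algebra_def)

context
begin

interpretation R: ring A by (rule ring_axioms)

lemmas add_l_cancel = R.add.l_cancel
lemmas add_inv_ex [simp] = R.add.l_inv_ex R.add.r_inv_ex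
lemmas minus_minus [simp] = R.minus_minus
lemmas finsum_empty [simp] = R.finsum_empty
lemmas finsum_zero [simp] = R.add.finprod_one
lemmas finsum_infinite [simp] = R.finsum_infinite
lemmas finsum_mono_neutral_cong_left = R.add.finprod_mono_neutral_cong_left
lemmas add_cancel_zero [simp] = R.add.l_cancel_one R.add.l_cancel_one' R.add.r_cancel_one R.add.r_cancel_one'
lemmas add_right_cancel [simp] = R.add.right_cancel
lemmas minus_eq_zero_iff [simp] = R.add.inv_eq_1_iff
lemmas a_ac = R.a_ac
lemmas a_assoc = R.a_assoc
lemmas a_closed [simp, intro] = R.a_closed
lemmas a_comm = R.a_comm
lemmas a_coset_add_zero [simp] = R.a_coset_add_zero
lemmas a_inv_closed [simp, intro] = R.a_inv_closed
lemmas finsum_addf [simp] = R.finsum_addf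
lemmas finsum_closed [simp, intro] = R.finsum_closed
lemmas finsum_cong' = R.finsum_cong'
lemmas finsum_insert [simp] = R.finsum_insert
lemmas finsum_reindex = R.finsum_reindex
lemmas finsum_singleton = R.finsum_singleton
lemmas genideal_ideal = R.genideal_ideal
lemmas genideal_minimal = R.genideal_minimal
lemmas genideal_self = R.genideal_self
lemmas inv_char = R.inv_char
lemmas inv_one [simp] = R.inv_one
lemmas is_abelian_group = R.is_abelian_group
lemmas is_monoid = R.is_monoid
lemmas l_distr = R.l_distr
lemmas l_minus = R.l_minus
lemmas l_neg = R.l_neg
lemmas l_null [simp] = R.l_null
lemmas l_one [simp] = R.l_one
lemmas l_zero [simp] = R.l_zero
lemmas m_assoc = R.m_assoc
lemmas m_closed [simp, intro] = R.m_closed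
lemmas minus_closed [simp, intro] = R.minus_closed
lemmas minus_equality = R.minus_equality
lemmas minus_unique = R.minus_unique
lemmas minus_zero [simp] = R.minus_zero
lemmas monoid_axioms = R.monoid_axioms
lemmas nat_pow_0 [simp] = R.nat_pow_0
lemmas nat_pow_Suc [simp] = R.nat_pow_Suc
lemmas nat_pow_Suc2 = R.nat_pow_Suc2
lemmas nat_pow_closed [simp, intro] = R.nat_pow_closed
lemmas nat_pow_eone [simp] = R.nat_pow_eone
lemmas nat_pow_mult = R.nat_pow_mult
lemmas nat_pow_one [simp] = R.nat_pow_one
lemmas one_closed [simp, intro] = R.one_closed
lemmas quotient_eq_iff_same_a_r_cos = R.quotient_eq_iff_same_a_r_cos
lemmas r_distr = R.r_distr
lemmas r_minus = R.r_minus
lemmas r_neg = R.r_neg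
lemmas r_null [simp] = R.r_null
lemmas r_one [simp] = R.r_one
lemmas r_right_minus_eq [simp] = R.r_right_minus_eq
lemmas r_zero [simp] = R.r_zero
lemmas zero_closed [simp, intro] = R.zero_closed

end

lemma mod: "module scalars A"
  using k_alg by (simp add: k_algebra_def)

lemma smult_closed [simp, intro]: "a \<in> carrier A \<Longrightarrow> c \<odot> a \<in> carrier A"
  using module.smult_closed[OF mod] by simp

lemma smult_add_left: "a \<in> carrier A \<Longrightarrow> (c + d) \<odot> a = c \<odot> a \<oplus> d \<odot> a"
  using module.smult_l_distr[OF mod] by simp

lemma smult_add_right: "a \<in> carrier A \<Longrightarrow> b \<in> carrier A \<Longrightarrow> c \<odot> (a \<oplus> b) = c \<odot> a \<oplus> c \<odot> b"
  using module.smult_r_distr[OF mod] by simp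

lemma smult_smult [simp]: "a \<in> carrier A \<Longrightarrow> c \<odot> (d \<odot> a) = (c * d) \<odot> a"
  using module.smult_assoc1[OF mod] by simp

lemma smult_1 [simp]: "a \<in> carrier A \<Longrightarrow> 1 \<odot> a = a"
  using module.smult_one[OF mod] by simp

lemma smult_mult [simp]: "a \<in> carrier A \<Longrightarrow> b \<in> carrier A \<Longrightarrow> (c \<odot> a) \<otimes> b = c \<odot> (a \<otimes> b)"
  using k_alg by (simp add: k_algebra_def)

lemma mult_smult [simp]: "a \<in> carrier A \<Longrightarrow> b \<in> carrier A \<Longrightarrow> a \<otimes> (c \<odot> b) = c \<odot> (a \<otimes> b)"
  using k_alg by (simp add: k_algebra_def)

lemma smult_0 [simp]: "a \<in> carrier A \<Longrightarrow> 0 \<odot> a = \<zero>"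
proof -
  assume a: "a \<in> carrier A"
  have "0 \<odot> a \<oplus> 0 \<odot> a = 0 \<odot> a \<oplus> \<zero>"
    using a smult_add_left[of a 0 0] by simp
  then show ?thesis using a by (simp only: add_l_cancel smult_closed zero_closed)
qed

lemma smult_zero [simp]: "c \<odot> \<zero> = \<zero>"
proof -
  have "c \<odot> \<zero> = c \<odot> (0 \<odot> \<zero>)" by simp
  also have "\<dots> = (c * 0) \<odot> \<zero>" by (simp only: smult_smult zero_closed)
  finally show ?thesis by simp
qed

lemma minus_smult: "a \<in> carrier A \<Longrightarrow> \<ominus> a = (- 1) \<odot> a"
proof -
  assume a: "a \<in> carrier A"
  have "(- 1) \<odot> a \<oplus> a = (-1 + 1) \<odot> a"
    using a by (subst smult_add_left) auto
  then have "(- 1) \<odot> a \<oplus> a = \<zero>" using a by simp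
  then show ?thesis using a by (intro minus_equality) auto
qed

lemma diff_smult: "a \<in> carrier A \<Longrightarrow> b \<in> carrier A \<Longrightarrow> a \<ominus> b = a \<oplus> (- 1) \<odot> b"
  by (simp add: a_minus_def minus_smult)

lemma smult_collect:
  "a \<in> carrier A \<Longrightarrow> c \<odot> a \<oplus> d \<odot> a = (c + d) \<odot> a"
  "a \<in> carrier A \<Longrightarrow> a \<oplus> d \<odot> a = (1 + d) \<odot> a"
  "a \<in> carrier A \<Longrightarrow> c \<odot> a \<oplus> a = (c + 1) \<odot> a"
  "a \<in> carrier A \<Longrightarrow> a \<oplus> a = 2 \<odot> a"
  using smult_add_left[of a c d] smult_add_left[of a 1 d] smult_add_left[of a c 1] smult_add_left[of a 1 1]
  by simp_all

lemma smult_collect_left: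
  "a \<in> carrier A \<Longrightarrow> b \<in> carrier A \<Longrightarrow> c \<odot> a \<oplus> (d \<odot> a \<oplus> b) = (c + d) \<odot> a \<oplus> b"
  "a \<in> carrier A \<Longrightarrow> b \<in> carrier A \<Longrightarrow> a \<oplus> (d \<odot> a \<oplus> b) = (1 + d) \<odot> a \<oplus> b"
  "a \<in> carrier A \<Longrightarrow> b \<in> carrier A \<Longrightarrow> c \<odot> a \<oplus> (a \<oplus> b) = (c + 1) \<odot> a \<oplus> b"
  "a \<in> carrier A \<Longrightarrow> b \<in> carrier A \<Longrightarrow> a \<oplus> (a \<oplus> b) = 2 \<odot> a \<oplus> b"
  by (simp_all add: smult_collect a_assoc[symmetric])

end

lemma kalg_iff [simp]: "kalg A \<longleftrightarrow> k_algebra A"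
  by (simp add: kalg_def)

lemma k_algebra_scalars [simp]: "k_algebra scalars"
  by (rule k_algebraI) (auto simp: algebra_simps cring_scalars cring.axioms(1))

definition linear_map ::
    "('k::field, 'a, 'm) module_scheme \<Rightarrow> ('k, 'b, 'n) module_scheme \<Rightarrow> ('a \<Rightarrow> 'b) \<Rightarrow> bool" where
  "linear_map A B f \<longleftrightarrow> (\<forall>a\<in>carrier A. f a \<in> carrier B) \<and>
     (\<forall>a\<in>carrier A. \<forall>b\<in>carrier A. f (a \<oplus>\<^bsub>A\<^esub> b) = f a \<oplus>\<^bsub>B\<^esub> f b) \<and>
     (\<forall>c. \<forall>a\<in>carrier A. f (c \<odot>\<^bsub>A\<^esub> a) = c \<odot>\<^bsub>B\<^esub> f a)"

lemma linear_mapI: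
  assumes "\<And>a. a \<in> carrier A \<Longrightarrow> f a \<in> carrier B"
    and "\<And>a b. a \<in> carrier A \<Longrightarrow> b \<in> carrier A \<Longrightarrow> f (a \<oplus>\<^bsub>A\<^esub> b) = f a \<oplus>\<^bsub>B\<^esub> f b"
    and "\<And>c a. a \<in> carrier A \<Longrightarrow> f (c \<odot>\<^bsub>A\<^esub> a) = c \<odot>\<^bsub>B\<^esub> f a"
  shows "linear_map A B f"
  using assms by (simp add: linear_map_def)

lemma linear_mapD:
  assumes "linear_map A B f"
  shows "a \<in> carrier A \<Longrightarrow> f a \<in> carrier B"
    and "a \<in> carrier A \<Longrightarrow> b \<in> carrier A \<Longrightarrow> f (a \<oplus>\<^bsub>A\<^esub> b) = f a \<oplus>\<^bsub>B\<^esub> f b"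
    and "a \<in> carrier A \<Longrightarrow> f (c \<odot>\<^bsub>A\<^esub> a) = c \<odot>\<^bsub>B\<^esub> f a"
  using assms by (auto simp: linear_map_def)

lemma linear_map_zero:
  assumes "k_algebra A" "k_algebra B" "linear_map A B f"
  shows "f \<zero>\<^bsub>A\<^esub> = \<zero>\<^bsub>B\<^esub>"
proof -
  interpret A: kalg A using assms by simp
  interpret B: kalg B using assms by simp
  have "f (0 \<odot>\<^bsub>A\<^esub> \<zero>\<^bsub>A\<^esub>) = 0 \<odot>\<^bsub>B\<^esub> f \<zero>\<^bsub>A\<^esub>"
    by (rule linear_mapD(3)[OF assms(3)]) simp
  then show ?thesis using linear_mapD(1)[OF assms(3)] by simp
qed

lemma linear_map_minus:
  assumes "k_algebra A" "k_algebra B" "linear_map A B f"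
  shows "a \<in> carrier A \<Longrightarrow> f (\<ominus>\<^bsub>A\<^esub> a) = \<ominus>\<^bsub>B\<^esub> f a"
    and "a \<in> carrier A \<Longrightarrow> b \<in> carrier A \<Longrightarrow> f (a \<ominus>\<^bsub>A\<^esub> b) = f a \<ominus>\<^bsub>B\<^esub> f b"
proof -
  interpret A: kalg A using assms by simp
  interpret B: kalg B using assms by simp
  note l = linear_mapD[OF assms(3)]
  show "a \<in> carrier A \<Longrightarrow> f (\<ominus>\<^bsub>A\<^esub> a) = \<ominus>\<^bsub>B\<^esub> f a"
    by (simp add: A.minus_smult B.minus_smult l)
  show "a \<in> carrier A \<Longrightarrow> b \<in> carrier A \<Longrightarrow> f (a \<ominus>\<^bsub>A\<^esub> b) = f a \<ominus>\<^bsub>B\<^esub> f b"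
    by (simp add: A.diff_smult B.diff_smult l)
qed

lemma linear_map_comp:
  "linear_map A B f \<Longrightarrow> linear_map B C g \<Longrightarrow> linear_map A C (\<lambda>x. g (f x))"
  by (simp add: linear_map_def)

lemma linear_map_cong:
  "linear_map A B f \<Longrightarrow> (\<And>x. x \<in> carrier A \<Longrightarrow> f x = g x) \<Longrightarrow> k_algebra A \<Longrightarrow> linear_map A B g"
  using kalg.smult_closed[of A] abelian_monoid.a_closed[of A]
  by (simp add: linear_map_def k_algebra_def ring.is_abelian_group abelian_group.axioms(1))

lemma alg_hom_iff:
  "f \<in> alg_hom A B \<longleftrightarrow> linear_map A B f \<and>
     (\<forall>a\<in>carrier A. \<forall>b\<in>carrier A. f (a \<otimes>\<^bsub>A\<^esub> b) = f a \<otimes>\<^bsub>B\<^esub> f b) \<and> f \<one>\<^bsub>A\<^esub> = \<one>\<^bsub>B\<^esub>"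
  by (auto simp: alg_hom_def linear_map_def ring_hom_def)

lemma alg_hom_linear: "f \<in> alg_hom A B \<Longrightarrow> linear_map A B f"
  by (simp add: alg_hom_iff)

lemma alg_homI:
  assumes "linear_map A B f"
    and "\<And>a b. a \<in> carrier A \<Longrightarrow> b \<in> carrier A \<Longrightarrow> f (a \<otimes>\<^bsub>A\<^esub> b) = f a \<otimes>\<^bsub>B\<^esub> f b"
    and "f \<one>\<^bsub>A\<^esub> = \<one>\<^bsub>B\<^esub>"
  shows "f \<in> alg_hom A B"
  using assms by (simp add: alg_hom_iff)

lemma alg_homD:
  assumes "f \<in> alg_hom A B"
  shows "a \<in> carrier A \<Longrightarrow> f a \<in> carrier B"
    and "a \<in> carrier A \<Longrightarrow> b \<in> carrier A \<Longrightarrow> f (a \<oplus>\<^bsub>A\<^esub> b) = f a \<oplus>\<^bsub>B\<^esub> f b"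
    and "a \<in> carrier A \<Longrightarrow> f (c \<odot>\<^bsub>A\<^esub> a) = c \<odot>\<^bsub>B\<^esub> f a"
    and "a \<in> carrier A \<Longrightarrow> b \<in> carrier A \<Longrightarrow> f (a \<otimes>\<^bsub>A\<^esub> b) = f a \<otimes>\<^bsub>B\<^esub> f b"
    and "f \<one>\<^bsub>A\<^esub> = \<one>\<^bsub>B\<^esub>"
  using assms by (auto simp: alg_hom_iff linear_map_def)

lemma alg_hom_comp:
  "f \<in> alg_hom A B \<Longrightarrow> g \<in> alg_hom B C \<Longrightarrow> (\<lambda>x. g (f x)) \<in> alg_hom A C"
  by (simp add: alg_hom_iff linear_map_def)

lemma alg_hom_id: "(\<lambda>x. x) \<in> alg_hom A A"
  by (simp add: alg_hom_iff linear_map_def)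

lemma op_alg_simps [simp]:
  "carrier (op_alg A) = carrier A" "\<one>\<^bsub>op_alg A\<^esub> = \<one>\<^bsub>A\<^esub>" "\<zero>\<^bsub>op_alg A\<^esub> = \<zero>\<^bsub>A\<^esub>"
  "a \<otimes>\<^bsub>op_alg A\<^esub> b = b \<otimes>\<^bsub>A\<^esub> a" "a \<oplus>\<^bsub>op_alg A\<^esub> b = a \<oplus>\<^bsub>A\<^esub> b" "c \<odot>\<^bsub>op_alg A\<^esub> a = c \<odot>\<^bsub>A\<^esub> a"
  by (simp_all add: op_alg_def)

lemma k_algebra_op [simp]:
  assumes "k_algebra A"
  shows "k_algebra (op_alg A)"
proof -
  interpret A: kalg A using assms by simp
  have "ring (op_alg A)"
  proof (rule ringI)
    show "abelian_group (op_alg A)"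
      by (rule abelian_groupI) (auto simp: A.a_ac intro: A.l_neg)
    show "Group.monoid (op_alg A)"
      by (rule monoidI) (auto simp: A.m_assoc)
  qed (auto simp: A.l_distr A.r_distr)
  then show ?thesis
    by (rule k_algebraI) (auto simp: A.smult_add_left A.smult_add_right)
qed

lemma linear_map_op [simp]: "linear_map A (op_alg B) f \<longleftrightarrow> linear_map A B f"
  by (simp add: linear_map_def)

inductive_set alg_gen :: "('k::field, 'a, 'm) module_scheme \<Rightarrow> 'a set \<Rightarrow> 'a set" for A and G where
  gen: "a \<in> G \<Longrightarrow> a \<in> alg_gen A G"
| unit: "\<one>\<^bsub>A\<^esub> \<in> alg_gen A G"
| add: "a \<in> alg_gen A G \<Longrightarrow> b \<in> alg_gen A G \<Longrightarrow> a \<oplus>\<^bsub>A\<^esub> b \<in> alg_gen A G"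
| smult: "a \<in> alg_gen A G \<Longrightarrow> c \<odot>\<^bsub>A\<^esub> a \<in> alg_gen A G"
| mult: "a \<in> alg_gen A G \<Longrightarrow> b \<in> alg_gen A G \<Longrightarrow> a \<otimes>\<^bsub>A\<^esub> b \<in> alg_gen A G"

definition generated_by :: "('k::field, 'a, 'm) module_scheme \<Rightarrow> 'a set \<Rightarrow> bool" where
  "generated_by A G \<longleftrightarrow> G \<subseteq> carrier A \<and> carrier A \<subseteq> alg_gen A G"

lemma (in kalg) alg_gen_closed: "G \<subseteq> carrier A \<Longrightarrow> a \<in> alg_gen A G \<Longrightarrow> a \<in> carrier A"
  by (rotate_tac, induction rule: alg_gen.induct) auto

lemma generated_induct [consumes 3, case_names gen one add smult mult]:
  assumes "k_algebra A" and gb: "generated_by A G" and a: "a \<in> carrier A"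
    and "\<And>a. a \<in> G \<Longrightarrow> P a" and "P \<one>\<^bsub>A\<^esub>"
    and "\<And>a b. a \<in> carrier A \<Longrightarrow> b \<in> carrier A \<Longrightarrow> P a \<Longrightarrow> P b \<Longrightarrow> P (a \<oplus>\<^bsub>A\<^esub> b)"
    and "\<And>c a. a \<in> carrier A \<Longrightarrow> P a \<Longrightarrow> P (c \<odot>\<^bsub>A\<^esub> a)"
    and "\<And>a b. a \<in> carrier A \<Longrightarrow> b \<in> carrier A \<Longrightarrow> P a \<Longrightarrow> P b \<Longrightarrow> P (a \<otimes>\<^bsub>A\<^esub> b)"
  shows "P a"
proof -
  interpret kalg A using assms by simp
  have G: "G \<subseteq> carrier A" and "a \<in> alg_gen A G"
    using gb a by (auto simp: generated_by_def)
  from this(2) show ?thesis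
    by (induction rule: alg_gen.induct) (use G assms alg_gen_closed in auto)
qed

text \<open>All verifications on generators below rest on this: morphisms that agree on generators agree.\<close>

lemma alg_hom_eqI:
  assumes "k_algebra A" and "generated_by A G"
    and f: "f \<in> alg_hom A B" and g: "g \<in> alg_hom A B"
    and "\<And>x. x \<in> G \<Longrightarrow> f x = g x" and "a \<in> carrier A"
  shows "f a = g a"
  using assms(1,2,6)
  by (induction rule: generated_induct)
    (auto simp: alg_homD[OF f] alg_homD[OF g] assms)

text \<open>Changes of generators, used to replace an involution by its idempotents.\<close>

lemma generated_mono:
  assumes A: "k_algebra A" and "generated_by A G" and Y: "Y \<subseteq> carrier A" and "G \<subseteq> alg_gen A Y"
  shows "generated_by A Y"
  unfolding generated_by_def
proof (intro conjI Y, rule subsetI)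
  fix a assume "a \<in> carrier A"
  with assms(1,2) show "a \<in> alg_gen A Y"
    by (induction rule: generated_induct) (use assms(4) in \<open>auto intro: alg_gen.intros\<close>)
qed

section \<open>Monoid algebras\<close>

lemma lookup_map_scale [simp]: "Poly_Mapping.lookup (Poly_Mapping.map ((*) c) f) m = c * Poly_Mapping.lookup f m"
  for c :: "'k::field"
  by (cases "Poly_Mapping.lookup f m = 0") (simp_all add: Poly_Mapping.map.rep_eq)

lemma keys_map_scale: "Poly_Mapping.keys (Poly_Mapping.map ((*) c) f) \<subseteq> Poly_Mapping.keys f"
  for c :: "'k::field"
  by (auto simp: in_keys_iff)

lemma map_scale_single [simp]:
  "Poly_Mapping.map ((*) c) (Poly_Mapping.single m d) = Poly_Mapping.single m (c * d)" for c :: "'k::field"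
  by (rule poly_mapping_eqI) (simp add: lookup_single when_def)

lemma map_scale_add:
  "Poly_Mapping.map ((*) c) (f + g) = Poly_Mapping.map ((*) c) f + Poly_Mapping.map ((*) c) g"
  for c :: "'k::field"
  by (rule poly_mapping_eqI) (simp add: lookup_add algebra_simps)

lemma monoid_algebra_simps [simp]:
  "carrier (monoid_algebra M) = {f. Poly_Mapping.keys f \<subseteq> carrier M}"
  "\<one>\<^bsub>monoid_algebra M\<^esub> = mon \<one>\<^bsub>M\<^esub>"
  "\<zero>\<^bsub>monoid_algebra M\<^esub> = 0"
  "f \<oplus>\<^bsub>monoid_algebra M\<^esub> g = f + g"
  "c \<odot>\<^bsub>monoid_algebra M\<^esub> f = Poly_Mapping.map ((*) c) f"
  by (simp_all add: monoid_algebra_def)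

lemma keys_add_subset: "Poly_Mapping.keys f \<subseteq> S \<Longrightarrow> Poly_Mapping.keys g \<subseteq> S \<Longrightarrow> Poly_Mapping.keys (f + g) \<subseteq> S"
  using keys_add[of f g] by blast

lemma keys_single_subset: "m \<in> S \<Longrightarrow> Poly_Mapping.keys (Poly_Mapping.single m c) \<subseteq> S"
  by auto

lemma poly_mapping_span_induct [consumes 1, case_names zero single add]:
  assumes "Poly_Mapping.keys f \<subseteq> S"
    and "P 0" and "\<And>m c. m \<in> S \<Longrightarrow> P (Poly_Mapping.single m c)"
    and "\<And>f g. Poly_Mapping.keys f \<subseteq> S \<Longrightarrow> Poly_Mapping.keys g \<subseteq> S \<Longrightarrow> P f \<Longrightarrow> P g \<Longrightarrow> P (f + g)"
  shows "P (f :: 'm \<Rightarrow>\<^sub>0 'k::field)"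
  using assms(1)
proof (induction f rule: update_induct)
  case const
  then show ?case using assms by simp
next
  case (update f a b)
  have eq: "Poly_Mapping.update a b f = Poly_Mapping.single a b + f"
    using update(1) by (intro poly_mapping_eqI)
      (auto simp: lookup_update lookup_add lookup_single when_def in_keys_iff)
  have k: "Poly_Mapping.keys (Poly_Mapping.update a b f) = insert a (Poly_Mapping.keys f)"
    using update(1,2) by (auto simp: in_keys_iff lookup_update split: if_splits)
  then show ?case using update unfolding eq
    by (intro assms(4)) (auto intro: assms(3))
qed

lemma monoid_algebra_mult_expand:
  assumes "finite S" "Poly_Mapping.keys f \<subseteq> S" "finite T" "Poly_Mapping.keys g \<subseteq> T"
  shows "f \<otimes>\<^bsub>monoid_algebra M\<^esub> g = (\<Sum>a\<in>S. \<Sum>b\<in>T.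
     Poly_Mapping.single (a \<otimes>\<^bsub>M\<^esub> b) (Poly_Mapping.lookup f a * Poly_Mapping.lookup g b))"
proof -
  have 1: "(\<Sum>b\<in>Poly_Mapping.keys g. Poly_Mapping.single (a \<otimes>\<^bsub>M\<^esub> b) (Poly_Mapping.lookup f a * Poly_Mapping.lookup g b)) =
     (\<Sum>b\<in>T. Poly_Mapping.single (a \<otimes>\<^bsub>M\<^esub> b) (Poly_Mapping.lookup f a * Poly_Mapping.lookup g b))" for a
    by (rule sum.mono_neutral_left) (use assms in \<open>auto simp: in_keys_iff\<close>)
  show ?thesis unfolding monoid_algebra_def by (simp add: 1)
    (rule sum.mono_neutral_left, use assms in \<open>auto simp: in_keys_iff\<close>)
qed

lemma monoid_algebra_mult_single [simp]:
  "Poly_Mapping.single a c \<otimes>\<^bsub>monoid_algebra M\<^esub> Poly_Mapping.single b d =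
     Poly_Mapping.single (a \<otimes>\<^bsub>M\<^esub> b) (c * d)"
  by (subst monoid_algebra_mult_expand[of "{a}" _ "{b}"]) auto

lemma monoid_algebra_mult_add:
  "(f + f') \<otimes>\<^bsub>monoid_algebra M\<^esub> g = f \<otimes>\<^bsub>monoid_algebra M\<^esub> g + f' \<otimes>\<^bsub>monoid_algebra M\<^esub> g"
  "g \<otimes>\<^bsub>monoid_algebra M\<^esub> (f + f') = g \<otimes>\<^bsub>monoid_algebra M\<^esub> f + g \<otimes>\<^bsub>monoid_algebra M\<^esub> f'"
  using keys_add[of f f']
  by (subst (1 2 3) monoid_algebra_mult_expand[of "Poly_Mapping.keys f \<union> Poly_Mapping.keys f'" _ "Poly_Mapping.keys g"]
      monoid_algebra_mult_expand[of "Poly_Mapping.keys g" _ "Poly_Mapping.keys f \<union> Poly_Mapping.keys f'"];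
      auto simp: lookup_add algebra_simps single_add sum.distrib)+

lemma monoid_algebra_mult_zero [simp]:
  "0 \<otimes>\<^bsub>monoid_algebra M\<^esub> g = 0" "g \<otimes>\<^bsub>monoid_algebra M\<^esub> 0 = 0"
  by (simp_all add: monoid_algebra_def)

lemma monoid_algebra_mult_smult:
  "Poly_Mapping.map ((*) c) f \<otimes>\<^bsub>monoid_algebra M\<^esub> g = Poly_Mapping.map ((*) c) (f \<otimes>\<^bsub>monoid_algebra M\<^esub> g)"
  "f \<otimes>\<^bsub>monoid_algebra M\<^esub> Poly_Mapping.map ((*) c) g = Poly_Mapping.map ((*) c) (f \<otimes>\<^bsub>monoid_algebra M\<^esub> g)"
proof -
  have *: "Poly_Mapping.map ((*) c) (sum h S) = (\<Sum>x\<in>S. Poly_Mapping.map ((*) c) (h x))" if "finite S"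
    for h :: "'x \<Rightarrow> 'a \<Rightarrow>\<^sub>0 'b" and S
    using that by (induction S) (auto simp: map_scale_add intro: poly_mapping_eqI)
  show "Poly_Mapping.map ((*) c) f \<otimes>\<^bsub>monoid_algebra M\<^esub> g = Poly_Mapping.map ((*) c) (f \<otimes>\<^bsub>monoid_algebra M\<^esub> g)"
    by (subst (1 2) monoid_algebra_mult_expand[of "Poly_Mapping.keys f" _ "Poly_Mapping.keys g"])
      (use keys_map_scale[of c f] in \<open>auto simp: * mult.assoc\<close>)
  show "f \<otimes>\<^bsub>monoid_algebra M\<^esub> Poly_Mapping.map ((*) c) g = Poly_Mapping.map ((*) c) (f \<otimes>\<^bsub>monoid_algebra M\<^esub> g)"
    by (subst (1 2) monoid_algebra_mult_expand[of "Poly_Mapping.keys f" _ "Poly_Mapping.keys g"])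
      (use keys_map_scale[of c g] in \<open>auto simp: * mult.left_commute\<close>)
qed

lemma k_algebra_monoid_algebra:
  assumes "Group.monoid M"
  shows "k_algebra (monoid_algebra M :: ('k::field, _) module)"
proof -
  interpret M: Group.monoid M by fact
  let ?A = "monoid_algebra M :: ('k, _) module"
  have closed: "Poly_Mapping.keys (f \<otimes>\<^bsub>?A\<^esub> g) \<subseteq> carrier M"
    if f: "Poly_Mapping.keys f \<subseteq> carrier M" and g: "Poly_Mapping.keys g \<subseteq> carrier M" for f g
    using f
  proof (induction f rule: poly_mapping_span_induct)
    case (single m c)
    from g show ?case
      by (induction g rule: poly_mapping_span_induct)
        (simp_all add: monoid_algebra_mult_add single keys_add_subset keys_single_subset del: keys_single)
  qed (simp_all add: monoid_algebra_mult_add keys_add_subset)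
  have assoc: "f \<otimes>\<^bsub>?A\<^esub> g \<otimes>\<^bsub>?A\<^esub> h = f \<otimes>\<^bsub>?A\<^esub> (g \<otimes>\<^bsub>?A\<^esub> h)"
    if f: "Poly_Mapping.keys f \<subseteq> carrier M" and g: "Poly_Mapping.keys g \<subseteq> carrier M"
      and h: "Poly_Mapping.keys h \<subseteq> carrier M" for f g h
    using f
  proof (induction f rule: poly_mapping_span_induct)
    case (single m c)
    from g show ?case
    proof (induction g rule: poly_mapping_span_induct)
      case (single m' c')
      from h show ?case
        by (induction h rule: poly_mapping_span_induct)
          (use single \<open>m \<in> carrier M\<close> in \<open>auto simp: monoid_algebra_mult_add M.m_assoc mult.assoc\<close>)
    qed (simp_all add: monoid_algebra_mult_add)
  qed (simp_all add: monoid_algebra_mult_add)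
  have unit: "mon \<one>\<^bsub>M\<^esub> \<otimes>\<^bsub>?A\<^esub> f = f" "f \<otimes>\<^bsub>?A\<^esub> mon \<one>\<^bsub>M\<^esub> = f"
    if f: "Poly_Mapping.keys f \<subseteq> carrier M" for f
    using f by (induction f rule: poly_mapping_span_induct) (auto simp: monoid_algebra_mult_add)
  have "ring ?A"
  proof (rule ringI)
    show "abelian_group ?A"
    proof (rule abelian_groupI)
      fix f assume "f \<in> carrier ?A"
      then show "\<exists>g\<in>carrier ?A. g \<oplus>\<^bsub>?A\<^esub> f = \<zero>\<^bsub>?A\<^esub>"
        by (intro bexI[of _ "- f"]) (auto simp: in_keys_iff)
    qed (auto simp: algebra_simps dest: keys_add_subset[THEN subsetD, rotated 2])
    show "Group.monoid ?A"
      by (rule monoidI) (use closed assoc unit in \<open>simp_all add: keys_single_subset del: keys_single\<close>)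
  qed (auto simp: monoid_algebra_mult_add)
  then show ?thesis
    by (rule k_algebraI)
      (auto simp: monoid_algebra_mult_smult map_scale_add lookup_add
         algebra_simps intro!: poly_mapping_eqI dest: keys_map_scale[THEN subsetD])
qed

text \<open>Linear extension is determined by, and realises, arbitrary values on the basis.\<close>

lemma lin_ext_expand:
  assumes "k_algebra B" and "finite S" "Poly_Mapping.keys f \<subseteq> S" "\<phi> \<in> S \<rightarrow> carrier B"
  shows "lin_ext B \<phi> f = (\<Oplus>\<^bsub>B\<^esub>m\<in>S. Poly_Mapping.lookup f m \<odot>\<^bsub>B\<^esub> \<phi> m)"
proof -
  interpret B: kalg B using assms by simp
  show ?thesis unfolding lin_ext_def
    by (rule B.finsum_mono_neutral_cong_left) (use assms in \<open>auto simp: in_keys_iff Pi_def\<close>)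
qed

lemma lin_ext_linear:
  assumes B: "k_algebra B" and \<phi>: "\<phi> \<in> carrier M \<rightarrow> carrier B"
  shows "linear_map (monoid_algebra M) (B :: ('k::field, 'b, 'n) module_scheme) (lin_ext B \<phi>)"
proof -
  interpret B: kalg B using assms by simp
  show ?thesis
  proof (rule linear_mapI)
    fix f :: "_ \<Rightarrow>\<^sub>0 'k" assume "f \<in> carrier (monoid_algebra M)"
    then have f: "Poly_Mapping.keys f \<subseteq> carrier M" by simp
    show "lin_ext B \<phi> f \<in> carrier B"
      unfolding lin_ext_def by (rule B.finsum_closed) (use f \<phi> in auto)
    fix c
    have "lin_ext B \<phi> (c \<odot>\<^bsub>monoid_algebra M\<^esub> f) =
      (\<Oplus>\<^bsub>B\<^esub>m\<in>Poly_Mapping.keys f. c \<odot>\<^bsub>B\<^esub> (Poly_Mapping.lookup f m \<odot>\<^bsub>B\<^esub> \<phi> m))"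
      using f \<phi> keys_map_scale[of c f]
      by (subst lin_ext_expand[OF B, of "Poly_Mapping.keys f"]) (auto intro!: B.finsum_cong' simp: Pi_iff subset_iff)
    also have "(\<Oplus>\<^bsub>B\<^esub>m\<in>S. c \<odot>\<^bsub>B\<^esub> (Poly_Mapping.lookup f m \<odot>\<^bsub>B\<^esub> \<phi> m)) =
        c \<odot>\<^bsub>B\<^esub> (\<Oplus>\<^bsub>B\<^esub>m\<in>S. Poly_Mapping.lookup f m \<odot>\<^bsub>B\<^esub> \<phi> m)"
      if "finite S" "S \<subseteq> carrier M" for S
      using that
    proof (induction S)
      case (insert x S)
      have p1: "(\<lambda>m. c \<odot>\<^bsub>B\<^esub> (Poly_Mapping.lookup f m \<odot>\<^bsub>B\<^esub> \<phi> m)) \<in> S \<rightarrow> carrier B"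
        and p2: "(\<lambda>m. (Poly_Mapping.lookup f m \<odot>\<^bsub>B\<^esub> \<phi> m)) \<in> S \<rightarrow> carrier B"
        and p3: "\<phi> x \<in> carrier B"
        using insert \<phi> by auto
      have p4: "(\<Oplus>\<^bsub>B\<^esub>m\<in>S. Poly_Mapping.lookup f m \<odot>\<^bsub>B\<^esub> \<phi> m) \<in> carrier B"
        using p2 by (rule B.finsum_closed)
      have "(\<Oplus>\<^bsub>B\<^esub>m\<in>insert x S. c \<odot>\<^bsub>B\<^esub> (Poly_Mapping.lookup f m \<odot>\<^bsub>B\<^esub> \<phi> m)) =
         c \<odot>\<^bsub>B\<^esub> (Poly_Mapping.lookup f x \<odot>\<^bsub>B\<^esub> \<phi> x) \<oplus>\<^bsub>B\<^esub> (\<Oplus>\<^bsub>B\<^esub>m\<in>S. c \<odot>\<^bsub>B\<^esub> (Poly_Mapping.lookup f m \<odot>\<^bsub>B\<^esub> \<phi> m))"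
        using insert p1 p3 by (intro B.finsum_insert) auto
      also have "\<dots> = c \<odot>\<^bsub>B\<^esub> ((Poly_Mapping.lookup f x \<odot>\<^bsub>B\<^esub> \<phi> x) \<oplus>\<^bsub>B\<^esub> (\<Oplus>\<^bsub>B\<^esub>m\<in>S. Poly_Mapping.lookup f m \<odot>\<^bsub>B\<^esub> \<phi> m))"
        using insert p3 p4 by (simp add: B.smult_add_right)
      also have "(Poly_Mapping.lookup f x \<odot>\<^bsub>B\<^esub> \<phi> x) \<oplus>\<^bsub>B\<^esub> (\<Oplus>\<^bsub>B\<^esub>m\<in>S. Poly_Mapping.lookup f m \<odot>\<^bsub>B\<^esub> \<phi> m)
         = (\<Oplus>\<^bsub>B\<^esub>m\<in>insert x S. Poly_Mapping.lookup f m \<odot>\<^bsub>B\<^esub> \<phi> m)"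
        using insert p2 p3 by (intro B.finsum_insert[symmetric]) auto
      finally show ?case .
    qed simp
    note this[of "Poly_Mapping.keys f"]
    finally show "lin_ext B \<phi> (c \<odot>\<^bsub>monoid_algebra M\<^esub> f) = c \<odot>\<^bsub>B\<^esub> lin_ext B \<phi> f"
      using f by (simp add: lin_ext_def)
  next
    fix f g :: "_ \<Rightarrow>\<^sub>0 'k" assume "f \<in> carrier (monoid_algebra M)" "g \<in> carrier (monoid_algebra M)"
    then have f: "Poly_Mapping.keys f \<subseteq> carrier M" and g: "Poly_Mapping.keys g \<subseteq> carrier M" by simp_all
    let ?S = "Poly_Mapping.keys f \<union> Poly_Mapping.keys g"
    have "lin_ext B \<phi> (f + g) =
      (\<Oplus>\<^bsub>B\<^esub>m\<in>?S. Poly_Mapping.lookup f m \<odot>\<^bsub>B\<^esub> \<phi> m \<oplus>\<^bsub>B\<^esub> Poly_Mapping.lookup g m \<odot>\<^bsub>B\<^esub> \<phi> m)"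
      using f g \<phi> keys_add[of f g]
      by (subst lin_ext_expand[OF B, of ?S]) (auto intro!: B.finsum_cong' simp: lookup_add B.smult_add_left Pi_def)
    also have "\<dots> = (\<Oplus>\<^bsub>B\<^esub>m\<in>?S. Poly_Mapping.lookup f m \<odot>\<^bsub>B\<^esub> \<phi> m) \<oplus>\<^bsub>B\<^esub> (\<Oplus>\<^bsub>B\<^esub>m\<in>?S. Poly_Mapping.lookup g m \<odot>\<^bsub>B\<^esub> \<phi> m)"
      using f g \<phi> by (intro B.finsum_addf) auto
    also have "\<dots> = lin_ext B \<phi> f \<oplus>\<^bsub>B\<^esub> lin_ext B \<phi> g"
      using f g \<phi> by (subst (1 2) lin_ext_expand[OF B, of ?S]) auto
    finally show "lin_ext B \<phi> (f \<oplus>\<^bsub>monoid_algebra M\<^esub> g) = lin_ext B \<phi> f \<oplus>\<^bsub>B\<^esub> lin_ext B \<phi> g"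
      by simp
  qed
qed

lemma lin_ext_single:
  assumes B: "k_algebra B" and \<phi>: "\<phi> m \<in> carrier B"
  shows "lin_ext B \<phi> (Poly_Mapping.single m c) = c \<odot>\<^bsub>B\<^esub> \<phi> m"
proof -
  interpret B: kalg B using assms by simp
  have "lin_ext B \<phi> (Poly_Mapping.single m c) = (\<Oplus>\<^bsub>B\<^esub>m\<in>{m}. Poly_Mapping.lookup (Poly_Mapping.single m c) m \<odot>\<^bsub>B\<^esub> \<phi> m)"
    using lin_ext_expand[OF B, of "{m}" "Poly_Mapping.single m c" \<phi>] \<phi> by simp
  also have "\<dots> = c \<odot>\<^bsub>B\<^esub> \<phi> m"
    using \<phi> by (subst B.finsum_insert) auto
  finally show ?thesis .
qed

lemma linear_map_monoid_algebra_eqI: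
  assumes M: "Group.monoid M" and "k_algebra B"
    and f: "linear_map (monoid_algebra M) B f" and g: "linear_map (monoid_algebra M) B g"
    and eq: "\<And>m. m \<in> carrier M \<Longrightarrow> f (mon m) = g (mon m)" and u: "u \<in> carrier (monoid_algebra M)"
  shows "f u = g u"
proof -
  have "Poly_Mapping.keys u \<subseteq> carrier M" using u by simp
  then show ?thesis
  proof (induction u rule: poly_mapping_span_induct)
    case zero
    show ?case using linear_map_zero[OF k_algebra_monoid_algebra[OF M] assms(2) f]
        linear_map_zero[OF k_algebra_monoid_algebra[OF M] assms(2) g] by simp
  next
    case (single m c)
    then show ?case
      using linear_mapD(3)[OF f, of "mon m" c] linear_mapD(3)[OF g, of "mon m" c] eq by simp
  next
    case (add u w)
    then show ?case using linear_mapD(2)[OF f, of u w] linear_mapD(2)[OF g, of u w] by simp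
  qed
qed

lemma lin_ext_alg_hom:
  assumes M: "Group.monoid M" and B: "k_algebra B" and \<phi>: "\<phi> \<in> carrier M \<rightarrow> carrier B"
    and mult: "\<And>a b. a \<in> carrier M \<Longrightarrow> b \<in> carrier M \<Longrightarrow> \<phi> (a \<otimes>\<^bsub>M\<^esub> b) = \<phi> a \<otimes>\<^bsub>B\<^esub> \<phi> b"
    and one: "\<phi> \<one>\<^bsub>M\<^esub> = \<one>\<^bsub>B\<^esub>"
  shows "lin_ext B \<phi> \<in> alg_hom (monoid_algebra M) (B :: ('k::field, 'b, 'n) module_scheme)"
proof -
  interpret M: Group.monoid M by fact
  interpret B: kalg B using assms by simp
  interpret A: kalg "monoid_algebra M :: ('k, _) module" using k_algebra_monoid_algebra[OF M] by simp
  note l = linear_mapD[OF lin_ext_linear[OF B \<phi>]]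
  note s = lin_ext_single[OF B, of \<phi>]
  have l2: "lin_ext B \<phi> (f + g) = lin_ext B \<phi> f \<oplus>\<^bsub>B\<^esub> lin_ext B \<phi> g"
    if "Poly_Mapping.keys f \<subseteq> carrier M" "Poly_Mapping.keys g \<subseteq> carrier M" for f g
    using l(2)[of f g] that by simp
  have z: "lin_ext B \<phi> 0 = \<zero>\<^bsub>B\<^esub>" by (simp add: lin_ext_def)
  have ph: "\<phi> a \<in> carrier B" if "a \<in> carrier M" for a using \<phi> that by auto
  have cl: "Poly_Mapping.keys (f \<otimes>\<^bsub>monoid_algebra M\<^esub> g) \<subseteq> carrier M"
    if "Poly_Mapping.keys f \<subseteq> carrier M" "Poly_Mapping.keys g \<subseteq> carrier M" for f g :: "_ \<Rightarrow>\<^sub>0 'k"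
    using A.m_closed[of f g] that by simp
  show ?thesis
  proof (rule alg_homI)
    fix f g :: "_ \<Rightarrow>\<^sub>0 'k" assume "f \<in> carrier (monoid_algebra M)" "g \<in> carrier (monoid_algebra M)"
    then have f: "Poly_Mapping.keys f \<subseteq> carrier M" and g: "Poly_Mapping.keys g \<subseteq> carrier M" by simp_all
    have lg: "lin_ext B \<phi> g \<in> carrier B" using l(1) g by simp
    from f show "lin_ext B \<phi> (f \<otimes>\<^bsub>monoid_algebra M\<^esub> g) = lin_ext B \<phi> f \<otimes>\<^bsub>B\<^esub> lin_ext B \<phi> g"
    proof (induction f rule: poly_mapping_span_induct)
      case (single m c)
      from g show ?case
      proof (induction g rule: poly_mapping_span_induct)
        case (single m' d)
        then show ?case using \<open>m \<in> carrier M\<close>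
          by (simp add: s ph mult mult.commute)
      next
        case (add f g)
        then show ?case using l(1) \<open>m \<in> carrier M\<close>
          by (simp add: monoid_algebra_mult_add l2 cl keys_single_subset B.r_distr del: keys_single)
      qed (use l(1) \<open>m \<in> carrier M\<close> in \<open>simp add: z\<close>)
    next
      case (add f f')
      then show ?case using l(1) g by (simp add: monoid_algebra_mult_add l2 cl B.l_distr)
    qed (simp add: z lg)
  qed (use lin_ext_linear[OF B \<phi>] in \<open>simp_all add: s one\<close>)
qed

section \<open>Quotients and presentations\<close>

locale kalg_ideal = kalg A + ideal I A
  for A :: "('k::field, 'a, 'm) module_scheme" (structure) and I
begin

lemma coset_memE:
  assumes "u \<in> I +> a"
  obtains i where "i \<in> I" "u = i \<oplus> a"
  using assms unfolding a_r_coset_def' by blast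

lemma smult_ideal: "i \<in> I \<Longrightarrow> c \<odot> i \<in> I"
  using I_l_closed[of i "c \<odot> \<one>"] a_Hcarr[of i] by simp

lemma coset_eq_iff: "a \<in> carrier A \<Longrightarrow> b \<in> carrier A \<Longrightarrow> I +> a = I +> b \<longleftrightarrow> a \<ominus> b \<in> I"
  using quotient_eq_iff_same_a_r_cos[OF is_ideal, of a b] by simp

lemma quot_simps:
  "carrier (quot_algebra A I) = (\<lambda>a. I +> a) ` carrier A"
  "\<one>\<^bsub>quot_algebra A I\<^esub> = I +> \<one>"
  "\<zero>\<^bsub>quot_algebra A I\<^esub> = I"
  "a \<in> carrier A \<Longrightarrow> b \<in> carrier A \<Longrightarrow> (I +> a) \<oplus>\<^bsub>quot_algebra A I\<^esub> (I +> b) = I +> (a \<oplus> b)"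
  "a \<in> carrier A \<Longrightarrow> b \<in> carrier A \<Longrightarrow> (I +> a) \<otimes>\<^bsub>quot_algebra A I\<^esub> (I +> b) = I +> (a \<otimes> b)"
  by (auto simp: quot_algebra_def FactRing_simps rcoset_mult_add a_rcos_sum)

lemma quot_smult:
  assumes a: "a \<in> carrier A"
  shows "c \<odot>\<^bsub>quot_algebra A I\<^esub> (I +> a) = I +> (c \<odot> a)"
proof -
  have "I +> (c \<odot> u) = I +> (c \<odot> a)" if u: "u \<in> I +> a" for u
  proof -
    obtain i where i: "i \<in> I" "u = i \<oplus> a"
      by (rule coset_memE[OF u])
    have ic: "i \<in> carrier A" using i by (simp add: a_Hcarr)
    have "c \<odot> u = c \<odot> i \<oplus> c \<odot> a"
      using i ic a by (simp add: smult_add_right)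
    then have "c \<odot> u \<ominus> c \<odot> a = c \<odot> i"
      using ic a by (simp add: a_minus_def a_assoc r_neg)
    moreover have "c \<odot> u \<in> carrier A" using ic a i(2) by simp
    ultimately show ?thesis
      using smult_ideal[OF i(1), of c] a by (simp only: coset_eq_iff smult_closed)
  qed
  then have "(\<Union>u\<in>I +> a. I +> (c \<odot> u)) = (\<Union>u\<in>I +> a. I +> (c \<odot> a))"
    by (rule SUP_cong[OF refl])
  moreover have "I +> a \<noteq> {}" using a_rcos_self[OF a] by blast
  ultimately have "(\<Union>u\<in>I +> a. I +> (c \<odot> u)) = I +> (c \<odot> a)"
    by (simp only: UN_constant if_False)
  then show ?thesis by (simp add: quot_algebra_def)
qed

lemma k_algebra_quot: "k_algebra (quot_algebra A I)"
proof -
  let ?Q = "quot_algebra A I"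
  have Z: "\<zero>\<^bsub>?Q\<^esub> = I +> \<zero>" by (simp only: quot_simps(3) a_rcos_const zero_closed a_coset_add_zero a_subset)
  have "ring ?Q"
  proof (rule ringI)
    show "abelian_group ?Q"
    proof (rule abelian_groupI)
      fix U assume "U \<in> carrier ?Q"
      then obtain a where "a \<in> carrier A" "U = I +> a" by (auto simp: quot_simps(1))
      then show "\<exists>W\<in>carrier ?Q. W \<oplus>\<^bsub>?Q\<^esub> U = \<zero>\<^bsub>?Q\<^esub>"
        by (intro bexI[of _ "I +> (\<ominus> a)"]) (auto simp: quot_simps(1,4) l_neg Z simp del: a_rcos_const)
    qed (auto simp: quot_simps(1,4) Z a_ac simp del: a_coset_add_zero a_rcos_const)
    show "Group.monoid ?Q"
      by (rule monoidI) (auto simp: quot_simps(1,2,5) m_assoc)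
  qed (auto simp: quot_simps(1,4,5) l_distr r_distr)
  then show ?thesis
    by (rule k_algebraI) (auto simp: quot_simps quot_smult smult_add_left smult_add_right)
qed

lemma coset_alg_hom: "(\<lambda>a. I +> a) \<in> alg_hom A (quot_algebra A I)"
  by (rule alg_homI) (auto simp: quot_simps quot_smult intro: linear_mapI)

lemma coset_zero: "i \<in> I \<Longrightarrow> I +> i = \<zero>\<^bsub>quot_algebra A I\<^esub>"
  by (simp add: quot_simps a_rcos_const)

lemma the_elem_lift:
  assumes "k_algebra C" "linear_map A C f" "\<And>i. i \<in> I \<Longrightarrow> f i = \<zero>\<^bsub>C\<^esub>" "a \<in> carrier A"
  shows "the_elem (f ` (I +> a)) = f a"
proof -
  interpret C: kalg C using assms by simp
  note l = linear_mapD[OF assms(2)]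
  have "f u = f a" if u: "u \<in> I +> a" for u
  proof -
    obtain i where i: "i \<in> I" "u = i \<oplus> a"
      by (rule coset_memE[OF u])
    then show ?thesis using l(1)[OF assms(4)] l(2)[OF a_Hcarr[OF i(1)] assms(4)] assms(3)[OF i(1)] by simp
  qed
  then have "f ` (I +> a) = (\<lambda>_. f a) ` (I +> a)"
    by (rule image_cong[OF refl])
  also have "\<dots> = {f a}"
    by (rule image_constant[OF a_rcos_self[OF assms(4)]])
  finally show ?thesis by (simp only: the_elem_eq)
qed

end

definition word_eval :: "('k::field, 'b, 'n) module_scheme \<Rightarrow> ('g \<Rightarrow> 'b) \<Rightarrow> 'g list \<Rightarrow> 'b" where
  "word_eval C f w = foldr (\<lambda>g y. f g \<otimes>\<^bsub>C\<^esub> y) w \<one>\<^bsub>C\<^esub>"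

lemma word_eval_simps [simp]:
  "word_eval C f [] = \<one>\<^bsub>C\<^esub>" "word_eval C f (g # w) = f g \<otimes>\<^bsub>C\<^esub> word_eval C f w"
  by (simp_all add: word_eval_def)

lemma pres_lift_eval: "pres_lift C f U = the_elem (lin_ext C (word_eval C f) ` U)"
  by (simp add: pres_lift_def word_eval_def[abs_def])

abbreviation words :: "'g set \<Rightarrow> 'g list monoid" where
  "words V \<equiv> \<lparr>carrier = lists V, monoid.mult = (@), one = []\<rparr>"

lemma monoid_words: "Group.monoid (words V)"
  by (rule monoidI) auto

lemma k_algebra_free [simp]: "k_algebra (free_alg V)"
  by (simp add: free_alg_def k_algebra_monoid_algebra monoid_words)

lemma free_alg_simps:
  "carrier (free_alg V) = {f. Poly_Mapping.keys f \<subseteq> lists V}"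
  "\<zero>\<^bsub>free_alg V\<^esub> = 0" "\<one>\<^bsub>free_alg V\<^esub> = mon []"
  "f \<oplus>\<^bsub>free_alg V\<^esub> g = f + g"
  "c \<odot>\<^bsub>free_alg V\<^esub> f = Poly_Mapping.map ((*) c) f"
  "Poly_Mapping.single a c \<otimes>\<^bsub>free_alg V\<^esub> Poly_Mapping.single b d = Poly_Mapping.single (a @ b) (c * d)"
  by (simp_all add: free_alg_def)

lemma word_eval_closed:
  assumes "k_algebra C" "f \<in> V \<rightarrow> carrier C"
  shows "w \<in> lists V \<Longrightarrow> word_eval C f w \<in> carrier C"
proof -
  interpret C: kalg C using assms by simp
  show "w \<in> lists V \<Longrightarrow> word_eval C f w \<in> carrier C"
    by (induction w) (use assms in auto)
qed

lemma word_eval_alg_hom: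
  assumes C: "k_algebra C" and f: "f \<in> V \<rightarrow> carrier C"
  shows "lin_ext C (word_eval C f) \<in> alg_hom (free_alg V) C"
proof -
  interpret C: kalg C using assms by simp
  show ?thesis unfolding free_alg_def
  proof (rule lin_ext_alg_hom[OF monoid_words C])
    show "word_eval C f \<in> carrier (words V) \<rightarrow> carrier C"
      using word_eval_closed[OF assms] by auto
    fix a b assume "a \<in> carrier (words V)" "b \<in> carrier (words V)"
    then have a: "a \<in> lists V" and b: "b \<in> lists V" by auto
    from a show "word_eval C f (a \<otimes>\<^bsub>words V\<^esub> b) = word_eval C f a \<otimes>\<^bsub>C\<^esub> word_eval C f b"
    proof (induction a)
      case Nil
      then show ?case using word_eval_closed[OF assms b] by simp
    next
      case (Cons g a)
      then have "f g \<in> carrier C" using f by auto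
      then show ?case using Cons word_eval_closed[OF assms b] word_eval_closed[OF assms Cons(2)]
        by (simp add: C.m_assoc)
    qed
  qed simp
qed

locale presentation =
  fixes V :: "'g set" and R :: "('g list \<Rightarrow>\<^sub>0 'k::field) set"
  assumes relators: "R \<subseteq> carrier (free_alg V)"
begin

abbreviation "J \<equiv> Idl\<^bsub>free_alg V\<^esub> R"

interpretation F: kalg_ideal "free_alg V" J
proof -
  interpret kalg "free_alg V :: ('k, _) module" by simp
  show "kalg_ideal (free_alg V) J"
    by (intro kalg_ideal.intro genideal_ideal relators kalg_axioms)
qed

lemma k_algebra_pres: "k_algebra (pres_alg V R)"
  unfolding pres_alg_def by (rule F.k_algebra_quot)

context
  fixes C :: "('k, 'b, 'n) module_scheme" and f
  assumes C: "k_algebra C" and f: "f \<in> V \<rightarrow> carrier C"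
    and resp: "\<And>r. r \<in> R \<Longrightarrow> lin_ext C (word_eval C f) r = \<zero>\<^bsub>C\<^esub>"
begin

lemma word_eval_ideal: "r \<in> J \<Longrightarrow> lin_ext C (word_eval C f) r = \<zero>\<^bsub>C\<^esub>"
proof -
  interpret C: kalg C using C by simp
  let ?h = "lin_ext C (word_eval C f)"
  have hom: "?h \<in> ring_hom (free_alg V) C"
    using word_eval_alg_hom[OF C f] by (simp add: alg_hom_def)
  interpret h: ring_hom_ring "free_alg V" C ?h
    by (rule ring_hom_ringI2) (use hom F.ring_axioms C.ring_axioms in auto)
  have "J \<subseteq> a_kernel (free_alg V) C ?h"
    by (rule F.genideal_minimal[OF h.kernel_is_ideal])
      (use relators resp in \<open>unfold a_kernel_def', blast\<close>)
  then show "r \<in> J \<Longrightarrow> ?h r = \<zero>\<^bsub>C\<^esub>"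
    unfolding a_kernel_def' by blast
qed

lemma pres_lift_coset:
  "u \<in> carrier (free_alg V) \<Longrightarrow>
     pres_lift C f (J +>\<^bsub>free_alg V\<^esub> u) = lin_ext C (word_eval C f) u"
  unfolding pres_lift_eval
  by (rule F.the_elem_lift[OF C alg_hom_linear[OF word_eval_alg_hom[OF C f]]])
    (auto intro: word_eval_ideal)

lemma pres_lift_alg_hom: "pres_lift C f \<in> alg_hom (pres_alg V R) C"
proof -
  note h = alg_homD[OF word_eval_alg_hom[OF C f]]
  show ?thesis unfolding pres_alg_def
    by (intro alg_homI linear_mapI)
      (auto simp: F.quot_simps F.quot_smult pres_lift_coset h simp del: F.a_rcos_const)
qed

lemma pres_lift_gen: "g \<in> V \<Longrightarrow> pres_lift C f (pres_gen V R g) = f g"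
proof -
  assume g: "g \<in> V"
  interpret C: kalg C using C by simp
  have m: "mon [g] \<in> carrier (free_alg V :: ('k, _) module)" using g by (simp add: free_alg_simps)
  have fg: "f g \<in> carrier C" using f g by auto
  show ?thesis unfolding pres_gen_def pres_lift_coset[OF m]
    using fg by (subst lin_ext_single[OF C]) auto
qed

end

lemma pres_gen_closed: "g \<in> V \<Longrightarrow> pres_gen V R g \<in> carrier (pres_alg V R)"
  unfolding pres_gen_def pres_alg_def F.quot_simps by (rule imageI) (simp add: free_alg_simps)

lemma coset_word_eval:
  assumes u: "u \<in> carrier (free_alg V)"
  shows "J +>\<^bsub>free_alg V\<^esub> u = lin_ext (pres_alg V R) (word_eval (pres_alg V R) (pres_gen V R)) u"
proof -
  interpret P: kalg "pres_alg V R" using k_algebra_pres by simp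
  note w = word_eval_alg_hom[OF k_algebra_pres, of "pres_gen V R"]
  have p: "pres_gen V R \<in> V \<rightarrow> carrier (pres_alg V R)" by (auto intro: pres_gen_closed)
  let ?M = "words V"
  note co = F.coset_alg_hom[folded pres_alg_def]
  have cw: "J +>\<^bsub>free_alg V\<^esub> mon w = word_eval (pres_alg V R) (pres_gen V R) w" if "w \<in> lists V" for w
    using that
  proof (induction w)
    case Nil
    then show ?case using alg_homD(5)[OF co] by (simp add: free_alg_simps)
  next
    case (Cons g w)
    have "mon (g # w) = mon [g] \<otimes>\<^bsub>free_alg V\<^esub> mon w"
      by (simp add: free_alg_simps)
    then show ?case using Cons alg_homD(4)[OF co, of "mon [g]" "mon w"]
      by (simp add: free_alg_simps pres_gen_def)
  qed
  show ?thesis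
    by (rule linear_map_monoid_algebra_eqI[OF monoid_words k_algebra_pres
        alg_hom_linear[OF co, unfolded free_alg_def]
        alg_hom_linear[OF w[OF p], unfolded free_alg_def], folded free_alg_def])
      (use u in \<open>auto simp: cw[unfolded in_lists_conv_set] lin_ext_single[OF k_algebra_pres] word_eval_closed[OF k_algebra_pres p] free_alg_simps\<close>)
qed

lemma relator_zero:
  "r \<in> R \<Longrightarrow> lin_ext (pres_alg V R) (word_eval (pres_alg V R) (pres_gen V R)) r = \<zero>\<^bsub>pres_alg V R\<^esub>"
  using coset_word_eval[of r] relators F.coset_zero[of r] F.genideal_self[OF relators]
  by (auto simp: pres_alg_def)

lemma generated_pres: "generated_by (pres_alg V R) (pres_gen V R ` V)"
  unfolding generated_by_def
proof (intro conjI, use pres_gen_closed in blast, rule subsetI)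
  interpret P: kalg "pres_alg V R" using k_algebra_pres by simp
  let ?S = "alg_gen (pres_alg V R) (pres_gen V R ` V)"
  note co = F.coset_alg_hom[folded pres_alg_def]
  fix a assume "a \<in> carrier (pres_alg V R)"
  then obtain u where u: "u \<in> carrier (free_alg V)" "a = J +>\<^bsub>free_alg V\<^esub> u"
    by (auto simp: pres_alg_def F.quot_simps)
  from u(1) have "Poly_Mapping.keys u \<subseteq> lists V" by (simp add: free_alg_simps)
  then have "J +>\<^bsub>free_alg V\<^esub> u \<in> ?S"
  proof (induction u rule: poly_mapping_span_induct)
    case zero
    have "0 \<odot>\<^bsub>pres_alg V R\<^esub> \<one>\<^bsub>pres_alg V R\<^esub> \<in> ?S"
      by (intro alg_gen.intros)
    then show ?case using linear_map_zero[OF _ k_algebra_pres alg_hom_linear[OF co]]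
      by (simp add: free_alg_simps)
  next
    case (single w c)
    have "J +>\<^bsub>free_alg V\<^esub> mon w \<in> ?S"
      using single
    proof (induction w)
      case Nil
      have "J +>\<^bsub>free_alg V\<^esub> mon [] = \<one>\<^bsub>pres_alg V R\<^esub>" using alg_homD(5)[OF co] by (simp add: free_alg_simps)
      then show ?case by (simp add: alg_gen.unit)
    next
      case (Cons g w)
      have "mon (g # w) = mon [g] \<otimes>\<^bsub>free_alg V\<^esub> mon w"
        by (simp add: free_alg_simps)
      then have "J +>\<^bsub>free_alg V\<^esub> mon (g # w) = pres_gen V R g \<otimes>\<^bsub>pres_alg V R\<^esub> (J +>\<^bsub>free_alg V\<^esub> mon w)"
        using Cons alg_homD(4)[OF co, of "mon [g]" "mon w"]
        by (simp add: free_alg_simps pres_gen_def)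
      then show ?case using Cons by (simp add: alg_gen.mult[OF alg_gen.gen])
    qed
    then have "c \<odot>\<^bsub>pres_alg V R\<^esub> (J +>\<^bsub>free_alg V\<^esub> mon w) \<in> ?S" by (rule alg_gen.smult)
    then show ?case using single alg_homD(3)[OF co, of "mon w" c] by (simp add: free_alg_simps)
  next
    case (add f g)
    then show ?case using alg_homD(2)[OF co, of f g] alg_gen.add by (simp add: free_alg_simps)
  qed
  then show "a \<in> ?S" using u by simp
qed

end

section \<open>Bilinear maps and tensor products\<close>

definition bilinear where
  "bilinear A B C f \<longleftrightarrow> (\<forall>a\<in>carrier A. linear_map B C (f a)) \<and>
     (\<forall>b\<in>carrier B. linear_map A C (\<lambda>a. f a b))"

lemma monoid_algebra_mult_diff:
  "f \<otimes>\<^bsub>monoid_algebra M\<^esub> (g - h) = f \<otimes>\<^bsub>monoid_algebra M\<^esub> g - f \<otimes>\<^bsub>monoid_algebra M\<^esub> h"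
  "(g - h) \<otimes>\<^bsub>monoid_algebra M\<^esub> f = g \<otimes>\<^bsub>monoid_algebra M\<^esub> f - h \<otimes>\<^bsub>monoid_algebra M\<^esub> f"
  for f g h :: "'m \<Rightarrow>\<^sub>0 'k::field"
  using monoid_algebra_mult_add(2)[where g = f and f = "g - h" and f' = h and M = M]
    monoid_algebra_mult_add(1)[where f = "g - h" and f' = h and g = f and M = M]
  by simp_all

lemma map_scale_diff:
  "Poly_Mapping.map ((*) c) (f - g) = Poly_Mapping.map ((*) c) f - Poly_Mapping.map ((*) c) g"
  for c :: "'k::field"
  by (rule poly_mapping_eqI) (simp add: lookup_minus algebra_simps)

lemma bilin_scaled:
  assumes "k_algebra A" "k_algebra B"
  shows "a \<in> carrier A \<Longrightarrow> a' \<in> carrier A \<Longrightarrow> b \<in> carrier B \<Longrightarrow>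
    Poly_Mapping.single (a \<oplus>\<^bsub>A\<^esub> a', b) c - Poly_Mapping.single (a, b) c - Poly_Mapping.single (a', b) c \<in> bilin A B"
  "a \<in> carrier A \<Longrightarrow> b \<in> carrier B \<Longrightarrow> b' \<in> carrier B \<Longrightarrow>
    Poly_Mapping.single (a, b \<oplus>\<^bsub>B\<^esub> b') c - Poly_Mapping.single (a, b) c - Poly_Mapping.single (a, b') c \<in> bilin A B"
  "a \<in> carrier A \<Longrightarrow> b \<in> carrier B \<Longrightarrow>
    Poly_Mapping.single (d \<odot>\<^bsub>A\<^esub> a, b) c - Poly_Mapping.single (a, b) (c * d) \<in> bilin A B"
  "a \<in> carrier A \<Longrightarrow> b \<in> carrier B \<Longrightarrow>
    Poly_Mapping.single (a, d \<odot>\<^bsub>B\<^esub> b) c - Poly_Mapping.single (a, b) (c * d) \<in> bilin A B"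
  "a \<in> carrier A \<Longrightarrow> b \<in> carrier B \<Longrightarrow>
    Poly_Mapping.single (d \<odot>\<^bsub>A\<^esub> a, b) c - Poly_Mapping.single (a, b) (d * c) \<in> bilin A B"
  "a \<in> carrier A \<Longrightarrow> b \<in> carrier B \<Longrightarrow>
    Poly_Mapping.single (a, d \<odot>\<^bsub>B\<^esub> b) c - Poly_Mapping.single (a, b) (d * c) \<in> bilin A B"
  using bilin.scale[OF bilin.add_left[of a A a' b B], where c = c]
    bilin.scale[OF bilin.add_right[of a A b B b'], where c = c]
    bilin.scale[OF bilin.smult_left[of a A b B d], where c = c]
    bilin.scale[OF bilin.smult_right[of a A b B d], where c = c]
  by (simp_all add: map_scale_diff mult.commute)

locale two_algebras =
  fixes A :: "('k::field, 'a, 'm) module_scheme" and B :: "('k, 'b, 'n) module_scheme"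
  assumes kA: "k_algebra A" and kB: "k_algebra B"
begin

sublocale A: kalg A using kA by simp
sublocale B: kalg B using kB by simp

abbreviation "N \<equiv> monoid_algebra (A \<times>\<times> B) :: ('k, 'a \<times> 'b \<Rightarrow>\<^sub>0 'k) module"

lemma monoid_prod: "Group.monoid (A \<times>\<times> B)"
  by (intro DirProd_monoid A.monoid_axioms B.monoid_axioms)

interpretation N: kalg N
  using k_algebra_monoid_algebra[OF monoid_prod] by simp

lemma bilin_closed: "u \<in> bilin A B \<Longrightarrow> Poly_Mapping.keys u \<subseteq> carrier A \<times> carrier B"
proof (induction rule: bilin.induct)
  case (scale u c)
  show ?case by (rule subset_trans[OF keys_map_scale scale.IH])
next
  case (plus u w)
  then show ?case by (simp add: keys_add_subset)
qed (auto dest!: keys_diff[THEN subsetD] split: if_splits)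

lemma bilin_single_mult:
  assumes p: "p \<in> carrier A" and r: "r \<in> carrier B" and u: "u \<in> bilin A B"
  shows "Poly_Mapping.single (p, r) c \<otimes>\<^bsub>N\<^esub> u \<in> bilin A B"
    and "u \<otimes>\<^bsub>N\<^esub> Poly_Mapping.single (p, r) c \<in> bilin A B"
  using u
  by (induction rule: bilin.induct)
    (use p r in \<open>simp_all add: bilin.zero bilin.plus monoid_algebra_mult_add monoid_algebra_mult_diff
      monoid_algebra_mult_smult bilin.scale A.l_distr A.r_distr B.l_distr B.r_distr bilin_scaled[OF kA kB]\<close>)

lemma bilin_ideal: "ideal (bilin A B) N"
proof (rule idealI)
  show "subgroup (bilin A B) (add_monoid N)"
  proof (rule subgroup.intro)
    fix u assume u: "u \<in> bilin A B"
    have uc: "u \<in> carrier N" using bilin_closed[OF u] by simp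
    have "(-1) \<odot>\<^bsub>N\<^esub> u \<in> bilin A B" using bilin.scale[OF u, of "-1"] by simp
    then show "inv\<^bsub>add_monoid N\<^esub> u \<in> bilin A B"
      using N.minus_smult[OF uc] by (simp add: a_inv_def)
  qed (use bilin_closed in \<open>auto intro: bilin.zero bilin.plus\<close>)
  fix u f assume u: "u \<in> bilin A B" and "f \<in> carrier N"
  then have f: "Poly_Mapping.keys f \<subseteq> carrier A \<times> carrier B" by simp
  show "f \<otimes>\<^bsub>N\<^esub> u \<in> bilin A B"
    using f by (induction f rule: poly_mapping_span_induct)
      (use u in \<open>auto simp: monoid_algebra_mult_add bilin_single_mult intro: bilin.intros\<close>)
  show "u \<otimes>\<^bsub>N\<^esub> f \<in> bilin A B"
    using f by (induction f rule: poly_mapping_span_induct)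
      (use u in \<open>auto simp: monoid_algebra_mult_add bilin_single_mult intro: bilin.intros\<close>)
qed (rule N.ring_axioms)

interpretation T: kalg_ideal N "bilin A B"
  by (intro kalg_ideal.intro bilin_ideal N.kalg_axioms)

lemma k_algebra_tensor: "k_algebra (tensor_alg A B)"
  unfolding tensor_alg_def by (rule T.k_algebra_quot)

lemma tens_closed: "a \<in> carrier A \<Longrightarrow> b \<in> carrier B \<Longrightarrow> tens A B a b \<in> carrier (tensor_alg A B)"
  unfolding tens_def tensor_alg_def T.quot_simps by (rule imageI) simp

lemma N_diff: "u \<in> carrier N \<Longrightarrow> w \<in> carrier N \<Longrightarrow> u \<ominus>\<^bsub>N\<^esub> w = u - w"
proof -
  assume *: "u \<in> carrier N" "w \<in> carrier N"
  have "(-1) \<odot>\<^bsub>N\<^esub> w = - w" by (auto intro!: poly_mapping_eqI)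
  then show ?thesis using N.diff_smult[OF *] by simp
qed

lemma tens_eqI:
  "u \<in> carrier N \<Longrightarrow> w \<in> carrier N \<Longrightarrow> u - w \<in> bilin A B \<Longrightarrow> bilin A B +>\<^bsub>N\<^esub> u = bilin A B +>\<^bsub>N\<^esub> w"
  by (subst T.coset_eq_iff) (simp_all add: N_diff del: monoid_algebra_simps(1))

lemma tens_add_left:
  assumes "a \<in> carrier A" "a' \<in> carrier A" "b \<in> carrier B"
  shows "tens A B (a \<oplus>\<^bsub>A\<^esub> a') b = tens A B a b \<oplus>\<^bsub>tensor_alg A B\<^esub> tens A B a' b"
proof -
  have "bilin A B +>\<^bsub>N\<^esub> mon (a \<oplus>\<^bsub>A\<^esub> a', b) = bilin A B +>\<^bsub>N\<^esub> (mon (a, b) + mon (a', b))"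
    by (rule tens_eqI) (use assms bilin.add_left[of a A a' b B] in
      \<open>simp_all add: diff_diff_eq keys_add_subset keys_single_subset del: keys_single\<close>)
  then show ?thesis unfolding tens_def tensor_alg_def
    using assms T.quot_simps(4)[of "mon (a, b)" "mon (a', b)"] by simp
qed

lemma tens_add_right:
  assumes "a \<in> carrier A" "b \<in> carrier B" "b' \<in> carrier B"
  shows "tens A B a (b \<oplus>\<^bsub>B\<^esub> b') = tens A B a b \<oplus>\<^bsub>tensor_alg A B\<^esub> tens A B a b'"
proof -
  have "bilin A B +>\<^bsub>N\<^esub> mon (a, b \<oplus>\<^bsub>B\<^esub> b') = bilin A B +>\<^bsub>N\<^esub> (mon (a, b) + mon (a, b'))"
    by (rule tens_eqI) (use assms bilin.add_right[of a A b B b'] in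
      \<open>simp_all add: diff_diff_eq keys_add_subset keys_single_subset del: keys_single\<close>)
  then show ?thesis unfolding tens_def tensor_alg_def
    using assms T.quot_simps(4)[of "mon (a, b)" "mon (a, b')"] by simp
qed

lemma tens_smult_left:
  assumes "a \<in> carrier A" "b \<in> carrier B"
  shows "tens A B (c \<odot>\<^bsub>A\<^esub> a) b = c \<odot>\<^bsub>tensor_alg A B\<^esub> tens A B a b"
proof -
  have "bilin A B +>\<^bsub>N\<^esub> mon (c \<odot>\<^bsub>A\<^esub> a, b) = bilin A B +>\<^bsub>N\<^esub> (Poly_Mapping.single (a, b) c)"
    by (rule tens_eqI) (use assms bilin.smult_left[of a A b B] in simp_all)
  then show ?thesis unfolding tens_def tensor_alg_def
    using assms T.quot_smult[of "mon (a, b)" c] by simp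
qed

lemma tens_smult_right:
  assumes "a \<in> carrier A" "b \<in> carrier B"
  shows "tens A B a (c \<odot>\<^bsub>B\<^esub> b) = c \<odot>\<^bsub>tensor_alg A B\<^esub> tens A B a b"
proof -
  have "bilin A B +>\<^bsub>N\<^esub> mon (a, c \<odot>\<^bsub>B\<^esub> b) = bilin A B +>\<^bsub>N\<^esub> (Poly_Mapping.single (a, b) c)"
    by (rule tens_eqI) (use assms bilin.smult_right[of a A b B] in simp_all)
  then show ?thesis unfolding tens_def tensor_alg_def
    using assms T.quot_smult[of "mon (a, b)" c] by simp
qed

lemma tens_mult:
  assumes "a \<in> carrier A" "a' \<in> carrier A" "b \<in> carrier B" "b' \<in> carrier B"
  shows "tens A B a b \<otimes>\<^bsub>tensor_alg A B\<^esub> tens A B a' b' = tens A B (a \<otimes>\<^bsub>A\<^esub> a') (b \<otimes>\<^bsub>B\<^esub> b')"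
  unfolding tens_def tensor_alg_def
  using assms T.quot_simps(5)[of "mon (a, b)" "mon (a', b')"] by simp

lemma tens_one: "\<one>\<^bsub>tensor_alg A B\<^esub> = tens A B \<one>\<^bsub>A\<^esub> \<one>\<^bsub>B\<^esub>"
  by (simp add: tens_def tensor_alg_def T.quot_simps)

lemma tensor_induct [consumes 1, case_names tens add]:
  assumes "t \<in> carrier (tensor_alg A B)"
    and tens: "\<And>a b. a \<in> carrier A \<Longrightarrow> b \<in> carrier B \<Longrightarrow> P (tens A B a b)"
    and add: "\<And>t u. t \<in> carrier (tensor_alg A B) \<Longrightarrow> u \<in> carrier (tensor_alg A B) \<Longrightarrow> P t \<Longrightarrow> P u \<Longrightarrow>
      P (t \<oplus>\<^bsub>tensor_alg A B\<^esub> u)"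
  shows "P t"
proof -
  obtain u where u: "u \<in> carrier N" "t = bilin A B +>\<^bsub>N\<^esub> u"
    using assms(1) by (auto simp: tensor_alg_def T.quot_simps)
  from u(1) have "Poly_Mapping.keys u \<subseteq> carrier A \<times> carrier B" by simp
  then have "P (bilin A B +>\<^bsub>N\<^esub> u)"
  proof (induction u rule: poly_mapping_span_induct)
    case zero
    have "bilin A B +>\<^bsub>N\<^esub> mon (\<zero>\<^bsub>A\<^esub>, \<zero>\<^bsub>B\<^esub>) = bilin A B +>\<^bsub>N\<^esub> 0"
      by (rule tens_eqI) (use bilin.smult_left[of "\<zero>\<^bsub>A\<^esub>" A "\<zero>\<^bsub>B\<^esub>" B 0] in auto)
    then show ?case using tens[of "\<zero>\<^bsub>A\<^esub>" "\<zero>\<^bsub>B\<^esub>"] by (simp add: tens_def)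
  next
    case (single m c)
    obtain a b where m: "m = (a, b)" "a \<in> carrier A" "b \<in> carrier B" using single by auto
    have "bilin A B +>\<^bsub>N\<^esub> mon (c \<odot>\<^bsub>A\<^esub> a, b) = bilin A B +>\<^bsub>N\<^esub> (Poly_Mapping.single (a, b) c)"
      by (rule tens_eqI) (use m bilin.smult_left[of a A b B] in auto)
    then show ?case using tens[of "c \<odot>\<^bsub>A\<^esub> a" b] m by (simp add: tens_def)
  next
    case (add f g)
    have "P ((bilin A B +>\<^bsub>N\<^esub> f) \<oplus>\<^bsub>tensor_alg A B\<^esub> (bilin A B +>\<^bsub>N\<^esub> g))"
      by (rule assms(3)) (use add in \<open>auto simp: tensor_alg_def T.quot_simps\<close>)
    then show ?case using add T.quot_simps(4)[of f g] by (simp add: tensor_alg_def)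
  qed
  then show ?thesis using u by simp
qed

lemma generated_tensor:
  assumes gA: "generated_by A Y" and gB: "generated_by B Z"
  shows "generated_by (tensor_alg A B) ((\<lambda>a. tens A B a \<one>\<^bsub>B\<^esub>) ` Y \<union> (\<lambda>b. tens A B \<one>\<^bsub>A\<^esub> b) ` Z)"
    (is "generated_by ?T ?W")
  unfolding generated_by_def
proof (intro conjI)
  show "?W \<subseteq> carrier ?T"
    using gA gB by (auto simp: generated_by_def intro!: tens_closed)
  show "carrier ?T \<subseteq> alg_gen ?T ?W"
  proof
    fix t assume "t \<in> carrier ?T"
    then show "t \<in> alg_gen ?T ?W"
    proof (induction t rule: tensor_induct)
      case (tens a b)
      have l: "tens A B a \<one>\<^bsub>B\<^esub> \<in> alg_gen ?T ?W"
        using kA gA tens(1)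
      proof (induction a rule: generated_induct)
        case one
        then show ?case using alg_gen.unit[of ?T ?W] by (simp add: tens_one)
      next
        case (mult a a')
        then show ?case using alg_gen.mult[OF mult(3,4)] by (simp add: tens_mult)
      qed (auto simp: tens_add_left tens_smult_left intro: alg_gen.intros)
      have r: "tens A B \<one>\<^bsub>A\<^esub> b \<in> alg_gen ?T ?W"
        using kB gB tens(2)
      proof (induction b rule: generated_induct)
        case one
        then show ?case using alg_gen.unit[of ?T ?W] by (simp add: tens_one)
      next
        case (mult a a')
        then show ?case using alg_gen.mult[OF mult(3,4)] by (simp add: tens_mult)
      qed (auto simp: tens_add_right tens_smult_right intro: alg_gen.intros)
      show ?case using alg_gen.mult[OF l r] tens by (simp add: tens_mult)
    qed (auto intro: alg_gen.intros)
  qed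
qed

lemma linear_map_tensor_eqI:
  assumes f: "linear_map (tensor_alg A B) C f" and g: "linear_map (tensor_alg A B) C g"
    and "\<And>a b. a \<in> carrier A \<Longrightarrow> b \<in> carrier B \<Longrightarrow> f (tens A B a b) = g (tens A B a b)"
    and "t \<in> carrier (tensor_alg A B)"
  shows "f t = g t"
  using assms(4)
  by (induction t rule: tensor_induct) (auto simp: assms(3) linear_mapD[OF f] linear_mapD[OF g])

context
  fixes C :: "('k, 'c, 'o) module_scheme" and f
  assumes kC: "k_algebra C" and f: "bilinear A B C f"
begin

lemma f_closed: "a \<in> carrier A \<Longrightarrow> b \<in> carrier B \<Longrightarrow> f a b \<in> carrier C"
  using f linear_mapD(1) by (fastforce simp: bilinear_def)

lemma pairs_closed: "(\<lambda>(a, b). f a b) \<in> carrier (A \<times>\<times> B) \<rightarrow> carrier C"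
  by (auto intro: f_closed)

lemma bilin_vanish: "u \<in> bilin A B \<Longrightarrow> lin_ext C (\<lambda>(a, b). f a b) u = \<zero>\<^bsub>C\<^esub>"
proof -
  interpret C: kalg C using kC by simp
  note lin = lin_ext_linear[OF kC pairs_closed]
  note l = linear_mapD[OF lin] and d = linear_map_minus(2)[OF N.k_alg kC lin]
  have d': "lin_ext C (\<lambda>(a, b). f a b) (u - w) = lin_ext C (\<lambda>(a, b). f a b) u \<ominus>\<^bsub>C\<^esub> lin_ext C (\<lambda>(a, b). f a b) w"
    if "Poly_Mapping.keys u \<subseteq> carrier A \<times> carrier B" "Poly_Mapping.keys w \<subseteq> carrier A \<times> carrier B" for u w
    using d[of u w] that N_diff[of u w] by simp
  have kd: "Poly_Mapping.keys (u - w) \<subseteq> carrier A \<times> carrier B"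
    if "Poly_Mapping.keys u \<subseteq> carrier A \<times> carrier B" "Poly_Mapping.keys w \<subseteq> carrier A \<times> carrier B"
    for u w :: "'a \<times> 'b \<Rightarrow>\<^sub>0 'k"
    using that keys_diff[of u w] by blast
  have fl: "linear_map B C (f a)" if "a \<in> carrier A" for a using f that by (simp add: bilinear_def)
  have fr: "linear_map A C (\<lambda>a. f a b)" if "b \<in> carrier B" for b using f that by (simp add: bilinear_def)
  show "u \<in> bilin A B \<Longrightarrow> lin_ext C (\<lambda>(a, b). f a b) u = \<zero>\<^bsub>C\<^esub>"
  proof (induction rule: bilin.induct)
    case zero
    then show ?case by (simp add: lin_ext_def)
  next
    case (plus u w)
    then show ?case using l(2)[of u w] bilin_closed by simp
  next
    case (scale u c)
    then show ?case using l(3)[of u c] bilin_closed by simp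
  next
    case (add_left a a' b)
    then show ?case using linear_mapD(2)[OF fr[of b], of a a']
      by (simp add: d' kd keys_single_subset lin_ext_single[OF kC] f_closed del: keys_single)
        (simp add: C.diff_smult f_closed C.smult_add_right C.a_ac C.smult_collect_left C.smult_collect)
  next
    case (add_right a b b')
    then show ?case using linear_mapD(2)[OF fl[of a], of b b']
      by (simp add: d' kd keys_single_subset lin_ext_single[OF kC] f_closed del: keys_single)
        (simp add: C.diff_smult f_closed C.smult_add_right C.a_ac C.smult_collect_left C.smult_collect)
  next
    case (smult_left a b c)
    then show ?case using linear_mapD(3)[OF fr[of b], of a c]
      by (simp add: d' kd keys_single_subset lin_ext_single[OF kC] f_closed C.r_neg a_minus_def del: keys_single)
  next
    case (smult_right a b c)
    then show ?case using linear_mapD(3)[OF fl[of a], of b c]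
      by (simp add: d' kd keys_single_subset lin_ext_single[OF kC] f_closed C.r_neg a_minus_def del: keys_single)
  qed
qed

lemma lift2_coset:
  "u \<in> carrier N \<Longrightarrow> lift2 C (bilin A B +>\<^bsub>N\<^esub> u) f = lin_ext C (\<lambda>(a, b). f a b) u"
  unfolding lift2_def
  by (rule T.the_elem_lift[OF kC lin_ext_linear[OF kC pairs_closed]]) (auto intro: bilin_vanish)

lemma lift2_tens: "a \<in> carrier A \<Longrightarrow> b \<in> carrier B \<Longrightarrow> lift2 C (tens A B a b) f = f a b"
proof -
  interpret C: kalg C using kC by simp
  show "a \<in> carrier A \<Longrightarrow> b \<in> carrier B \<Longrightarrow> lift2 C (tens A B a b) f = f a b"
    unfolding tens_def by (subst lift2_coset) (simp_all add: lin_ext_single[OF kC] f_closed)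
qed

lemma lift2_linear: "linear_map (tensor_alg A B) C (\<lambda>t. lift2 C t f)"
  using linear_mapD[OF lin_ext_linear[OF kC pairs_closed]]
  by (intro linear_mapI) (auto simp: tensor_alg_def T.quot_simps T.quot_smult lift2_coset
      simp del: monoid_algebra_simps T.a_rcos_const)

lemma lift2_alg_hom:
  assumes "\<And>a a' b b'. a \<in> carrier A \<Longrightarrow> a' \<in> carrier A \<Longrightarrow> b \<in> carrier B \<Longrightarrow> b' \<in> carrier B \<Longrightarrow>
      f (a \<otimes>\<^bsub>A\<^esub> a') (b \<otimes>\<^bsub>B\<^esub> b') = f a b \<otimes>\<^bsub>C\<^esub> f a' b'"
    and "f \<one>\<^bsub>A\<^esub> \<one>\<^bsub>B\<^esub> = \<one>\<^bsub>C\<^esub>"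
  shows "(\<lambda>t. lift2 C t f) \<in> alg_hom (tensor_alg A B) C"
proof -
  interpret C: kalg C using kC by simp
  interpret TT: kalg "tensor_alg A B" using k_algebra_tensor by simp
  note l = linear_mapD[OF lift2_linear]
  show ?thesis
  proof (rule alg_homI[OF lift2_linear])
    fix t u assume t: "t \<in> carrier (tensor_alg A B)" and u: "u \<in> carrier (tensor_alg A B)"
    from t show "lift2 C (t \<otimes>\<^bsub>tensor_alg A B\<^esub> u) f = lift2 C t f \<otimes>\<^bsub>C\<^esub> lift2 C u f"
    proof (induction t rule: tensor_induct)
      case (tens a b)
      from u show ?case
        by (induction u rule: tensor_induct)
          (use tens in \<open>auto simp: tens_mult lift2_tens assms tens_closed TT.r_distr C.r_distr l f_closed\<close>)
    qed (use u in \<open>auto simp: TT.l_distr C.l_distr l\<close>)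
  qed (simp add: tens_one lift2_tens assms)
qed

end

end

section \<open>Calculus of linear and multilinear maps\<close>

lemmas k_algebra_tensor [simp] = two_algebras.k_algebra_tensor[OF two_algebras.intro]

lemma bilinearI:
  assumes "\<And>a. a \<in> carrier A \<Longrightarrow> linear_map B C (f a)"
    and "\<And>b. b \<in> carrier B \<Longrightarrow> linear_map A C (\<lambda>a. f a b)"
  shows "bilinear A B C f"
  using assms by (simp add: bilinear_def)

lemma linear_map_id: "linear_map A A (\<lambda>x. x)"
  by (simp add: linear_map_def)

lemma linear_map_mult_left:
  "k_algebra B \<Longrightarrow> linear_map A B f \<Longrightarrow> c \<in> carrier B \<Longrightarrow> linear_map A B (\<lambda>x. f x \<otimes>\<^bsub>B\<^esub> c)"
  using kalg.smult_mult[of B] ring.ring_simprules(13)[of B] ring.ring_simprules(5)[of B]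
  by (simp add: linear_map_def k_algebra_def)

lemma linear_map_mult_right:
  "k_algebra B \<Longrightarrow> linear_map A B f \<Longrightarrow> c \<in> carrier B \<Longrightarrow> linear_map A B (\<lambda>x. c \<otimes>\<^bsub>B\<^esub> f x)"
  using kalg.mult_smult[of B] ring.ring_simprules(23)[of B] ring.ring_simprules(5)[of B]
  by (simp add: linear_map_def k_algebra_def)

lemma linear_map_smult:
  "k_algebra B \<Longrightarrow> linear_map A B f \<Longrightarrow> linear_map A B (\<lambda>x. c \<odot>\<^bsub>B\<^esub> f x)"
  using kalg.smult_smult[of B] kalg.smult_add_right[of B] kalg.smult_closed[of B]
  by (simp add: linear_map_def mult.commute)

lemma linear_map_scale:
  "k_algebra B \<Longrightarrow> linear_map A scalars f \<Longrightarrow> b \<in> carrier B \<Longrightarrow> linear_map A B (\<lambda>x. f x \<odot>\<^bsub>B\<^esub> b)"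
  using kalg.smult_smult[of B] kalg.smult_add_left[of B] kalg.smult_closed[of B]
  by (simp add: linear_map_def)

lemma linear_map_times:
  "linear_map A scalars f \<Longrightarrow> linear_map A scalars (\<lambda>x. f x * c)"
  "linear_map A scalars f \<Longrightarrow> linear_map A scalars (\<lambda>x. c * f x)"
  by (simp_all add: linear_map_def algebra_simps)

lemma linear_map_tens_left:
  "k_algebra B \<Longrightarrow> k_algebra C \<Longrightarrow> linear_map A B f \<Longrightarrow> c \<in> carrier C \<Longrightarrow>
     linear_map A (tensor_alg B C) (\<lambda>x. tens B C (f x) c)"
  using two_algebras.tens_closed[of B C] two_algebras.tens_add_left[of B C] two_algebras.tens_smult_left[of B C]
  by (simp add: linear_map_def two_algebras_def)

lemma linear_map_tens_right:
  "k_algebra B \<Longrightarrow> k_algebra C \<Longrightarrow> linear_map A C f \<Longrightarrow> b \<in> carrier B \<Longrightarrow>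
     linear_map A (tensor_alg B C) (\<lambda>x. tens B C b (f x))"
  using two_algebras.tens_closed[of B C] two_algebras.tens_add_right[of B C] two_algebras.tens_smult_right[of B C]
  by (simp add: linear_map_def two_algebras_def)

lemma linear_map_lift2:
  "k_algebra B \<Longrightarrow> k_algebra C \<Longrightarrow> k_algebra E \<Longrightarrow> linear_map A (tensor_alg B C) f \<Longrightarrow> bilinear B C E g \<Longrightarrow>
     linear_map A E (\<lambda>x. lift2 E (f x) g)"
  using two_algebras.lift2_linear[of B C E g]
  by (simp add: linear_map_def two_algebras_def)

lemma linear_map_lift2_param:
  assumes "k_algebra B" "k_algebra C" "k_algebra E" and t: "t \<in> carrier (tensor_alg B C)"
    and lin: "\<And>b c. b \<in> carrier B \<Longrightarrow> c \<in> carrier C \<Longrightarrow> linear_map A E (\<lambda>x. g x b c)"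
    and bil: "\<And>x. x \<in> carrier A \<Longrightarrow> bilinear B C E (g x)" and A: "k_algebra A"
  shows "linear_map A E (\<lambda>x. lift2 E t (g x))"
proof -
  interpret A: kalg A using assms by simp
  interpret E: kalg E using assms by simp
  interpret BC: two_algebras B C using assms by unfold_locales
  interpret T: kalg "tensor_alg B C" using assms by simp
  note lt = BC.lift2_tens[OF E.k_alg bil] and ll = linear_mapD[OF BC.lift2_linear[OF E.k_alg bil]]
  show ?thesis
  proof (rule linear_mapI)
    show "lift2 E t (g x) \<in> carrier E" if "x \<in> carrier A" for x using ll(1)[OF that t] .
    show "lift2 E t (g (x \<oplus>\<^bsub>A\<^esub> y)) = lift2 E t (g x) \<oplus>\<^bsub>E\<^esub> lift2 E t (g y)"
      if x: "x \<in> carrier A" and y: "y \<in> carrier A" for x y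
      using t
    proof (induction t rule: BC.tensor_induct)
      case (tens b c)
      then show ?case using x y linear_mapD(2)[OF lin[OF tens] x y] by (simp add: lt)
    next
      case (add t u)
      then show ?case using x y ll(1)[OF x] ll(1)[OF y] by (simp add: ll E.a_ac)
    qed
    show "lift2 E t (g (c \<odot>\<^bsub>A\<^esub> x)) = c \<odot>\<^bsub>E\<^esub> lift2 E t (g x)" if x: "x \<in> carrier A" for x c
      using t
    proof (induction t rule: BC.tensor_induct)
      case (tens b d)
      then show ?case using x linear_mapD(3)[OF lin[OF tens] x] by (simp add: lt)
    next
      case (add t u)
      then show ?case using x ll(1)[OF x] by (simp add: ll E.smult_add_right)
    qed
  qed
qed

lemma linear_map_add:
  assumes "k_algebra B" "linear_map A B f" "linear_map A B g"
  shows "linear_map A B (\<lambda>x. f x \<oplus>\<^bsub>B\<^esub> g x)"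
proof -
  interpret B: kalg B using assms by simp
  show ?thesis using assms(2,3) by (simp add: linear_map_def B.a_ac B.smult_add_right)
qed

lemmas lin_intros = linear_map_id linear_map_mult_left linear_map_mult_right linear_map_smult linear_map_scale
  linear_map_times linear_map_tens_left linear_map_tens_right linear_map_lift2 linear_map_lift2_param
  linear_map_add bilinearI

lemma bilinear_cong:
  assumes "bilinear A B C f" "\<And>a b. a \<in> carrier A \<Longrightarrow> b \<in> carrier B \<Longrightarrow> f a b = g a b"
    and "k_algebra A" "k_algebra B"
  shows "bilinear A B C g"
  using assms linear_map_cong[of B C] linear_map_cong[of A C]
  unfolding bilinear_def by (metis (mono_tags, lifting))

definition trilinear where
  "trilinear A B D C f \<longleftrightarrow>
     (\<forall>a\<in>carrier A. \<forall>b\<in>carrier B. linear_map D C (f a b)) \<and>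
     (\<forall>a\<in>carrier A. \<forall>d\<in>carrier D. linear_map B C (\<lambda>b. f a b d)) \<and>
     (\<forall>b\<in>carrier B. \<forall>d\<in>carrier D. linear_map A C (\<lambda>a. f a b d))"

lemma trilinearI:
  assumes "\<And>a b. a \<in> carrier A \<Longrightarrow> b \<in> carrier B \<Longrightarrow> linear_map D C (f a b)"
    and "\<And>a d. a \<in> carrier A \<Longrightarrow> d \<in> carrier D \<Longrightarrow> linear_map B C (\<lambda>b. f a b d)"
    and "\<And>b d. b \<in> carrier B \<Longrightarrow> d \<in> carrier D \<Longrightarrow> linear_map A C (\<lambda>a. f a b d)"
  shows "trilinear A B D C f"
  using assms by (simp add: trilinear_def)

lemma trilinear_bilinear:
  assumes "k_algebra A" "k_algebra B" "k_algebra D" "k_algebra C" "trilinear A B D C f"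
  shows "a \<in> carrier A \<Longrightarrow> bilinear B D C (f a)"
    and "bilinear A (tensor_alg B D) C (\<lambda>a u. lift2 C u (f a))"
proof -
  show 1: "bilinear B D C (f a)" if "a \<in> carrier A" for a
    using assms that by (auto simp: trilinear_def bilinear_def)
  show "bilinear A (tensor_alg B D) C (\<lambda>a u. lift2 C u (f a))"
  proof (rule bilinearI)
    show "linear_map (tensor_alg B D) C (\<lambda>u. lift2 C u (f a))" if "a \<in> carrier A" for a
      by (rule linear_map_lift2[OF _ _ _ linear_map_id 1]) (use assms that in auto)
    show "linear_map A C (\<lambda>a. lift2 C u (f a))" if "u \<in> carrier (tensor_alg B D)" for u
      by (rule linear_map_lift2_param[of B D]) (use assms that 1 in \<open>auto simp: trilinear_def\<close>)
  qed
qed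

lemma lift3_tens:
  assumes "k_algebra A" "k_algebra B" "k_algebra D" "k_algebra C" "trilinear A B D C f"
    and "a \<in> carrier A" "b \<in> carrier B" "d \<in> carrier D"
  shows "lift3 C (tens A (tensor_alg B D) a (tens B D b d)) f = f a b d"
proof -
  interpret P: two_algebras A "tensor_alg B D" using assms by unfold_locales auto
  interpret Q: two_algebras B D using assms by unfold_locales auto
  show ?thesis unfolding lift3_def
    using assms by (simp add: P.lift2_tens trilinear_bilinear[OF assms(1-5)] Q.tens_closed Q.lift2_tens)
qed

lemma lift3_linear:
  assumes "k_algebra A" "k_algebra B" "k_algebra D" "k_algebra C" "trilinear A B D C f"
  shows "linear_map (tensor_alg A (tensor_alg B D)) C (\<lambda>t. lift3 C t f)"
proof -
  interpret P: two_algebras A "tensor_alg B D" using assms by unfold_locales auto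
  show ?thesis unfolding lift3_def
    using assms by (intro P.lift2_linear trilinear_bilinear)
qed

section \<open>Algebra morphisms between tensor products\<close>

text \<open>Commuting images are what makes the product of two morphisms multiplicative on a tensor product.\<close>

lemma alg_hom_tensorI:
  assumes k: "k_algebra A" "k_algebra B" "k_algebra C" and f: "f \<in> alg_hom A C" and g: "g \<in> alg_hom B C"
    and comm: "\<And>a b. a \<in> carrier A \<Longrightarrow> b \<in> carrier B \<Longrightarrow> g b \<otimes>\<^bsub>C\<^esub> f a = f a \<otimes>\<^bsub>C\<^esub> g b"
  shows "bilinear A B C (\<lambda>a b. f a \<otimes>\<^bsub>C\<^esub> g b)"
    and "(\<lambda>t. lift2 C t (\<lambda>a b. f a \<otimes>\<^bsub>C\<^esub> g b)) \<in> alg_hom (tensor_alg A B) C"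
proof -
  interpret AB: two_algebras A B using assms by unfold_locales
  interpret C: kalg C using assms by simp
  note h = alg_homD[OF f] alg_homD[OF g]
  show bil: "bilinear A B C (\<lambda>a b. f a \<otimes>\<^bsub>C\<^esub> g b)"
    by (rule bilinearI; intro lin_intros)
      (use k h alg_hom_linear[OF f] alg_hom_linear[OF g] in auto)
  show "(\<lambda>t. lift2 C t (\<lambda>a b. f a \<otimes>\<^bsub>C\<^esub> g b)) \<in> alg_hom (tensor_alg A B) C"
  proof (rule AB.lift2_alg_hom[OF k(3) bil])
    fix a a' b b' assume c: "a \<in> carrier A" "a' \<in> carrier A" "b \<in> carrier B" "b' \<in> carrier B"
    have "f a \<otimes>\<^bsub>C\<^esub> f a' \<otimes>\<^bsub>C\<^esub> (g b \<otimes>\<^bsub>C\<^esub> g b') = f a \<otimes>\<^bsub>C\<^esub> (f a' \<otimes>\<^bsub>C\<^esub> g b) \<otimes>\<^bsub>C\<^esub> g b'"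
      using c h by (simp add: C.m_assoc)
    also have "\<dots> = f a \<otimes>\<^bsub>C\<^esub> g b \<otimes>\<^bsub>C\<^esub> (f a' \<otimes>\<^bsub>C\<^esub> g b')"
      using c h by (simp only: comm[OF c(2,3), symmetric]) (simp add: C.m_assoc)
    finally show "f (a \<otimes>\<^bsub>A\<^esub> a') \<otimes>\<^bsub>C\<^esub> g (b \<otimes>\<^bsub>B\<^esub> b') = f a \<otimes>\<^bsub>C\<^esub> g b \<otimes>\<^bsub>C\<^esub> (f a' \<otimes>\<^bsub>C\<^esub> g b')"
      using c h by simp
  qed (use h in simp)
qed

lemma alg_hom_tensor_map:
  assumes k: "k_algebra A" "k_algebra B" "k_algebra C" "k_algebra D"
    and f: "f \<in> alg_hom A C" and g: "g \<in> alg_hom B D"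
  shows "bilinear A B (tensor_alg C D) (\<lambda>a b. tens C D (f a) (g b))"
    and "(\<lambda>t. lift2 (tensor_alg C D) t (\<lambda>a b. tens C D (f a) (g b))) \<in> alg_hom (tensor_alg A B) (tensor_alg C D)"
proof -
  interpret AB: two_algebras A B using assms by unfold_locales
  interpret CD: two_algebras C D using assms by unfold_locales
  note h = alg_homD[OF f] alg_homD[OF g]
  show bil: "bilinear A B (tensor_alg C D) (\<lambda>a b. tens C D (f a) (g b))"
    by (rule bilinearI; intro lin_intros)
      (use k h alg_hom_linear[OF f] alg_hom_linear[OF g] in auto)
  show "(\<lambda>t. lift2 (tensor_alg C D) t (\<lambda>a b. tens C D (f a) (g b))) \<in> alg_hom (tensor_alg A B) (tensor_alg C D)"
    by (rule AB.lift2_alg_hom[OF CD.k_algebra_tensor bil]) (use h in \<open>auto simp: CD.tens_mult CD.tens_one\<close>)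
qed

lemma tens_embed:
  assumes k: "k_algebra A" "k_algebra B"
  shows "(\<lambda>a. tens A B a \<one>\<^bsub>B\<^esub>) \<in> alg_hom A (tensor_alg A B)"
    and "(\<lambda>b. tens A B \<one>\<^bsub>A\<^esub> b) \<in> alg_hom B (tensor_alg A B)"
proof -
  interpret AB: two_algebras A B using assms by unfold_locales
  show "(\<lambda>a. tens A B a \<one>\<^bsub>B\<^esub>) \<in> alg_hom A (tensor_alg A B)"
    by (intro alg_homI lin_intros k) (simp_all add: AB.tens_mult AB.tens_one)
  show "(\<lambda>b. tens A B \<one>\<^bsub>A\<^esub> b) \<in> alg_hom B (tensor_alg A B)"
    by (intro alg_homI lin_intros k) (simp_all add: AB.tens_mult AB.tens_one)
qed

section \<open>Tensor powers\<close>

locale tensor_powers = kalg A for A :: "('k::field, 'a, 'm) module_scheme" (structure)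
begin

sublocale P2: two_algebras A A
  rewrites "tensor_alg A A = T2 A" and "tens A A = t2 A"
proof -
  show "two_algebras A A" by (intro two_algebras.intro k_alg k_alg)
qed (simp_all add: T2_def t2_def[abs_def])

lemma k_algebra_T2: "k_algebra (T2 A)" by (rule P2.k_algebra_tensor)

sublocale T2: kalg "T2 A" using k_algebra_T2 by simp

sublocale P3: two_algebras A "T2 A"
  rewrites "tensor_alg A (T2 A) = T3 A"
proof -
  show "two_algebras A (T2 A)" by (intro two_algebras.intro k_alg k_algebra_T2)
qed (simp_all add: T3_def)

lemma k_algebra_T3: "k_algebra (T3 A)" by (rule P3.k_algebra_tensor)

sublocale T3: kalg "T3 A" using k_algebra_T3 by simp

sublocale P4: two_algebras A "T3 A"
  rewrites "tensor_alg A (T3 A) = T4 A"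
proof -
  show "two_algebras A (T3 A)" by (intro two_algebras.intro k_alg k_algebra_T3)
qed (simp_all add: T4_def)

lemma k_algebra_T4: "k_algebra (T4 A)" by (rule P4.k_algebra_tensor)

sublocale T4: kalg "T4 A" using k_algebra_T4 by simp

lemma t2_closed [simp]: "a \<in> carrier A \<Longrightarrow> b \<in> carrier A \<Longrightarrow> t2 A a b \<in> carrier (T2 A)"
  by (rule P2.tens_closed)

lemma t3_closed [simp]:
  "a \<in> carrier A \<Longrightarrow> b \<in> carrier A \<Longrightarrow> c \<in> carrier A \<Longrightarrow> t3 A a b c \<in> carrier (T3 A)"
  unfolding t3_def by (intro P3.tens_closed t2_closed)

lemma t4_closed [simp]:
  "a \<in> carrier A \<Longrightarrow> b \<in> carrier A \<Longrightarrow> c \<in> carrier A \<Longrightarrow> d \<in> carrier A \<Longrightarrow> t4 A a b c d \<in> carrier (T4 A)"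
  unfolding t4_def by (intro P4.tens_closed t3_closed)

lemma t2_linear:
  "a \<in> carrier A \<Longrightarrow> linear_map A (T2 A) (\<lambda>b. t2 A a b)"
  "b \<in> carrier A \<Longrightarrow> linear_map A (T2 A) (\<lambda>a. t2 A a b)"
  unfolding T2_def t2_def by (intro lin_intros k_alg; assumption)+

lemma t3_linear:
  "a \<in> carrier A \<Longrightarrow> b \<in> carrier A \<Longrightarrow> linear_map A (T3 A) (\<lambda>c. t3 A a b c)"
  "a \<in> carrier A \<Longrightarrow> c \<in> carrier A \<Longrightarrow> linear_map A (T3 A) (\<lambda>b. t3 A a b c)"
  "b \<in> carrier A \<Longrightarrow> c \<in> carrier A \<Longrightarrow> linear_map A (T3 A) (\<lambda>a. t3 A a b c)"
  unfolding T3_def t3_def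
  by (rule lin_intros k_alg k_algebra_T2 t2_linear t2_closed | assumption)+

lemma t4_linear:
  "a \<in> carrier A \<Longrightarrow> b \<in> carrier A \<Longrightarrow> c \<in> carrier A \<Longrightarrow> linear_map A (T4 A) (\<lambda>d. t4 A a b c d)"
  "a \<in> carrier A \<Longrightarrow> b \<in> carrier A \<Longrightarrow> d \<in> carrier A \<Longrightarrow> linear_map A (T4 A) (\<lambda>c. t4 A a b c d)"
  "a \<in> carrier A \<Longrightarrow> c \<in> carrier A \<Longrightarrow> d \<in> carrier A \<Longrightarrow> linear_map A (T4 A) (\<lambda>b. t4 A a b c d)"
  "b \<in> carrier A \<Longrightarrow> c \<in> carrier A \<Longrightarrow> d \<in> carrier A \<Longrightarrow> linear_map A (T4 A) (\<lambda>a. t4 A a b c d)"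
  unfolding T4_def t4_def
  by (rule lin_intros k_alg k_algebra_T3 t3_linear t3_closed | assumption)+

lemmas t2_distrib = linear_mapD(2)[OF t2_linear(1)] linear_mapD(2)[OF t2_linear(2)]
  linear_mapD(3)[OF t2_linear(1)] linear_mapD(3)[OF t2_linear(2)]

lemmas t3_distrib = linear_mapD(2)[OF t3_linear(1)] linear_mapD(2)[OF t3_linear(2)] linear_mapD(2)[OF t3_linear(3)]
  linear_mapD(3)[OF t3_linear(1)] linear_mapD(3)[OF t3_linear(2)] linear_mapD(3)[OF t3_linear(3)]

lemmas t4_distrib = linear_mapD(2)[OF t4_linear(1)] linear_mapD(2)[OF t4_linear(2)] linear_mapD(2)[OF t4_linear(3)]
  linear_mapD(2)[OF t4_linear(4)]
  linear_mapD(3)[OF t4_linear(1)] linear_mapD(3)[OF t4_linear(2)] linear_mapD(3)[OF t4_linear(3)]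
  linear_mapD(3)[OF t4_linear(4)]

lemma t2_zero [simp]:
  "a \<in> carrier A \<Longrightarrow> t2 A a \<zero> = \<zero>\<^bsub>T2 A\<^esub>" "a \<in> carrier A \<Longrightarrow> t2 A \<zero> a = \<zero>\<^bsub>T2 A\<^esub>"
  using linear_map_zero[OF k_alg k_algebra_T2 t2_linear(1)] linear_map_zero[OF k_alg k_algebra_T2 t2_linear(2)]
  by simp_all

lemma t3_zero [simp]:
  "a \<in> carrier A \<Longrightarrow> b \<in> carrier A \<Longrightarrow> t3 A a b \<zero> = \<zero>\<^bsub>T3 A\<^esub>"
  "a \<in> carrier A \<Longrightarrow> b \<in> carrier A \<Longrightarrow> t3 A a \<zero> b = \<zero>\<^bsub>T3 A\<^esub>"
  "a \<in> carrier A \<Longrightarrow> b \<in> carrier A \<Longrightarrow> t3 A \<zero> a b = \<zero>\<^bsub>T3 A\<^esub>"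
  using linear_map_zero[OF k_alg k_algebra_T3 t3_linear(1)] linear_map_zero[OF k_alg k_algebra_T3 t3_linear(2)]
    linear_map_zero[OF k_alg k_algebra_T3 t3_linear(3)]
  by simp_all

lemma t4_zero [simp]:
  "a \<in> carrier A \<Longrightarrow> b \<in> carrier A \<Longrightarrow> c \<in> carrier A \<Longrightarrow> t4 A a b c \<zero> = \<zero>\<^bsub>T4 A\<^esub>"
  "a \<in> carrier A \<Longrightarrow> b \<in> carrier A \<Longrightarrow> c \<in> carrier A \<Longrightarrow> t4 A a b \<zero> c = \<zero>\<^bsub>T4 A\<^esub>"
  "a \<in> carrier A \<Longrightarrow> b \<in> carrier A \<Longrightarrow> c \<in> carrier A \<Longrightarrow> t4 A a \<zero> b c = \<zero>\<^bsub>T4 A\<^esub>"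
  "a \<in> carrier A \<Longrightarrow> b \<in> carrier A \<Longrightarrow> c \<in> carrier A \<Longrightarrow> t4 A \<zero> a b c = \<zero>\<^bsub>T4 A\<^esub>"
  using linear_map_zero[OF k_alg k_algebra_T4 t4_linear(1)] linear_map_zero[OF k_alg k_algebra_T4 t4_linear(2)]
    linear_map_zero[OF k_alg k_algebra_T4 t4_linear(3)] linear_map_zero[OF k_alg k_algebra_T4 t4_linear(4)]
  by simp_all

lemma t2_mult [simp]:
  "\<lbrakk>a \<in> carrier A; b \<in> carrier A; a' \<in> carrier A; b' \<in> carrier A\<rbrakk> \<Longrightarrow>
     t2 A a b \<otimes>\<^bsub>T2 A\<^esub> t2 A a' b' = t2 A (a \<otimes> a') (b \<otimes> b')"
  by (rule P2.tens_mult)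

lemma t3_mult [simp]:
  "\<lbrakk>a \<in> carrier A; b \<in> carrier A; c \<in> carrier A; a' \<in> carrier A; b' \<in> carrier A; c' \<in> carrier A\<rbrakk> \<Longrightarrow>
     t3 A a b c \<otimes>\<^bsub>T3 A\<^esub> t3 A a' b' c' = t3 A (a \<otimes> a') (b \<otimes> b') (c \<otimes> c')"
  by (simp add: t3_def P3.tens_mult)

lemma t4_mult [simp]:
  "\<lbrakk>a \<in> carrier A; b \<in> carrier A; c \<in> carrier A; d \<in> carrier A;
    a' \<in> carrier A; b' \<in> carrier A; c' \<in> carrier A; d' \<in> carrier A\<rbrakk> \<Longrightarrow>
     t4 A a b c d \<otimes>\<^bsub>T4 A\<^esub> t4 A a' b' c' d' = t4 A (a \<otimes> a') (b \<otimes> b') (c \<otimes> c') (d \<otimes> d')"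
  by (simp add: t4_def P4.tens_mult)

lemma t2_one: "\<one>\<^bsub>T2 A\<^esub> = t2 A \<one> \<one>"
  by (rule P2.tens_one)

lemma t3_one: "\<one>\<^bsub>T3 A\<^esub> = t3 A \<one> \<one> \<one>"
  by (simp add: t3_def t2_one P3.tens_one)

lemma t4_one: "\<one>\<^bsub>T4 A\<^esub> = t4 A \<one> \<one> \<one> \<one>"
  by (simp add: t4_def t3_one P4.tens_one)

lemma lift3_t3:
  assumes "k_algebra C" "trilinear A A A C f" "a \<in> carrier A" "b \<in> carrier A" "c \<in> carrier A"
  shows "lift3 C (t3 A a b c) f = f a b c"
  using lift3_tens[OF k_alg k_alg k_alg assms] by (simp add: t3_def t2_def T2_def)

lemma lift3_T3_linear:
  assumes "k_algebra C" "trilinear A A A C f"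
  shows "linear_map (T3 A) C (\<lambda>t. lift3 C t f)"
  using lift3_linear[OF k_alg k_alg k_alg assms] by (simp add: T3_def T2_def)

lemma T2_eqI:
  assumes "linear_map (T2 A) C f" "linear_map (T2 A) C g"
    and "\<And>a b. a \<in> carrier A \<Longrightarrow> b \<in> carrier A \<Longrightarrow> f (t2 A a b) = g (t2 A a b)" and "t \<in> carrier (T2 A)"
  shows "f t = g t"
  using assms by (rule P2.linear_map_tensor_eqI)

end

lemma bilinear_mult_left:
  assumes "k_algebra C" "bilinear A B C f" "c \<in> carrier C"
  shows "bilinear A B C (\<lambda>a b. f a b \<otimes>\<^bsub>C\<^esub> c)"
  by (rule bilinearI; rule linear_map_mult_left) (use assms in \<open>simp_all add: bilinear_def\<close>)

lemma alg_hom_cong: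
  assumes f: "f \<in> alg_hom A B" and eq: "\<And>x. x \<in> carrier A \<Longrightarrow> f x = g x" and A: "k_algebra A"
  shows "g \<in> alg_hom A B"
proof -
  interpret A: kalg A using A by simp
  show ?thesis
  proof (rule alg_homI[OF linear_map_cong[OF alg_hom_linear[OF f] eq A]])
    show "g (a \<otimes>\<^bsub>A\<^esub> b) = g a \<otimes>\<^bsub>B\<^esub> g b" if "a \<in> carrier A" "b \<in> carrier A" for a b
      using that alg_homD(4)[OF f that] by (simp add: eq)
    show "g \<one>\<^bsub>A\<^esub> = \<one>\<^bsub>B\<^esub>"
      using alg_homD(5)[OF f] by (simp add: eq)
  qed
qed

lemma alg_hom_op: "f \<in> alg_hom A B \<Longrightarrow> f \<in> alg_hom (op_alg A) (op_alg B)"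
  by (simp add: alg_hom_iff linear_map_def)

section \<open>Quasi-Hopf data\<close>

lemma with_structure_simps [simp]:
  "carrier (with_structure A \<Delta> \<epsilon> \<Phi> S \<alpha> \<beta>) = carrier A"
  "monoid.mult (with_structure A \<Delta> \<epsilon> \<Phi> S \<alpha> \<beta>) = monoid.mult A"
  "monoid.one (with_structure A \<Delta> \<epsilon> \<Phi> S \<alpha> \<beta>) = monoid.one A"
  "ring.zero (with_structure A \<Delta> \<epsilon> \<Phi> S \<alpha> \<beta>) = ring.zero A"
  "ring.add (with_structure A \<Delta> \<epsilon> \<Phi> S \<alpha> \<beta>) = ring.add A"
  "module.smult (with_structure A \<Delta> \<epsilon> \<Phi> S \<alpha> \<beta>) = module.smult A"
  "comult (with_structure A \<Delta> \<epsilon> \<Phi> S \<alpha> \<beta>) = \<Delta>"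
  "counit (with_structure A \<Delta> \<epsilon> \<Phi> S \<alpha> \<beta>) = \<epsilon>"
  "reassoc (with_structure A \<Delta> \<epsilon> \<Phi> S \<alpha> \<beta>) = \<Phi>"
  "antipode (with_structure A \<Delta> \<epsilon> \<Phi> S \<alpha> \<beta>) = S"
  "alpha (with_structure A \<Delta> \<epsilon> \<Phi> S \<alpha> \<beta>) = \<alpha>"
  "beta (with_structure A \<Delta> \<epsilon> \<Phi> S \<alpha> \<beta>) = \<beta>"
  by (simp_all add: with_structure_def module.defs quasi_hopf.defs)

text \<open>Quasi-Hopf records extend their underlying algebra record by further fields, so the two are never
  equal as records. All constructions of tensor products and morphisms depend on the common fields only.\<close>

definition same_algebra ::
    "('k::field, 'a, 'm) module_scheme \<Rightarrow> ('k, 'a, 'n) module_scheme \<Rightarrow> bool" where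
  "same_algebra A B \<longleftrightarrow> carrier A = carrier B \<and> monoid.mult A = monoid.mult B \<and> monoid.one A = monoid.one B \<and>
     ring.zero A = ring.zero B \<and> ring.add A = ring.add B \<and> module.smult A = module.smult B"

lemma same_algebra_structure: "same_algebra (with_structure A \<Delta> \<epsilon> \<Phi> S \<alpha> \<beta>) A"
  by (simp add: same_algebra_def)

lemma same_algebra_sym: "same_algebra A B \<Longrightarrow> same_algebra B A"
  by (simp add: same_algebra_def)

lemma same_algebra_refl: "same_algebra A A"
  by (simp add: same_algebra_def)

lemma bilin_mono_same:
  assumes s: "same_algebra A A'" "same_algebra B B'" and u: "u \<in> bilin A B"
  shows "u \<in> bilin A' B'"
  using u
proof (induction rule: bilin.induct)
  case (add_left a a' b)
  then show ?case using bilin.add_left[of a A' a' b B'] s by (simp add: same_algebra_def)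
next
  case (add_right a b b')
  then show ?case using bilin.add_right[of a A' b B' b'] s by (simp add: same_algebra_def)
next
  case (smult_left a b c)
  then show ?case using bilin.smult_left[of a A' b B' c] s by (simp add: same_algebra_def)
next
  case (smult_right a b c)
  then show ?case using bilin.smult_right[of a A' b B' c] s by (simp add: same_algebra_def)
qed (auto intro: bilin.zero bilin.plus bilin.scale)

lemma tensor_same:
  assumes s: "same_algebra A A'" "same_algebra B B'"
  shows "tensor_alg A B = tensor_alg A' B'" and "tens A B = tens A' B'"
proof -
  have "bilin A B = bilin A' B'"
    using bilin_mono_same[OF s] bilin_mono_same[OF s[THEN same_algebra_sym]] by blast
  moreover have "A \<times>\<times> B = A' \<times>\<times> B'"
    using s by (simp add: same_algebra_def DirProd_def)
  ultimately show "tensor_alg A B = tensor_alg A' B'" and "tens A B = tens A' B'"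
    by (simp_all add: tensor_alg_def tens_def[abs_def])
qed

lemma tensor_powers_same:
  assumes s: "same_algebra A A'"
  shows "T2 A = T2 A'" "T3 A = T3 A'" "T4 A = T4 A'" "t2 A = t2 A'" "t3 A = t3 A'" "t4 A = t4 A'"
proof -
  show 2: "T2 A = T2 A'" "t2 A = t2 A'" using tensor_same[OF s s] by (simp_all add: T2_def t2_def[abs_def])
  have s2: "same_algebra (T2 A) (T2 A')" by (simp add: same_algebra_refl 2)
  show 3: "T3 A = T3 A'" "t3 A = t3 A'" using tensor_same[OF s s2] 2 by (simp_all add: T3_def t3_def[abs_def])
  have s3: "same_algebra (T3 A) (T3 A')" by (simp add: same_algebra_refl 3)
  show "T4 A = T4 A'" "t4 A = t4 A'" using tensor_same[OF s s3] 3 by (simp_all add: T4_def t4_def[abs_def])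
qed

lemma k_algebra_same:
  assumes "same_algebra A B" "k_algebra A"
  shows "k_algebra B"
proof -
  interpret A: kalg A using assms by simp
  have s: "carrier B = carrier A" "monoid.mult B = monoid.mult A" "monoid.one B = monoid.one A"
     "ring.zero B = ring.zero A" "ring.add B = ring.add A" "module.smult B = module.smult A"
    using assms by (simp_all add: same_algebra_def)
  have "ring B"
  proof (rule ringI)
    show "abelian_group B"
      by (rule abelian_groupI) (auto simp: s A.a_ac intro: A.l_neg)
    show "Group.monoid B"
      by (rule monoidI) (auto simp: s A.m_assoc)
  qed (auto simp: s A.l_distr A.r_distr)
  then show ?thesis
    by (rule k_algebraI) (auto simp: s A.smult_add_left A.smult_add_right)
qed

lemma alg_hom_same:
  "same_algebra A A' \<Longrightarrow> same_algebra B B' \<Longrightarrow> alg_hom A B = alg_hom A' B'"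
  by (auto simp: same_algebra_def alg_hom_iff linear_map_def)

lemma same_algebra_op: "same_algebra A B \<Longrightarrow> same_algebra (op_alg A) (op_alg B)"
  by (auto simp: same_algebra_def fun_eq_iff op_alg_def)

lemma generated_same:
  assumes "same_algebra A B" "generated_by A Y"
  shows "generated_by B Y"
proof -
  have "a \<in> alg_gen B Y" if "a \<in> alg_gen A Y" for a
    using that
  proof (induction rule: alg_gen.induct)
    case unit
    show ?case using alg_gen.unit[of B Y] assms(1) by (simp add: same_algebra_def)
  next
    case (add a b)
    then show ?case using alg_gen.add[of a B Y b] assms(1) by (simp add: same_algebra_def)
  next
    case (smult a c)
    then show ?case using alg_gen.smult[of a B Y c] assms(1) by (simp add: same_algebra_def)
  next
    case (mult a b)
    then show ?case using alg_gen.mult[of a B Y b] assms(1) by (simp add: same_algebra_def)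
  qed (rule alg_gen.gen)
  then show ?thesis using assms by (auto simp: generated_by_def same_algebra_def)
qed

text \<open>The part of the axioms that makes \<open>\<Delta>\<close>, \<open>\<epsilon>\<close> and \<open>S\<close> computable from their values on generators.\<close>

definition pre_quasi_hopf :: "('k::field, 'a) quasi_hopf \<Rightarrow> bool" where
  "pre_quasi_hopf H \<longleftrightarrow> k_algebra H \<and> comult H \<in> alg_hom H (T2 H) \<and>
     counit H \<in> alg_hom H scalars \<and> antipode H \<in> alg_hom H (op_alg H)"

lemma pre_quasi_hopf_structureI:
  assumes "k_algebra A" "\<Delta> \<in> alg_hom A (T2 A)" "\<epsilon> \<in> alg_hom A scalars" "S \<in> alg_hom A (op_alg A)"
  shows "pre_quasi_hopf (with_structure A \<Delta> \<epsilon> \<Phi> S \<alpha> \<beta>)"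
proof -
  let ?H = "with_structure A \<Delta> \<epsilon> \<Phi> S \<alpha> \<beta>"
  note s = same_algebra_structure[of A \<Delta> \<epsilon> \<Phi> S \<alpha> \<beta>]
  note r = same_algebra_refl
  show ?thesis
    using assms k_algebra_same[OF same_algebra_sym[OF s]] alg_hom_same[OF s r[of "T2 A"]]
      alg_hom_same[OF s r[of scalars]] alg_hom_same[OF s same_algebra_op[OF s]]
    by (simp add: pre_quasi_hopf_def tensor_powers_same[OF s])
qed

locale pre_qh = fixes H :: "('k::field, 'a) quasi_hopf"
  assumes pre: "pre_quasi_hopf H"
begin

sublocale tensor_powers H
  using pre by (simp add: tensor_powers_def pre_quasi_hopf_def)

lemma comult_hom: "comult H \<in> alg_hom H (T2 H)"
  and counit_hom: "counit H \<in> alg_hom H scalars"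
  and antipode_hom: "antipode H \<in> alg_hom H (op_alg H)"
  using pre by (simp_all add: pre_quasi_hopf_def)

lemmas comult_simps = alg_homD[OF comult_hom]
lemmas counit_simps = alg_homD[OF counit_hom, simplified]
lemmas antipode_simps = alg_homD[OF antipode_hom, simplified]

end

lemma pre_quasi_hopf_tensor:
  fixes H :: "('k::field, 'a) quasi_hopf" and K :: "('k, 'b) quasi_hopf"
  assumes H: "pre_quasi_hopf H" and K: "pre_quasi_hopf K"
  defines "T \<equiv> tensor_alg H K" and "Q \<equiv> quasi_hopf_tensor H K"
  shows "pre_quasi_hopf Q" and "same_algebra Q T"
    and "\<And>h k. h \<in> carrier H \<Longrightarrow> k \<in> carrier K \<Longrightarrow> comult Q (tens H K h k) =
       lift2 (T2 T) (comult H h) (\<lambda>a b. t2 T (tens H K a \<one>\<^bsub>K\<^esub>) (tens H K b \<one>\<^bsub>K\<^esub>)) \<otimes>\<^bsub>T2 T\<^esub>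
       lift2 (T2 T) (comult K k) (\<lambda>a b. t2 T (tens H K \<one>\<^bsub>H\<^esub> a) (tens H K \<one>\<^bsub>H\<^esub> b))"
    and "\<And>h k. h \<in> carrier H \<Longrightarrow> k \<in> carrier K \<Longrightarrow> counit Q (tens H K h k) = counit H h * counit K k"
    and "\<And>h k. h \<in> carrier H \<Longrightarrow> k \<in> carrier K \<Longrightarrow>
       antipode Q (tens H K h k) = tens H K (antipode H h) (antipode K k)"
proof -
  interpret H: pre_qh H using H by unfold_locales
  interpret K: pre_qh K using K by unfold_locales
  interpret HK: two_algebras H K by (unfold_locales) (rule H.k_alg K.k_alg)+
  have kT: "k_algebra T" unfolding T_def by (rule HK.k_algebra_tensor)
  interpret T: tensor_powers T using kT by (simp add: tensor_powers_def)
  let ?i = "\<lambda>a. tens H K a \<one>\<^bsub>K\<^esub>" and ?j = "\<lambda>b. tens H K \<one>\<^bsub>H\<^esub> b"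
  note i = tens_embed(1)[OF H.k_alg K.k_alg, folded T_def] and j = tens_embed(2)[OF H.k_alg K.k_alg, folded T_def]
  let ?i2 = "\<lambda>t. lift2 (T2 T) t (\<lambda>a b. t2 T (?i a) (?i b))" and ?j2 = "\<lambda>t. lift2 (T2 T) t (\<lambda>a b. t2 T (?j a) (?j b))"
  have i2: "?i2 \<in> alg_hom (T2 H) (T2 T)" and bi: "bilinear H H (T2 T) (\<lambda>a b. t2 T (?i a) (?i b))"
    using alg_hom_tensor_map[OF H.k_alg H.k_alg kT kT i i] by (simp_all add: T2_def t2_def)
  have j2: "?j2 \<in> alg_hom (T2 K) (T2 T)" and bj: "bilinear K K (T2 T) (\<lambda>a b. t2 T (?j a) (?j b))"
    using alg_hom_tensor_map[OF K.k_alg K.k_alg kT kT j j] by (simp_all add: T2_def t2_def)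
  note i2t = H.P2.lift2_tens[OF T.k_algebra_T2 bi] and j2t = K.P2.lift2_tens[OF T.k_algebra_T2 bj]
  have ic: "?i a \<in> carrier T" if "a \<in> carrier H" for a using alg_homD(1)[OF i that] .
  have jc: "?j a \<in> carrier T" if "a \<in> carrier K" for a using alg_homD(1)[OF j that] .
  have ij: "?i a \<otimes>\<^bsub>T\<^esub> ?j b = tens H K a b" "?j b \<otimes>\<^bsub>T\<^esub> ?i a = tens H K a b"
    if "a \<in> carrier H" "b \<in> carrier K" for a b
    using that by (simp_all add: T_def HK.tens_mult)
  have comm: "?j2 t \<otimes>\<^bsub>T2 T\<^esub> ?i2 s = ?i2 s \<otimes>\<^bsub>T2 T\<^esub> ?j2 t" if s: "s \<in> carrier (T2 H)" and t: "t \<in> carrier (T2 K)" for s t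
    using s
  proof (induction s rule: H.P2.tensor_induct)
    case (tens a b)
    from t show ?case
    proof (induction t rule: K.P2.tensor_induct)
      case (tens c d)
      then show ?case using \<open>a \<in> carrier H\<close> \<open>b \<in> carrier H\<close>
        by (simp add: i2t j2t ic jc ij)
    next
      case (add t u)
      then show ?case using \<open>a \<in> carrier H\<close> \<open>b \<in> carrier H\<close>
        by (simp add: alg_homD[OF i2] alg_homD[OF j2] T.T2.l_distr T.T2.r_distr)
    qed
  next
    case (add s u)
    then show ?case using t by (simp add: alg_homD[OF i2] alg_homD[OF j2] T.T2.l_distr T.T2.r_distr)
  qed
  let ?D = "\<lambda>h k. ?i2 (comult H h) \<otimes>\<^bsub>T2 T\<^esub> ?j2 (comult K k)"
  note homs = alg_hom_comp[OF H.comult_hom i2] alg_hom_comp[OF K.comult_hom j2]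
  have D: "(\<lambda>t. lift2 (T2 T) t ?D) \<in> alg_hom T (T2 T)"
    unfolding T_def by (rule alg_hom_tensorI(2)[OF H.k_alg K.k_alg T.k_algebra_T2 homs, unfolded T_def])
      (rule comm[unfolded T_def], (rule H.comult_simps(1) K.comult_simps(1), assumption)+)
  have bD: "bilinear H K (T2 T) ?D"
    by (rule alg_hom_tensorI(1)[OF H.k_alg K.k_alg T.k_algebra_T2 homs])
      (rule comm, (rule H.comult_simps(1) K.comult_simps(1), assumption)+)
  have tc: "tens H K a b \<in> carrier T" if "a \<in> carrier H" "b \<in> carrier K" for a b
    using that by (simp add: T_def HK.tens_closed)
  have tl: "linear_map B T (\<lambda>x. tens H K (f x) b)" if "linear_map B H f" "b \<in> carrier K" for B f b
    unfolding T_def by (rule linear_map_tens_left[OF H.k_alg K.k_alg that])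
  have tr: "linear_map B T (\<lambda>x. tens H K b (f x))" if "linear_map B K f" "b \<in> carrier H" for B f b
    unfolding T_def by (rule linear_map_tens_right[OF H.k_alg K.k_alg that])
  note t2l = linear_map_comp[OF _ T.t2_linear(1)] linear_map_comp[OF _ T.t2_linear(2)]
  have b1: "bilinear K K (T2 T) (\<lambda>k1 k2. t2 T (tens H K h1 k1) (tens H K h2 k2))"
    if "h1 \<in> carrier H" "h2 \<in> carrier H" for h1 h2
    by (rule bilinearI; rule t2l) (rule tr linear_map_id that tc | assumption)+
  note b1t = K.P2.lift2_tens[OF T.k_algebra_T2 b1] and b1l = linear_mapD[OF K.P2.lift2_linear[OF T.k_algebra_T2 b1]]
  have in1: "lift2 (T2 T) t (\<lambda>k1 k2. t2 T (tens H K h1 k1) (tens H K h2 k2)) = t2 T (?i h1) (?i h2) \<otimes>\<^bsub>T2 T\<^esub> ?j2 t"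
    if h: "h1 \<in> carrier H" "h2 \<in> carrier H" and t: "t \<in> carrier (T2 K)" for h1 h2 t
    using t
  proof (induction t rule: K.P2.tensor_induct)
    case (tens a b)
    then show ?case using h by (simp add: b1t j2t ic jc ij)
  next
    case (add t u)
    then show ?case using h by (simp add: b1l alg_homD[OF j2] T.T2.r_distr ic)
  qed
  have b2: "bilinear H H (T2 T) (\<lambda>h1 h2. lift2 (T2 T) t (\<lambda>k1 k2. t2 T (tens H K h1 k1) (tens H K h2 k2)))"
    if t: "t \<in> carrier (T2 K)" for t
  proof (rule bilinear_cong[OF _ in1[symmetric] H.k_alg H.k_alg])
    show "bilinear H H (T2 T) (\<lambda>a b. t2 T (?i a) (?i b) \<otimes>\<^bsub>T2 T\<^esub> ?j2 t)"
      by (rule bilinear_mult_left[OF T.k_algebra_T2 bi alg_homD(1)[OF j2 t]])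
  qed (use t in auto)
  note b2t = H.P2.lift2_tens[OF T.k_algebra_T2 b2] and b2l = linear_mapD[OF H.P2.lift2_linear[OF T.k_algebra_T2 b2]]
  have in2: "lift2 (T2 T) s (\<lambda>h1 h2. lift2 (T2 T) t (\<lambda>k1 k2. t2 T (tens H K h1 k1) (tens H K h2 k2))) = ?i2 s \<otimes>\<^bsub>T2 T\<^esub> ?j2 t"
    if s: "s \<in> carrier (T2 H)" and t: "t \<in> carrier (T2 K)" for s t
    using s
  proof (induction s rule: H.P2.tensor_induct)
    case (tens a b)
    show ?case by (simp only: b2t[OF t tens] in1[OF tens t] i2t[OF tens])
  next
    case (add s u)
    then show ?case using t by (simp add: b2l alg_homD[OF i2] alg_homD[OF j2] T.T2.l_distr)
  qed
  let ?D' = "\<lambda>h k. lift2 (T2 T) (comult H h) (\<lambda>h1 h2. lift2 (T2 T) (comult K k) (\<lambda>k1 k2. t2 T (tens H K h1 k1) (tens H K h2 k2)))"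
  have DD: "?D h k = ?D' h k" if "h \<in> carrier H" "k \<in> carrier K" for h k
    using that by (simp add: in2 H.comult_simps K.comult_simps)
  have bD': "bilinear H K (T2 T) ?D'"
    by (rule bilinear_cong[OF bD DD H.k_alg K.k_alg])
  have eqD: "lift2 (T2 T) t ?D = lift2 (T2 T) t ?D'" if "t \<in> carrier T" for t
  proof (rule HK.linear_map_tensor_eqI[OF HK.lift2_linear[OF T.k_algebra_T2 bD] HK.lift2_linear[OF T.k_algebra_T2 bD']])
    fix a b assume ab: "a \<in> carrier H" "b \<in> carrier K"
    show "lift2 (T2 T) (tens H K a b) ?D = lift2 (T2 T) (tens H K a b) ?D'"
      by (simp only: HK.lift2_tens[OF T.k_algebra_T2 bD ab] HK.lift2_tens[OF T.k_algebra_T2 bD' ab] DD[OF ab])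
  qed (use that in \<open>simp only: T_def\<close>)
  have D': "(\<lambda>t. lift2 (T2 T) t ?D') \<in> alg_hom T (T2 T)"
    by (rule alg_hom_cong[OF D eqD kT])
  have E: "(\<lambda>t. lift2 scalars t (\<lambda>h k. counit H h * counit K k)) \<in> alg_hom T scalars"
    and bE: "bilinear H K scalars (\<lambda>h k. counit H h * counit K k)"
    using alg_hom_tensorI[OF H.k_alg K.k_alg k_algebra_scalars H.counit_hom K.counit_hom]
    by (simp_all add: T_def)
  have iop: "?i \<in> alg_hom (op_alg H) (op_alg T)" and jop: "?j \<in> alg_hom (op_alg K) (op_alg T)"
    by (rule alg_hom_op[OF i], rule alg_hom_op[OF j])
  let ?S = "\<lambda>h k. tens H K (antipode H h) (antipode K k)"
  have S0: "(\<lambda>t. lift2 (op_alg T) t (\<lambda>h k. ?i (antipode H h) \<otimes>\<^bsub>op_alg T\<^esub> ?j (antipode K k))) \<in> alg_hom T (op_alg T)"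
    and bS0: "bilinear H K (op_alg T) (\<lambda>h k. ?i (antipode H h) \<otimes>\<^bsub>op_alg T\<^esub> ?j (antipode K k))"
    using alg_hom_tensorI[OF H.k_alg K.k_alg k_algebra_op[OF kT] alg_hom_comp[OF H.antipode_hom iop] alg_hom_comp[OF K.antipode_hom jop]]
    by (simp_all add: ij H.antipode_simps K.antipode_simps T_def[symmetric])
  have bS: "bilinear H K T ?S"
    using bilinear_cong[OF bS0 _ H.k_alg K.k_alg, of ?S]
    by (simp add: ij H.antipode_simps K.antipode_simps bilinear_def)
  have eqS: "lift2 (op_alg T) t (\<lambda>h k. ?i (antipode H h) \<otimes>\<^bsub>op_alg T\<^esub> ?j (antipode K k)) = lift2 T t ?S" if "t \<in> carrier T" for t
  proof (rule HK.linear_map_tensor_eqI[OF HK.lift2_linear[OF k_algebra_op[OF kT] bS0, unfolded linear_map_op] HK.lift2_linear[OF kT bS]])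
    fix a b assume ab: "a \<in> carrier H" "b \<in> carrier K"
    show "lift2 (op_alg T) (tens H K a b) (\<lambda>h k. ?i (antipode H h) \<otimes>\<^bsub>op_alg T\<^esub> ?j (antipode K k)) = lift2 T (tens H K a b) ?S"
      unfolding HK.lift2_tens[OF k_algebra_op[OF kT] bS0 ab] HK.lift2_tens[OF kT bS ab]
      using ab by (simp only: op_alg_simps ij H.antipode_simps(1) K.antipode_simps(1))
  qed (use that in \<open>simp only: T_def\<close>)
  have S: "(\<lambda>t. lift2 T t ?S) \<in> alg_hom T (op_alg T)"
    by (rule alg_hom_cong[OF S0 eqS kT])
  show "pre_quasi_hopf Q" unfolding Q_def quasi_hopf_tensor_def Let_def T_def[symmetric]
    by (intro pre_quasi_hopf_structureI kT D' E S)
  show "same_algebra Q T" unfolding Q_def quasi_hopf_tensor_def Let_def T_def[symmetric]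
    by (rule same_algebra_structure)
  fix h k assume hk: "h \<in> carrier H" "k \<in> carrier K"
  show "comult Q (tens H K h k) = ?D h k"
    unfolding Q_def quasi_hopf_tensor_def Let_def T_def[symmetric] with_structure_simps
    by (simp only: HK.lift2_tens[OF T.k_algebra_T2 bD' hk] DD[OF hk])
  show "counit Q (tens H K h k) = counit H h * counit K k"
    unfolding Q_def quasi_hopf_tensor_def Let_def T_def[symmetric] with_structure_simps
    by (rule HK.lift2_tens[OF k_algebra_scalars bE hk])
  show "antipode Q (tens H K h k) = tens H K (antipode H h) (antipode K k)"
    unfolding Q_def quasi_hopf_tensor_def Let_def T_def[symmetric] with_structure_simps
    by (rule HK.lift2_tens[OF kT bS hk])
qed

lemma (in kalg) pow_comm: "a \<in> carrier A \<Longrightarrow> a \<otimes> a [^] (m::nat) = a [^] m \<otimes> a"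
  using nat_pow_Suc2[of a m] by simp

section \<open>Bases and dual bases\<close>

inductive_set lin_span :: "('k::field, 'a, 'm) module_scheme \<Rightarrow> 'a set \<Rightarrow> 'a set" for A and G where
  zero: "\<zero>\<^bsub>A\<^esub> \<in> lin_span A G"
| base: "a \<in> G \<Longrightarrow> a \<in> lin_span A G"
| add: "a \<in> lin_span A G \<Longrightarrow> b \<in> lin_span A G \<Longrightarrow> a \<oplus>\<^bsub>A\<^esub> b \<in> lin_span A G"
| smult: "a \<in> lin_span A G \<Longrightarrow> c \<odot>\<^bsub>A\<^esub> a \<in> lin_span A G"

text \<open>Linear independence is certified by coordinate functionals, which are easy to transport along
  isomorphisms and tensor products.\<close>

definition dual_basis ::
    "('k::field, 'a, 'm) module_scheme \<Rightarrow> 'i set \<Rightarrow> ('i \<Rightarrow> 'a) \<Rightarrow> ('i \<Rightarrow> 'a \<Rightarrow> 'k) \<Rightarrow> bool" where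
  "dual_basis A I b \<phi> \<longleftrightarrow> finite I \<and> b ` I \<subseteq> carrier A \<and> (\<forall>i\<in>I. linear_map A scalars (\<phi> i)) \<and>
     (\<forall>i\<in>I. \<forall>j\<in>I. \<phi> i (b j) = (if i = j then 1 else 0)) \<and> carrier A \<subseteq> lin_span A (b ` I)"

lemma linear_map_finsum:
  assumes k: "k_algebra A" "k_algebra B" and f: "linear_map A B f" and "finite S" "g \<in> S \<rightarrow> carrier A"
  shows "f (\<Oplus>\<^bsub>A\<^esub>x\<in>S. g x) = (\<Oplus>\<^bsub>B\<^esub>x\<in>S. f (g x))"
proof -
  interpret A: kalg A using k by simp
  interpret B: kalg B using k by simp
  show ?thesis using assms(4,5)
  proof (induction S)
    case empty
    show ?case using linear_map_zero[OF k f] by simp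
  next
    case (insert x S)
    have g: "g x \<in> carrier A" "g \<in> S \<rightarrow> carrier A" using insert by auto
    have fg: "(\<lambda>x. f (g x)) \<in> S \<rightarrow> carrier B" using g linear_mapD(1)[OF f] by auto
    have "f (\<Oplus>\<^bsub>A\<^esub>x\<in>insert x S. g x) = f (g x \<oplus>\<^bsub>A\<^esub> (\<Oplus>\<^bsub>A\<^esub>x\<in>S. g x))"
      using insert g by simp
    also have "\<dots> = f (g x) \<oplus>\<^bsub>B\<^esub> (\<Oplus>\<^bsub>B\<^esub>x\<in>S. f (g x))"
      using linear_mapD(2)[OF f g(1) A.finsum_closed[OF g(2)]] insert g by simp
    also have "\<dots> = (\<Oplus>\<^bsub>B\<^esub>x\<in>insert x S. f (g x))"
      using insert fg linear_mapD(1)[OF f g(1)] by simp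
    finally show ?case .
  qed
qed

lemma finsum_scalars: "(\<Oplus>\<^bsub>scalars\<^esub>x\<in>S. f x) = (\<Sum>x\<in>S. f x)" for f :: "'x \<Rightarrow> 'k::field"
proof (cases "finite S")
  case True
  interpret kalg "scalars :: ('k, 'k) module" by simp
  from True show ?thesis by (induction S) auto
next
  case False
  then show ?thesis by (simp add: finsum_def finprod_def)
qed

context
  fixes A :: "('k::field, 'a, 'm) module_scheme" and I :: "'i set" and b \<phi>
  assumes A: "k_algebra A" and db: "dual_basis A I b \<phi>"
begin

interpretation A: kalg A using A by simp

lemma dual_basis_facts:
  "finite I" "i \<in> I \<Longrightarrow> b i \<in> carrier A" "i \<in> I \<Longrightarrow> linear_map A scalars (\<phi> i)"
  "i \<in> I \<Longrightarrow> j \<in> I \<Longrightarrow> \<phi> i (b j) = (if i = j then 1 else 0)" "carrier A \<subseteq> lin_span A (b ` I)"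
  using db by (auto simp: dual_basis_def)

lemma dual_basis_expand:
  assumes a: "a \<in> carrier A"
  shows "a = (\<Oplus>\<^bsub>A\<^esub>i\<in>I. \<phi> i a \<odot>\<^bsub>A\<^esub> b i)"
proof -
  let ?E = "\<lambda>a. (\<Oplus>\<^bsub>A\<^esub>i\<in>I. \<phi> i a \<odot>\<^bsub>A\<^esub> b i)"
  have E: "a \<in> carrier A \<and> ?E a = a" if "a \<in> lin_span A (b ` I)" for a
    using that
  proof (induction rule: lin_span.induct)
    case zero
    have "?E \<zero>\<^bsub>A\<^esub> = (\<Oplus>\<^bsub>A\<^esub>i\<in>I. \<zero>\<^bsub>A\<^esub>)"
      using linear_map_zero[OF A k_algebra_scalars dual_basis_facts(3)] dual_basis_facts(2)
      by (intro A.finsum_cong') auto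
    then show ?case by simp
  next
    case (base a)
    then obtain j where j: "j \<in> I" "a = b j" by auto
    have "?E (b j) = (\<Oplus>\<^bsub>A\<^esub>i\<in>I. if j = i then b i else \<zero>\<^bsub>A\<^esub>)"
      using j dual_basis_facts(2,4) by (intro A.finsum_cong') auto
    also have "\<dots> = b j"
      using j dual_basis_facts(1,2) by (intro A.finsum_singleton) auto
    finally show ?case using j dual_basis_facts(2) by simp
  next
    case (add a a')
    have "?E (a \<oplus>\<^bsub>A\<^esub> a') = (\<Oplus>\<^bsub>A\<^esub>i\<in>I. \<phi> i a \<odot>\<^bsub>A\<^esub> b i \<oplus>\<^bsub>A\<^esub> \<phi> i a' \<odot>\<^bsub>A\<^esub> b i)"
      using add linear_mapD(2)[OF dual_basis_facts(3), simplified] dual_basis_facts(2)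
      by (intro A.finsum_cong') (auto simp: A.smult_add_left)
    also have "\<dots> = ?E a \<oplus>\<^bsub>A\<^esub> ?E a'"
      using dual_basis_facts(2) by (intro A.finsum_addf) auto
    finally show ?case using add by simp
  next
    case (smult a c)
    have l: "linear_map A A (\<lambda>a. c \<odot>\<^bsub>A\<^esub> a)"
      by (intro linear_map_smult A linear_map_id)
    have "?E (c \<odot>\<^bsub>A\<^esub> a) = (\<Oplus>\<^bsub>A\<^esub>i\<in>I. c \<odot>\<^bsub>A\<^esub> (\<phi> i a \<odot>\<^bsub>A\<^esub> b i))"
      using smult linear_mapD(3)[OF dual_basis_facts(3), simplified] dual_basis_facts(2)
      by (intro A.finsum_cong') auto
    also have "\<dots> = c \<odot>\<^bsub>A\<^esub> ?E a"
      using dual_basis_facts(1,2) by (intro linear_map_finsum[OF A A l, symmetric]) auto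
    finally show ?case using smult by simp
  qed
  then show ?thesis using a dual_basis_facts(5) by auto
qed

lemma dual_basis_eqI:
  assumes "a \<in> carrier A" "a' \<in> carrier A" "\<And>i. i \<in> I \<Longrightarrow> \<phi> i a = \<phi> i a'"
  shows "a = a'"
proof -
  have "a = (\<Oplus>\<^bsub>A\<^esub>i\<in>I. \<phi> i a \<odot>\<^bsub>A\<^esub> b i)" by (rule dual_basis_expand[OF assms(1)])
  also have "\<dots> = (\<Oplus>\<^bsub>A\<^esub>i\<in>I. \<phi> i a' \<odot>\<^bsub>A\<^esub> b i)"
    using assms(3) dual_basis_facts(2) by (intro A.finsum_cong') auto
  also have "\<dots> = a'" by (rule dual_basis_expand[OF assms(2), symmetric])
  finally show ?thesis .
qed

lemma dual_basis_linear_eqI: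
  assumes "k_algebra B" "linear_map A B f" "linear_map A B g" "\<And>i. i \<in> I \<Longrightarrow> f (b i) = g (b i)" "a \<in> carrier A"
  shows "f a = g a"
proof -
  interpret B: kalg B using assms by simp
  have e: "h a = (\<Oplus>\<^bsub>B\<^esub>i\<in>I. \<phi> i a \<odot>\<^bsub>B\<^esub> h (b i))" if h: "linear_map A B h" for h
  proof -
    have "h (\<Oplus>\<^bsub>A\<^esub>i\<in>I. \<phi> i a \<odot>\<^bsub>A\<^esub> b i) = (\<Oplus>\<^bsub>B\<^esub>i\<in>I. h (\<phi> i a \<odot>\<^bsub>A\<^esub> b i))"
      using dual_basis_facts(1,2) by (intro linear_map_finsum[OF A assms(1) h]) auto
    also have "\<dots> = (\<Oplus>\<^bsub>B\<^esub>i\<in>I. \<phi> i a \<odot>\<^bsub>B\<^esub> h (b i))"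
      using dual_basis_facts(2) linear_mapD[OF h] by (intro B.finsum_cong') auto
    finally show ?thesis using dual_basis_expand[OF assms(5)] by simp
  qed
  show ?thesis unfolding e[OF assms(2)] e[OF assms(3)]
    using assms(4) dual_basis_facts(2) linear_mapD(1)[OF assms(3)] by (intro B.finsum_cong') auto
qed

lemma dual_basis_dimension: "has_dimension A (card I)"
proof -
  note f = dual_basis_facts
  have inj: "inj_on b I"
  proof (rule inj_onI)
    fix i j assume ij: "i \<in> I" "j \<in> I" "b i = b j"
    then show "i = j" using f(4)[of i i] f(4)[of i j] by (auto split: if_splits)
  qed
  let ?B = "b ` I" and ?\<psi> = "\<lambda>x. \<phi> (inv_into I b x)"
  have sum: "(\<Oplus>\<^bsub>A\<^esub>x\<in>?B. c x \<odot>\<^bsub>A\<^esub> x) = (\<Oplus>\<^bsub>A\<^esub>i\<in>I. c (b i) \<odot>\<^bsub>A\<^esub> b i)" for c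
    using inj f(2) by (intro A.finsum_reindex) auto
  have coeff: "\<phi> j (\<Oplus>\<^bsub>A\<^esub>i\<in>I. c (b i) \<odot>\<^bsub>A\<^esub> b i) = c (b j)" if j: "j \<in> I" for c j
  proof -
    have "\<phi> j (\<Oplus>\<^bsub>A\<^esub>i\<in>I. c (b i) \<odot>\<^bsub>A\<^esub> b i) = (\<Sum>i\<in>I. \<phi> j (c (b i) \<odot>\<^bsub>A\<^esub> b i))"
      unfolding finsum_scalars[symmetric]
      using f(1,2) by (intro linear_map_finsum[OF A k_algebra_scalars f(3)[OF j]]) auto
    also have "\<dots> = (\<Sum>i\<in>I. if j = i then c (b i) else 0)"
      using j f(2,4) linear_mapD(3)[OF f(3)[OF j]] by (intro sum.cong) auto
    finally show ?thesis using j f(1) by simp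
  qed
  have ex: "\<exists>!c. c \<in> ?B \<rightarrow>\<^sub>E UNIV \<and> a = (\<Oplus>\<^bsub>A\<^esub>x\<in>?B. c x \<odot>\<^bsub>A\<^esub> x)" if a: "a \<in> carrier A" for a
  proof (rule ex1I)
    let ?c = "restrict (\<lambda>x. ?\<psi> x a) ?B"
    have "a = (\<Oplus>\<^bsub>A\<^esub>i\<in>I. \<phi> i a \<odot>\<^bsub>A\<^esub> b i)" by (rule dual_basis_expand[OF a])
    also have "\<dots> = (\<Oplus>\<^bsub>A\<^esub>i\<in>I. ?c (b i) \<odot>\<^bsub>A\<^esub> b i)"
      using inj f(2) by (intro A.finsum_cong') auto
    finally show "?c \<in> ?B \<rightarrow>\<^sub>E UNIV \<and> a = (\<Oplus>\<^bsub>A\<^esub>x\<in>?B. ?c x \<odot>\<^bsub>A\<^esub> x)"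
      unfolding sum by auto
    fix c assume c: "c \<in> ?B \<rightarrow>\<^sub>E UNIV \<and> a = (\<Oplus>\<^bsub>A\<^esub>x\<in>?B. c x \<odot>\<^bsub>A\<^esub> x)"
    show "c = ?c"
    proof (rule PiE_ext[of _ ?B "\<lambda>_. UNIV"])
      fix x assume "x \<in> ?B"
      then obtain j where j: "j \<in> I" "x = b j" by auto
      then show "c x = ?c x" using c coeff[OF j(1), of c] inj unfolding sum by simp
    qed (use c in auto)
  qed
  show ?thesis unfolding has_dimension_def
    by (rule exI[of _ ?B]) (use f(1,2) ex inj in \<open>auto simp: card_image\<close>)
qed

end

lemma lin_span_map:
  assumes f: "linear_map A B f" and A: "k_algebra A" and B: "k_algebra B" and G: "G \<subseteq> carrier A" and "\<And>a. a \<in> G \<Longrightarrow> f a \<in> lin_span B G'"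
    and "a \<in> lin_span A G"
  shows "a \<in> carrier A \<and> f a \<in> lin_span B G'"
proof -
  interpret A: kalg A using A by simp
  note l = linear_mapD[OF f]
  from assms(6) show ?thesis
  proof (induction rule: lin_span.induct)
    case zero
    then show ?case using linear_map_zero[OF A B f] by (simp add: lin_span.zero)
  qed (use G assms(5) l in \<open>auto intro: lin_span.intros\<close>)
qed

lemma dual_basis_transport:
  assumes A: "k_algebra A" and B: "k_algebra B" and db: "dual_basis A I b \<phi>"
    and f: "linear_map A B f" and g: "linear_map B A g"
    and gf: "\<And>a. a \<in> carrier A \<Longrightarrow> g (f a) = a" and fg: "\<And>x. x \<in> carrier B \<Longrightarrow> f (g x) = x"
  shows "dual_basis B I (\<lambda>i. f (b i)) (\<lambda>i x. \<phi> i (g x))"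
proof -
  note d = dual_basis_facts[OF A db]
  have "x \<in> lin_span B ((\<lambda>i. f (b i)) ` I)" if x: "x \<in> carrier B" for x
  proof -
    have "g x \<in> lin_span A (b ` I)" using d(5) linear_mapD(1)[OF g x] by auto
    then have "f (g x) \<in> lin_span B ((\<lambda>i. f (b i)) ` I)"
      by (rule lin_span_map[OF f A B, THEN conjunct2, rotated 2]) (use d(2) in \<open>auto intro: lin_span.base\<close>)
    then show ?thesis using fg[OF x] by simp
  qed
  then show ?thesis unfolding dual_basis_def
    using d linear_mapD(1)[OF f] linear_map_comp[OF g d(3)] gf by auto
qed

text \<open>The products of coordinate functionals are well defined on the tensor product by bilinearity.\<close>

lemma dual_basis_tensor:
  assumes A: "k_algebra A" and B: "k_algebra B" and dA: "dual_basis A I b \<phi>" and dB: "dual_basis B J c \<psi>"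
  shows "dual_basis (tensor_alg A B) (I \<times> J) (\<lambda>(i, j). tens A B (b i) (c j))
    (\<lambda>(i, j) t. lift2 scalars t (\<lambda>x y. \<phi> i x * \<psi> j y))"
proof -
  interpret AB: two_algebras A B using A B by unfold_locales
  interpret T: kalg "tensor_alg A B" using A B by simp
  note a = dual_basis_facts[OF A dA] and b = dual_basis_facts[OF B dB]
  have bil: "bilinear A B scalars (\<lambda>x y. \<phi> i x * \<psi> j y)" if "i \<in> I" "j \<in> J" for i j
    by (rule bilinearI) (intro linear_map_times a(3) b(3) that)+
  note lt = AB.lift2_tens[OF k_algebra_scalars bil]
  let ?G = "(\<lambda>(i, j). tens A B (b i) (c j)) ` (I \<times> J)"
  have s1: "tens A B (b i) y \<in> lin_span (tensor_alg A B) ?G" if i: "i \<in> I" and y: "y \<in> carrier B" for i y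
  proof -
    have "y \<in> lin_span B (c ` J)" using b(5) y by auto
    then show ?thesis
      by (rule lin_span_map[OF linear_map_tens_right[OF A B linear_map_id a(2)[OF i]] B T.k_alg, THEN conjunct2, rotated 2])
        (use b(2) i in \<open>auto intro!: lin_span.base\<close>)
  qed
  have s2: "tens A B x y \<in> lin_span (tensor_alg A B) ?G" if x: "x \<in> carrier A" and y: "y \<in> carrier B" for x y
  proof -
    have "x \<in> lin_span A (b ` I)" using a(5) x by auto
    then show ?thesis
      by (rule lin_span_map[OF linear_map_tens_left[OF A B linear_map_id y] A T.k_alg, THEN conjunct2, rotated 2])
        (use a(2) s1[OF _ y] in auto)
  qed
  have "t \<in> lin_span (tensor_alg A B) ?G" if "t \<in> carrier (tensor_alg A B)" for t
    using that by (induction t rule: AB.tensor_induct) (auto intro: s2 lin_span.add)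
  then show ?thesis unfolding dual_basis_def
    using a(1,2,4) b(1,2,4) AB.lift2_linear[OF k_algebra_scalars bil]
    by (auto simp: lt AB.tens_closed)
qed

section \<open>The algebra with a grouplike involution and an anticommuting nilpotent\<close>

definition nil_rels :: "nat \<Rightarrow> (gen list \<Rightarrow>\<^sub>0 'k::field) set" where
  "nil_rels n = {mon [Gen_g, Gen_g] - mon [], mon (replicate n Gen_x), mon [Gen_g, Gen_x] + mon [Gen_x, Gen_g]}"

lemma H8_rels_nil: "H8_rels = nil_rels 4"
  by (simp add: H8_rels_def nil_rels_def numeral_eq_Suc)

lemma sweedler_rels_nil: "sweedler_rels = nil_rels 2"
  by (simp add: sweedler_rels_def nil_rels_def numeral_eq_Suc add.commute)

definition endo_alg :: "('k::field, ('i \<Rightarrow> 'k) \<Rightarrow> ('i \<Rightarrow> 'k)) module" where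
  "endo_alg = \<lparr>carrier = {T. (\<forall>f g. T (\<lambda>i. f i + g i) = (\<lambda>i. T f i + T g i)) \<and> (\<forall>c f. T (\<lambda>i. c * f i) = (\<lambda>i. c * T f i))},
     monoid.mult = (\<circ>), one = id, ring.zero = (\<lambda>f i. 0), add = (\<lambda>S T f i. S f i + T f i),
     smult = (\<lambda>c T f i. c * T f i)\<rparr>"

lemma endo_alg_simps [simp]:
  "S \<otimes>\<^bsub>endo_alg\<^esub> T = S \<circ> T" "\<one>\<^bsub>endo_alg\<^esub> = id" "\<zero>\<^bsub>endo_alg\<^esub> = (\<lambda>f i. 0)"
  "S \<oplus>\<^bsub>endo_alg\<^esub> T = (\<lambda>f i. S f i + T f i)" "c \<odot>\<^bsub>endo_alg\<^esub> T = (\<lambda>f i. c * T f i)"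
  "T \<in> carrier endo_alg \<longleftrightarrow> (\<forall>f g. T (\<lambda>i. f i + g i) = (\<lambda>i. T f i + T g i)) \<and> (\<forall>c f. T (\<lambda>i. c * f i) = (\<lambda>i. c * T f i))"
  by (simp_all add: endo_alg_def)

lemma k_algebra_endo: "k_algebra (endo_alg :: ('k::field, ('i \<Rightarrow> 'k) \<Rightarrow> _) module)"
proof -
  have "ring (endo_alg :: ('k, ('i \<Rightarrow> 'k) \<Rightarrow> _) module)"
  proof (rule ringI)
    show "abelian_group (endo_alg :: ('k, ('i \<Rightarrow> 'k) \<Rightarrow> _) module)"
    proof (rule abelian_groupI)
      fix T assume "T \<in> carrier (endo_alg :: ('k, ('i \<Rightarrow> 'k) \<Rightarrow> _) module)"
      then show "\<exists>S\<in>carrier endo_alg. S \<oplus>\<^bsub>endo_alg\<^esub> T = \<zero>\<^bsub>endo_alg\<^esub>"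
        by (intro bexI[of _ "\<lambda>f i. - T f i"]) (auto simp: fun_eq_iff)
    qed (auto simp: fun_eq_iff algebra_simps)
    show "Group.monoid (endo_alg :: ('k, ('i \<Rightarrow> 'k) \<Rightarrow> _) module)"
      by (rule monoidI) (auto simp: o_def)
  qed (auto simp: fun_eq_iff)
  then show ?thesis
    by (rule k_algebraI) (auto simp: fun_eq_iff algebra_simps)
qed

locale nil_alg =
  fixes n :: nat and fld :: "'k::field itself"
  assumes n: "0 < n"
begin

definition P :: "('k, (gen list \<Rightarrow>\<^sub>0 'k) set) module" where "P = pres_alg UNIV (nil_rels n)"
definition g where "g = pres_gen UNIV (nil_rels n :: (gen list \<Rightarrow>\<^sub>0 'k) set) Gen_g"
definition x where "x = pres_gen UNIV (nil_rels n :: (gen list \<Rightarrow>\<^sub>0 'k) set) Gen_x"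

sublocale pr: presentation UNIV "nil_rels n :: (gen list \<Rightarrow>\<^sub>0 'k) set"
  by unfold_locales (auto simp: free_alg_simps)

sublocale kalg P
  using pr.k_algebra_pres by (simp add: P_def)

lemma closed [simp]: "g \<in> carrier P" "x \<in> carrier P"
  using pr.pres_gen_closed by (auto simp: P_def g_def x_def)

lemma generated: "generated_by P {g, x}"
proof -
  have "(pres_gen UNIV (nil_rels n :: (gen list \<Rightarrow>\<^sub>0 'k) set)) ` UNIV = {g, x}"
    unfolding g_def x_def using gen.exhaust by (metis (full_types) UNIV_eq_I image_insert image_empty insertCI)
  then show ?thesis using pr.generated_pres by (simp add: P_def)
qed

lemma word_eval_replicate:
  assumes "k_algebra C" "f a \<in> carrier C"
  shows "word_eval C f (replicate m a) = f a [^]\<^bsub>C\<^esub> m"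
proof -
  interpret C: kalg C using assms by simp
  show ?thesis using assms by (induction m) (simp_all add: C.pow_comm)
qed

lemma lin_ext_nil_rels:
  fixes C :: "('k, 'b, 'c) module_scheme"
  assumes C: "k_algebra C" and f: "\<And>s. f s \<in> carrier C" and r: "r \<in> nil_rels n"
  shows "lin_ext C (word_eval C f) r \<in> {f Gen_g \<otimes>\<^bsub>C\<^esub> f Gen_g \<ominus>\<^bsub>C\<^esub> \<one>\<^bsub>C\<^esub>, f Gen_x [^]\<^bsub>C\<^esub> n,
      f Gen_g \<otimes>\<^bsub>C\<^esub> f Gen_x \<oplus>\<^bsub>C\<^esub> f Gen_x \<otimes>\<^bsub>C\<^esub> f Gen_g}"
    and "r = mon [Gen_g, Gen_g] - mon [] \<Longrightarrow> lin_ext C (word_eval C f) r = f Gen_g \<otimes>\<^bsub>C\<^esub> f Gen_g \<ominus>\<^bsub>C\<^esub> \<one>\<^bsub>C\<^esub>"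
    and "r = mon (replicate n Gen_x) \<Longrightarrow> lin_ext C (word_eval C f) r = f Gen_x [^]\<^bsub>C\<^esub> n"
    and "r = mon [Gen_g, Gen_x] + mon [Gen_x, Gen_g] \<Longrightarrow>
       lin_ext C (word_eval C f) r = f Gen_g \<otimes>\<^bsub>C\<^esub> f Gen_x \<oplus>\<^bsub>C\<^esub> f Gen_x \<otimes>\<^bsub>C\<^esub> f Gen_g"
proof -
  interpret C: kalg C using C by simp
  interpret F: kalg "free_alg UNIV :: ('k, gen list \<Rightarrow>\<^sub>0 'k) module" by simp
  have f': "f \<in> UNIV \<rightarrow> carrier C" using f by simp
  note h = alg_homD[OF word_eval_alg_hom[OF C f']]
  note w = word_eval_closed[OF C f']
  have s: "lin_ext C (word_eval C f) (mon v) = word_eval C f v" for v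
    using w[of v] by (simp add: lin_ext_single[OF C])
  have mi: "u \<ominus>\<^bsub>free_alg UNIV\<^esub> v = u - v" for u v :: "gen list \<Rightarrow>\<^sub>0 'k"
  proof -
    have "(-1) \<odot>\<^bsub>free_alg UNIV\<^esub> v = - v" by (auto intro!: poly_mapping_eqI simp: free_alg_simps)
    then show ?thesis using F.diff_smult[of u v] by (simp add: free_alg_simps)
  qed
  show 1: "r = mon [Gen_g, Gen_g] - mon [] \<Longrightarrow> lin_ext C (word_eval C f) r = f Gen_g \<otimes>\<^bsub>C\<^esub> f Gen_g \<ominus>\<^bsub>C\<^esub> \<one>\<^bsub>C\<^esub>"
    using linear_map_minus(2)[OF F.k_alg C alg_hom_linear[OF word_eval_alg_hom[OF C f']], of "mon [Gen_g, Gen_g]" "mon []"] f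
    by (simp add: mi s free_alg_simps)
  show 2: "r = mon (replicate n Gen_x) \<Longrightarrow> lin_ext C (word_eval C f) r = f Gen_x [^]\<^bsub>C\<^esub> n"
    by (simp add: s word_eval_replicate[where f = f, OF C f])
  show 3: "r = mon [Gen_g, Gen_x] + mon [Gen_x, Gen_g] \<Longrightarrow>
       lin_ext C (word_eval C f) r = f Gen_g \<otimes>\<^bsub>C\<^esub> f Gen_x \<oplus>\<^bsub>C\<^esub> f Gen_x \<otimes>\<^bsub>C\<^esub> f Gen_g"
    using h(2)[of "mon [Gen_g, Gen_x]" "mon [Gen_x, Gen_g]"] f by (simp add: s free_alg_simps)
  show "lin_ext C (word_eval C f) r \<in> {f Gen_g \<otimes>\<^bsub>C\<^esub> f Gen_g \<ominus>\<^bsub>C\<^esub> \<one>\<^bsub>C\<^esub>, f Gen_x [^]\<^bsub>C\<^esub> n,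
      f Gen_g \<otimes>\<^bsub>C\<^esub> f Gen_x \<oplus>\<^bsub>C\<^esub> f Gen_x \<otimes>\<^bsub>C\<^esub> f Gen_g}"
    using 1 2 3 r unfolding nil_rels_def by blast
qed

lemma relations: "g \<otimes>\<^bsub>P\<^esub> g = \<one>\<^bsub>P\<^esub>" "x [^]\<^bsub>P\<^esub> n = \<zero>\<^bsub>P\<^esub>" "x \<otimes>\<^bsub>P\<^esub> g = \<ominus>\<^bsub>P\<^esub> (g \<otimes>\<^bsub>P\<^esub> x)"
proof -
  let ?f = "pres_gen UNIV (nil_rels n :: (gen list \<Rightarrow>\<^sub>0 'k) set)"
  have fc: "\<And>s. ?f s \<in> carrier P" using pr.pres_gen_closed by (simp add: P_def)
  have z: "lin_ext P (word_eval P ?f) r = \<zero>\<^bsub>P\<^esub>" if "r \<in> nil_rels n" for r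
    using pr.relator_zero[OF that] by (simp add: P_def)
  note l = lin_ext_nil_rels(2-4)[of P ?f, OF k_alg fc _ refl]
  have "g \<otimes>\<^bsub>P\<^esub> g \<ominus>\<^bsub>P\<^esub> \<one>\<^bsub>P\<^esub> = \<zero>\<^bsub>P\<^esub>"
    using l(1) z by (simp add: nil_rels_def g_def)
  then show "g \<otimes>\<^bsub>P\<^esub> g = \<one>\<^bsub>P\<^esub>" by (simp add: r_right_minus_eq)
  show "x [^]\<^bsub>P\<^esub> n = \<zero>\<^bsub>P\<^esub>" using l(2) z by (simp add: nil_rels_def x_def)
  have "g \<otimes>\<^bsub>P\<^esub> x \<oplus>\<^bsub>P\<^esub> x \<otimes>\<^bsub>P\<^esub> g = \<zero>\<^bsub>P\<^esub>"
    using l(3) z by (simp add: nil_rels_def x_def g_def)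
  then have "x \<otimes>\<^bsub>P\<^esub> g \<oplus>\<^bsub>P\<^esub> g \<otimes>\<^bsub>P\<^esub> x = \<zero>\<^bsub>P\<^esub>" by (simp add: a_comm)
  from minus_equality[OF this] show "x \<otimes>\<^bsub>P\<^esub> g = \<ominus>\<^bsub>P\<^esub> (g \<otimes>\<^bsub>P\<^esub> x)" by simp
qed

lemma lift:
  fixes C :: "('k, 'b, 'c) module_scheme"
  assumes C: "k_algebra C" and c: "\<And>s. f s \<in> carrier C" and "f Gen_g \<otimes>\<^bsub>C\<^esub> f Gen_g = \<one>\<^bsub>C\<^esub>"
    and "f Gen_x [^]\<^bsub>C\<^esub> n = \<zero>\<^bsub>C\<^esub>" and "f Gen_g \<otimes>\<^bsub>C\<^esub> f Gen_x \<oplus>\<^bsub>C\<^esub> f Gen_x \<otimes>\<^bsub>C\<^esub> f Gen_g = \<zero>\<^bsub>C\<^esub>"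
  shows "pres_lift C f \<in> alg_hom P C" "pres_lift C f g = f Gen_g" "pres_lift C f x = f Gen_x"
proof -
  interpret C: kalg C using C by simp
  have z: "lin_ext C (word_eval C f) r = \<zero>\<^bsub>C\<^esub>" if "r \<in> nil_rels n" for r
    using lin_ext_nil_rels(1)[where f = f, OF C c that] assms(3-) by (auto simp: a_minus_def C.r_neg)
  have f': "f \<in> UNIV \<rightarrow> carrier C" using c by simp
  show "pres_lift C f \<in> alg_hom P C" using pr.pres_lift_alg_hom[OF C f' z] by (simp add: P_def)
  show "pres_lift C f g = f Gen_g" "pres_lift C f x = f Gen_x"
    using pr.pres_lift_gen[OF C f' z] by (simp_all add: g_def x_def)
qed

definition basis :: "bool \<times> nat \<Rightarrow> (gen list \<Rightarrow>\<^sub>0 'k) set" where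
  "basis = (\<lambda>(a, j). (if a then g else \<one>\<^bsub>P\<^esub>) \<otimes>\<^bsub>P\<^esub> x [^]\<^bsub>P\<^esub> j)"

text \<open>Left multiplication by the generators, written on coordinate functions for the monomials
  \<open>g\<^sup>a x\<^sup>j\<close>. Since these operators satisfy the relators, the monomials are linearly independent.\<close>

definition reg_g :: "(bool \<times> nat \<Rightarrow> 'k) \<Rightarrow> (bool \<times> nat \<Rightarrow> 'k)" where
  "reg_g f = (\<lambda>(a, j). f (\<not> a, j))"

definition reg_x :: "(bool \<times> nat \<Rightarrow> 'k) \<Rightarrow> (bool \<times> nat \<Rightarrow> 'k)" where
  "reg_x f = (\<lambda>(a, j). if 0 < j \<and> j < n then (if a then - f (a, j - 1) else f (a, j - 1)) else 0)"

definition reg :: "(gen list \<Rightarrow>\<^sub>0 'k) set \<Rightarrow> (bool \<times> nat \<Rightarrow> 'k) \<Rightarrow> (bool \<times> nat \<Rightarrow> 'k)" where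
  "reg = pres_lift endo_alg (case_gen reg_g reg_x)"

definition coord :: "bool \<times> nat \<Rightarrow> (gen list \<Rightarrow>\<^sub>0 'k) set \<Rightarrow> 'k" where
  "coord i u = reg u (\<lambda>j. if j = (False, 0) then 1 else 0) i"

lemma reg_hom: "reg \<in> alg_hom P endo_alg" and reg_gens: "reg g = reg_g" "reg x = reg_x"
proof -
  have cl: "\<And>s. case_gen reg_g reg_x s \<in> carrier endo_alg"
    by (auto simp: reg_g_def reg_x_def fun_eq_iff split: gen.split)
  have it: "reg_x [^]\<^bsub>endo_alg\<^esub> m = reg_x ^^ m" for m :: nat
    by (induction m) (simp_all add: funpow_Suc_right del: funpow.simps(2))
  have pw: "(reg_x ^^ m) f (a, j) = 0" if "j < m \<or> (0 < m \<and> n \<le> j)" for m f a j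
    using that
  proof (induction m arbitrary: a j)
    case (Suc m)
    have "reg_x h (a, j) = (if 0 < j \<and> j < n then (if a then - h (a, j - 1) else h (a, j - 1)) else 0)" for h
      by (simp add: reg_x_def)
    then show ?case using Suc.IH[of "j - 1" a] Suc.prems by (cases j) auto
  qed simp
  have "reg_x [^]\<^bsub>endo_alg\<^esub> n = \<zero>\<^bsub>endo_alg\<^esub>"
    using pw[of _ n] n by (auto simp: it fun_eq_iff) (use not_less in blast)
  then have *: "case_gen reg_g reg_x Gen_x [^]\<^bsub>endo_alg\<^esub> n = \<zero>\<^bsub>endo_alg\<^esub>"
    "case_gen reg_g reg_x Gen_g \<otimes>\<^bsub>endo_alg\<^esub> case_gen reg_g reg_x Gen_g = \<one>\<^bsub>endo_alg\<^esub>"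
    "case_gen reg_g reg_x Gen_g \<otimes>\<^bsub>endo_alg\<^esub> case_gen reg_g reg_x Gen_x \<oplus>\<^bsub>endo_alg\<^esub>
      case_gen reg_g reg_x Gen_x \<otimes>\<^bsub>endo_alg\<^esub> case_gen reg_g reg_x Gen_g = \<zero>\<^bsub>endo_alg\<^esub>"
    by (auto simp: fun_eq_iff reg_g_def reg_x_def)
  show "reg \<in> alg_hom P endo_alg" "reg g = reg_g" "reg x = reg_x"
    using lift[OF k_algebra_endo cl *(2,1,3)] by (simp_all add: reg_def)
qed

lemma coord_linear: "linear_map P scalars (coord i)"
  using alg_homD[OF reg_hom] by (auto simp: coord_def intro!: linear_mapI)

lemma coord_mult:
  assumes "u \<in> carrier P"
  shows "coord (a, j) (g \<otimes>\<^bsub>P\<^esub> u) = coord (\<not> a, j) u"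
    and "coord (a, j) (x \<otimes>\<^bsub>P\<^esub> u) = (if 0 < j \<and> j < n then (if a then - coord (a, j - 1) u else coord (a, j - 1) u) else 0)"
  using assms alg_homD(4)[OF reg_hom, of g u] alg_homD(4)[OF reg_hom, of x u]
  by (simp_all add: coord_def reg_gens reg_g_def reg_x_def)

lemma coord_one: "coord i \<one>\<^bsub>P\<^esub> = (if i = (False, 0) then 1 else 0)"
  using alg_homD(5)[OF reg_hom] by (simp add: coord_def)

lemma coord_power: "m < n \<Longrightarrow> coord i (x [^]\<^bsub>P\<^esub> m) = (if i = (False, m) then 1 else 0)"
proof (induction m arbitrary: i)
  case (Suc m)
  obtain a j where i: "i = (a, j)" by force
  show ?case using Suc coord_mult(2)[of "x [^]\<^bsub>P\<^esub> m" a j] unfolding i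
    by (cases j) (simp_all add: pow_comm)
qed (simp add: coord_one)

text \<open>The coordinates come from the action on the monomial \<open>1\<close>, which recovers each monomial.\<close>

lemma dual_basis_nil: "dual_basis P (UNIV \<times> {..<n}) basis coord"
proof -
  have bc: "basis i \<in> carrier P" for i by (auto simp: basis_def split: prod.split)
  have cb: "coord i (basis j) = (if i = j then 1 else 0)" if "i \<in> UNIV \<times> {..<n}" "j \<in> UNIV \<times> {..<n}" for i j
    using that by (auto simp: basis_def coord_power coord_mult split: prod.splits if_splits)
  let ?S = "lin_span P (basis ` (UNIV \<times> {..<n}))"
  have Sc: "u \<in> carrier P" if "u \<in> ?S" for u
    using that by (induction rule: lin_span.induct) (use bc in auto)
  have bS: "basis (a, j) \<in> ?S" for a j
  proof (cases "j < n")
    case True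
    then show ?thesis by (auto intro!: lin_span.base)
  next
    case False
    then have "x [^]\<^bsub>P\<^esub> j = x [^]\<^bsub>P\<^esub> n \<otimes>\<^bsub>P\<^esub> x [^]\<^bsub>P\<^esub> (j - n)" by (simp add: nat_pow_mult)
    then have "basis (a, j) = \<zero>\<^bsub>P\<^esub>" by (auto simp: basis_def relations(2))
    then show ?thesis by (simp add: lin_span.zero)
  qed
  have neg: "\<ominus>\<^bsub>P\<^esub> u \<in> ?S" if "u \<in> ?S" for u
    using lin_span.smult[OF that, of "-1"] Sc[OF that] by (simp add: minus_smult)
  have gb: "g \<otimes>\<^bsub>P\<^esub> basis (a, j) \<in> ?S" for a j
  proof -
    have "g \<otimes>\<^bsub>P\<^esub> basis (a, j) = basis (\<not> a, j)"
      by (auto simp: basis_def m_assoc[symmetric] relations)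
    then show ?thesis using bS by simp
  qed
  have xb: "x \<otimes>\<^bsub>P\<^esub> basis (a, j) \<in> ?S" for a j
  proof -
    have "x \<otimes>\<^bsub>P\<^esub> basis (a, j) = (if a then \<ominus>\<^bsub>P\<^esub> basis (a, Suc j) else basis (a, Suc j))"
      by (simp add: basis_def m_assoc[symmetric] relations(3) l_minus pow_comm)
        (simp add: m_assoc pow_comm)
    then show ?thesis using bS[of a "Suc j"] neg by auto
  qed
  have mult: "s \<otimes>\<^bsub>P\<^esub> u \<in> ?S" if u: "u \<in> ?S" and s: "s = g \<or> s = x" for s u
  proof -
    have sc: "s \<in> carrier P" using s by auto
    show ?thesis
      by (rule lin_span_map[OF linear_map_mult_right[OF k_alg linear_map_id sc] k_alg k_alg _ _ u, THEN conjunct2])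
        (use bc gb xb s in auto)
  qed
  have "\<forall>u\<in>?S. w \<otimes>\<^bsub>P\<^esub> u \<in> ?S" if "w \<in> carrier P" for w
    using k_alg generated that
  proof (induction w rule: generated_induct)
    case (mult a b)
    then show ?case using Sc by (auto simp: m_assoc)
  next
    case (add a b)
    then show ?case using Sc by (auto simp: l_distr intro: lin_span.add)
  next
    case (smult c a)
    then show ?case using Sc by (auto intro: lin_span.smult)
  qed (use Sc mult in auto)
  moreover have "\<one>\<^bsub>P\<^esub> \<in> ?S" using bS[of False 0] by (simp add: basis_def)
  ultimately have "carrier P \<subseteq> ?S" by force
  then show ?thesis unfolding dual_basis_def using bc cb coord_linear by auto
qed

end

section \<open>Complementary idempotents exchanged by a generator\<close>

lemma (in kalg) pow_2: "a \<in> carrier A \<Longrightarrow> a [^] (2::nat) = a \<otimes> a"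
  by (simp add: numeral_2_eq_2)

lemma (in kalg) pow_4: "a \<in> carrier A \<Longrightarrow> a [^] (4::nat) = (a \<otimes> a) \<otimes> (a \<otimes> a)"
  by (simp add: numeral_eq_Suc m_assoc)

lemma op_pow: "k_algebra A \<Longrightarrow> a \<in> carrier A \<Longrightarrow> a [^]\<^bsub>op_alg A\<^esub> (m::nat) = a [^]\<^bsub>A\<^esub> m"
  by (induction m) (simp_all add: kalg.pow_comm)

text \<open>The \<open>q\<close>-binomial theorem: for a primitive fourth root of unity all middle \<open>q\<close>-binomial coefficients of
  degree \<open>4\<close> vanish.\<close>

lemma (in kalg) q_commuting_fourth_power:
  assumes a: "a \<in> carrier A" and b: "b \<in> carrier A" and ba: "b \<otimes> a = q \<odot> (a \<otimes> b)" and qq: "q * q = - 1"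
  shows "(a \<oplus> b) [^] (4::nat) = a [^] (4::nat) \<oplus> b [^] (4::nat)"
proof -
  have ba': "b \<otimes> (a \<otimes> u) = q \<odot> (a \<otimes> (b \<otimes> u))" if "u \<in> carrier A" for u
    using a b that ba by (simp add: m_assoc[symmetric])
  let ?U = "a \<otimes> a \<oplus> b \<otimes> b" and ?V = "(1 + q) \<odot> (a \<otimes> b)"
  have 1: "(a \<oplus> b) \<otimes> (a \<oplus> b) = ?U \<oplus> ?V"
    using a b by (simp add: l_distr r_distr ba smult_add_left a_ac)
  have c: "a \<otimes> (a \<otimes> (a \<otimes> b)) \<in> carrier A" "a \<otimes> (b \<otimes> (b \<otimes> b)) \<in> carrier A" "a \<otimes> (a \<otimes> (b \<otimes> b)) \<in> carrier A"
    using a b by auto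
  have UV: "?U \<otimes> ?V = (1 + q) \<odot> (a \<otimes> (a \<otimes> (a \<otimes> b))) \<oplus> (- (1 + q)) \<odot> (a \<otimes> (b \<otimes> (b \<otimes> b)))"
    using a b c by (simp add: l_distr r_distr m_assoc ba ba' smult_add_right mult.assoc qq algebra_simps)
  have VU: "?V \<otimes> ?U = (- (1 + q)) \<odot> (a \<otimes> (a \<otimes> (a \<otimes> b))) \<oplus> (1 + q) \<odot> (a \<otimes> (b \<otimes> (b \<otimes> b)))"
    using a b c by (simp add: l_distr r_distr m_assoc ba ba' smult_add_right mult.assoc qq algebra_simps)
  have cancel: "(c \<odot> u \<oplus> (-c) \<odot> w) \<oplus> ((-c) \<odot> u \<oplus> c \<odot> w) = \<zero>" if "u \<in> carrier A" "w \<in> carrier A" for c u w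
  proof -
    have "(c \<odot> u \<oplus> (-c) \<odot> w) \<oplus> ((-c) \<odot> u \<oplus> c \<odot> w) = (c \<odot> u \<oplus> (-c) \<odot> u) \<oplus> ((-c) \<odot> w \<oplus> c \<odot> w)"
      using that by (simp add: a_ac)
    also have "\<dots> = (c + -c) \<odot> u \<oplus> (-c + c) \<odot> w" using that by (simp only: smult_add_left)
    finally show ?thesis using that by simp
  qed
  have UVVU: "?U \<otimes> ?V \<oplus> ?V \<otimes> ?U = \<zero>"
    unfolding UV VU by (rule cancel) (rule c)+
  have qqq: "(1 + q) * (1 + q) * q = -2"
    using qq by (simp add: algebra_simps) (simp add: qq mult.assoc[symmetric])
  have VV: "?V \<otimes> ?V = (-2) \<odot> (a \<otimes> (a \<otimes> (b \<otimes> b)))"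
    using a b c by (simp add: m_assoc ba ba' qqq flip: mult.assoc)
  have UU: "?U \<otimes> ?U = a [^] (4::nat) \<oplus> b [^] (4::nat) \<oplus> 2 \<odot> (a \<otimes> (a \<otimes> (b \<otimes> b)))"
  proof -
    have "?U \<otimes> ?U = a \<otimes> (a \<otimes> (a \<otimes> a)) \<oplus> b \<otimes> (b \<otimes> (b \<otimes> b)) \<oplus> (a \<otimes> (a \<otimes> (b \<otimes> b)) \<oplus> a \<otimes> (a \<otimes> (b \<otimes> b)))"
      using a b by (simp add: l_distr r_distr m_assoc ba ba' qq a_ac)
    then show ?thesis using a b c by (simp add: pow_4 m_assoc smult_collect)
  qed
  have "(a \<oplus> b) [^] (4::nat) = (?U \<oplus> ?V) \<otimes> (?U \<oplus> ?V)"
    using a b by (simp add: pow_4 1)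
  also have "\<dots> = ?U \<otimes> ?U \<oplus> (?U \<otimes> ?V \<oplus> ?V \<otimes> ?U) \<oplus> ?V \<otimes> ?V"
  proof -
    have "?U \<in> carrier A" "?V \<in> carrier A" using a b by auto
    then show ?thesis by (simp only: l_distr r_distr a_closed m_closed a_ac)
  qed
  also have "\<dots> = a [^] (4::nat) \<oplus> b [^] (4::nat) \<oplus> (2 \<odot> (a \<otimes> (a \<otimes> (b \<otimes> b))) \<oplus> (-2) \<odot> (a \<otimes> (a \<otimes> (b \<otimes> b))))"
    unfolding UVVU VV UU using a b c by (simp add: a_assoc)
  also have "\<dots> = a [^] (4::nat) \<oplus> b [^] (4::nat)"
    using a b c by (simp add: smult_collect)
  finally show ?thesis .
qed

locale idempotent_pair = tensor_powers A for A :: "('k::field, 'a, 'm) module_scheme" (structure) +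
  fixes e f x :: 'a
  assumes ec [simp]: "e \<in> carrier A" and fc [simp]: "f \<in> carrier A" and xc [simp]: "x \<in> carrier A"
    and ef_one: "e \<oplus> f = \<one>"
    and ee [simp]: "e \<otimes> e = e" and ff [simp]: "f \<otimes> f = f" and ef [simp]: "e \<otimes> f = \<zero>" and fe [simp]: "f \<otimes> e = \<zero>"
    and xe [simp]: "x \<otimes> e = f \<otimes> x" and xf [simp]: "x \<otimes> f = e \<otimes> x"
begin

lemma idem_left [simp]:
  assumes "u \<in> carrier A"
  shows "e \<otimes> (e \<otimes> u) = e \<otimes> u" "f \<otimes> (f \<otimes> u) = f \<otimes> u" "e \<otimes> (f \<otimes> u) = \<zero>" "f \<otimes> (e \<otimes> u) = \<zero>"
    "x \<otimes> (e \<otimes> u) = f \<otimes> (x \<otimes> u)" "x \<otimes> (f \<otimes> u) = e \<otimes> (x \<otimes> u)"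
  using assms by (simp_all add: m_assoc[symmetric])

lemma split_one:
  assumes "k_algebra B" and l: "linear_map A B F" "linear_map A B G" and eq: "F e = G e" "F f = G f"
  shows "F \<one> = G \<one>"
  using linear_mapD(2)[OF l(1), of e f] linear_mapD(2)[OF l(2), of e f] eq by (simp add: ef_one)

lemma T2_eq_idem:
  assumes u: "u \<in> carrier (T2 A)" and w: "w \<in> carrier (T2 A)"
    and eq: "\<And>a b. a \<in> {e, f} \<Longrightarrow> b \<in> {e, f} \<Longrightarrow> t2 A a b \<otimes>\<^bsub>T2 A\<^esub> u = t2 A a b \<otimes>\<^bsub>T2 A\<^esub> w"
  shows "u = w"
proof -
  have l: "linear_map A (T2 A) (\<lambda>b. t2 A a b \<otimes>\<^bsub>T2 A\<^esub> y)" "linear_map A (T2 A) (\<lambda>b. t2 A b a \<otimes>\<^bsub>T2 A\<^esub> y)"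
    if "a \<in> carrier A" "y \<in> carrier (T2 A)" for a y
    using that by (auto intro!: linear_map_mult_left[OF k_algebra_T2] t2_linear)
  have 1: "t2 A a \<one> \<otimes>\<^bsub>T2 A\<^esub> u = t2 A a \<one> \<otimes>\<^bsub>T2 A\<^esub> w" if "a \<in> {e, f}" for a
    by (rule split_one[OF k_algebra_T2 l(1) l(1)]) (use that u w eq in auto)
  have "t2 A \<one> \<one> \<otimes>\<^bsub>T2 A\<^esub> u = t2 A \<one> \<one> \<otimes>\<^bsub>T2 A\<^esub> w"
    by (rule split_one[OF k_algebra_T2 l(2) l(2)]) (use u w 1 in auto)
  then show ?thesis using u w by (simp flip: t2_one)
qed

text \<open>Tensors of \<open>e\<close> and \<open>f\<close> sum to \<open>1\<close>, so an element is determined by its products with them; on such a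
  product the reassociator is a sign.\<close>

lemma T3_eq_idem:
  assumes u: "u \<in> carrier (T3 A)" and w: "w \<in> carrier (T3 A)"
    and eq: "\<And>a b c. a \<in> {e, f} \<Longrightarrow> b \<in> {e, f} \<Longrightarrow> c \<in> {e, f} \<Longrightarrow> t3 A a b c \<otimes>\<^bsub>T3 A\<^esub> u = t3 A a b c \<otimes>\<^bsub>T3 A\<^esub> w"
  shows "u = w"
proof -
  have l: "linear_map A (T3 A) (\<lambda>c. t3 A a b c \<otimes>\<^bsub>T3 A\<^esub> y)" "linear_map A (T3 A) (\<lambda>c. t3 A a c b \<otimes>\<^bsub>T3 A\<^esub> y)"
     "linear_map A (T3 A) (\<lambda>c. t3 A c a b \<otimes>\<^bsub>T3 A\<^esub> y)"
    if "a \<in> carrier A" "b \<in> carrier A" "y \<in> carrier (T3 A)" for a b y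
    using that by (auto intro!: linear_map_mult_left[OF k_algebra_T3] t3_linear)
  have 1: "t3 A a b \<one> \<otimes>\<^bsub>T3 A\<^esub> u = t3 A a b \<one> \<otimes>\<^bsub>T3 A\<^esub> w" if "a \<in> {e, f}" "b \<in> {e, f}" for a b
    by (rule split_one[OF k_algebra_T3 l(1) l(1)]) (use that u w eq in auto)
  have 2: "t3 A a \<one> \<one> \<otimes>\<^bsub>T3 A\<^esub> u = t3 A a \<one> \<one> \<otimes>\<^bsub>T3 A\<^esub> w" if "a \<in> {e, f}" for a
    by (rule split_one[OF k_algebra_T3 l(2) l(2)]) (use that u w 1 in auto)
  have "t3 A \<one> \<one> \<one> \<otimes>\<^bsub>T3 A\<^esub> u = t3 A \<one> \<one> \<one> \<otimes>\<^bsub>T3 A\<^esub> w"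
    by (rule split_one[OF k_algebra_T3 l(3) l(3)]) (use u w 2 in auto)
  then show ?thesis using u w by (simp flip: t3_one)
qed

lemma T4_eq_idem:
  assumes u: "u \<in> carrier (T4 A)" and w: "w \<in> carrier (T4 A)"
    and eq: "\<And>a b c d. a \<in> {e, f} \<Longrightarrow> b \<in> {e, f} \<Longrightarrow> c \<in> {e, f} \<Longrightarrow> d \<in> {e, f} \<Longrightarrow>
      t4 A a b c d \<otimes>\<^bsub>T4 A\<^esub> u = t4 A a b c d \<otimes>\<^bsub>T4 A\<^esub> w"
  shows "u = w"
proof -
  have l: "linear_map A (T4 A) (\<lambda>d. t4 A a b c d \<otimes>\<^bsub>T4 A\<^esub> y)" "linear_map A (T4 A) (\<lambda>d. t4 A a b d c \<otimes>\<^bsub>T4 A\<^esub> y)"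
     "linear_map A (T4 A) (\<lambda>d. t4 A a d b c \<otimes>\<^bsub>T4 A\<^esub> y)" "linear_map A (T4 A) (\<lambda>d. t4 A d a b c \<otimes>\<^bsub>T4 A\<^esub> y)"
    if "a \<in> carrier A" "b \<in> carrier A" "c \<in> carrier A" "y \<in> carrier (T4 A)" for a b c y
    using that by (auto intro!: linear_map_mult_left[OF k_algebra_T4] t4_linear)
  have 1: "t4 A a b c \<one> \<otimes>\<^bsub>T4 A\<^esub> u = t4 A a b c \<one> \<otimes>\<^bsub>T4 A\<^esub> w" if "a \<in> {e, f}" "b \<in> {e, f}" "c \<in> {e, f}" for a b c
    by (rule split_one[OF k_algebra_T4 l(1) l(1)]) (use that u w eq in auto)
  have 2: "t4 A a b \<one> \<one> \<otimes>\<^bsub>T4 A\<^esub> u = t4 A a b \<one> \<one> \<otimes>\<^bsub>T4 A\<^esub> w" if "a \<in> {e, f}" "b \<in> {e, f}" for a b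
    by (rule split_one[OF k_algebra_T4 l(2) l(2)]) (use that u w 1 in auto)
  have 3: "t4 A a \<one> \<one> \<one> \<otimes>\<^bsub>T4 A\<^esub> u = t4 A a \<one> \<one> \<one> \<otimes>\<^bsub>T4 A\<^esub> w" if "a \<in> {e, f}" for a
    by (rule split_one[OF k_algebra_T4 l(3) l(3)]) (use that u w 2 in auto)
  have "t4 A \<one> \<one> \<one> \<one> \<otimes>\<^bsub>T4 A\<^esub> u = t4 A \<one> \<one> \<one> \<one> \<otimes>\<^bsub>T4 A\<^esub> w"
    by (rule split_one[OF k_algebra_T4 l(4) l(4)]) (use u w 3 in auto)
  then show ?thesis using u w by (simp flip: t4_one)
qed

definition dx :: "'k \<Rightarrow> ('k, 'a) tensor2" where
  "dx q = t2 A x (e \<oplus> q \<odot> f) \<oplus>\<^bsub>T2 A\<^esub> t2 A \<one> (e \<otimes> x) \<oplus>\<^bsub>T2 A\<^esub> t2 A (e \<ominus> f) (f \<otimes> x)"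

lemma dx_closed [simp]: "dx q \<in> carrier (T2 A)"
  by (simp add: dx_def)

lemma e_minus_f: "e \<ominus> f = e \<oplus> (-1) \<odot> f"
  by (simp add: diff_smult)

lemma dx_parts:
  assumes qq: "q * q = - 1"
  defines "a \<equiv> t2 A x (e \<oplus> q \<odot> f)" and "b \<equiv> t2 A \<one> (e \<otimes> x) \<oplus>\<^bsub>T2 A\<^esub> t2 A (e \<ominus> f) (f \<otimes> x)"
  shows "b \<otimes>\<^bsub>T2 A\<^esub> a = q \<odot>\<^bsub>T2 A\<^esub> (a \<otimes>\<^bsub>T2 A\<^esub> b)"
    and "b \<otimes>\<^bsub>T2 A\<^esub> b = t2 A (e \<ominus> f) (x \<otimes> x)"
    and "t2 A (e \<ominus> f) (e \<ominus> f) \<otimes>\<^bsub>T2 A\<^esub> (a \<oplus>\<^bsub>T2 A\<^esub> b) \<oplus>\<^bsub>T2 A\<^esub> (a \<oplus>\<^bsub>T2 A\<^esub> b) \<otimes>\<^bsub>T2 A\<^esub> t2 A (e \<ominus> f) (e \<ominus> f) = \<zero>\<^bsub>T2 A\<^esub>"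
proof -
  note s = a_def b_def e_minus_f t2_distrib m_assoc l_distr r_distr T2.l_distr T2.r_distr qq
    T2.smult_add_right smult_add_right T2.smult_collect smult_collect
  show "b \<otimes>\<^bsub>T2 A\<^esub> a = q \<odot>\<^bsub>T2 A\<^esub> (a \<otimes>\<^bsub>T2 A\<^esub> b)"
    by (rule T2_eq_idem; (elim insertE emptyE)?) (simp_all add: s)
  show "b \<otimes>\<^bsub>T2 A\<^esub> b = t2 A (e \<ominus> f) (x \<otimes> x)"
    by (rule T2_eq_idem; (elim insertE emptyE)?) (simp_all add: s)
  let ?g = "t2 A (e \<ominus> f) (e \<ominus> f)"
  have c: "a \<in> carrier (T2 A)" "b \<in> carrier (T2 A)" "?g \<in> carrier (T2 A)"
    by (simp_all add: a_def b_def)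
  have 1: "?g \<otimes>\<^bsub>T2 A\<^esub> a \<oplus>\<^bsub>T2 A\<^esub> a \<otimes>\<^bsub>T2 A\<^esub> ?g = \<zero>\<^bsub>T2 A\<^esub>"
    by (rule T2_eq_idem; (elim insertE emptyE)?) (simp_all add: s)
  have 2: "?g \<otimes>\<^bsub>T2 A\<^esub> b \<oplus>\<^bsub>T2 A\<^esub> b \<otimes>\<^bsub>T2 A\<^esub> ?g = \<zero>\<^bsub>T2 A\<^esub>"
    by (rule T2_eq_idem; (elim insertE emptyE)?) (simp_all add: s)
  have "?g \<otimes>\<^bsub>T2 A\<^esub> (a \<oplus>\<^bsub>T2 A\<^esub> b) \<oplus>\<^bsub>T2 A\<^esub> (a \<oplus>\<^bsub>T2 A\<^esub> b) \<otimes>\<^bsub>T2 A\<^esub> ?g =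
     (?g \<otimes>\<^bsub>T2 A\<^esub> a \<oplus>\<^bsub>T2 A\<^esub> a \<otimes>\<^bsub>T2 A\<^esub> ?g) \<oplus>\<^bsub>T2 A\<^esub> (?g \<otimes>\<^bsub>T2 A\<^esub> b \<oplus>\<^bsub>T2 A\<^esub> b \<otimes>\<^bsub>T2 A\<^esub> ?g)"
    using c by (simp only: T2.l_distr T2.r_distr T2.a_closed T2.m_closed T2.a_ac)
  then show "?g \<otimes>\<^bsub>T2 A\<^esub> (a \<oplus>\<^bsub>T2 A\<^esub> b) \<oplus>\<^bsub>T2 A\<^esub> (a \<oplus>\<^bsub>T2 A\<^esub> b) \<otimes>\<^bsub>T2 A\<^esub> ?g = \<zero>\<^bsub>T2 A\<^esub>"
    by (simp add: 1 2)
qed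

text \<open>The two parts of \<open>\<Delta>(x)\<close> are \<open>q\<close>-commuting, hence the fourth power is the sum of the fourth powers.\<close>

lemma dx_power:
  assumes qq: "q * q = - 1" and x4: "x [^] (4::nat) = \<zero>"
  shows "dx q [^]\<^bsub>T2 A\<^esub> (4::nat) = \<zero>\<^bsub>T2 A\<^esub>"
    and "t2 A (e \<ominus> f) (e \<ominus> f) \<otimes>\<^bsub>T2 A\<^esub> dx q \<oplus>\<^bsub>T2 A\<^esub> dx q \<otimes>\<^bsub>T2 A\<^esub> t2 A (e \<ominus> f) (e \<ominus> f) = \<zero>\<^bsub>T2 A\<^esub>"
proof -
  let ?w = "e \<oplus> q \<odot> f"
  let ?a = "t2 A x ?w" and ?b = "t2 A \<one> (e \<otimes> x) \<oplus>\<^bsub>T2 A\<^esub> t2 A (e \<ominus> f) (f \<otimes> x)"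
  have d: "dx q = ?a \<oplus>\<^bsub>T2 A\<^esub> ?b" by (simp add: dx_def T2.a_assoc)
  have x4': "(x \<otimes> x) \<otimes> (x \<otimes> x) = \<zero>" using x4 by (simp add: pow_4)
  have "?a [^]\<^bsub>T2 A\<^esub> (4::nat) = t2 A ((x \<otimes> x) \<otimes> (x \<otimes> x)) ((?w \<otimes> ?w) \<otimes> (?w \<otimes> ?w))"
    by (simp add: T2.pow_4 del: idem_left)
  then have a4: "?a [^]\<^bsub>T2 A\<^esub> (4::nat) = \<zero>\<^bsub>T2 A\<^esub>" unfolding x4' by simp
  have "?b [^]\<^bsub>T2 A\<^esub> (4::nat) = t2 A (e \<ominus> f) (x \<otimes> x) \<otimes>\<^bsub>T2 A\<^esub> t2 A (e \<ominus> f) (x \<otimes> x)"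
    by (subst T2.pow_4) (simp_all only: dx_parts(2)[OF qq], simp)
  also have "\<dots> = t2 A ((e \<ominus> f) \<otimes> (e \<ominus> f)) ((x \<otimes> x) \<otimes> (x \<otimes> x))" by simp
  finally have b4: "?b [^]\<^bsub>T2 A\<^esub> (4::nat) = \<zero>\<^bsub>T2 A\<^esub>" unfolding x4' by simp
  have "?a \<in> carrier (T2 A)" "?b \<in> carrier (T2 A)" by simp_all
  from T2.q_commuting_fourth_power[OF this dx_parts(1)[OF qq] qq]
  show "dx q [^]\<^bsub>T2 A\<^esub> (4::nat) = \<zero>\<^bsub>T2 A\<^esub>" unfolding d a4 b4 by simp
  show "t2 A (e \<ominus> f) (e \<ominus> f) \<otimes>\<^bsub>T2 A\<^esub> dx q \<oplus>\<^bsub>T2 A\<^esub> dx q \<otimes>\<^bsub>T2 A\<^esub> t2 A (e \<ominus> f) (e \<ominus> f) = \<zero>\<^bsub>T2 A\<^esub>"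
    unfolding d by (rule dx_parts(3)[OF qq])
qed

lemma antipode_power:
  assumes qq: "q * q = - 1" and x4: "x [^] (4::nat) = \<zero>"
  shows "(\<ominus> (x \<otimes> (e \<oplus> q \<odot> f))) [^] (4::nat) = \<zero>"
    and "(\<ominus> (x \<otimes> (e \<oplus> q \<odot> f))) \<otimes> (e \<ominus> f) \<oplus> (e \<ominus> f) \<otimes> (\<ominus> (x \<otimes> (e \<oplus> q \<odot> f))) = \<zero>"
proof -
  let ?y = "x \<otimes> (e \<oplus> q \<odot> f)"
  have y: "?y = f \<otimes> x \<oplus> q \<odot> (e \<otimes> x)" by (simp add: r_distr)
  have s: "u = u'" if "u \<in> carrier A" "u' \<in> carrier A" "e \<otimes> u = e \<otimes> u'" "f \<otimes> u = f \<otimes> u'" for u u'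
    using that ef_one by (metis ec fc l_distr l_one)
  have yy: "?y \<otimes> ?y = q \<odot> (x \<otimes> x)"
    unfolding y by (rule s) (simp_all add: l_distr r_distr m_assoc smult_add_right)
  have "(\<ominus> ?y) [^] (4::nat) = (q * q) \<odot> ((x \<otimes> x) \<otimes> (x \<otimes> x))"
    by (subst pow_4) (simp_all add: l_minus r_minus yy)
  then show "(\<ominus> ?y) [^] (4::nat) = \<zero>" using x4 by (simp add: pow_4)
  show "\<ominus> ?y \<otimes> (e \<ominus> f) \<oplus> (e \<ominus> f) \<otimes> (\<ominus> ?y) = \<zero>"
    unfolding y e_minus_f minus_smult[OF m_closed[OF xc a_closed[OF ec smult_closed[OF fc]]]]
    by (rule s) (simp_all add: y minus_smult l_distr r_distr m_assoc smult_add_right smult_collect)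
qed

end

section \<open>Quasi-Hopf algebras on generators\<close>

locale qh_core = pre_qh H + idempotent_pair H e f x
  for H :: "('k::field, 'a) quasi_hopf" and e f x :: 'a +
  fixes q :: 'k
  assumes qq: "q * q = - 1"
    and comult_f: "comult H f = t2 H e f \<oplus>\<^bsub>T2 H\<^esub> t2 H f e" and comult_x: "comult H x = dx q"
    and counit_f: "counit H f = 0" and counit_x: "counit H x = 0"
    and antipode_f: "antipode H f = f" and antipode_x: "antipode H x = \<ominus>\<^bsub>H\<^esub> (x \<otimes>\<^bsub>H\<^esub> (e \<oplus>\<^bsub>H\<^esub> q \<odot>\<^bsub>H\<^esub> f))"
    and reassoc: "reassoc H = \<one>\<^bsub>T3 H\<^esub> \<ominus>\<^bsub>T3 H\<^esub> 2 \<odot>\<^bsub>T3 H\<^esub> t3 H f f f"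
    and alpha: "alpha H = e \<ominus>\<^bsub>H\<^esub> f" and beta: "beta H = \<one>\<^bsub>H\<^esub>"
begin

lemma e_complement: "e = \<one>\<^bsub>H\<^esub> \<oplus>\<^bsub>H\<^esub> (-1) \<odot>\<^bsub>H\<^esub> f"
  using ef_one by (metis a_assoc diff_smult ec fc one_closed a_minus_def r_neg r_zero a_inv_closed)

lemma comult_e: "comult H e = t2 H e e \<oplus>\<^bsub>T2 H\<^esub> t2 H f f"
proof -
  have l: "comult H e = t2 H \<one>\<^bsub>H\<^esub> \<one>\<^bsub>H\<^esub> \<oplus>\<^bsub>T2 H\<^esub> (-1) \<odot>\<^bsub>T2 H\<^esub> (t2 H e f \<oplus>\<^bsub>T2 H\<^esub> t2 H f e)"
    by (subst e_complement) (simp add: comult_simps comult_f t2_one)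
  show ?thesis unfolding l
    by (rule T2_eq_idem; (elim insertE emptyE)?)
      (simp_all add: T2.r_distr T2.smult_add_right T2.smult_collect)
qed

lemma counit_e: "counit H e = 1"
  by (subst e_complement) (simp add: counit_simps counit_f)

lemma antipode_e: "antipode H e = e"
  by (subst (1 2) e_complement) (simp add: antipode_simps antipode_f)

lemma reassoc': "reassoc H = t3 H \<one>\<^bsub>H\<^esub> \<one>\<^bsub>H\<^esub> \<one>\<^bsub>H\<^esub> \<oplus>\<^bsub>T3 H\<^esub> (-2) \<odot>\<^bsub>T3 H\<^esub> t3 H f f f"
  by (simp add: reassoc T3.diff_smult t3_one)

lemma reassoc_closed: "reassoc H \<in> carrier (T3 H)"
  by (simp add: reassoc')

lemma reassoc_square: "reassoc H \<otimes>\<^bsub>T3 H\<^esub> reassoc H = \<one>\<^bsub>T3 H\<^esub>"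
  unfolding reassoc'
  by (rule T3_eq_idem; (elim insertE emptyE)?)
    (simp_all add: t3_one T3.r_distr T3.smult_add_right T3.smult_collect T3.l_distr)

lemma reassoc_inv: "reassoc_inv H = reassoc H"
  unfolding reassoc_inv_def
  using T3.inv_char[OF reassoc_closed reassoc_closed reassoc_square reassoc_square] .

lemma lift3_reassoc:
  assumes C: "k_algebra C" and t: "trilinear H H H C F"
  shows "lift3 C (reassoc H) F = F \<one>\<^bsub>H\<^esub> \<one>\<^bsub>H\<^esub> \<one>\<^bsub>H\<^esub> \<oplus>\<^bsub>C\<^esub> (-2) \<odot>\<^bsub>C\<^esub> F f f f"
  using linear_mapD[OF lift3_T3_linear[OF C t]]
  by (simp add: reassoc' lift3_t3[OF C t])

end

context qh_core
begin

definition group_elem :: "'a \<Rightarrow> bool" where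
  "group_elem u \<longleftrightarrow> u \<in> carrier H \<and> u \<otimes>\<^bsub>H\<^esub> u = \<one>\<^bsub>H\<^esub> \<and>
     u \<otimes>\<^bsub>H\<^esub> e = e \<otimes>\<^bsub>H\<^esub> u \<and> u \<otimes>\<^bsub>H\<^esub> f = f \<otimes>\<^bsub>H\<^esub> u \<and> x \<otimes>\<^bsub>H\<^esub> u = u \<otimes>\<^bsub>H\<^esub> x \<and>
     comult H u = t2 H u u \<and> counit H u = 1 \<and> antipode H u = u"

definition skew_elem :: "'a \<Rightarrow> 'a \<Rightarrow> bool" where
  "skew_elem u \<theta> \<longleftrightarrow> \<theta> \<in> carrier H \<and> \<theta> \<otimes>\<^bsub>H\<^esub> \<theta> = \<zero>\<^bsub>H\<^esub> \<and>
     \<theta> \<otimes>\<^bsub>H\<^esub> e = e \<otimes>\<^bsub>H\<^esub> \<theta> \<and> \<theta> \<otimes>\<^bsub>H\<^esub> f = f \<otimes>\<^bsub>H\<^esub> \<theta> \<and> \<theta> \<otimes>\<^bsub>H\<^esub> x = x \<otimes>\<^bsub>H\<^esub> \<theta> \<and>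
     \<theta> \<otimes>\<^bsub>H\<^esub> u = (-1) \<odot>\<^bsub>H\<^esub> (u \<otimes>\<^bsub>H\<^esub> \<theta>) \<and>
     comult H \<theta> = t2 H u \<theta> \<oplus>\<^bsub>T2 H\<^esub> t2 H \<theta> \<one>\<^bsub>H\<^esub> \<and> counit H \<theta> = 0 \<and>
     antipode H \<theta> = \<ominus>\<^bsub>H\<^esub> (u \<otimes>\<^bsub>H\<^esub> \<theta>)"

definition co_right where
  "co_right t = lift2 (T3 H) t (\<lambda>a b. tens H (T2 H) a (comult H b))"

definition co_left where
  "co_left t = lift2 (T3 H) t (\<lambda>a b. lift2 (T3 H) (comult H a) (\<lambda>a1 a2. t3 H a1 a2 b))"

definition conv_left where
  "conv_left m t = lift2 H t (\<lambda>a b. antipode H a \<otimes>\<^bsub>H\<^esub> m \<otimes>\<^bsub>H\<^esub> b)"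

definition conv_right where
  "conv_right m t = lift2 H t (\<lambda>a b. a \<otimes>\<^bsub>H\<^esub> m \<otimes>\<^bsub>H\<^esub> antipode H b)"

lemma co_right_hom: "co_right \<in> alg_hom (T2 H) (T3 H)"
  and co_right_t2: "a \<in> carrier H \<Longrightarrow> b \<in> carrier H \<Longrightarrow> co_right (t2 H a b) = tens H (T2 H) a (comult H b)"
proof -
  note h = alg_hom_tensor_map[OF k_alg k_alg k_alg k_algebra_T2 alg_hom_id comult_hom, folded T2_def T3_def]
  show "co_right \<in> alg_hom (T2 H) (T3 H)"
    unfolding co_right_def[abs_def] by (rule h(2))
  show "a \<in> carrier H \<Longrightarrow> b \<in> carrier H \<Longrightarrow> co_right (t2 H a b) = tens H (T2 H) a (comult H b)"
    unfolding co_right_def by (rule P2.lift2_tens[OF k_algebra_T3 h(1)])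
qed

lemma t3_bilinear: "c \<in> carrier H \<Longrightarrow> bilinear H H (T3 H) (\<lambda>a b. t3 H a b c)"
  by (rule bilinearI) (rule t3_linear; assumption)+

lemma front_hom: "(\<lambda>t. lift2 (T3 H) t (\<lambda>a b. t3 H a b \<one>\<^bsub>H\<^esub>)) \<in> alg_hom (T2 H) (T3 H)"
  by (rule P2.lift2_alg_hom[OF k_algebra_T3 t3_bilinear]) (simp_all add: t3_one)

lemma back_hom: "(\<lambda>b. t3 H \<one>\<^bsub>H\<^esub> \<one>\<^bsub>H\<^esub> b) \<in> alg_hom H (T3 H)"
  by (rule alg_homI[OF t3_linear(1)]) (simp_all add: t3_one)

lemma front_t2: "a \<in> carrier H \<Longrightarrow> b \<in> carrier H \<Longrightarrow> c \<in> carrier H \<Longrightarrow>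
    lift2 (T3 H) (t2 H a b) (\<lambda>a b. t3 H a b c) = t3 H a b c"
  by (rule P2.lift2_tens[OF k_algebra_T3 t3_bilinear])

lemma front_back:
  assumes t: "t \<in> carrier (T2 H)" and c: "c \<in> carrier H"
  shows "lift2 (T3 H) t (\<lambda>a b. t3 H a b c) = lift2 (T3 H) t (\<lambda>a b. t3 H a b \<one>\<^bsub>H\<^esub>) \<otimes>\<^bsub>T3 H\<^esub> t3 H \<one>\<^bsub>H\<^esub> \<one>\<^bsub>H\<^esub> c"
    and "t3 H \<one>\<^bsub>H\<^esub> \<one>\<^bsub>H\<^esub> c \<otimes>\<^bsub>T3 H\<^esub> lift2 (T3 H) t (\<lambda>a b. t3 H a b \<one>\<^bsub>H\<^esub>) = lift2 (T3 H) t (\<lambda>a b. t3 H a b \<one>\<^bsub>H\<^esub>) \<otimes>\<^bsub>T3 H\<^esub> t3 H \<one>\<^bsub>H\<^esub> \<one>\<^bsub>H\<^esub> c"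
proof -
  have c3: "t3 H \<one>\<^bsub>H\<^esub> \<one>\<^bsub>H\<^esub> c \<in> carrier (T3 H)" using c by simp
  have l: "linear_map (T2 H) (T3 H) (\<lambda>t. lift2 (T3 H) t (\<lambda>a b. t3 H a b c))" if "c \<in> carrier H" for c
    by (rule P2.lift2_linear[OF k_algebra_T3 t3_bilinear[OF that]])
  show "lift2 (T3 H) t (\<lambda>a b. t3 H a b c) = lift2 (T3 H) t (\<lambda>a b. t3 H a b \<one>\<^bsub>H\<^esub>) \<otimes>\<^bsub>T3 H\<^esub> t3 H \<one>\<^bsub>H\<^esub> \<one>\<^bsub>H\<^esub> c"
    by (rule T2_eqI[OF l[OF c] linear_map_mult_left[OF k_algebra_T3 l[OF one_closed] c3] _ t])
      (simp add: front_t2 c)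
  show "t3 H \<one>\<^bsub>H\<^esub> \<one>\<^bsub>H\<^esub> c \<otimes>\<^bsub>T3 H\<^esub> lift2 (T3 H) t (\<lambda>a b. t3 H a b \<one>\<^bsub>H\<^esub>) = lift2 (T3 H) t (\<lambda>a b. t3 H a b \<one>\<^bsub>H\<^esub>) \<otimes>\<^bsub>T3 H\<^esub> t3 H \<one>\<^bsub>H\<^esub> \<one>\<^bsub>H\<^esub> c"
    by (rule T2_eqI[OF linear_map_mult_right[OF k_algebra_T3 l[OF one_closed] c3] linear_map_mult_left[OF k_algebra_T3 l[OF one_closed] c3] _ t])
      (simp add: front_t2 c)
qed

lemma co_left_hom: "co_left \<in> alg_hom (T2 H) (T3 H)"
  and co_left_t2: "a \<in> carrier H \<Longrightarrow> b \<in> carrier H \<Longrightarrow>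
    co_left (t2 H a b) = lift2 (T3 H) (comult H a) (\<lambda>a1 a2. t3 H a1 a2 b)"
proof -
  let ?F = "\<lambda>a b. lift2 (T3 H) (comult H a) (\<lambda>a b. t3 H a b \<one>\<^bsub>H\<^esub>) \<otimes>\<^bsub>T3 H\<^esub> t3 H \<one>\<^bsub>H\<^esub> \<one>\<^bsub>H\<^esub> b"
  let ?G = "\<lambda>a b. lift2 (T3 H) (comult H a) (\<lambda>a1 a2. t3 H a1 a2 b)"
  have F: "bilinear H H (T3 H) ?F" "(\<lambda>t. lift2 (T3 H) t ?F) \<in> alg_hom (T2 H) (T3 H)"
    using alg_hom_tensorI[OF k_alg k_alg k_algebra_T3 alg_hom_comp[OF comult_hom front_hom] back_hom
        front_back(2)[OF comult_simps(1)], folded T2_def] by blast+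
  have GF: "?F a b = ?G a b" if "a \<in> carrier H" "b \<in> carrier H" for a b
    by (rule front_back(1)[OF comult_simps(1), symmetric]) (rule that)+
  have G: "bilinear H H (T3 H) ?G"
    by (rule bilinear_cong[OF F(1) GF k_alg k_alg])
  note t = P2.lift2_tens[OF k_algebra_T3 G] P2.lift2_tens[OF k_algebra_T3 F(1)]
  have eq: "lift2 (T3 H) t ?F = co_left t" if "t \<in> carrier (T2 H)" for t
    unfolding co_left_def
  proof (rule T2_eqI[OF P2.lift2_linear[OF k_algebra_T3 F(1)] P2.lift2_linear[OF k_algebra_T3 G] _ that])
    fix a b assume ab: "a \<in> carrier H" "b \<in> carrier H"
    show "lift2 (T3 H) (t2 H a b) ?F = lift2 (T3 H) (t2 H a b) ?G"
      unfolding t(1)[OF ab] t(2)[OF ab] by (rule GF[OF ab])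
  qed
  show "co_left \<in> alg_hom (T2 H) (T3 H)"
    by (rule alg_hom_cong[OF F(2) eq k_algebra_T2])
  show "a \<in> carrier H \<Longrightarrow> b \<in> carrier H \<Longrightarrow> co_left (t2 H a b) = ?G a b"
    unfolding co_left_def by (rule t(1))
qed

lemma tens_t2: "tens H (T2 H) a (t2 H b c) = t3 H a b c"
  by (simp add: t3_def)

lemmas tens_expand = P3.tens_add_right P3.tens_smult_right tens_t2

lemmas front_expand = linear_mapD(2)[OF P2.lift2_linear[OF k_algebra_T3 t3_bilinear]]
  linear_mapD(3)[OF P2.lift2_linear[OF k_algebra_T3 t3_bilinear]] front_t2

lemma antipode_linear: "linear_map H H (antipode H)"
  using alg_hom_linear[OF antipode_hom] by simp

lemma conv_bilinear:
  assumes "m \<in> carrier H"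
  shows "bilinear H H H (\<lambda>a b. antipode H a \<otimes>\<^bsub>H\<^esub> m \<otimes>\<^bsub>H\<^esub> b)" "bilinear H H H (\<lambda>a b. a \<otimes>\<^bsub>H\<^esub> m \<otimes>\<^bsub>H\<^esub> antipode H b)"
  by (rule bilinearI; rule linear_map_mult_left linear_map_mult_right linear_map_id antipode_linear k_alg;
      (rule linear_map_mult_left linear_map_mult_right linear_map_id antipode_linear k_alg)?; simp add: assms antipode_simps antipode_linear k_alg linear_map_id linear_map_mult_left)+

lemma conv_t2:
  assumes "m \<in> carrier H" "a \<in> carrier H" "b \<in> carrier H"
  shows "conv_left m (t2 H a b) = antipode H a \<otimes>\<^bsub>H\<^esub> m \<otimes>\<^bsub>H\<^esub> b"
    "conv_right m (t2 H a b) = a \<otimes>\<^bsub>H\<^esub> m \<otimes>\<^bsub>H\<^esub> antipode H b"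
  unfolding conv_left_def conv_right_def
  by (rule P2.lift2_tens[OF k_alg conv_bilinear(1)[OF assms(1)] assms(2,3)],
      rule P2.lift2_tens[OF k_alg conv_bilinear(2)[OF assms(1)] assms(2,3)])

lemma conv_linear:
  assumes "m \<in> carrier H"
  shows "linear_map (T2 H) H (conv_left m)" "linear_map (T2 H) H (conv_right m)"
  unfolding conv_left_def[abs_def] conv_right_def[abs_def]
  by (rule P2.lift2_linear[OF k_alg conv_bilinear(1)[OF assms]], rule P2.lift2_linear[OF k_alg conv_bilinear(2)[OF assms]])

lemma conv_smult:
  assumes m: "m \<in> carrier H" and t: "t \<in> carrier (T2 H)"
  shows "conv_left (c \<odot>\<^bsub>H\<^esub> m) t = c \<odot>\<^bsub>H\<^esub> conv_left m t" "conv_right (c \<odot>\<^bsub>H\<^esub> m) t = c \<odot>\<^bsub>H\<^esub> conv_right m t"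
proof -
  have cm: "c \<odot>\<^bsub>H\<^esub> m \<in> carrier H" using m by simp
  show "conv_left (c \<odot>\<^bsub>H\<^esub> m) t = c \<odot>\<^bsub>H\<^esub> conv_left m t"
    by (rule T2_eqI[OF conv_linear(1)[OF cm] linear_map_smult[OF k_alg conv_linear(1)[OF m]] _ t])
      (simp add: conv_t2 m antipode_simps)
  show "conv_right (c \<odot>\<^bsub>H\<^esub> m) t = c \<odot>\<^bsub>H\<^esub> conv_right m t"
    by (rule T2_eqI[OF conv_linear(2)[OF cm] linear_map_smult[OF k_alg conv_linear(2)[OF m]] _ t])
      (simp add: conv_t2 m antipode_simps)
qed

lemma conv_mult:
  assumes m: "m \<in> carrier H" and t: "t \<in> carrier (T2 H)" and s: "s \<in> carrier (T2 H)"
  shows "conv_left m (t \<otimes>\<^bsub>T2 H\<^esub> s) = lift2 H s (\<lambda>c d. antipode H c \<otimes>\<^bsub>H\<^esub> conv_left m t \<otimes>\<^bsub>H\<^esub> d)"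
    and "conv_right m (t \<otimes>\<^bsub>T2 H\<^esub> s) = lift2 H t (\<lambda>c d. c \<otimes>\<^bsub>H\<^esub> conv_right m s \<otimes>\<^bsub>H\<^esub> antipode H d)"
proof -
  note L = linear_mapD[OF conv_linear(1)] and R = linear_mapD[OF conv_linear(2)]
  have tc: "conv_left m t \<in> carrier H" "conv_right m s \<in> carrier H" using m t s L R by simp_all
  have l1: "linear_map (T2 H) H (\<lambda>t. conv_left m (t \<otimes>\<^bsub>T2 H\<^esub> s))" "linear_map (T2 H) H (\<lambda>t. conv_right m (s \<otimes>\<^bsub>T2 H\<^esub> t))"
    "linear_map (T2 H) H (\<lambda>t. conv_left m (s \<otimes>\<^bsub>T2 H\<^esub> t))" "linear_map (T2 H) H (\<lambda>t. conv_right m (t \<otimes>\<^bsub>T2 H\<^esub> s))"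
    if "s \<in> carrier (T2 H)" for s
    by (rule linear_map_comp[OF _ conv_linear(1)[OF m]] linear_map_comp[OF _ conv_linear(2)[OF m]],
        rule linear_map_mult_left[OF k_algebra_T2 linear_map_id that] linear_map_mult_right[OF k_algebra_T2 linear_map_id that])+
  have "conv_left m (t \<otimes>\<^bsub>T2 H\<^esub> s) = conv_left (conv_left m t) s"
  proof (rule T2_eqI[OF l1(3)[OF t] conv_linear(1)[OF tc(1)] _ s])
    fix c d assume cd: "c \<in> carrier H" "d \<in> carrier H"
    have cd2: "t2 H c d \<in> carrier (T2 H)" using cd by simp
    have l2: "linear_map (T2 H) H (\<lambda>t. antipode H c \<otimes>\<^bsub>H\<^esub> conv_left m t \<otimes>\<^bsub>H\<^esub> d)"
      by (rule linear_map_mult_left[OF k_alg linear_map_mult_right[OF k_alg conv_linear(1)[OF m]]]) (simp_all add: cd antipode_simps)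
    have "conv_left m (t \<otimes>\<^bsub>T2 H\<^esub> t2 H c d) = antipode H c \<otimes>\<^bsub>H\<^esub> conv_left m t \<otimes>\<^bsub>H\<^esub> d"
      by (rule T2_eqI[OF l1(1)[OF cd2] l2 _ t]) (simp add: conv_t2 m cd antipode_simps m_assoc)
    then show "conv_left m (t \<otimes>\<^bsub>T2 H\<^esub> t2 H c d) = conv_left (conv_left m t) (t2 H c d)"
      using cd tc by (simp add: conv_t2)
  qed
  then show "conv_left m (t \<otimes>\<^bsub>T2 H\<^esub> s) = lift2 H s (\<lambda>c d. antipode H c \<otimes>\<^bsub>H\<^esub> conv_left m t \<otimes>\<^bsub>H\<^esub> d)"
    by (simp only: conv_left_def)
  have "conv_right m (t \<otimes>\<^bsub>T2 H\<^esub> s) = conv_right (conv_right m s) t"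
  proof (rule T2_eqI[OF l1(4)[OF s] conv_linear(2)[OF tc(2)] _ t])
    fix c d assume cd: "c \<in> carrier H" "d \<in> carrier H"
    have cd2: "t2 H c d \<in> carrier (T2 H)" using cd by simp
    have l2: "linear_map (T2 H) H (\<lambda>s. c \<otimes>\<^bsub>H\<^esub> conv_right m s \<otimes>\<^bsub>H\<^esub> antipode H d)"
      by (rule linear_map_mult_left[OF k_alg linear_map_mult_right[OF k_alg conv_linear(2)[OF m]]]) (simp_all add: cd antipode_simps)
    have "conv_right m (t2 H c d \<otimes>\<^bsub>T2 H\<^esub> s) = c \<otimes>\<^bsub>H\<^esub> conv_right m s \<otimes>\<^bsub>H\<^esub> antipode H d"
      by (rule T2_eqI[OF l1(2)[OF cd2] l2 _ s]) (simp add: conv_t2 m cd antipode_simps m_assoc)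
    then show "conv_right m (t2 H c d \<otimes>\<^bsub>T2 H\<^esub> s) = conv_right (conv_right m s) (t2 H c d)"
      using cd tc by (simp add: conv_t2)
  qed
  then show "conv_right m (t \<otimes>\<^bsub>T2 H\<^esub> s) = lift2 H t (\<lambda>c d. c \<otimes>\<^bsub>H\<^esub> conv_right m s \<otimes>\<^bsub>H\<^esub> antipode H d)"
    by (simp only: conv_right_def)
qed

lemma alpha_closed: "alpha H \<in> carrier H" and beta_closed: "beta H \<in> carrier H"
  by (simp_all add: alpha beta)

lemma H_eq_idem:
  assumes "a \<in> carrier H" "b \<in> carrier H" "e \<otimes>\<^bsub>H\<^esub> a = e \<otimes>\<^bsub>H\<^esub> b" "f \<otimes>\<^bsub>H\<^esub> a = f \<otimes>\<^bsub>H\<^esub> b"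
  shows "a = b"
  using assms ef_one by (metis ec fc l_distr l_one)

end

lemma (in kalg) smult_collect_far:
  "a \<in> carrier A \<Longrightarrow> b \<in> carrier A \<Longrightarrow> c \<odot> a \<oplus> (b \<oplus> d \<odot> a) = (c + d) \<odot> a \<oplus> b"
  "a \<in> carrier A \<Longrightarrow> b \<in> carrier A \<Longrightarrow> b' \<in> carrier A \<Longrightarrow>
     a \<oplus> (b \<oplus> (b' \<oplus> d \<odot> a)) = (1 + d) \<odot> a \<oplus> (b \<oplus> b')"
  by (simp_all add: smult_add_left a_ac)

context qh_core
begin

context
  fixes u \<theta>
  assumes U: "group_elem u" and TH: "skew_elem u \<theta>" and generated: "generated_by H {f, x, u, \<theta>}"
begin

lemma u_facts [simp]:
  "u \<in> carrier H" "u \<otimes>\<^bsub>H\<^esub> u = \<one>\<^bsub>H\<^esub>"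
  "u \<otimes>\<^bsub>H\<^esub> e = e \<otimes>\<^bsub>H\<^esub> u" "u \<otimes>\<^bsub>H\<^esub> f = f \<otimes>\<^bsub>H\<^esub> u" "x \<otimes>\<^bsub>H\<^esub> u = u \<otimes>\<^bsub>H\<^esub> x"
  using U by (simp_all add: group_elem_def)

lemma u_structure: "comult H u = t2 H u u" "counit H u = 1" "antipode H u = u"
  using U by (simp_all add: group_elem_def)

lemma th_facts [simp]:
  "\<theta> \<in> carrier H" "\<theta> \<otimes>\<^bsub>H\<^esub> \<theta> = \<zero>\<^bsub>H\<^esub>"
  "\<theta> \<otimes>\<^bsub>H\<^esub> e = e \<otimes>\<^bsub>H\<^esub> \<theta>" "\<theta> \<otimes>\<^bsub>H\<^esub> f = f \<otimes>\<^bsub>H\<^esub> \<theta>" "\<theta> \<otimes>\<^bsub>H\<^esub> x = x \<otimes>\<^bsub>H\<^esub> \<theta>"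
  "\<theta> \<otimes>\<^bsub>H\<^esub> u = (-1) \<odot>\<^bsub>H\<^esub> (u \<otimes>\<^bsub>H\<^esub> \<theta>)"
  using TH by (simp_all add: skew_elem_def)

lemma th_structure:
  "comult H \<theta> = t2 H u \<theta> \<oplus>\<^bsub>T2 H\<^esub> t2 H \<theta> \<one>\<^bsub>H\<^esub>" "counit H \<theta> = 0" "antipode H \<theta> = \<ominus>\<^bsub>H\<^esub> (u \<otimes>\<^bsub>H\<^esub> \<theta>)"
  using TH by (simp_all add: skew_elem_def)

lemma u_left [simp]:
  assumes "w \<in> carrier H"
  shows "u \<otimes>\<^bsub>H\<^esub> (u \<otimes>\<^bsub>H\<^esub> w) = w" "u \<otimes>\<^bsub>H\<^esub> (e \<otimes>\<^bsub>H\<^esub> w) = e \<otimes>\<^bsub>H\<^esub> (u \<otimes>\<^bsub>H\<^esub> w)"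
    "u \<otimes>\<^bsub>H\<^esub> (f \<otimes>\<^bsub>H\<^esub> w) = f \<otimes>\<^bsub>H\<^esub> (u \<otimes>\<^bsub>H\<^esub> w)" "x \<otimes>\<^bsub>H\<^esub> (u \<otimes>\<^bsub>H\<^esub> w) = u \<otimes>\<^bsub>H\<^esub> (x \<otimes>\<^bsub>H\<^esub> w)"
  using assms by (simp_all add: m_assoc[symmetric])

lemma th_left [simp]:
  assumes "w \<in> carrier H"
  shows "\<theta> \<otimes>\<^bsub>H\<^esub> (\<theta> \<otimes>\<^bsub>H\<^esub> w) = \<zero>\<^bsub>H\<^esub>" "\<theta> \<otimes>\<^bsub>H\<^esub> (e \<otimes>\<^bsub>H\<^esub> w) = e \<otimes>\<^bsub>H\<^esub> (\<theta> \<otimes>\<^bsub>H\<^esub> w)"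
    "\<theta> \<otimes>\<^bsub>H\<^esub> (f \<otimes>\<^bsub>H\<^esub> w) = f \<otimes>\<^bsub>H\<^esub> (\<theta> \<otimes>\<^bsub>H\<^esub> w)" "\<theta> \<otimes>\<^bsub>H\<^esub> (x \<otimes>\<^bsub>H\<^esub> w) = x \<otimes>\<^bsub>H\<^esub> (\<theta> \<otimes>\<^bsub>H\<^esub> w)"
    "\<theta> \<otimes>\<^bsub>H\<^esub> (u \<otimes>\<^bsub>H\<^esub> w) = (-1) \<odot>\<^bsub>H\<^esub> (u \<otimes>\<^bsub>H\<^esub> (\<theta> \<otimes>\<^bsub>H\<^esub> w))"
  using assms by (simp_all add: m_assoc[symmetric])

lemmas expand = m_assoc l_distr r_distr smult_add_right smult_collect
  T2.l_distr T2.r_distr T2.smult_add_right T2.smult_collect t2_distrib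
  T3.l_distr T3.r_distr T3.smult_add_right T3.smult_collect t3_distrib
  T4.l_distr T4.r_distr T4.smult_add_right T4.smult_collect t4_distrib

lemmas comult_gens = comult_simps comult_e comult_f comult_x u_structure th_structure
lemmas counit_gens = counit_simps counit_e counit_f counit_x u_structure th_structure
lemmas antipode_gens = antipode_simps antipode_e antipode_f antipode_x u_structure th_structure

lemmas closure = ec fc xc u_facts(1) th_facts(1) one_closed m_closed a_closed smult_closed t2_closed
  T2.a_closed T2.smult_closed T2.m_closed t3_closed T3.a_closed T3.smult_closed

lemmas co_eval = comult_e comult_f comult_x u_structure(1) th_structure(1) dx_def e_minus_f comult_simps(2-5) t2_one
  alg_homD(2,3)[OF co_left_hom] co_left_t2 alg_homD(2,3)[OF co_right_hom] co_right_t2 front_expand tens_expand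
  P3.tens_add_left P3.tens_smult_left T2.l_distr T2.r_distr t2_mult T2.smult_mult T2.mult_smult

lemma coassoc_gens:
  assumes "h \<in> {f, x, u, \<theta>}"
  shows "co_right (comult H h) \<otimes>\<^bsub>T3 H\<^esub> reassoc H = reassoc H \<otimes>\<^bsub>T3 H\<^esub> co_left (comult H h)"
proof -
  have f: "co_right (comult H f) \<otimes>\<^bsub>T3 H\<^esub> reassoc H = reassoc H \<otimes>\<^bsub>T3 H\<^esub> co_left (comult H f)"
    unfolding reassoc'
    apply (simp only: co_eval closure)
    apply (rule T3_eq_idem; (elim insertE emptyE)?)
    apply (simp_all add: expand qq)
    done
  have x: "co_right (comult H x) \<otimes>\<^bsub>T3 H\<^esub> reassoc H = reassoc H \<otimes>\<^bsub>T3 H\<^esub> co_left (comult H x)"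
    unfolding reassoc'
    apply (simp only: co_eval closure)
    apply (rule T3_eq_idem; (elim insertE emptyE)?)
    apply (simp_all add: expand qq T3.a_assoc T3.smult_collect_far T3.smult_collect_left)
    done
  have u: "co_right (comult H u) \<otimes>\<^bsub>T3 H\<^esub> reassoc H = reassoc H \<otimes>\<^bsub>T3 H\<^esub> co_left (comult H u)"
    unfolding reassoc'
    apply (simp only: co_eval closure)
    apply (rule T3_eq_idem; (elim insertE emptyE)?)
    apply (simp_all add: expand qq)
    done
  have th: "co_right (comult H \<theta>) \<otimes>\<^bsub>T3 H\<^esub> reassoc H = reassoc H \<otimes>\<^bsub>T3 H\<^esub> co_left (comult H \<theta>)"
    unfolding reassoc'
    apply (simp only: co_eval closure)
    apply (rule T3_eq_idem; (elim insertE emptyE)?)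
    apply (simp_all add: m_assoc T3.l_distr T3.r_distr T3.smult_add_right t3_distrib T3.a_ac)
    done
  show ?thesis using assms f x u th by blast
qed

lemma coassoc:
  assumes "h \<in> carrier H"
  shows "co_right (comult H h) = reassoc H \<otimes>\<^bsub>T3 H\<^esub> co_left (comult H h) \<otimes>\<^bsub>T3 H\<^esub> reassoc_inv H"
proof -
  note R = alg_homD[OF co_right_hom] and L = alg_homD[OF co_left_hom]
  note c = reassoc_closed
  have "co_right (comult H h) \<otimes>\<^bsub>T3 H\<^esub> reassoc H = reassoc H \<otimes>\<^bsub>T3 H\<^esub> co_left (comult H h)"
    using k_alg generated assms
  proof (induction h rule: generated_induct)
    case (mult a b)
    note cl = R(1)[OF comult_simps(1)] L(1)[OF comult_simps(1)]
    have "co_right (comult H (a \<otimes>\<^bsub>H\<^esub> b)) \<otimes>\<^bsub>T3 H\<^esub> reassoc H =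
        co_right (comult H a) \<otimes>\<^bsub>T3 H\<^esub> (co_right (comult H b) \<otimes>\<^bsub>T3 H\<^esub> reassoc H)"
      using mult(1,2) c cl by (simp add: comult_simps R T3.m_assoc)
    also have "\<dots> = (co_right (comult H a) \<otimes>\<^bsub>T3 H\<^esub> reassoc H) \<otimes>\<^bsub>T3 H\<^esub> co_left (comult H b)"
      using mult(1,2,4) c cl by (simp add: T3.m_assoc)
    also have "\<dots> = reassoc H \<otimes>\<^bsub>T3 H\<^esub> co_left (comult H (a \<otimes>\<^bsub>H\<^esub> b))"
      using mult(1,2,3) c cl by (simp add: comult_simps L T3.m_assoc)
    finally show ?case .
  qed (simp_all add: coassoc_gens comult_simps R L c T3.l_distr T3.r_distr)
  then have "co_right (comult H h) \<otimes>\<^bsub>T3 H\<^esub> reassoc H \<otimes>\<^bsub>T3 H\<^esub> reassoc H =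
      reassoc H \<otimes>\<^bsub>T3 H\<^esub> co_left (comult H h) \<otimes>\<^bsub>T3 H\<^esub> reassoc H" by simp
  then show ?thesis using assms c R(1)[OF comult_simps(1)]
    by (simp add: reassoc_inv T3.m_assoc reassoc_square)
qed

lemma counit_axiom:
  assumes "h \<in> carrier H"
  shows "lift2 H (comult H h) (\<lambda>a b. counit H b \<odot>\<^bsub>H\<^esub> a) = h"
    and "lift2 H (comult H h) (\<lambda>a b. counit H a \<odot>\<^bsub>H\<^esub> b) = h"
proof -
  have cl: "linear_map H scalars (counit H)" by (rule alg_hom_linear[OF counit_hom])
  have br: "bilinear H H H (\<lambda>a b. counit H b \<odot>\<^bsub>H\<^esub> a)" and bl: "bilinear H H H (\<lambda>a b. counit H a \<odot>\<^bsub>H\<^esub> b)"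
    by (rule bilinearI; intro linear_map_smult linear_map_scale linear_map_id cl k_alg; assumption)+
  note t = P2.lift2_tens[OF k_alg br] P2.lift2_tens[OF k_alg bl]
  have r: "(\<lambda>t. lift2 H t (\<lambda>a b. counit H b \<odot>\<^bsub>H\<^esub> a)) \<in> alg_hom (T2 H) H"
    by (rule P2.lift2_alg_hom[OF k_alg br]) (simp_all add: counit_simps mult.commute)
  have l: "(\<lambda>t. lift2 H t (\<lambda>a b. counit H a \<odot>\<^bsub>H\<^esub> b)) \<in> alg_hom (T2 H) H"
    by (rule P2.lift2_alg_hom[OF k_alg bl]) (simp_all add: counit_simps mult.commute)
  show "lift2 H (comult H h) (\<lambda>a b. counit H b \<odot>\<^bsub>H\<^esub> a) = h"
    by (rule alg_hom_eqI[OF k_alg generated alg_hom_comp[OF comult_hom r] alg_hom_id _ assms], elim insertE emptyE)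
      (simp_all add: comult_gens dx_def e_minus_f linear_mapD[OF alg_hom_linear[OF r]] t counit_gens ef_one l_distr[symmetric])
  show "lift2 H (comult H h) (\<lambda>a b. counit H a \<odot>\<^bsub>H\<^esub> b) = h"
    by (rule alg_hom_eqI[OF k_alg generated alg_hom_comp[OF comult_hom l] alg_hom_id _ assms], elim insertE emptyE)
      (simp_all add: comult_gens dx_def e_minus_f linear_mapD[OF alg_hom_linear[OF l]] t counit_gens ef_one l_distr[symmetric])
qed

lemma antipode_left:
  assumes "h \<in> carrier H"
  shows "conv_left (alpha H) (comult H h) = counit H h \<odot>\<^bsub>H\<^esub> alpha H"
  using k_alg generated assms
proof (induction h rule: generated_induct)
  case (gen h)
  note s = linear_mapD[OF conv_linear(1)] conv_t2 comult_gens dx_def e_minus_f alpha antipode_gens counit_gens expand minus_smult qq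
  have f: "conv_left (alpha H) (comult H f) = counit H f \<odot>\<^bsub>H\<^esub> alpha H"
    by (rule H_eq_idem) (simp_all add: s)
  have x: "conv_left (alpha H) (comult H x) = counit H x \<odot>\<^bsub>H\<^esub> alpha H"
    by (rule H_eq_idem) (simp_all add: s)
  have u: "conv_left (alpha H) (comult H u) = counit H u \<odot>\<^bsub>H\<^esub> alpha H"
    by (rule H_eq_idem) (simp_all add: s)
  have th: "conv_left (alpha H) (comult H \<theta>) = counit H \<theta> \<odot>\<^bsub>H\<^esub> alpha H"
    by (rule H_eq_idem) (simp_all add: s)
  show ?case using gen f x u th by blast
next
  case one
  show ?case by (simp add: comult_simps t2_one conv_t2 alpha_closed antipode_simps counit_simps)
next
  case (add a b)
  then show ?case by (simp add: comult_simps counit_simps linear_mapD[OF conv_linear(1)] alpha_closed smult_add_left)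
next
  case (smult c a)
  then show ?case by (simp add: comult_simps counit_simps linear_mapD[OF conv_linear(1)] alpha_closed)
next
  case (mult a b)
  then show ?case
    by (simp add: comult_simps counit_simps conv_mult(1) alpha_closed conv_left_def[symmetric] conv_smult)
qed

lemma antipode_right:
  assumes "h \<in> carrier H"
  shows "conv_right (beta H) (comult H h) = counit H h \<odot>\<^bsub>H\<^esub> beta H"
  using k_alg generated assms
proof (induction h rule: generated_induct)
  case (gen h)
  note s = linear_mapD[OF conv_linear(2)] conv_t2 comult_gens dx_def e_minus_f beta antipode_gens counit_gens expand minus_smult qq
  have f: "conv_right (beta H) (comult H f) = counit H f \<odot>\<^bsub>H\<^esub> beta H"
    by (rule H_eq_idem) (simp_all add: s)
  have x: "conv_right (beta H) (comult H x) = counit H x \<odot>\<^bsub>H\<^esub> beta H"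
    by (rule H_eq_idem) (simp_all add: s)
  have u: "conv_right (beta H) (comult H u) = counit H u \<odot>\<^bsub>H\<^esub> beta H"
    by (rule H_eq_idem) (simp_all add: s)
  have th: "conv_right (beta H) (comult H \<theta>) = counit H \<theta> \<odot>\<^bsub>H\<^esub> beta H"
    by (rule H_eq_idem) (simp_all add: s)
  show ?case using gen f x u th by blast
next
  case one
  show ?case by (simp add: comult_simps t2_one conv_t2 beta_closed antipode_simps counit_simps)
next
  case (add a b)
  then show ?case by (simp add: comult_simps counit_simps linear_mapD[OF conv_linear(2)] beta_closed smult_add_left)
next
  case (smult c a)
  then show ?case by (simp add: comult_simps counit_simps linear_mapD[OF conv_linear(2)] beta_closed)
next
  case (mult a b)
  then show ?case
    by (simp add: comult_simps counit_simps conv_mult(2) beta_closed conv_right_def[symmetric] conv_smult mult.commute)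
qed

end

end

context qh_core
begin

lemma comult_linear: "linear_map H (T2 H) (comult H)"
  by (rule alg_hom_linear[OF comult_hom])

lemma t4_bilinear:
  assumes "p \<in> carrier H" "r \<in> carrier H"
  shows "bilinear H H (T4 H) (\<lambda>a b. t4 H a b p r)" "bilinear H H (T4 H) (\<lambda>a b. t4 H p a b r)"
    "bilinear H H (T4 H) (\<lambda>a b. t4 H p r a b)"
  by (rule bilinearI; rule t4_linear; (rule assms | assumption))+

lemma lift2_T4_linear:
  assumes "\<And>a b. a \<in> carrier H \<Longrightarrow> b \<in> carrier H \<Longrightarrow> linear_map H (T4 H) (\<lambda>c. F c a b)"
    and "\<And>c. c \<in> carrier H \<Longrightarrow> bilinear H H (T4 H) (F c)" and "t \<in> carrier (T2 H)"
  shows "linear_map H (T4 H) (\<lambda>c. lift2 (T4 H) t (F c))"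
  by (rule linear_map_lift2_param[of H H]) (use assms k_alg k_algebra_T4 in \<open>simp_all flip: T2_def\<close>)

lemma lift2_T4_comult:
  assumes "bilinear H H (T4 H) F"
  shows "linear_map H (T4 H) (\<lambda>c. lift2 (T4 H) (comult H c) F)"
  by (rule linear_map_comp[OF comult_linear P2.lift2_linear[OF k_algebra_T4 assms]])

lemma pentagon_trilinear:
  "trilinear H H H (T4 H) (\<lambda>a b c. lift2 (T4 H) (comult H a) (\<lambda>a1 a2. t4 H a1 a2 b c))"
  "trilinear H H H (T4 H) (\<lambda>a b c. lift2 (T4 H) (comult H b) (\<lambda>b1 b2. t4 H a b1 b2 c))"
  "trilinear H H H (T4 H) (\<lambda>a b c. lift2 (T4 H) (comult H c) (\<lambda>c1 c2. t4 H a b c1 c2))"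
  "trilinear H H H (T4 H) (\<lambda>a b c. t4 H a b c \<one>\<^bsub>H\<^esub>)"
  by (rule trilinearI; (rule lift2_T4_comult lift2_T4_linear t4_linear t4_bilinear comult_simps one_closed | assumption)+)+

lemmas lift2_T4_eval =
  linear_mapD(2)[OF P2.lift2_linear[OF k_algebra_T4 t4_bilinear(1)]] P2.lift2_tens[OF k_algebra_T4 t4_bilinear(1)]
  linear_mapD(2)[OF P2.lift2_linear[OF k_algebra_T4 t4_bilinear(2)]] P2.lift2_tens[OF k_algebra_T4 t4_bilinear(2)]
  linear_mapD(2)[OF P2.lift2_linear[OF k_algebra_T4 t4_bilinear(3)]] P2.lift2_tens[OF k_algebra_T4 t4_bilinear(3)]

lemma pentagon_terms:
  "lift3 (T4 H) (reassoc H) (\<lambda>a b c. lift2 (T4 H) (comult H a) (\<lambda>a1 a2. t4 H a1 a2 b c)) =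
     t4 H \<one>\<^bsub>H\<^esub> \<one>\<^bsub>H\<^esub> \<one>\<^bsub>H\<^esub> \<one>\<^bsub>H\<^esub> \<oplus>\<^bsub>T4 H\<^esub> (-2) \<odot>\<^bsub>T4 H\<^esub> (t4 H e f f f \<oplus>\<^bsub>T4 H\<^esub> t4 H f e f f)"
  "lift3 (T4 H) (reassoc H) (\<lambda>a b c. lift2 (T4 H) (comult H b) (\<lambda>b1 b2. t4 H a b1 b2 c)) =
     t4 H \<one>\<^bsub>H\<^esub> \<one>\<^bsub>H\<^esub> \<one>\<^bsub>H\<^esub> \<one>\<^bsub>H\<^esub> \<oplus>\<^bsub>T4 H\<^esub> (-2) \<odot>\<^bsub>T4 H\<^esub> (t4 H f e f f \<oplus>\<^bsub>T4 H\<^esub> t4 H f f e f)"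
  "lift3 (T4 H) (reassoc H) (\<lambda>a b c. lift2 (T4 H) (comult H c) (\<lambda>c1 c2. t4 H a b c1 c2)) =
     t4 H \<one>\<^bsub>H\<^esub> \<one>\<^bsub>H\<^esub> \<one>\<^bsub>H\<^esub> \<one>\<^bsub>H\<^esub> \<oplus>\<^bsub>T4 H\<^esub> (-2) \<odot>\<^bsub>T4 H\<^esub> (t4 H f f e f \<oplus>\<^bsub>T4 H\<^esub> t4 H f f f e)"
  "lift3 (T4 H) (reassoc H) (\<lambda>a b c. t4 H a b c \<one>\<^bsub>H\<^esub>) =
     t4 H \<one>\<^bsub>H\<^esub> \<one>\<^bsub>H\<^esub> \<one>\<^bsub>H\<^esub> \<one>\<^bsub>H\<^esub> \<oplus>\<^bsub>T4 H\<^esub> (-2) \<odot>\<^bsub>T4 H\<^esub> t4 H f f f \<one>\<^bsub>H\<^esub>"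
  unfolding lift3_reassoc[OF k_algebra_T4 pentagon_trilinear(1)] lift3_reassoc[OF k_algebra_T4 pentagon_trilinear(2)]
    lift3_reassoc[OF k_algebra_T4 pentagon_trilinear(3)] lift3_reassoc[OF k_algebra_T4 pentagon_trilinear(4)]
  by (simp_all only: comult_simps(5) comult_f t2_one lift2_T4_eval t2_closed ec fc one_closed)

lemma pentagon_front:
  "tens H (T3 H) \<one>\<^bsub>H\<^esub> (reassoc H) = t4 H \<one>\<^bsub>H\<^esub> \<one>\<^bsub>H\<^esub> \<one>\<^bsub>H\<^esub> \<one>\<^bsub>H\<^esub> \<oplus>\<^bsub>T4 H\<^esub> (-2) \<odot>\<^bsub>T4 H\<^esub> t4 H \<one>\<^bsub>H\<^esub> f f f"
  unfolding reassoc' t4_def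
  by (simp only: P4.tens_add_right P4.tens_smult_right one_closed t3_closed fc T3.smult_closed)

lemma pentagon:
  "tens H (T3 H) \<one>\<^bsub>H\<^esub> (reassoc H) \<otimes>\<^bsub>T4 H\<^esub>
     lift3 (T4 H) (reassoc H) (\<lambda>X1 X2 X3. lift2 (T4 H) (comult H X2) (\<lambda>a b. t4 H X1 a b X3)) \<otimes>\<^bsub>T4 H\<^esub>
     lift3 (T4 H) (reassoc H) (\<lambda>X1 X2 X3. t4 H X1 X2 X3 \<one>\<^bsub>H\<^esub>) =
   lift3 (T4 H) (reassoc H) (\<lambda>X1 X2 X3. lift2 (T4 H) (comult H X3) (\<lambda>a b. t4 H X1 X2 a b)) \<otimes>\<^bsub>T4 H\<^esub>
     lift3 (T4 H) (reassoc H) (\<lambda>X1 X2 X3. lift2 (T4 H) (comult H X1) (\<lambda>a b. t4 H a b X2 X3))"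
  unfolding pentagon_front pentagon_terms
proof (rule T4_eq_idem)
  fix a b c d assume "a \<in> {e, f}" "b \<in> {e, f}" "c \<in> {e, f}" "d \<in> {e, f}"
  then have ac: "a \<in> carrier H" "b \<in> carrier H" "c \<in> carrier H" "d \<in> carrier H" by auto
  let ?o = "t4 H \<one>\<^bsub>H\<^esub> \<one>\<^bsub>H\<^esub> \<one>\<^bsub>H\<^esub> \<one>\<^bsub>H\<^esub>" and ?p = "t4 H a b c d"
  let ?A = "?o \<oplus>\<^bsub>T4 H\<^esub> (-2) \<odot>\<^bsub>T4 H\<^esub> t4 H \<one>\<^bsub>H\<^esub> f f f" and ?B = "?o \<oplus>\<^bsub>T4 H\<^esub> (-2) \<odot>\<^bsub>T4 H\<^esub> (t4 H f e f f \<oplus>\<^bsub>T4 H\<^esub> t4 H f f e f)"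
    and ?C = "?o \<oplus>\<^bsub>T4 H\<^esub> (-2) \<odot>\<^bsub>T4 H\<^esub> t4 H f f f \<one>\<^bsub>H\<^esub>" and ?D = "?o \<oplus>\<^bsub>T4 H\<^esub> (-2) \<odot>\<^bsub>T4 H\<^esub> (t4 H f f e f \<oplus>\<^bsub>T4 H\<^esub> t4 H f f f e)"
    and ?E = "?o \<oplus>\<^bsub>T4 H\<^esub> (-2) \<odot>\<^bsub>T4 H\<^esub> (t4 H e f f f \<oplus>\<^bsub>T4 H\<^esub> t4 H f e f f)"
  have cl: "?p \<in> carrier (T4 H)" "?A \<in> carrier (T4 H)" "?B \<in> carrier (T4 H)" "?C \<in> carrier (T4 H)"
    "?D \<in> carrier (T4 H)" "?E \<in> carrier (T4 H)"
    using ac by simp_all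
  note s = T4.r_distr T4.smult_add_right T4.smult_collect
  have ev: "((?p \<otimes>\<^bsub>T4 H\<^esub> ?A) \<otimes>\<^bsub>T4 H\<^esub> ?B) \<otimes>\<^bsub>T4 H\<^esub> ?C = (?p \<otimes>\<^bsub>T4 H\<^esub> ?D) \<otimes>\<^bsub>T4 H\<^esub> ?E"
    using \<open>a \<in> {e, f}\<close> \<open>b \<in> {e, f}\<close> \<open>c \<in> {e, f}\<close> \<open>d \<in> {e, f}\<close>
    by (elim insertE emptyE) (simp_all add: s)
  show "?p \<otimes>\<^bsub>T4 H\<^esub> (?A \<otimes>\<^bsub>T4 H\<^esub> ?B \<otimes>\<^bsub>T4 H\<^esub> ?C) = ?p \<otimes>\<^bsub>T4 H\<^esub> (?D \<otimes>\<^bsub>T4 H\<^esub> ?E)"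
    using ev by (simp only: T4.m_assoc cl T4.m_closed)
qed simp_all

lemma reassoc_counit:
  "lift3 (T2 H) (reassoc H) (\<lambda>X1 X2 X3. counit H X2 \<odot>\<^bsub>T2 H\<^esub> t2 H X1 X3) = t2 H \<one>\<^bsub>H\<^esub> \<one>\<^bsub>H\<^esub>"
proof -
  have "trilinear H H H (T2 H) (\<lambda>X1 X2 X3. counit H X2 \<odot>\<^bsub>T2 H\<^esub> t2 H X1 X3)"
    by (rule trilinearI; (rule linear_map_smult linear_map_scale k_algebra_T2 t2_linear t2_closed alg_hom_linear[OF counit_hom] | assumption)+)
  from lift3_reassoc[OF k_algebra_T2 this] show ?thesis
    by (simp add: counit_simps counit_f)
qed

lemma antipode_linear_map: "linear_map H H (antipode H)"
  using alg_hom_linear[OF antipode_hom] by simp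

lemma reassoc_antipode:
  "lift3 H (reassoc H) (\<lambda>X1 X2 X3. X1 \<otimes>\<^bsub>H\<^esub> beta H \<otimes>\<^bsub>H\<^esub> antipode H X2 \<otimes>\<^bsub>H\<^esub> alpha H \<otimes>\<^bsub>H\<^esub> X3) = \<one>\<^bsub>H\<^esub>"
  "lift3 H (reassoc_inv H) (\<lambda>x1 x2 x3. antipode H x1 \<otimes>\<^bsub>H\<^esub> alpha H \<otimes>\<^bsub>H\<^esub> x2 \<otimes>\<^bsub>H\<^esub> beta H \<otimes>\<^bsub>H\<^esub> antipode H x3) = \<one>\<^bsub>H\<^esub>"
proof -
  note r = linear_map_mult_left linear_map_mult_right linear_map_id antipode_linear_map k_alg m_closed
    antipode_simps(1) alpha_closed beta_closed
  have "trilinear H H H H (\<lambda>X1 X2 X3. X1 \<otimes>\<^bsub>H\<^esub> beta H \<otimes>\<^bsub>H\<^esub> antipode H X2 \<otimes>\<^bsub>H\<^esub> alpha H \<otimes>\<^bsub>H\<^esub> X3)"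
    by (rule trilinearI; (rule r | assumption)+)
  from lift3_reassoc[OF k_alg this]
  show "lift3 H (reassoc H) (\<lambda>X1 X2 X3. X1 \<otimes>\<^bsub>H\<^esub> beta H \<otimes>\<^bsub>H\<^esub> antipode H X2 \<otimes>\<^bsub>H\<^esub> alpha H \<otimes>\<^bsub>H\<^esub> X3) = \<one>\<^bsub>H\<^esub>"
    by (simp add: antipode_simps antipode_f alpha beta e_minus_f r_distr l_distr m_assoc)
      (rule H_eq_idem; simp add: r_distr smult_collect)
  have "trilinear H H H H (\<lambda>x1 x2 x3. antipode H x1 \<otimes>\<^bsub>H\<^esub> alpha H \<otimes>\<^bsub>H\<^esub> x2 \<otimes>\<^bsub>H\<^esub> beta H \<otimes>\<^bsub>H\<^esub> antipode H x3)"
    by (rule trilinearI; (rule r | assumption)+)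
  from lift3_reassoc[OF k_alg this]
  show "lift3 H (reassoc_inv H) (\<lambda>x1 x2 x3. antipode H x1 \<otimes>\<^bsub>H\<^esub> alpha H \<otimes>\<^bsub>H\<^esub> x2 \<otimes>\<^bsub>H\<^esub> beta H \<otimes>\<^bsub>H\<^esub> antipode H x3) = \<one>\<^bsub>H\<^esub>"
    by (simp add: reassoc_inv antipode_simps antipode_f alpha beta e_minus_f r_distr l_distr m_assoc)
      (rule H_eq_idem; simp add: r_distr smult_collect)
qed

lemma reassoc_unit: "reassoc H \<in> Units (T3 H)"
  unfolding Units_def using reassoc_closed reassoc_square by blast

text \<open>Coassociativity, counit and antipode identities hold on products if they hold on the factors, and are
  checked on the generators in the preceding lemmas.\<close>

theorem quasi_hopf_algebra_generated:
  assumes "group_elem u" "skew_elem u \<theta>" "generated_by H {f, x, u, \<theta>}"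
  shows "quasi_hopf_algebra H"
  unfolding quasi_hopf_algebra_def Let_def co_right_def[symmetric] co_left_def[symmetric]
    conv_left_def[symmetric] conv_right_def[symmetric]
  by (intro conjI ballI k_alg comult_hom counit_hom antipode_hom reassoc_unit reassoc_counit reassoc_antipode
      alpha_closed beta_closed pentagon coassoc[OF assms] counit_axiom[OF assms] antipode_left[OF assms] antipode_right[OF assms])

end

section \<open>Morphisms of quasi-Hopf data\<close>

definition quasi_hopf_hom ::
    "('k::field, 'a) quasi_hopf \<Rightarrow> ('k, 'b) quasi_hopf \<Rightarrow> ('a \<Rightarrow> 'b) set" where
  "quasi_hopf_hom H K = {f \<in> alg_hom H K.
     (\<forall>h\<in>carrier H.
        comult K (f h) = lift2 (T2 K) (comult H h) (\<lambda>a b. t2 K (f a) (f b)) \<and>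
        counit K (f h) = counit H h \<and>
        antipode K (f h) = f (antipode H h)) \<and>
     reassoc K = lift3 (T3 K) (reassoc H) (\<lambda>X1 X2 X3. t3 K (f X1) (f X2) (f X3)) \<and>
     alpha K = f (alpha H) \<and> beta K = f (beta H)}"

lemma quasi_hopf_iso_iff:
  "f \<in> quasi_hopf_iso H K \<longleftrightarrow> f \<in> quasi_hopf_hom H K \<and> bij_betw f (carrier H) (carrier K)"
  unfolding quasi_hopf_iso_def quasi_hopf_hom_def by blast

lemma T2_map:
  assumes H: "k_algebra H" and K: "k_algebra K" and j: "j \<in> alg_hom H K"
  shows "(\<lambda>t. lift2 (T2 K) t (\<lambda>a b. t2 K (j a) (j b))) \<in> alg_hom (T2 H) (T2 K)"
    and "a \<in> carrier H \<Longrightarrow> b \<in> carrier H \<Longrightarrow> lift2 (T2 K) (t2 H a b) (\<lambda>a b. t2 K (j a) (j b)) = t2 K (j a) (j b)"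
proof -
  interpret two_algebras H H using H by unfold_locales
  note m = alg_hom_tensor_map[OF H H K K j j]
  show "(\<lambda>t. lift2 (T2 K) t (\<lambda>a b. t2 K (j a) (j b))) \<in> alg_hom (T2 H) (T2 K)"
    using m(2) by (simp only: T2_def t2_def)
  show "a \<in> carrier H \<Longrightarrow> b \<in> carrier H \<Longrightarrow> lift2 (T2 K) (t2 H a b) (\<lambda>a b. t2 K (j a) (j b)) = t2 K (j a) (j b)"
    using lift2_tens[OF _ m(1)] K by (simp add: T2_def t2_def)
qed

lemma T3_map_trilinear:
  assumes H: "k_algebra H" and K: "k_algebra K" and j: "linear_map H K j"
  shows "trilinear H H H (T3 K) (\<lambda>a b c. t3 K (j a) (j b) (j c))"
proof -
  interpret K: tensor_powers K using K by (simp add: tensor_powers_def)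
  show ?thesis
    by (rule trilinearI; (rule linear_map_comp[OF j K.t3_linear(1)] linear_map_comp[OF j K.t3_linear(2)]
        linear_map_comp[OF j K.t3_linear(3)]); rule linear_mapD(1)[OF j]; assumption)
qed

context qh_core
begin

context
  fixes K :: "('k, 'c) quasi_hopf" and j
  assumes K: "pre_quasi_hopf K" and hom: "j \<in> quasi_hopf_hom H K"
begin

interpretation K: pre_qh K using K by unfold_locales

lemma j_hom: "j \<in> alg_hom H K"
  using hom unfolding quasi_hopf_hom_def by blast

lemmas J = alg_homD[OF j_hom]

lemma j_structure:
  "h \<in> carrier H \<Longrightarrow> comult K (j h) = lift2 (T2 K) (comult H h) (\<lambda>a b. t2 K (j a) (j b))"
  "h \<in> carrier H \<Longrightarrow> counit K (j h) = counit H h"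
  "h \<in> carrier H \<Longrightarrow> antipode K (j h) = j (antipode H h)"
  "reassoc K = lift3 (T3 K) (reassoc H) (\<lambda>X1 X2 X3. t3 K (j X1) (j X2) (j X3))"
  "alpha K = j (alpha H)" "beta K = j (beta H)"
  using hom unfolding quasi_hopf_hom_def by blast+

lemma j_minus: "j \<zero>\<^bsub>H\<^esub> = \<zero>\<^bsub>K\<^esub>" "a \<in> carrier H \<Longrightarrow> j (\<ominus>\<^bsub>H\<^esub> a) = \<ominus>\<^bsub>K\<^esub> j a"
  "a \<in> carrier H \<Longrightarrow> b \<in> carrier H \<Longrightarrow> j (a \<ominus>\<^bsub>H\<^esub> b) = j a \<ominus>\<^bsub>K\<^esub> j b"
  using linear_map_zero[OF k_alg K.k_alg alg_hom_linear[OF j_hom]] linear_map_minus[OF k_alg K.k_alg alg_hom_linear[OF j_hom]]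
  by simp_all

lemma idempotent_pair_transfer: "idempotent_pair K (j e) (j f) (j x)"
proof (intro idempotent_pair.intro idempotent_pair_axioms.intro)
  show "tensor_powers K" by (rule K.tensor_powers_axioms)
  show "j e \<oplus>\<^bsub>K\<^esub> j f = \<one>\<^bsub>K\<^esub>" using J(2)[of e f] J(5) by (simp add: ef_one)
qed (simp_all add: J(1) J(4)[symmetric] j_minus(1))

text \<open>A quasi-Hopf morphism carries the whole pattern to its target; the extension and the tensor products
  inherit it from \<open>H\<^sub>q(8)\<close> in this way.\<close>

lemma core_transfer: "qh_core K (j e) (j f) (j x) q"
proof (intro qh_core.intro qh_core_axioms.intro idempotent_pair_transfer)
  interpret I: idempotent_pair K "j e" "j f" "j x" by (rule idempotent_pair_transfer)
  note J2 = linear_mapD[OF alg_hom_linear[OF T2_map(1)[OF k_alg K.k_alg j_hom]]] T2_map(2)[OF k_alg K.k_alg j_hom]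
  show "pre_qh K" by (rule K.pre_qh_axioms)
  show "q * q = - 1" by (rule qq)
  note c = ec fc xc one_closed m_closed a_closed smult_closed minus_closed t2_closed T2.a_closed
  show "comult K (j f) = t2 K (j e) (j f) \<oplus>\<^bsub>T2 K\<^esub> t2 K (j f) (j e)"
    unfolding j_structure(1)[OF fc] comult_f by (simp only: J2 c)
  show "comult K (j x) = I.dx q"
    unfolding j_structure(1)[OF xc] comult_x dx_def I.dx_def by (simp only: J2 J j_minus c)
  show "counit K (j f) = 0" "counit K (j x) = 0"
    by (simp_all only: j_structure(2) fc xc counit_f counit_x)
  show "antipode K (j f) = j f" by (simp only: j_structure(3) fc antipode_f)
  show "antipode K (j x) = \<ominus>\<^bsub>K\<^esub> (j x \<otimes>\<^bsub>K\<^esub> (j e \<oplus>\<^bsub>K\<^esub> q \<odot>\<^bsub>K\<^esub> j f))"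
    unfolding j_structure(3)[OF xc] antipode_x by (simp only: J j_minus c)
  show "reassoc K = \<one>\<^bsub>T3 K\<^esub> \<ominus>\<^bsub>T3 K\<^esub> 2 \<odot>\<^bsub>T3 K\<^esub> t3 K (j f) (j f) (j f)"
    unfolding j_structure(4) lift3_reassoc[OF K.k_algebra_T3 T3_map_trilinear[OF k_alg K.k_alg alg_hom_linear[OF j_hom]]]
      J(5) K.t3_one
    by (subst K.T3.diff_smult) (simp_all add: J(1))
  show "alpha K = j e \<ominus>\<^bsub>K\<^esub> j f" by (simp only: j_structure(5) alpha j_minus ec fc)
  show "beta K = \<one>\<^bsub>K\<^esub>" by (simp only: j_structure(6) beta J(5))
qed

lemma group_elem_transfer:
  assumes u: "group_elem u"
  shows "qh_core.group_elem K (j e) (j f) (j x) (j u)"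
proof -
  note J2 = T2_map(2)[OF k_alg K.k_alg j_hom]
  show ?thesis
    unfolding qh_core.group_elem_def[OF core_transfer]
    using u unfolding group_elem_def
    by (elim conjE, intro conjI) (simp_all only: j_structure(1-3) J(1,5) J2 J(4)[symmetric] ec fc xc)
qed

end

end

section \<open>Tensor products of quasi-Hopf data\<close>

lemma linear_map_lift3_param:
  assumes k: "k_algebra A" "k_algebra B" "k_algebra D" "k_algebra E" "k_algebra Y"
    and t: "t \<in> carrier (tensor_alg A (tensor_alg B D))"
    and lin: "\<And>a b d. a \<in> carrier A \<Longrightarrow> b \<in> carrier B \<Longrightarrow> d \<in> carrier D \<Longrightarrow> linear_map Y E (\<lambda>y. g y a b d)"
    and tri: "\<And>y. y \<in> carrier Y \<Longrightarrow> trilinear A B D E (g y)"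
  shows "linear_map Y E (\<lambda>y. lift3 E t (g y))"
  unfolding lift3_def
proof (rule linear_map_lift2_param[OF k(1) _ k(4) t])
  show "linear_map Y E (\<lambda>y. lift2 E c (g y b))" if "b \<in> carrier A" "c \<in> carrier (tensor_alg B D)" for b c
    by (rule linear_map_lift2_param[OF k(2,3,4) that(2)])
      (use that lin trilinear_bilinear(1)[OF k(1,2,3,4) tri] k in auto)
  show "bilinear A (tensor_alg B D) E (\<lambda>a u. lift2 E u (g y a))" if "y \<in> carrier Y" for y
    by (rule trilinear_bilinear(2)[OF k(1,2,3,4) tri[OF that]])
qed (use k in simp_all)

locale two_pre_qh =
  fixes H :: "('k::field, 'a) quasi_hopf" and K :: "('k, 'b) quasi_hopf"
  assumes H: "pre_quasi_hopf H" and K: "pre_quasi_hopf K"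
begin

sublocale H: pre_qh H using H by unfold_locales
sublocale K: pre_qh K using K by unfold_locales
sublocale HK: two_algebras H K by unfold_locales (rule H.k_alg K.k_alg)+

definition "Q = quasi_hopf_tensor H K"

lemma pre_Q: "pre_quasi_hopf Q"
  unfolding Q_def by (rule pre_quasi_hopf_tensor(1)[OF H K])

lemma same_Q: "same_algebra Q (tensor_alg H K)"
  unfolding Q_def by (rule pre_quasi_hopf_tensor(2)[OF H K])

lemma Q_simps [simp]:
  "carrier Q = carrier (tensor_alg H K)" "monoid.mult Q = monoid.mult (tensor_alg H K)" "monoid.one Q = monoid.one (tensor_alg H K)"
  "ring.zero Q = ring.zero (tensor_alg H K)" "ring.add Q = ring.add (tensor_alg H K)" "module.smult Q = module.smult (tensor_alg H K)"
  using same_Q by (simp_all add: same_algebra_def)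

lemmas T_same = tensor_powers_same[OF same_Q]

lemma k_algebra_Q: "k_algebra Q"
  using pre_Q by (simp add: pre_quasi_hopf_def)

lemma i_hom: "(\<lambda>h. tens H K h \<one>\<^bsub>K\<^esub>) \<in> alg_hom H Q" and j_hom: "(\<lambda>k. tens H K \<one>\<^bsub>H\<^esub> k) \<in> alg_hom K Q"
  using tens_embed[OF H.k_alg K.k_alg] alg_hom_same[OF same_algebra_refl same_Q] by blast+

lemma i2_hom: "(\<lambda>t. lift2 (T2 Q) t (\<lambda>a b. t2 Q (tens H K a \<one>\<^bsub>K\<^esub>) (tens H K b \<one>\<^bsub>K\<^esub>))) \<in> alg_hom (T2 H) (T2 Q)"
  and j2_hom: "(\<lambda>t. lift2 (T2 Q) t (\<lambda>a b. t2 Q (tens H K \<one>\<^bsub>H\<^esub> a) (tens H K \<one>\<^bsub>H\<^esub> b))) \<in> alg_hom (T2 K) (T2 Q)"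
  by (rule T2_map(1)[OF H.k_alg k_algebra_Q i_hom], rule T2_map(1)[OF K.k_alg k_algebra_Q j_hom])

lemma structure_i:
  assumes h: "h \<in> carrier H"
  shows "comult Q (tens H K h \<one>\<^bsub>K\<^esub>) = lift2 (T2 Q) (comult H h) (\<lambda>a b. t2 Q (tens H K a \<one>\<^bsub>K\<^esub>) (tens H K b \<one>\<^bsub>K\<^esub>))"
    "counit Q (tens H K h \<one>\<^bsub>K\<^esub>) = counit H h"
    "antipode Q (tens H K h \<one>\<^bsub>K\<^esub>) = tens H K (antipode H h) \<one>\<^bsub>K\<^esub>"
proof -
  interpret Q2: kalg "T2 Q" using k_algebra_Q by (simp add: T2_def)
  note p = pre_quasi_hopf_tensor(3-5)[OF H K h K.one_closed, folded T_same Q_def]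
  show "comult Q (tens H K h \<one>\<^bsub>K\<^esub>) = lift2 (T2 Q) (comult H h) (\<lambda>a b. t2 Q (tens H K a \<one>\<^bsub>K\<^esub>) (tens H K b \<one>\<^bsub>K\<^esub>))"
    unfolding p(1) K.comult_simps(5) alg_homD(5)[OF j2_hom]
    by (rule Q2.r_one[OF alg_homD(1)[OF i2_hom H.comult_simps(1)[OF h]]])
  show "counit Q (tens H K h \<one>\<^bsub>K\<^esub>) = counit H h" "antipode Q (tens H K h \<one>\<^bsub>K\<^esub>) = tens H K (antipode H h) \<one>\<^bsub>K\<^esub>"
    by (simp_all only: p K.counit_simps(5) K.antipode_simps(5) mult_1_right)
qed

lemma structure_j:
  assumes k: "k \<in> carrier K"
  shows "comult Q (tens H K \<one>\<^bsub>H\<^esub> k) = lift2 (T2 Q) (comult K k) (\<lambda>a b. t2 Q (tens H K \<one>\<^bsub>H\<^esub> a) (tens H K \<one>\<^bsub>H\<^esub> b))"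
    "counit Q (tens H K \<one>\<^bsub>H\<^esub> k) = counit K k"
    "antipode Q (tens H K \<one>\<^bsub>H\<^esub> k) = tens H K \<one>\<^bsub>H\<^esub> (antipode K k)"
proof -
  interpret Q2: kalg "T2 Q" using k_algebra_Q by (simp add: T2_def)
  note p = pre_quasi_hopf_tensor(3-5)[OF H K H.one_closed k, folded T_same Q_def]
  show "comult Q (tens H K \<one>\<^bsub>H\<^esub> k) = lift2 (T2 Q) (comult K k) (\<lambda>a b. t2 Q (tens H K \<one>\<^bsub>H\<^esub> a) (tens H K \<one>\<^bsub>H\<^esub> b))"
    unfolding p(1) H.comult_simps(5) alg_homD(5)[OF i2_hom]
    by (rule Q2.l_one[OF alg_homD(1)[OF j2_hom K.comult_simps(1)[OF k]]])
  show "counit Q (tens H K \<one>\<^bsub>H\<^esub> k) = counit K k" "antipode Q (tens H K \<one>\<^bsub>H\<^esub> k) = tens H K \<one>\<^bsub>H\<^esub> (antipode K k)"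
    by (simp_all only: p H.counit_simps(5) H.antipode_simps(5) mult_1_left)
qed

text \<open>If the left factor has trivial reassociator, the right factor is a quasi-Hopf subalgebra.\<close>

lemma right_factor_hom:
  assumes "reassoc H = \<one>\<^bsub>T3 H\<^esub>" "alpha H = \<one>\<^bsub>H\<^esub>" "beta H = \<one>\<^bsub>H\<^esub>" and rK: "reassoc K \<in> carrier (T3 K)"
  shows "(\<lambda>k. tens H K \<one>\<^bsub>H\<^esub> k) \<in> quasi_hopf_hom K Q"
proof -
  have kT: "k_algebra (tensor_alg H K)" by (rule HK.k_algebra_tensor)
  interpret T: tensor_powers "tensor_alg H K" using kT by (simp add: tensor_powers_def)
  let ?T = "tensor_alg H K"
  let ?G = "\<lambda>X1 X2 X3 Y1 Y2 Y3. t3 ?T (tens H K X1 Y1) (tens H K X2 Y2) (tens H K X3 Y3)"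
  have l: "linear_map K ?T (\<lambda>Y. tens H K a Y)" if "a \<in> carrier H" for a
    by (rule linear_map_tens_right[OF H.k_alg K.k_alg linear_map_id that])
  have r: "linear_map H ?T (\<lambda>Y. tens H K Y a)" if "a \<in> carrier K" for a
    by (rule linear_map_tens_left[OF H.k_alg K.k_alg linear_map_id that])
  have t1: "trilinear K K K (T3 ?T) (?G X1 X2 X3)" if "X1 \<in> carrier H" "X2 \<in> carrier H" "X3 \<in> carrier H" for X1 X2 X3
    by (rule trilinearI; (rule linear_map_comp[OF l T.t3_linear(1)] linear_map_comp[OF l T.t3_linear(2)]
        linear_map_comp[OF l T.t3_linear(3)]); (rule that HK.tens_closed | assumption)+)
  have rK': "reassoc K \<in> carrier (tensor_alg K (tensor_alg K K))" using rK by (simp add: T3_def T2_def)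
  have t2: "trilinear H H H (T3 ?T) (\<lambda>X1 X2 X3. lift3 (T3 ?T) (reassoc K) (?G X1 X2 X3))"
    by (rule trilinearI; rule linear_map_lift3_param[OF K.k_alg K.k_alg K.k_alg T.k_algebra_T3 H.k_alg rK'];
        (rule t1 | (rule linear_map_comp[OF r T.t3_linear(1)] linear_map_comp[OF r T.t3_linear(2)]
        linear_map_comp[OF r T.t3_linear(3)]; (rule HK.tens_closed)?) | assumption)+)
  have "reassoc Q = lift3 (T3 ?T) (reassoc H) (\<lambda>X1 X2 X3. lift3 (T3 ?T) (reassoc K) (?G X1 X2 X3))"
    unfolding Q_def quasi_hopf_tensor_def Let_def with_structure_simps ..
  also have "\<dots> = lift3 (T3 ?T) (reassoc K) (?G \<one>\<^bsub>H\<^esub> \<one>\<^bsub>H\<^esub> \<one>\<^bsub>H\<^esub>)"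
    unfolding assms(1) H.t3_one
    by (rule H.lift3_t3[OF T.k_algebra_T3 t2 H.one_closed H.one_closed H.one_closed])
  finally have rQ: "reassoc Q = lift3 (T3 Q) (reassoc K) (\<lambda>a b c. t3 Q (tens H K \<one>\<^bsub>H\<^esub> a) (tens H K \<one>\<^bsub>H\<^esub> b) (tens H K \<one>\<^bsub>H\<^esub> c))"
    unfolding T_same .
  have ab: "alpha Q = tens H K \<one>\<^bsub>H\<^esub> (alpha K)" "beta Q = tens H K \<one>\<^bsub>H\<^esub> (beta K)"
    unfolding Q_def quasi_hopf_tensor_def Let_def with_structure_simps assms(2,3) by (rule refl)+
  show ?thesis
    unfolding quasi_hopf_hom_def mem_Collect_eq using j_hom structure_j rQ ab by blast
qed

lemma generated_Q:
  "generated_by H Y \<Longrightarrow> generated_by K Z \<Longrightarrow>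
     generated_by Q ((\<lambda>a. tens H K a \<one>\<^bsub>K\<^esub>) ` Y \<union> (\<lambda>b. tens H K \<one>\<^bsub>H\<^esub> b) ` Z)"
  by (rule generated_same[OF same_algebra_sym[OF same_Q] HK.generated_tensor])

end

section \<open>The Hopf algebra of the group of order two\<close>

abbreviation "C2 \<equiv> integer_mod_group 2"

lemma C2_carrier: "carrier C2 = {0, 1}"
  by (auto simp: carrier_integer_mod_group)

lemma C2_monoid: "Group.monoid C2"
  by (rule group.is_monoid) simp

definition kC2_alg :: "('k::field, int \<Rightarrow>\<^sub>0 'k) module" where
  "kC2_alg = monoid_algebra C2"

lemma k_algebra_kC2: "k_algebra kC2_alg"
  unfolding kC2_alg_def by (rule k_algebra_monoid_algebra[OF C2_monoid])

lemma same_kC2: "same_algebra kC2 kC2_alg"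
  unfolding kC2_def group_hopf_def Let_def kC2_alg_def by (rule same_algebra_structure)

text \<open>The group algebra is universal for involutions.\<close>

lemma kC2_lift:
  assumes C: "k_algebra C" and G: "G \<in> carrier C" "G \<otimes>\<^bsub>C\<^esub> G = \<one>\<^bsub>C\<^esub>" and \<phi>: "\<phi> 0 = \<one>\<^bsub>C\<^esub>" "\<phi> 1 = G"
  shows "lin_ext C \<phi> \<in> alg_hom kC2 C" "lin_ext C \<phi> (mon 1) = G"
proof -
  interpret C: kalg C using C by simp
  have "lin_ext C \<phi> \<in> alg_hom (monoid_algebra C2) C"
    by (rule lin_ext_alg_hom[OF C2_monoid C]) (unfold C2_carrier, use G \<phi> in auto)
  then show "lin_ext C \<phi> \<in> alg_hom kC2 C"
    using alg_hom_same[OF same_kC2 same_algebra_refl, of C] by (simp add: kC2_alg_def)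
  show "lin_ext C \<phi> (mon 1) = G"
    using lin_ext_single[OF C, of \<phi> 1 1] G \<phi> by simp
qed

lemma lin_ext_op: "lin_ext (op_alg A) \<phi> = lin_ext A \<phi>"
proof -
  have "ring.add (op_alg A) = ring.add A" by (simp add: op_alg_def)
  then show ?thesis by (simp add: lin_ext_def[abs_def] finsum_def)
qed

lemma kC2_facts:
  shows "pre_quasi_hopf (kC2 :: ('k::field, _) quasi_hopf)"
    and "(mon 1 :: int \<Rightarrow>\<^sub>0 'k) \<in> carrier kC2" "mon 1 \<otimes>\<^bsub>kC2\<^esub> mon 1 = (\<one>\<^bsub>kC2\<^esub> :: int \<Rightarrow>\<^sub>0 'k)"
    and "generated_by (kC2 :: ('k, _) quasi_hopf) {mon 1}"
    and "comult kC2 (mon 1 :: int \<Rightarrow>\<^sub>0 'k) = t2 kC2 (mon 1) (mon 1)" "counit kC2 (mon 1 :: int \<Rightarrow>\<^sub>0 'k) = 1"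
    and "antipode kC2 (mon 1 :: int \<Rightarrow>\<^sub>0 'k) = mon 1"
    and "reassoc kC2 = \<one>\<^bsub>T3 (kC2 :: ('k, _) quasi_hopf)\<^esub>" "alpha kC2 = \<one>\<^bsub>kC2 :: ('k, _) quasi_hopf\<^esub>" "beta kC2 = \<one>\<^bsub>kC2 :: ('k, _) quasi_hopf\<^esub>"
proof -
  let ?A = "kC2_alg :: ('k, int \<Rightarrow>\<^sub>0 'k) module" and ?z = "mon 1 :: int \<Rightarrow>\<^sub>0 'k"
  interpret A: tensor_powers ?A using k_algebra_kC2 by (simp add: tensor_powers_def)
  have s: "carrier (kC2 :: ('k, _) quasi_hopf) = carrier ?A" "monoid.mult (kC2 :: ('k, _) quasi_hopf) = monoid.mult ?A"
    "monoid.one (kC2 :: ('k, _) quasi_hopf) = monoid.one ?A"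
    using same_kC2[where ?'a = 'k] by (simp_all add: same_algebra_def)
  have z: "?z \<in> carrier ?A" "?z \<otimes>\<^bsub>?A\<^esub> ?z = \<one>\<^bsub>?A\<^esub>"
    by (simp_all add: kC2_alg_def)
  show "?z \<in> carrier kC2" "?z \<otimes>\<^bsub>kC2\<^esub> ?z = \<one>\<^bsub>kC2\<^esub>" using z s by simp_all
  have oneA: "\<one>\<^bsub>?A\<^esub> = mon 0" by (simp add: kC2_alg_def)
  have g: "generated_by ?A {?z}"
    unfolding generated_by_def
  proof (intro conjI, use z in simp, rule subsetI)
    fix u assume "u \<in> carrier ?A"
    then have "Poly_Mapping.keys u \<subseteq> {0, 1}" by (simp add: kC2_alg_def C2_carrier)
    then show "u \<in> alg_gen ?A {?z}"
    proof (induction u rule: poly_mapping_span_induct)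
      case zero
      have "0 \<odot>\<^bsub>?A\<^esub> \<one>\<^bsub>?A\<^esub> \<in> alg_gen ?A {?z}" by (intro alg_gen.intros)
      then have "\<zero>\<^bsub>?A\<^esub> \<in> alg_gen ?A {?z}" by (simp only: A.smult_0 A.one_closed)
      then show ?case by (simp add: kC2_alg_def)
    next
      case (single m c)
      have "mon m \<in> alg_gen ?A {?z}"
        using single alg_gen.gen[of ?z "{?z}" ?A] alg_gen.unit[of ?A "{?z}"] oneA by auto
      then have "c \<odot>\<^bsub>?A\<^esub> mon m \<in> alg_gen ?A {?z}" by (rule alg_gen.smult)
      then show ?case by (simp add: kC2_alg_def)
    next
      case (add f g)
      then show ?case using alg_gen.add[of f ?A "{?z}" g] by (simp add: kC2_alg_def)
    qed
  qed
  show "generated_by (kC2 :: ('k, _) quasi_hopf) {?z}"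
    by (rule generated_same[OF same_algebra_sym[OF same_kC2] g])
  note same = alg_hom_same[OF same_kC2[where ?'a = 'k] same_algebra_refl]
  let ?D = "\<lambda>g. t2 ?A (mon g) (mon g)" and ?S = "\<lambda>g. mon (inv\<^bsub>C2\<^esub> g) :: int \<Rightarrow>\<^sub>0 'k"
  have D: "lin_ext (T2 ?A) ?D \<in> alg_hom ?A (T2 ?A)" "lin_ext (T2 ?A) ?D ?z = t2 ?A ?z ?z"
    using kC2_lift[OF A.k_algebra_T2, of "t2 ?A ?z ?z" ?D] z same[of "T2 ?A"] A.t2_one oneA by simp_all
  have E: "lin_ext scalars (\<lambda>g. 1) \<in> alg_hom ?A scalars" "lin_ext scalars (\<lambda>g. 1) ?z = 1"
    using kC2_lift[OF k_algebra_scalars, of "1 :: 'k" "\<lambda>g. 1"] same[of "scalars :: ('k, 'k) module"] by simp_all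
  have inv: "inv\<^bsub>C2\<^esub> 0 = 0" "inv\<^bsub>C2\<^esub> 1 = 1"
    by (subst inv_integer_mod_group; simp add: C2_carrier)+
  have S: "lin_ext ?A ?S \<in> alg_hom ?A (op_alg ?A)" "lin_ext ?A ?S ?z = ?z"
    using kC2_lift[OF k_algebra_op[OF A.k_alg], of ?z ?S] z same[of "op_alg ?A"] oneA inv by (simp_all add: lin_ext_op)
  show "pre_quasi_hopf (kC2 :: ('k, _) quasi_hopf)"
    unfolding kC2_def group_hopf_def Let_def kC2_alg_def[symmetric]
    by (intro pre_quasi_hopf_structureI A.k_alg D E S)
  show "comult kC2 ?z = t2 kC2 ?z ?z" "counit kC2 ?z = 1" "antipode kC2 ?z = ?z"
    unfolding tensor_powers_same[OF same_kC2]
    unfolding kC2_def group_hopf_def Let_def kC2_alg_def[symmetric] with_structure_simps by (rule D E S)+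
  show "reassoc kC2 = \<one>\<^bsub>T3 (kC2 :: ('k, _) quasi_hopf)\<^esub>" "alpha kC2 = \<one>\<^bsub>kC2 :: ('k, _) quasi_hopf\<^esub>" "beta kC2 = \<one>\<^bsub>kC2 :: ('k, _) quasi_hopf\<^esub>"
    unfolding tensor_powers_same[OF same_kC2]
    unfolding kC2_def group_hopf_def Let_def kC2_alg_def[symmetric] with_structure_simps by (rule refl)+
qed

section \<open>The algebras $H_4$ and $H_q(8)$\<close>

lemma (in tensor_powers) involution_idempotents:
  assumes g: "g \<in> carrier A" "g \<otimes> g = \<one>" and x: "x \<in> carrier A" "x \<otimes> g = \<ominus> (g \<otimes> x)" and two: "(2::'k) \<noteq> 0"
  shows "idempotent_pair A ((1 / 2) \<odot> (\<one> \<oplus> g)) ((1 / 2) \<odot> (\<one> \<ominus> g)) x"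
    and "(1 / 2) \<odot> (\<one> \<oplus> g) \<ominus> (1 / 2) \<odot> (\<one> \<ominus> g) = g"
proof -
  have h: "1 / 2 + 1 / 2 = (1::'k)" "1 / 4 + 1 / 4 = (1 / 2 :: 'k)" "1 / 2 + - (1 / 2) = (0::'k)" "2 / 4 = (1 / 2 :: 'k)"
  proof -
    have "(4::'k) = 2 * 2" by simp
    then have "(4::'k) \<noteq> 0" using two by (metis mult_eq_0_iff)
    then show "1 / 2 + 1 / 2 = (1::'k)" "1 / 4 + 1 / 4 = (1 / 2 :: 'k)" "1 / 2 + - (1 / 2) = (0::'k)" "2 / 4 = (1 / 2 :: 'k)" using two by (simp_all add: field_simps)
  qed
  let ?h = "1 / 2 :: 'k"
  have e: "?h \<odot> (\<one> \<oplus> g) = ?h \<odot> \<one> \<oplus> ?h \<odot> g" and f: "?h \<odot> (\<one> \<ominus> g) = ?h \<odot> \<one> \<oplus> (- ?h) \<odot> g"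
    using g by (simp_all add: smult_add_right diff_smult)
  have c4: "(a \<oplus> b) \<oplus> (a' \<oplus> b') = (a \<oplus> a') \<oplus> (b \<oplus> b')" if "a \<in> carrier A" "b \<in> carrier A" "a' \<in> carrier A" "b' \<in> carrier A" for a b a' b'
    using that by (simp add: a_ac)
  have lin: "(a \<odot> \<one> \<oplus> b \<odot> g) \<oplus> (c \<odot> \<one> \<oplus> d \<odot> g) = (a + c) \<odot> \<one> \<oplus> (b + d) \<odot> g" for a b c d
    using g by (subst c4) (simp_all add: smult_add_left)
  have mul: "(a \<odot> \<one> \<oplus> b \<odot> g) \<otimes> (c \<odot> \<one> \<oplus> d \<odot> g) = (a * c + b * d) \<odot> \<one> \<oplus> (a * d + b * c) \<odot> g" for a b c d
  proof -
    have "(a \<odot> \<one> \<oplus> b \<odot> g) \<otimes> (c \<odot> \<one> \<oplus> d \<odot> g) = ((a * c) \<odot> \<one> \<oplus> (a * d) \<odot> g) \<oplus> ((b * d) \<odot> \<one> \<oplus> (b * c) \<odot> g)"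
      using g by (simp add: l_distr r_distr smult_add_right a_ac mult.commute)
    then show ?thesis by (simp add: lin)
  qed
  have xs: "x \<otimes> (a \<odot> \<one> \<oplus> b \<odot> g) = (a \<odot> \<one> \<oplus> (- b) \<odot> g) \<otimes> x" for a b
    using g x by (simp add: l_distr r_distr minus_smult)
  show "idempotent_pair A (?h \<odot> (\<one> \<oplus> g)) (?h \<odot> (\<one> \<ominus> g)) x"
    unfolding e f
    by (intro idempotent_pair.intro idempotent_pair_axioms.intro tensor_powers_axioms)
      (use g x two in \<open>simp_all add: lin mul xs h(4)\<close>)
  show "?h \<odot> (\<one> \<oplus> g) \<ominus> ?h \<odot> (\<one> \<ominus> g) = g"
  proof -
    have "?h \<odot> (\<one> \<oplus> g) \<ominus> ?h \<odot> (\<one> \<ominus> g) = (?h \<odot> \<one> \<oplus> ?h \<odot> g) \<oplus> ((- ?h) \<odot> \<one> \<oplus> ?h \<odot> g)"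
      unfolding e f using g by (simp add: diff_smult smult_add_right)
    then show ?thesis using g h by (simp only: lin) simp
  qed
qed

lemma (in idempotent_pair) half_defect:
  assumes two: "(2::'k) \<noteq> 0"
  shows "(1 / 2) \<odot>\<^bsub>T2 A\<^esub> (t2 A \<one> \<one> \<oplus>\<^bsub>T2 A\<^esub> (-1) \<odot>\<^bsub>T2 A\<^esub> t2 A (e \<ominus> f) (e \<ominus> f)) = t2 A e f \<oplus>\<^bsub>T2 A\<^esub> t2 A f e"
  by (rule T2_eq_idem; (elim insertE emptyE)?)
    (use two in \<open>simp_all add: e_minus_f t2_distrib T2.r_distr T2.smult_add_right T2.smult_collect r_distr\<close>)

definition quartic :: "'k::field \<Rightarrow> bool" where
  "quartic q \<longleftrightarrow> q * q = - 1 \<and> (2::'k) \<noteq> 0"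

lemma generated_idempotent:
  assumes "k_algebra A" and g: "g \<in> carrier A" and gen: "generated_by A (insert g Y)" and two: "(2::'k::field) \<noteq> 0"
  shows "generated_by (A :: ('k, 'a, 'm) module_scheme) (insert ((1 / 2) \<odot>\<^bsub>A\<^esub> (\<one>\<^bsub>A\<^esub> \<ominus>\<^bsub>A\<^esub> g)) Y)"
proof -
  interpret A: kalg A using assms by simp
  let ?f = "(1 / 2) \<odot>\<^bsub>A\<^esub> (\<one>\<^bsub>A\<^esub> \<ominus>\<^bsub>A\<^esub> g)"
  have "\<one>\<^bsub>A\<^esub> \<oplus>\<^bsub>A\<^esub> (-2) \<odot>\<^bsub>A\<^esub> ?f = \<one>\<^bsub>A\<^esub> \<oplus>\<^bsub>A\<^esub> (-1) \<odot>\<^bsub>A\<^esub> (\<one>\<^bsub>A\<^esub> \<oplus>\<^bsub>A\<^esub> (-1) \<odot>\<^bsub>A\<^esub> g)"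
    using g two by (simp add: A.diff_smult)
  also have "\<dots> = g" using g by (simp add: A.smult_add_right A.a_assoc[symmetric] A.smult_collect)
  finally have "g \<in> alg_gen A (insert ?f Y)"
    using alg_gen.add[OF alg_gen.unit alg_gen.smult[OF alg_gen.gen[of ?f "insert ?f Y" A], of "-2"]] by simp
  then show ?thesis
    by (intro generated_mono[OF A.k_alg gen]) (use gen g in \<open>auto simp: generated_by_def intro: alg_gen.gen\<close>)
qed

context
  fixes q :: "'k::field"
  assumes q: "quartic q"
begin

interpretation N: nil_alg 4 "TYPE('k)" by unfold_locales simp

abbreviation (input) "P8 \<equiv> nil_alg.P 4 :: ('k, (gen list \<Rightarrow>\<^sub>0 'k) set) module"
abbreviation (input) "g8 \<equiv> nil_alg.g 4 :: (gen list \<Rightarrow>\<^sub>0 'k) set"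
abbreviation (input) "x8 \<equiv> nil_alg.x 4 :: (gen list \<Rightarrow>\<^sub>0 'k) set"
abbreviation (input) "e8 \<equiv> (1 / 2) \<odot>\<^bsub>P8\<^esub> (\<one>\<^bsub>P8\<^esub> \<oplus>\<^bsub>P8\<^esub> g8)"
abbreviation (input) "f8 \<equiv> (1 / 2) \<odot>\<^bsub>P8\<^esub> (\<one>\<^bsub>P8\<^esub> \<ominus>\<^bsub>P8\<^esub> g8)"

lemma same_H8: "same_algebra (H8 q) P8"
  unfolding H8_def Let_def H8_rels_nil N.P_def by (rule same_algebra_structure)

lemma H8_core: "qh_core (H8 q) e8 f8 x8 q" and H8_minus: "f8 = (1 / 2) \<odot>\<^bsub>H8 q\<^esub> (\<one>\<^bsub>H8 q\<^esub> \<ominus>\<^bsub>H8 q\<^esub> g8)"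
  and H8_generated: "generated_by (H8 q) {f8, x8}" and H8_e_minus_f: "e8 \<ominus>\<^bsub>H8 q\<^esub> f8 = g8"
  and comult_g8: "comult (H8 q) g8 = t2 (H8 q) g8 g8"
proof -
  have qq: "q * q = - 1" and two: "(2::'k) \<noteq> 0" using q by (simp_all add: quartic_def)
  interpret A: tensor_powers P8 using N.k_alg by (simp add: tensor_powers_def)
  note ii = A.involution_idempotents[OF N.closed(1) N.relations(1) N.closed(2) N.relations(3) two]
  interpret I: idempotent_pair P8 e8 f8 x8 by (rule ii(1))
  have ef: "e8 \<ominus>\<^bsub>P8\<^esub> f8 = g8" by (rule ii(2))
  have x4: "x8 [^]\<^bsub>P8\<^esub> (4::nat) = \<zero>\<^bsub>P8\<^esub>" using N.relations(2) by simp
  note s = same_H8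
  have s': "carrier (H8 q) = carrier P8" "monoid.mult (H8 q) = monoid.mult P8" "monoid.one (H8 q) = monoid.one P8"
    "ring.zero (H8 q) = ring.zero P8" "ring.add (H8 q) = ring.add P8" "module.smult (H8 q) = module.smult P8"
    using s by (simp_all add: same_algebra_def)
  have min: "\<ominus>\<^bsub>H8 q\<^esub> a = \<ominus>\<^bsub>P8\<^esub> a" "a \<ominus>\<^bsub>H8 q\<^esub> b = a \<ominus>\<^bsub>P8\<^esub> b" for a b
    by (simp_all add: a_minus_def a_inv_def m_inv_def s')
  let ?D = "\<lambda>s. case s of Gen_g \<Rightarrow> t2 P8 g8 g8 | Gen_x \<Rightarrow> t2 P8 x8 (e8 \<oplus>\<^bsub>P8\<^esub> q \<odot>\<^bsub>P8\<^esub> f8) \<oplus>\<^bsub>T2 P8\<^esub> t2 P8 \<one>\<^bsub>P8\<^esub> (e8 \<otimes>\<^bsub>P8\<^esub> x8)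
                 \<oplus>\<^bsub>T2 P8\<^esub> t2 P8 g8 (f8 \<otimes>\<^bsub>P8\<^esub> x8)"
  let ?E = "\<lambda>s. case s of Gen_g \<Rightarrow> 1 | Gen_x \<Rightarrow> (0 :: 'k)"
  let ?S = "\<lambda>s. case s of Gen_g \<Rightarrow> g8 | Gen_x \<Rightarrow> \<ominus>\<^bsub>P8\<^esub> (x8 \<otimes>\<^bsub>P8\<^esub> (e8 \<oplus>\<^bsub>P8\<^esub> q \<odot>\<^bsub>P8\<^esub> f8))"
  have H8_eq: "H8 q = with_structure P8 (pres_lift (T2 P8) ?D) (pres_lift scalars ?E)
      (\<one>\<^bsub>T3 P8\<^esub> \<ominus>\<^bsub>T3 P8\<^esub> (2 \<odot>\<^bsub>T3 P8\<^esub> t3 P8 f8 f8 f8)) (pres_lift (op_alg P8) ?S) g8 \<one>\<^bsub>P8\<^esub>"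
    unfolding H8_def Let_def H8_rels_nil N.P_def N.g_def N.x_def ..
  have Dx: "?D Gen_x = I.dx q" unfolding I.dx_def ef by simp
  have gc: "t2 P8 g8 g8 \<otimes>\<^bsub>T2 P8\<^esub> t2 P8 g8 g8 = \<one>\<^bsub>T2 P8\<^esub>"
    by (simp add: N.relations(1) A.t2_one)
  have D: "pres_lift (T2 P8) ?D \<in> alg_hom P8 (T2 P8)" "pres_lift (T2 P8) ?D g8 = t2 P8 g8 g8" "pres_lift (T2 P8) ?D x8 = I.dx q"
  proof -
    have c: "?D s \<in> carrier (T2 P8)" for s by (cases s) simp_all
    have r: "?D Gen_g \<otimes>\<^bsub>T2 P8\<^esub> ?D Gen_g = \<one>\<^bsub>T2 P8\<^esub>" "?D Gen_x [^]\<^bsub>T2 P8\<^esub> (4::nat) = \<zero>\<^bsub>T2 P8\<^esub>"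
      "?D Gen_g \<otimes>\<^bsub>T2 P8\<^esub> ?D Gen_x \<oplus>\<^bsub>T2 P8\<^esub> ?D Gen_x \<otimes>\<^bsub>T2 P8\<^esub> ?D Gen_g = \<zero>\<^bsub>T2 P8\<^esub>"
      unfolding Dx gen.case(1) using gc I.dx_power[OF qq x4, unfolded ef] by blast+
    show "pres_lift (T2 P8) ?D \<in> alg_hom P8 (T2 P8)" "pres_lift (T2 P8) ?D g8 = t2 P8 g8 g8" "pres_lift (T2 P8) ?D x8 = I.dx q"
      using N.lift[OF A.k_algebra_T2 c r] unfolding Dx gen.case(1) by blast+
  qed
  have E: "pres_lift scalars ?E \<in> alg_hom P8 scalars" "pres_lift scalars ?E g8 = 1" "pres_lift scalars ?E x8 = 0"
    using N.lift[OF k_algebra_scalars, of ?E] by (simp_all add: numeral_eq_Suc)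
  have S: "pres_lift (op_alg P8) ?S \<in> alg_hom P8 (op_alg P8)" "pres_lift (op_alg P8) ?S g8 = g8"
    "pres_lift (op_alg P8) ?S x8 = \<ominus>\<^bsub>P8\<^esub> (x8 \<otimes>\<^bsub>P8\<^esub> (e8 \<oplus>\<^bsub>P8\<^esub> q \<odot>\<^bsub>P8\<^esub> f8))"
  proof -
    let ?y = "\<ominus>\<^bsub>P8\<^esub> (x8 \<otimes>\<^bsub>P8\<^esub> (e8 \<oplus>\<^bsub>P8\<^esub> q \<odot>\<^bsub>P8\<^esub> f8))"
    have y: "?y \<in> carrier P8" by simp
    have c: "?S s \<in> carrier (op_alg P8)" for s using y by (cases s) simp_all
    have r: "?S Gen_g \<otimes>\<^bsub>op_alg P8\<^esub> ?S Gen_g = \<one>\<^bsub>op_alg P8\<^esub>" "?S Gen_x [^]\<^bsub>op_alg P8\<^esub> (4::nat) = \<zero>\<^bsub>op_alg P8\<^esub>"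
      "?S Gen_g \<otimes>\<^bsub>op_alg P8\<^esub> ?S Gen_x \<oplus>\<^bsub>op_alg P8\<^esub> ?S Gen_x \<otimes>\<^bsub>op_alg P8\<^esub> ?S Gen_g = \<zero>\<^bsub>op_alg P8\<^esub>"
      unfolding gen.case op_alg_simps op_pow[OF N.k_alg y]
      using N.relations(1) I.antipode_power[OF qq x4, unfolded ef] by blast+
    show "pres_lift (op_alg P8) ?S \<in> alg_hom P8 (op_alg P8)" "pres_lift (op_alg P8) ?S g8 = g8" "pres_lift (op_alg P8) ?S x8 = ?y"
      using N.lift[OF k_algebra_op[OF N.k_alg] c r] unfolding gen.case by blast+
  qed
  have pre: "pre_quasi_hopf (H8 q)"
    unfolding H8_eq by (intro pre_quasi_hopf_structureI N.k_alg D(1) E(1) S(1))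
  show f: "f8 = (1 / 2) \<odot>\<^bsub>H8 q\<^esub> (\<one>\<^bsub>H8 q\<^esub> \<ominus>\<^bsub>H8 q\<^esub> g8)" by (simp only: s' min)
  show efH: "e8 \<ominus>\<^bsub>H8 q\<^esub> f8 = g8" by (simp only: min ef)
  show "generated_by (H8 q) {f8, x8}"
    by (rule generated_same[OF same_algebra_sym[OF s] generated_idempotent[OF N.k_alg N.closed(1) N.generated two]])
  show "comult (H8 q) g8 = t2 (H8 q) g8 g8"
    unfolding tensor_powers_same[OF s] unfolding H8_eq with_structure_simps by (rule D)
  interpret H: pre_qh "H8 q" using pre by unfold_locales
  have IH: "idempotent_pair (H8 q) e8 f8 x8"
    by (intro idempotent_pair.intro H.tensor_powers_axioms idempotent_pair_axioms.intro)
      (simp_all only: s' I.ec I.fc I.xc I.ef_one I.ee I.ff I.ef I.fe I.xe I.xf)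
  interpret IH: idempotent_pair "H8 q" e8 f8 x8 by (rule IH)
  have Df: "pres_lift (T2 P8) ?D f8 = t2 P8 e8 f8 \<oplus>\<^bsub>T2 P8\<^esub> t2 P8 f8 e8"
  proof -
    have "pres_lift (T2 P8) ?D f8 = (1 / 2) \<odot>\<^bsub>T2 P8\<^esub> (t2 P8 \<one>\<^bsub>P8\<^esub> \<one>\<^bsub>P8\<^esub> \<oplus>\<^bsub>T2 P8\<^esub> (-1) \<odot>\<^bsub>T2 P8\<^esub> t2 P8 (e8 \<ominus>\<^bsub>P8\<^esub> f8) (e8 \<ominus>\<^bsub>P8\<^esub> f8))"
      unfolding ef using alg_homD[OF D(1)] D(2) by (simp add: N.diff_smult A.t2_one)
    also have "\<dots> = t2 P8 e8 f8 \<oplus>\<^bsub>T2 P8\<^esub> t2 P8 f8 e8"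
      by (rule I.half_defect[OF two])
    finally show ?thesis .
  qed
  have fval: "F f8 = (1 / 2) \<odot>\<^bsub>C\<^esub> (\<one>\<^bsub>C\<^esub> \<oplus>\<^bsub>C\<^esub> (-1) \<odot>\<^bsub>C\<^esub> F g8)" if "F \<in> alg_hom P8 C" for F and C :: "('k, 'c, 'd) module_scheme"
    using alg_homD[OF that] by (simp add: N.diff_smult)
  show "qh_core (H8 q) e8 f8 x8 q"
  proof (intro qh_core.intro qh_core_axioms.intro IH qq)
    show "pre_qh (H8 q)" by (rule H.pre_qh_axioms)
    show "comult (H8 q) f8 = t2 (H8 q) e8 f8 \<oplus>\<^bsub>T2 (H8 q)\<^esub> t2 (H8 q) f8 e8"
      unfolding tensor_powers_same[OF s] unfolding H8_eq with_structure_simps by (rule Df)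
    show "comult (H8 q) x8 = IH.dx q"
      unfolding IH.dx_def tensor_powers_same[OF s] s' efH
      unfolding H8_eq with_structure_simps D(3) I.dx_def ef ..
    show "counit (H8 q) f8 = 0"
      unfolding H8_eq with_structure_simps using fval[OF E(1)] E(2) by simp
    show "counit (H8 q) x8 = 0" unfolding H8_eq with_structure_simps by (rule E)
    have "pres_lift (op_alg P8) ?S f8 = f8" using fval[OF S(1)] S(2) by (simp add: N.diff_smult)
    then show "antipode (H8 q) f8 = f8" unfolding H8_eq with_structure_simps .
    show "antipode (H8 q) x8 = \<ominus>\<^bsub>H8 q\<^esub> (x8 \<otimes>\<^bsub>H8 q\<^esub> (e8 \<oplus>\<^bsub>H8 q\<^esub> q \<odot>\<^bsub>H8 q\<^esub> f8))"
      unfolding min s' unfolding H8_eq with_structure_simps by (rule S)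
    show "reassoc (H8 q) = \<one>\<^bsub>T3 (H8 q)\<^esub> \<ominus>\<^bsub>T3 (H8 q)\<^esub> 2 \<odot>\<^bsub>T3 (H8 q)\<^esub> t3 (H8 q) f8 f8 f8"
      unfolding tensor_powers_same[OF s] unfolding H8_eq with_structure_simps ..
    show "alpha (H8 q) = e8 \<ominus>\<^bsub>H8 q\<^esub> f8" unfolding efH unfolding H8_eq with_structure_simps ..
    show "beta (H8 q) = \<one>\<^bsub>H8 q\<^esub>" unfolding s' unfolding H8_eq with_structure_simps ..
  qed
qed

end

lemma sweedler_facts:
  fixes g x :: "(gen list \<Rightarrow>\<^sub>0 'k::field) set"
  defines "g \<equiv> nil_alg.g 2" and "x \<equiv> nil_alg.x 2"
  shows "same_algebra sweedler (nil_alg.P 2 :: ('k, _) module)" "pre_quasi_hopf (sweedler :: ('k, _) quasi_hopf)"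
    and "generated_by sweedler {g, x}"
    and "comult sweedler g = t2 sweedler g g"
    and "comult sweedler x = t2 sweedler g x \<oplus>\<^bsub>T2 (sweedler :: ('k, _) quasi_hopf)\<^esub> t2 sweedler x \<one>\<^bsub>sweedler\<^esub>"
    and "counit sweedler g = 1" "counit sweedler x = 0" "antipode sweedler g = g"
    and "antipode sweedler x = \<ominus>\<^bsub>sweedler :: ('k, _) quasi_hopf\<^esub> (g \<otimes>\<^bsub>sweedler\<^esub> x)"
    and "reassoc sweedler = \<one>\<^bsub>T3 (sweedler :: ('k, _) quasi_hopf)\<^esub>" "alpha sweedler = \<one>\<^bsub>sweedler :: ('k, _) quasi_hopf\<^esub>" "beta sweedler = \<one>\<^bsub>sweedler :: ('k, _) quasi_hopf\<^esub>"
    and "g \<in> carrier sweedler" "x \<in> carrier sweedler" "g \<otimes>\<^bsub>sweedler\<^esub> g = \<one>\<^bsub>sweedler\<^esub>" "x \<otimes>\<^bsub>sweedler\<^esub> x = \<zero>\<^bsub>sweedler\<^esub>"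
    and "x \<otimes>\<^bsub>sweedler\<^esub> g = (-1) \<odot>\<^bsub>sweedler :: ('k, _) quasi_hopf\<^esub> (g \<otimes>\<^bsub>sweedler\<^esub> x)"
proof -
  interpret N: nil_alg 2 "TYPE('k)" by unfold_locales simp
  let ?P = "N.P"
  interpret A: tensor_powers ?P using N.k_alg by (simp add: tensor_powers_def)
  have gx: "g = N.g" "x = N.x" by (simp_all add: g_def x_def)
  note cl = N.closed[folded gx] and rel = N.relations[folded gx]
  have xx: "x \<otimes>\<^bsub>?P\<^esub> x = \<zero>\<^bsub>?P\<^esub>" using rel(2) cl by (simp add: N.pow_2)
  have xg: "x \<otimes>\<^bsub>?P\<^esub> g = (-1) \<odot>\<^bsub>?P\<^esub> (g \<otimes>\<^bsub>?P\<^esub> x)" using rel(3) cl by (simp add: N.minus_smult)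
  have gg: "g \<otimes>\<^bsub>?P\<^esub> g = \<one>\<^bsub>?P\<^esub>" by (rule rel)
  have left: "g \<otimes>\<^bsub>?P\<^esub> (g \<otimes>\<^bsub>?P\<^esub> w) = w" "x \<otimes>\<^bsub>?P\<^esub> (x \<otimes>\<^bsub>?P\<^esub> w) = \<zero>\<^bsub>?P\<^esub>"
    "x \<otimes>\<^bsub>?P\<^esub> (g \<otimes>\<^bsub>?P\<^esub> w) = (-1) \<odot>\<^bsub>?P\<^esub> (g \<otimes>\<^bsub>?P\<^esub> (x \<otimes>\<^bsub>?P\<^esub> w))" if "w \<in> carrier ?P" for w
    using that cl by (simp_all add: N.m_assoc[symmetric] gg xx xg)
  let ?X = "t2 ?P g x \<oplus>\<^bsub>T2 ?P\<^esub> t2 ?P x \<one>\<^bsub>?P\<^esub>"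
  let ?D = "\<lambda>s. case s of Gen_g \<Rightarrow> t2 ?P g g | Gen_x \<Rightarrow> ?X"
  let ?E = "\<lambda>s. case s of Gen_g \<Rightarrow> 1 | Gen_x \<Rightarrow> (0 :: 'k)"
  let ?S = "\<lambda>s. case s of Gen_g \<Rightarrow> g | Gen_x \<Rightarrow> \<ominus>\<^bsub>?P\<^esub> (g \<otimes>\<^bsub>?P\<^esub> x)"
  have eq: "sweedler = with_structure ?P (pres_lift (T2 ?P) ?D) (pres_lift scalars ?E) \<one>\<^bsub>T3 ?P\<^esub> (pres_lift (op_alg ?P) ?S) \<one>\<^bsub>?P\<^esub> \<one>\<^bsub>?P\<^esub>"
    unfolding sweedler_def Let_def sweedler_rels_nil N.P_def gx N.g_def N.x_def ..
  show s: "same_algebra sweedler ?P" unfolding eq by (rule same_algebra_structure)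
  have s': "carrier sweedler = carrier ?P" "monoid.mult sweedler = monoid.mult ?P" "monoid.one sweedler = monoid.one ?P"
    "ring.zero sweedler = ring.zero ?P" "ring.add sweedler = ring.add ?P" "module.smult sweedler = module.smult ?P"
    using s by (simp_all add: same_algebra_def)
  have min: "\<ominus>\<^bsub>sweedler\<^esub> a = \<ominus>\<^bsub>?P\<^esub> a" for a
    by (simp_all add: a_minus_def a_inv_def m_inv_def s')
  have D: "pres_lift (T2 ?P) ?D \<in> alg_hom ?P (T2 ?P)" "pres_lift (T2 ?P) ?D g = t2 ?P g g" "pres_lift (T2 ?P) ?D x = ?X"
  proof -
    have c: "?D s \<in> carrier (T2 ?P)" for s using cl by (cases s) simp_all
    have Xc: "?X \<in> carrier (T2 ?P)" using cl by simp
    have 1: "t2 ?P g g \<otimes>\<^bsub>T2 ?P\<^esub> t2 ?P g g = \<one>\<^bsub>T2 ?P\<^esub>" using cl by (simp add: gg A.t2_one)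
    have 2: "?X [^]\<^bsub>T2 ?P\<^esub> (2::nat) = \<zero>\<^bsub>T2 ?P\<^esub>"
      unfolding A.T2.pow_2[OF Xc]
      using cl by (simp add: A.T2.l_distr A.T2.r_distr gg xx xg A.t2_distrib A.T2.smult_collect)
    have 3: "t2 ?P g g \<otimes>\<^bsub>T2 ?P\<^esub> ?X \<oplus>\<^bsub>T2 ?P\<^esub> ?X \<otimes>\<^bsub>T2 ?P\<^esub> t2 ?P g g = \<zero>\<^bsub>T2 ?P\<^esub>"
    proof -
      have a: "t2 ?P g g \<otimes>\<^bsub>T2 ?P\<^esub> ?X = t2 ?P \<one>\<^bsub>?P\<^esub> (g \<otimes>\<^bsub>?P\<^esub> x) \<oplus>\<^bsub>T2 ?P\<^esub> t2 ?P (g \<otimes>\<^bsub>?P\<^esub> x) g"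
        using cl by (simp add: A.T2.r_distr gg)
      have b: "?X \<otimes>\<^bsub>T2 ?P\<^esub> t2 ?P g g = (-1) \<odot>\<^bsub>T2 ?P\<^esub> (t2 ?P \<one>\<^bsub>?P\<^esub> (g \<otimes>\<^bsub>?P\<^esub> x) \<oplus>\<^bsub>T2 ?P\<^esub> t2 ?P (g \<otimes>\<^bsub>?P\<^esub> x) g)"
        using cl by (simp add: A.T2.l_distr gg xg A.t2_distrib A.T2.smult_add_right)
      show ?thesis unfolding a b using cl by (simp add: A.T2.smult_collect del: A.T2.smult_add_right)
    qed
    show "pres_lift (T2 ?P) ?D \<in> alg_hom ?P (T2 ?P)" "pres_lift (T2 ?P) ?D g = t2 ?P g g" "pres_lift (T2 ?P) ?D x = ?X"
      using N.lift[where f = ?D, OF A.k_algebra_T2 c, unfolded gen.case, OF 1 2 3] unfolding gx by blast+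
  qed
  have E: "pres_lift scalars ?E \<in> alg_hom ?P scalars" "pres_lift scalars ?E g = 1" "pres_lift scalars ?E x = 0"
    using N.lift[OF k_algebra_scalars, of ?E] unfolding gx by (simp_all add: numeral_eq_Suc)
  have S: "pres_lift (op_alg ?P) ?S \<in> alg_hom ?P (op_alg ?P)" "pres_lift (op_alg ?P) ?S g = g"
    "pres_lift (op_alg ?P) ?S x = \<ominus>\<^bsub>?P\<^esub> (g \<otimes>\<^bsub>?P\<^esub> x)"
  proof -
    let ?y = "\<ominus>\<^bsub>?P\<^esub> (g \<otimes>\<^bsub>?P\<^esub> x)"
    have y: "?y \<in> carrier ?P" "?y = (-1) \<odot>\<^bsub>?P\<^esub> (g \<otimes>\<^bsub>?P\<^esub> x)" using cl by (simp_all add: N.minus_smult)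
    have c: "?S s \<in> carrier (op_alg ?P)" for s using y(1) cl by (cases s) simp_all
    have 1: "g \<otimes>\<^bsub>op_alg ?P\<^esub> g = \<one>\<^bsub>op_alg ?P\<^esub>" by (simp add: gg)
    have 2: "?y [^]\<^bsub>op_alg ?P\<^esub> (2::nat) = \<zero>\<^bsub>op_alg ?P\<^esub>"
      unfolding op_pow[OF N.k_alg y(1)] N.pow_2[OF y(1)] op_alg_simps unfolding y(2)
      using cl by (simp add: N.m_assoc left xx)
    have 3: "g \<otimes>\<^bsub>op_alg ?P\<^esub> ?y \<oplus>\<^bsub>op_alg ?P\<^esub> ?y \<otimes>\<^bsub>op_alg ?P\<^esub> g = \<zero>\<^bsub>op_alg ?P\<^esub>"
      unfolding op_alg_simps y(2)
      using cl by (simp add: N.m_assoc left xg N.smult_collect)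
    show "pres_lift (op_alg ?P) ?S \<in> alg_hom ?P (op_alg ?P)" "pres_lift (op_alg ?P) ?S g = g" "pres_lift (op_alg ?P) ?S x = ?y"
      using N.lift[where f = ?S, OF k_algebra_op[OF N.k_alg] c, unfolded gen.case, OF 1 2 3] unfolding gx by blast+
  qed
  show "pre_quasi_hopf (sweedler :: ('k, _) quasi_hopf)"
    unfolding eq by (intro pre_quasi_hopf_structureI N.k_alg D(1) E(1) S(1))
  show "generated_by sweedler {g, x}"
    unfolding gx by (rule generated_same[OF same_algebra_sym[OF s] N.generated])
  show "comult sweedler g = t2 sweedler g g"
    unfolding tensor_powers_same[OF s] unfolding eq with_structure_simps by (rule D)
  show "comult sweedler x = t2 sweedler g x \<oplus>\<^bsub>T2 (sweedler :: ('k, _) quasi_hopf)\<^esub> t2 sweedler x \<one>\<^bsub>sweedler\<^esub>"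
    unfolding tensor_powers_same[OF s] s' unfolding eq with_structure_simps by (rule D)
  show "counit sweedler g = 1" "counit sweedler x = 0" "antipode sweedler g = g"
    unfolding eq with_structure_simps by (rule E S)+
  show "antipode sweedler x = \<ominus>\<^bsub>sweedler :: ('k, _) quasi_hopf\<^esub> (g \<otimes>\<^bsub>sweedler\<^esub> x)"
    unfolding min s' unfolding eq with_structure_simps by (rule S)
  show "reassoc sweedler = \<one>\<^bsub>T3 (sweedler :: ('k, _) quasi_hopf)\<^esub>" "alpha sweedler = \<one>\<^bsub>sweedler :: ('k, _) quasi_hopf\<^esub>" "beta sweedler = \<one>\<^bsub>sweedler :: ('k, _) quasi_hopf\<^esub>"
    unfolding tensor_powers_same[OF s] s' unfolding eq with_structure_simps by (rule refl)+
  show "g \<in> carrier sweedler" "x \<in> carrier sweedler" "g \<otimes>\<^bsub>sweedler\<^esub> g = \<one>\<^bsub>sweedler\<^esub>" "x \<otimes>\<^bsub>sweedler\<^esub> x = \<zero>\<^bsub>sweedler\<^esub>"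
    "x \<otimes>\<^bsub>sweedler\<^esub> g = (-1) \<odot>\<^bsub>sweedler :: ('k, _) quasi_hopf\<^esub> (g \<otimes>\<^bsub>sweedler\<^esub> x)"
    unfolding s' by (rule cl gg xx xg)+
qed

section \<open>The extension by a skew-primitive element\<close>

lemma (in kalg) add_diff_cancel:
  "a \<in> carrier A \<Longrightarrow> b \<in> carrier A \<Longrightarrow> a \<oplus> b \<ominus> a = b"
  "a \<in> carrier A \<Longrightarrow> b \<in> carrier A \<Longrightarrow> a \<oplus> (b \<ominus> a) = b"
proof -
  assume ab: "a \<in> carrier A" "b \<in> carrier A"
  have "a \<oplus> b \<ominus> a = b \<oplus> (a \<oplus> \<ominus> a)" using ab by (simp add: a_minus_def a_comm[of a b] a_assoc)
  then show "a \<oplus> b \<ominus> a = b" using ab by (simp add: r_neg)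
  have "a \<oplus> (b \<ominus> a) = b \<oplus> (\<ominus> a \<oplus> a)"
    unfolding a_minus_def using ab by (subst a_comm) (simp_all add: a_assoc)
  then show "a \<oplus> (b \<ominus> a) = b" using ab by (simp add: l_neg)
qed

text \<open>The relation \<open>\<phi>(h) t = t \<psi>(h)\<close> is multiplicative in \<open>h\<close>, so it suffices on generators. It serves for
  commutation relations as well as for the twisted relation that defines the extension.\<close>

lemma intertwiner:
  assumes H: "k_algebra H" and C: "k_algebra C" and gen: "generated_by H Y" and \<phi>: "\<phi> \<in> alg_hom H C" and \<psi>: "\<psi> \<in> alg_hom H C"
    and t: "t \<in> carrier C" and "\<And>y. y \<in> Y \<Longrightarrow> \<phi> y \<otimes>\<^bsub>C\<^esub> t = t \<otimes>\<^bsub>C\<^esub> \<psi> y" and h: "h \<in> carrier H"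
  shows "\<phi> h \<otimes>\<^bsub>C\<^esub> t = t \<otimes>\<^bsub>C\<^esub> \<psi> h"
proof -
  interpret C: kalg C using C by simp
  note p = alg_homD[OF \<phi>] alg_homD[OF \<psi>]
  show ?thesis using H gen h
  proof (induction h rule: generated_induct)
    case (gen y)
    then show ?case by (rule assms(7))
  next
    case one
    show ?case unfolding p(5,10) using t by simp
  next
    case (add a b)
    show ?case unfolding p(2)[OF add(1,2)] p(7)[OF add(1,2)]
      using add(3,4) p(1)[OF add(1)] p(1)[OF add(2)] p(6)[OF add(1)] p(6)[OF add(2)] t
      by (simp only: C.l_distr C.r_distr)
  next
    case (smult c a)
    show ?case unfolding p(3)[OF smult(1)] p(8)[OF smult(1)]
      using smult(2) p(1)[OF smult(1)] p(6)[OF smult(1)] t by (simp only: C.smult_mult C.mult_smult)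
  next
    case (mult a b)
    note c = p(1)[OF mult(1)] p(1)[OF mult(2)] p(6)[OF mult(1)] p(6)[OF mult(2)] t
    have "\<phi> a \<otimes>\<^bsub>C\<^esub> \<phi> b \<otimes>\<^bsub>C\<^esub> t = \<phi> a \<otimes>\<^bsub>C\<^esub> (t \<otimes>\<^bsub>C\<^esub> \<psi> b)"
      using c by (simp only: C.m_assoc mult(4))
    also have "\<dots> = (t \<otimes>\<^bsub>C\<^esub> \<psi> a) \<otimes>\<^bsub>C\<^esub> \<psi> b"
      unfolding mult(3)[symmetric] using c by (simp only: C.m_assoc C.m_closed)
    also have "\<dots> = t \<otimes>\<^bsub>C\<^esub> (\<psi> a \<otimes>\<^bsub>C\<^esub> \<psi> b)"
      using c by (simp only: C.m_assoc)
    finally show ?case unfolding p(4)[OF mult(1,2)] p(9)[OF mult(1,2)] .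
  qed
qed

lemma lin_ext_word_simps:
  assumes C: "k_algebra C" and f: "f \<in> V \<rightarrow> carrier C"
  shows "w \<in> lists V \<Longrightarrow> lin_ext C (word_eval C f) (Poly_Mapping.single w c) = c \<odot>\<^bsub>C\<^esub> word_eval C f w"
    and "a \<in> carrier (free_alg V) \<Longrightarrow> b \<in> carrier (free_alg V) \<Longrightarrow>
      lin_ext C (word_eval C f) (a - b) = lin_ext C (word_eval C f) a \<ominus>\<^bsub>C\<^esub> lin_ext C (word_eval C f) b"
proof -
  interpret F: kalg "free_alg V" by simp
  show "w \<in> lists V \<Longrightarrow> lin_ext C (word_eval C f) (Poly_Mapping.single w c) = c \<odot>\<^bsub>C\<^esub> word_eval C f w"
    by (rule lin_ext_single[where \<phi> = "word_eval C f", OF C word_eval_closed[OF C f]])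
  assume ab: "a \<in> carrier (free_alg V)" "b \<in> carrier (free_alg V)"
  have "(-1) \<odot>\<^bsub>free_alg V\<^esub> b = - b" by (intro poly_mapping_eqI) (simp add: free_alg_simps)
  then have "a \<ominus>\<^bsub>free_alg V\<^esub> b = a - b" using F.diff_smult[OF ab] by (simp add: free_alg_simps)
  then show "lin_ext C (word_eval C f) (a - b) = lin_ext C (word_eval C f) a \<ominus>\<^bsub>C\<^esub> lin_ext C (word_eval C f) b"
    using linear_map_minus(2)[OF F.k_alg C alg_hom_linear[OF word_eval_alg_hom[OF C f]] ab] by simp
qed

lemma trilinear_cong:
  assumes "trilinear A B D C F" and "\<And>a b d. a \<in> carrier A \<Longrightarrow> b \<in> carrier B \<Longrightarrow> d \<in> carrier D \<Longrightarrow> F a b d = G a b d"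
    and "k_algebra A" "k_algebra B" "k_algebra D"
  shows "trilinear A B D C G"
proof (rule trilinearI)
  show "linear_map D C (G a b)" if "a \<in> carrier A" "b \<in> carrier B" for a b
    by (rule linear_map_cong[of D C "F a b"]) (use assms that in \<open>simp_all add: trilinear_def\<close>)
  show "linear_map B C (\<lambda>b. G a b d)" if "a \<in> carrier A" "d \<in> carrier D" for a d
    by (rule linear_map_cong[of B C "\<lambda>b. F a b d"]) (use assms that in \<open>simp_all add: trilinear_def\<close>)
  show "linear_map A C (\<lambda>a. G a b d)" if "b \<in> carrier B" "d \<in> carrier D" for b d
    by (rule linear_map_cong[of A C "\<lambda>a. F a b d"]) (use assms that in \<open>simp_all add: trilinear_def\<close>)
qed

text \<open>The situation of a character that kills \<open>f\<close> and \<open>x\<close> and is \<open>-1\<close> on the grouplike involution. Then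
  \<open>h \<mapsto> \<sigma>(h\<^sub>1)h\<^sub>2\<close>, called \<open>\<tau>\<close> below, fixes \<open>f\<close> and \<open>x\<close> and negates \<open>u\<close>.\<close>

locale theta_data = qh_core H e f x q
  for H :: "('k::field, 'a) quasi_hopf" and e f x q +
  fixes u :: 'a and \<sigma> :: "'a \<Rightarrow> 'k"
  assumes U: "group_elem u" and gen: "generated_by H {f, x, u}" and \<sigma>: "\<sigma> \<in> alg_hom H scalars"
    and sf: "\<sigma> f = 0" and sx: "\<sigma> x = 0" and su: "\<sigma> u = - 1"
begin

lemmas s = alg_homD[OF \<sigma>, unfolded scalars_simps]

lemma se: "\<sigma> e = 1"
proof -
  have "\<sigma> (\<one>\<^bsub>H\<^esub> \<oplus>\<^bsub>H\<^esub> (-1) \<odot>\<^bsub>H\<^esub> f) = 1 + (-1) * 0"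
    by (simp only: s(2-5) sf one_closed smult_closed fc)
  then show ?thesis unfolding e_complement[symmetric] by simp
qed

lemma u_props: "u \<in> carrier H" "u \<otimes>\<^bsub>H\<^esub> u = \<one>\<^bsub>H\<^esub>" "u \<otimes>\<^bsub>H\<^esub> e = e \<otimes>\<^bsub>H\<^esub> u" "u \<otimes>\<^bsub>H\<^esub> f = f \<otimes>\<^bsub>H\<^esub> u" "x \<otimes>\<^bsub>H\<^esub> u = u \<otimes>\<^bsub>H\<^esub> x"
  "comult H u = t2 H u u" "counit H u = 1" "antipode H u = u"
  using U unfolding group_elem_def by blast+

definition \<tau> where "\<tau> h = lift2 H (comult H h) (\<lambda>a b. \<sigma> a \<odot>\<^bsub>H\<^esub> b)"

lemma tau_bilinear: "bilinear H H H (\<lambda>a b. \<sigma> a \<odot>\<^bsub>H\<^esub> b)"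
  by (rule bilinearI; (rule linear_map_smult linear_map_scale linear_map_id k_alg alg_hom_linear[OF \<sigma>] | assumption)+)

lemma tau_hom: "\<tau> \<in> alg_hom H H"
proof -
  have "(\<lambda>t. lift2 H t (\<lambda>a b. \<sigma> a \<odot>\<^bsub>H\<^esub> b)) \<in> alg_hom (T2 H) H"
    by (rule P2.lift2_alg_hom[OF k_alg tau_bilinear])
      (simp_all only: s(4,5) smult_mult mult_smult smult_smult smult_closed m_closed smult_1 one_closed mult.commute)
  from alg_hom_comp[OF comult_hom this] show ?thesis unfolding \<tau>_def[abs_def] .
qed

lemma tau_gens: "\<tau> f = f" "\<tau> x = x" "\<tau> u = (-1) \<odot>\<^bsub>H\<^esub> u"
proof -
  note l = linear_mapD(2,3)[OF P2.lift2_linear[OF k_alg tau_bilinear]] P2.lift2_tens[OF k_alg tau_bilinear]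
  note c = ec fc xc u_props(1) one_closed m_closed a_closed smult_closed t2_closed T2.a_closed T2.smult_closed
  have "\<tau> f = \<sigma> e \<odot>\<^bsub>H\<^esub> f \<oplus>\<^bsub>H\<^esub> \<sigma> f \<odot>\<^bsub>H\<^esub> e"
    unfolding \<tau>_def comult_f by (simp only: l c)
  then show "\<tau> f = f" by (simp add: se sf)
  have "\<tau> u = \<sigma> u \<odot>\<^bsub>H\<^esub> u"
    unfolding \<tau>_def u_props by (simp only: l c)
  then show "\<tau> u = (-1) \<odot>\<^bsub>H\<^esub> u" by (simp only: su)
  have "\<tau> x = \<sigma> x \<odot>\<^bsub>H\<^esub> (e \<oplus>\<^bsub>H\<^esub> q \<odot>\<^bsub>H\<^esub> f) \<oplus>\<^bsub>H\<^esub> \<sigma> \<one>\<^bsub>H\<^esub> \<odot>\<^bsub>H\<^esub> (e \<otimes>\<^bsub>H\<^esub> x)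
      \<oplus>\<^bsub>H\<^esub> \<sigma> (e \<oplus>\<^bsub>H\<^esub> (-1) \<odot>\<^bsub>H\<^esub> f) \<odot>\<^bsub>H\<^esub> (f \<otimes>\<^bsub>H\<^esub> x)"
    unfolding \<tau>_def comult_x dx_def e_minus_f by (simp only: l c)
  also have "\<dots> = e \<otimes>\<^bsub>H\<^esub> x \<oplus>\<^bsub>H\<^esub> f \<otimes>\<^bsub>H\<^esub> x"
    by (simp add: s(2,3,5) se sf sx)
  also have "\<dots> = x" by (simp add: l_distr[symmetric] ef_one)
  finally show "\<tau> x = x" .
qed

abbreviation "V \<equiv> theta_gens H"
abbreviation "R \<equiv> theta_rels H \<sigma>"
abbreviation "D0 \<equiv> pres_alg V R"
abbreviation "\<iota> h \<equiv> pres_gen V R (Some h)"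
abbreviation "\<theta> \<equiv> pres_gen V R None"

lemma theta_relator_cases:
  assumes "r \<in> R"
  obtains a b where "a \<in> carrier H" "b \<in> carrier H" "r = mon [Some (a \<oplus>\<^bsub>H\<^esub> b)] - mon [Some a] - mon [Some b]"
  | c a where "a \<in> carrier H" "r = mon [Some (c \<odot>\<^bsub>H\<^esub> a)] - Poly_Mapping.single [Some a] c"
  | a b where "a \<in> carrier H" "b \<in> carrier H" "r = mon [Some (a \<otimes>\<^bsub>H\<^esub> b)] - mon [Some a, Some b]"
  | "r = mon [Some \<one>\<^bsub>H\<^esub>] - mon []"
  | "r = mon [None, None]"
  | h where "h \<in> carrier H" "r = mon [Some h, None] - mon [None, Some (\<tau> h)]"
  using assms unfolding theta_rels_def \<tau>_def[symmetric] Un_iff mem_Collect_eq singleton_iff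
  apply (elim disjE exE conjE)
  subgoal by (rule that(1))
  subgoal by (rule that(2))
  subgoal by (rule that(3))
  subgoal by (rule that(4))
  subgoal by (rule that(5))
  subgoal by (rule that(6))
  done

lemma theta_relators:
  "a \<in> carrier H \<Longrightarrow> b \<in> carrier H \<Longrightarrow> mon [Some (a \<oplus>\<^bsub>H\<^esub> b)] - mon [Some a] - mon [Some b] \<in> R"
  "a \<in> carrier H \<Longrightarrow> mon [Some (c \<odot>\<^bsub>H\<^esub> a)] - Poly_Mapping.single [Some a] c \<in> R"
  "a \<in> carrier H \<Longrightarrow> b \<in> carrier H \<Longrightarrow> mon [Some (a \<otimes>\<^bsub>H\<^esub> b)] - mon [Some a, Some b] \<in> R"
  "mon [Some \<one>\<^bsub>H\<^esub>] - mon [] \<in> R" "mon [None, None] \<in> R"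
  "h \<in> carrier H \<Longrightarrow> mon [Some h, None] - mon [None, Some (\<tau> h)] \<in> R"
  unfolding theta_rels_def \<tau>_def[symmetric]
  subgoal by (rule UnI1, rule UnI1, rule UnI1, rule UnI1, rule UnI1, rule CollectI, intro exI conjI, rule refl)
  subgoal by (rule UnI1, rule UnI1, rule UnI1, rule UnI1, rule UnI2, rule CollectI, intro exI conjI, rule refl)
  subgoal by (rule UnI1, rule UnI1, rule UnI1, rule UnI2, rule CollectI, intro exI conjI, rule refl)
  subgoal by (rule UnI1, rule UnI1, rule UnI2, rule singletonI)
  subgoal by (rule UnI1, rule UnI2, rule singletonI)
  subgoal by (rule UnI2, rule CollectI, intro exI conjI, rule refl)
  done

lemma V_simps: "None \<in> V" "Some h \<in> V \<longleftrightarrow> h \<in> carrier H"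
  by (auto simp: theta_gens_def)

lemma single_free: "w \<in> lists V \<Longrightarrow> Poly_Mapping.single w c \<in> carrier (free_alg V)"
  by (simp add: free_alg_simps keys_single_subset del: keys_single)

lemma free_diff: "a \<in> carrier (free_alg V) \<Longrightarrow> b \<in> carrier (free_alg V) \<Longrightarrow> a - b \<in> carrier (free_alg V)"
  unfolding free_alg_simps mem_Collect_eq by (rule subset_trans[OF keys_diff Un_least])

lemma tau_closed: "h \<in> carrier H \<Longrightarrow> \<tau> h \<in> carrier H"
  by (rule alg_homD(1)[OF tau_hom])

lemma theta_presentation: "presentation V R"
proof
  show "R \<subseteq> carrier (free_alg V)"
  proof
    fix r assume "r \<in> R"
    then show "r \<in> carrier (free_alg V)"
      by (cases rule: theta_relator_cases) (simp_all add: free_diff single_free V_simps tau_closed)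
  qed
qed

interpretation pr: presentation V R by (rule theta_presentation)

lemma kD0: "k_algebra D0"
  by (rule pr.k_algebra_pres)

lemma theta_rel_eval:
  assumes C: "k_algebra C" and F: "F \<in> V \<rightarrow> carrier C"
  defines "ev \<equiv> lin_ext C (word_eval C F)"
  shows "a \<in> carrier H \<Longrightarrow> b \<in> carrier H \<Longrightarrow> ev (mon [Some (a \<oplus>\<^bsub>H\<^esub> b)] - mon [Some a] - mon [Some b]) = F (Some (a \<oplus>\<^bsub>H\<^esub> b)) \<ominus>\<^bsub>C\<^esub> F (Some a) \<ominus>\<^bsub>C\<^esub> F (Some b)"
    "a \<in> carrier H \<Longrightarrow> ev (mon [Some (c \<odot>\<^bsub>H\<^esub> a)] - Poly_Mapping.single [Some a] c) = F (Some (c \<odot>\<^bsub>H\<^esub> a)) \<ominus>\<^bsub>C\<^esub> c \<odot>\<^bsub>C\<^esub> F (Some a)"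
    "a \<in> carrier H \<Longrightarrow> b \<in> carrier H \<Longrightarrow> ev (mon [Some (a \<otimes>\<^bsub>H\<^esub> b)] - mon [Some a, Some b]) = F (Some (a \<otimes>\<^bsub>H\<^esub> b)) \<ominus>\<^bsub>C\<^esub> F (Some a) \<otimes>\<^bsub>C\<^esub> F (Some b)"
    "ev (mon [Some \<one>\<^bsub>H\<^esub>] - mon []) = F (Some \<one>\<^bsub>H\<^esub>) \<ominus>\<^bsub>C\<^esub> \<one>\<^bsub>C\<^esub>"
    "ev (mon [None, None]) = F None \<otimes>\<^bsub>C\<^esub> F None"
    "h \<in> carrier H \<Longrightarrow> ev (mon [Some h, None] - mon [None, Some (\<tau> h)]) = F (Some h) \<otimes>\<^bsub>C\<^esub> F None \<ominus>\<^bsub>C\<^esub> F None \<otimes>\<^bsub>C\<^esub> F (Some (\<tau> h))"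
proof -
  interpret C: kalg C using C by simp
  have Fc: "F None \<in> carrier C" "\<And>h. h \<in> carrier H \<Longrightarrow> F (Some h) \<in> carrier C"
    using F by (auto simp: V_simps)
  note e = lin_ext_word_simps[OF C F, folded ev_def] single_free free_diff V_simps Fc tau_closed
  show "a \<in> carrier H \<Longrightarrow> b \<in> carrier H \<Longrightarrow> ev (mon [Some (a \<oplus>\<^bsub>H\<^esub> b)] - mon [Some a] - mon [Some b]) = F (Some (a \<oplus>\<^bsub>H\<^esub> b)) \<ominus>\<^bsub>C\<^esub> F (Some a) \<ominus>\<^bsub>C\<^esub> F (Some b)"
    "a \<in> carrier H \<Longrightarrow> ev (mon [Some (c \<odot>\<^bsub>H\<^esub> a)] - Poly_Mapping.single [Some a] c) = F (Some (c \<odot>\<^bsub>H\<^esub> a)) \<ominus>\<^bsub>C\<^esub> c \<odot>\<^bsub>C\<^esub> F (Some a)"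
    "a \<in> carrier H \<Longrightarrow> b \<in> carrier H \<Longrightarrow> ev (mon [Some (a \<otimes>\<^bsub>H\<^esub> b)] - mon [Some a, Some b]) = F (Some (a \<otimes>\<^bsub>H\<^esub> b)) \<ominus>\<^bsub>C\<^esub> F (Some a) \<otimes>\<^bsub>C\<^esub> F (Some b)"
    "ev (mon [Some \<one>\<^bsub>H\<^esub>] - mon []) = F (Some \<one>\<^bsub>H\<^esub>) \<ominus>\<^bsub>C\<^esub> \<one>\<^bsub>C\<^esub>"
    "ev (mon [None, None]) = F None \<otimes>\<^bsub>C\<^esub> F None"
    "h \<in> carrier H \<Longrightarrow> ev (mon [Some h, None] - mon [None, Some (\<tau> h)]) = F (Some h) \<otimes>\<^bsub>C\<^esub> F None \<ominus>\<^bsub>C\<^esub> F None \<otimes>\<^bsub>C\<^esub> F (Some (\<tau> h))"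
    by (simp_all add: e)
qed

text \<open>The universal property of the extension.\<close>

lemma theta_lift:
  assumes C: "k_algebra C" and \<phi>: "\<phi> \<in> alg_hom H C" and t: "t \<in> carrier C" "t \<otimes>\<^bsub>C\<^esub> t = \<zero>\<^bsub>C\<^esub>"
    and comm: "\<And>h. h \<in> carrier H \<Longrightarrow> \<phi> h \<otimes>\<^bsub>C\<^esub> t = t \<otimes>\<^bsub>C\<^esub> \<phi> (\<tau> h)"
    and F: "F None = t" "\<And>h. h \<in> carrier H \<Longrightarrow> F (Some h) = \<phi> h"
  shows "pres_lift C F \<in> alg_hom D0 C" "pres_lift C F \<theta> = t" "h \<in> carrier H \<Longrightarrow> pres_lift C F (\<iota> h) = \<phi> h"
proof -
  interpret C: kalg C using C by simp
  note p = alg_homD[OF \<phi>]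
  have Fc: "F \<in> V \<rightarrow> carrier C" using F t p(1) by (auto simp: theta_gens_def)
  have z: "(a \<oplus>\<^bsub>C\<^esub> b) \<ominus>\<^bsub>C\<^esub> a \<ominus>\<^bsub>C\<^esub> b = \<zero>\<^bsub>C\<^esub>" if "a \<in> carrier C" "b \<in> carrier C" for a b
    using that by (simp add: C.add_diff_cancel C.r_right_minus_eq)
  have "lin_ext C (word_eval C F) r = \<zero>\<^bsub>C\<^esub>" if "r \<in> R" for r
    using that
    by (cases rule: theta_relator_cases)
      (simp_all only: theta_rel_eval[OF C Fc], simp_all add: F p t comm tau_closed z C.r_right_minus_eq)
  note L = pr.pres_lift_alg_hom[OF C Fc this] pr.pres_lift_gen[OF C Fc this]
  show "pres_lift C F \<in> alg_hom D0 C" "pres_lift C F \<theta> = t" "h \<in> carrier H \<Longrightarrow> pres_lift C F (\<iota> h) = \<phi> h"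
    using L F by (simp_all add: V_simps)
qed

lemma iota_hom: "(\<lambda>h. \<iota> h) \<in> alg_hom H D0" and theta_closed: "\<theta> \<in> carrier D0" and theta_square: "\<theta> \<otimes>\<^bsub>D0\<^esub> \<theta> = \<zero>\<^bsub>D0\<^esub>"
  and theta_comm: "h \<in> carrier H \<Longrightarrow> \<iota> h \<otimes>\<^bsub>D0\<^esub> \<theta> = \<theta> \<otimes>\<^bsub>D0\<^esub> \<iota> (\<tau> h)"
proof -
  interpret D: kalg D0 using kD0 by simp
  have gc: "pres_gen V R \<in> V \<rightarrow> carrier D0" using pr.pres_gen_closed by blast
  have ic: "\<iota> h \<in> carrier D0" if "h \<in> carrier H" for h
    by (rule pr.pres_gen_closed) (simp add: V_simps that)
  show tc: "\<theta> \<in> carrier D0" by (rule pr.pres_gen_closed) (simp add: V_simps)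
  note z = pr.relator_zero[OF theta_relators(1), unfolded theta_rel_eval[OF kD0 gc]]
    pr.relator_zero[OF theta_relators(2), unfolded theta_rel_eval[OF kD0 gc]]
    pr.relator_zero[OF theta_relators(3), unfolded theta_rel_eval[OF kD0 gc]]
    pr.relator_zero[OF theta_relators(4), unfolded theta_rel_eval[OF kD0 gc]]
    pr.relator_zero[OF theta_relators(5), unfolded theta_rel_eval[OF kD0 gc]]
    pr.relator_zero[OF theta_relators(6), unfolded theta_rel_eval[OF kD0 gc]]
  show "\<theta> \<otimes>\<^bsub>D0\<^esub> \<theta> = \<zero>\<^bsub>D0\<^esub>" by (rule z(5))
  show "\<iota> h \<otimes>\<^bsub>D0\<^esub> \<theta> = \<theta> \<otimes>\<^bsub>D0\<^esub> \<iota> (\<tau> h)" if "h \<in> carrier H"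
  proof -
    have "\<iota> h \<otimes>\<^bsub>D0\<^esub> \<theta> \<ominus>\<^bsub>D0\<^esub> \<theta> \<otimes>\<^bsub>D0\<^esub> \<iota> (\<tau> h) = \<zero>\<^bsub>D0\<^esub>"
      using pr.relator_zero[OF theta_relators(6)[OF that]] by (simp only: theta_rel_eval[OF kD0 gc] that)
    then show ?thesis using that ic tc tau_closed by (simp add: D.r_right_minus_eq)
  qed
  show "(\<lambda>h. \<iota> h) \<in> alg_hom H D0"
  proof (intro alg_homI linear_mapI)
    show "\<iota> \<one>\<^bsub>H\<^esub> = \<one>\<^bsub>D0\<^esub>"
      using pr.relator_zero[OF theta_relators(4)] ic by (simp only: theta_rel_eval[OF kD0 gc]) (simp add: D.r_right_minus_eq)
    show "\<iota> a \<in> carrier D0" if "a \<in> carrier H" for a using ic[OF that] .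
    show "\<iota> (c \<odot>\<^bsub>H\<^esub> a) = c \<odot>\<^bsub>D0\<^esub> \<iota> a" if "a \<in> carrier H" for a c
      using pr.relator_zero[OF theta_relators(2)[OF that, of c]] ic that
      by (simp only: theta_rel_eval[OF kD0 gc]) (simp add: D.r_right_minus_eq)
    show "\<iota> (a \<otimes>\<^bsub>H\<^esub> b) = \<iota> a \<otimes>\<^bsub>D0\<^esub> \<iota> b" if "a \<in> carrier H" "b \<in> carrier H" for a b
      using pr.relator_zero[OF theta_relators(3)[OF that]] ic that
      by (simp only: theta_rel_eval[OF kD0 gc]) (simp add: D.r_right_minus_eq)
    show "\<iota> (a \<oplus>\<^bsub>H\<^esub> b) = \<iota> a \<oplus>\<^bsub>D0\<^esub> \<iota> b" if ab: "a \<in> carrier H" "b \<in> carrier H" for a b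
    proof -
      have "\<iota> (a \<oplus>\<^bsub>H\<^esub> b) \<ominus>\<^bsub>D0\<^esub> \<iota> a \<ominus>\<^bsub>D0\<^esub> \<iota> b = \<zero>\<^bsub>D0\<^esub>"
        using pr.relator_zero[OF theta_relators(1)[OF ab]] by (simp only: theta_rel_eval[OF kD0 gc] ab)
      then have "\<iota> (a \<oplus>\<^bsub>H\<^esub> b) \<ominus>\<^bsub>D0\<^esub> \<iota> a = \<iota> b" using ic ab by (simp add: D.r_right_minus_eq)
      then have "\<iota> a \<oplus>\<^bsub>D0\<^esub> \<iota> b = \<iota> a \<oplus>\<^bsub>D0\<^esub> (\<iota> (a \<oplus>\<^bsub>H\<^esub> b) \<ominus>\<^bsub>D0\<^esub> \<iota> a)" by simp
      also have "\<dots> = \<iota> (a \<oplus>\<^bsub>H\<^esub> b)" using ic ab by (simp only: D.add_diff_cancel a_closed)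
      finally show ?thesis ..
    qed
  qed
qed

lemma theta_generated: "generated_by D0 {\<iota> f, \<iota> x, \<iota> u, \<theta>}"
proof (rule generated_mono[OF kD0 pr.generated_pres])
  have tc: "\<theta> \<in> carrier D0" by (rule theta_closed)
  show "{\<iota> f, \<iota> x, \<iota> u, \<theta>} \<subseteq> carrier D0"
    using alg_homD(1)[OF iota_hom] u_props tc by simp
  have "\<iota> h \<in> alg_gen D0 {\<iota> f, \<iota> x, \<iota> u, \<theta>}" if "h \<in> carrier H" for h
    using k_alg gen that
  proof (induction h rule: generated_induct)
    case (gen h)
    then show ?case by (intro alg_gen.gen) blast
  next
    case one
    show ?case unfolding alg_homD(5)[OF iota_hom] by (rule alg_gen.unit)
  next
    case (add a b)
    then show ?case using alg_gen.add by (simp only: alg_homD(2)[OF iota_hom])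
  next
    case (smult c a)
    then show ?case using alg_gen.smult by (simp only: alg_homD(3)[OF iota_hom])
  next
    case (mult a b)
    then show ?case using alg_gen.mult by (simp only: alg_homD(4)[OF iota_hom])
  qed
  then show "pres_gen V R ` V \<subseteq> alg_gen D0 {\<iota> f, \<iota> x, \<iota> u, \<theta>}"
    unfolding theta_gens_def by (intro image_subsetI) (elim insertE imageE; simp add: alg_gen.gen)
qed

lemma tau_e: "\<tau> e = e"
proof -
  have "\<tau> (\<one>\<^bsub>H\<^esub> \<oplus>\<^bsub>H\<^esub> (-1) \<odot>\<^bsub>H\<^esub> f) = \<one>\<^bsub>H\<^esub> \<oplus>\<^bsub>H\<^esub> (-1) \<odot>\<^bsub>H\<^esub> f"
    by (simp only: alg_homD(2,3,5)[OF tau_hom] tau_gens one_closed smult_closed fc)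
  then show ?thesis unfolding e_complement[symmetric] .
qed

interpretation D: tensor_powers D0 using kD0 by (simp add: tensor_powers_def)

lemmas i = alg_homD[OF iota_hom]

lemma theta_fixed: "h \<in> carrier H \<Longrightarrow> \<tau> h = h \<Longrightarrow> \<iota> h \<otimes>\<^bsub>D0\<^esub> \<theta> = \<theta> \<otimes>\<^bsub>D0\<^esub> \<iota> h"
  using theta_comm[of h] by simp

lemma theta_u: "\<theta> \<otimes>\<^bsub>D0\<^esub> \<iota> u = (-1) \<odot>\<^bsub>D0\<^esub> (\<iota> u \<otimes>\<^bsub>D0\<^esub> \<theta>)"
proof -
  have "\<iota> u \<otimes>\<^bsub>D0\<^esub> \<theta> = (-1) \<odot>\<^bsub>D0\<^esub> (\<theta> \<otimes>\<^bsub>D0\<^esub> \<iota> u)"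
    unfolding theta_comm[OF u_props(1)] tau_gens i(3)[OF u_props(1)]
    using theta_closed i(1)[OF u_props(1)] by (simp only: D.mult_smult)
  then show ?thesis using theta_closed i(1)[OF u_props(1)] by simp
qed

abbreviation "D \<equiv> theta_ext H \<sigma> u"

subsection \<open>The structure maps on the generators\<close>

text \<open>In each reassociator only the term \<open>1 \<otimes> 1 \<otimes> 1\<close> survives because \<open>\<sigma>\<close> kills \<open>f\<close>.\<close>

lemma coproduct_theta_value:
  "lift3 (T2 D0) (reassoc H) (\<lambda>X1 X2 X3. lift3 (T2 D0) (reassoc_inv H) (\<lambda>x1 x2 x3.
       \<sigma> (X2 \<otimes>\<^bsub>H\<^esub> x1) \<odot>\<^bsub>T2 D0\<^esub> t2 D0 (\<iota> (X1 \<otimes>\<^bsub>H\<^esub> u \<otimes>\<^bsub>H\<^esub> x2)) (\<theta> \<otimes>\<^bsub>D0\<^esub> \<iota> (X3 \<otimes>\<^bsub>H\<^esub> x3)))) \<oplus>\<^bsub>T2 D0\<^esub>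
   lift3 (T2 D0) (reassoc_inv H) (\<lambda>x1 x2 x3. \<sigma> x1 \<odot>\<^bsub>T2 D0\<^esub> t2 D0 (\<theta> \<otimes>\<^bsub>D0\<^esub> \<iota> x2) (\<iota> x3)) =
   t2 D0 (\<iota> u) \<theta> \<oplus>\<^bsub>T2 D0\<^esub> t2 D0 \<theta> \<one>\<^bsub>D0\<^esub>"
proof -
  note lin = linear_map_smult[OF D.k_algebra_T2] linear_map_scale[OF D.k_algebra_T2] linear_map_comp[OF _ D.t2_linear(1)] linear_map_comp[OF _ D.t2_linear(2)]
    linear_map_mult_right[OF kD0] linear_map_comp[OF _ alg_hom_linear[OF iota_hom]] linear_map_comp[OF _ alg_hom_linear[OF \<sigma>]]
    linear_map_mult_left[OF k_alg] linear_map_mult_right[OF k_alg] linear_map_id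
    D.t2_closed D.m_closed i(1) theta_closed m_closed u_props(1)
  let ?G = "\<lambda>X1 X2 X3 x1 x2 x3. \<sigma> (X2 \<otimes>\<^bsub>H\<^esub> x1) \<odot>\<^bsub>T2 D0\<^esub> t2 D0 (\<iota> (X1 \<otimes>\<^bsub>H\<^esub> u \<otimes>\<^bsub>H\<^esub> x2)) (\<theta> \<otimes>\<^bsub>D0\<^esub> \<iota> (X3 \<otimes>\<^bsub>H\<^esub> x3))"
  let ?K = "\<lambda>X1 X2 X3. \<sigma> X2 \<odot>\<^bsub>T2 D0\<^esub> t2 D0 (\<iota> (X1 \<otimes>\<^bsub>H\<^esub> u)) (\<theta> \<otimes>\<^bsub>D0\<^esub> \<iota> X3)"
  have G: "trilinear H H H (T2 D0) (?G X1 X2 X3)" if X: "X1 \<in> carrier H" "X2 \<in> carrier H" "X3 \<in> carrier H" for X1 X2 X3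
    by (rule trilinearI; (rule lin X | assumption)+)
  have GK: "?K X1 X2 X3 = lift3 (T2 D0) (reassoc_inv H) (?G X1 X2 X3)" if X: "X1 \<in> carrier H" "X2 \<in> carrier H" "X3 \<in> carrier H" for X1 X2 X3
    unfolding reassoc_inv lift3_reassoc[OF D.k_algebra_T2 G[OF X]]
    using X theta_closed by (simp add: i s sf u_props(1))
  have K: "trilinear H H H (T2 D0) ?K"
    by (rule trilinearI; (rule lin | assumption)+)
  have L: "trilinear H H H (T2 D0) (\<lambda>x1 x2 x3. \<sigma> x1 \<odot>\<^bsub>T2 D0\<^esub> t2 D0 (\<theta> \<otimes>\<^bsub>D0\<^esub> \<iota> x2) (\<iota> x3))"
    by (rule trilinearI; (rule lin alg_hom_linear[OF \<sigma>] alg_hom_linear[OF iota_hom] | assumption)+)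
  have K': "trilinear H H H (T2 D0) (\<lambda>X1 X2 X3. lift3 (T2 D0) (reassoc_inv H) (?G X1 X2 X3))"
    by (rule trilinear_cong[OF K GK k_alg k_alg k_alg])
  have 1: "lift3 (T2 D0) (reassoc H) (\<lambda>X1 X2 X3. lift3 (T2 D0) (reassoc_inv H) (?G X1 X2 X3)) = t2 D0 (\<iota> u) \<theta>"
    unfolding lift3_reassoc[OF D.k_algebra_T2 K']
      GK[OF one_closed one_closed one_closed, symmetric] GK[OF fc fc fc, symmetric]
    using theta_closed u_props(1) by (simp add: i s sf)
  have 2: "lift3 (T2 D0) (reassoc_inv H) (\<lambda>x1 x2 x3. \<sigma> x1 \<odot>\<^bsub>T2 D0\<^esub> t2 D0 (\<theta> \<otimes>\<^bsub>D0\<^esub> \<iota> x2) (\<iota> x3)) = t2 D0 \<theta> \<one>\<^bsub>D0\<^esub>"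
    unfolding reassoc_inv lift3_reassoc[OF D.k_algebra_T2 L]
    using theta_closed by (simp add: i s sf)
  show ?thesis unfolding 1 2 ..
qed

text \<open>Here one \<open>f\<close> term survives: \<open>\<sigma>\<close> is applied to a component of \<open>\<Delta>(f) = e \<otimes> f + f \<otimes> e\<close>, and
  \<open>\<sigma>(e) = 1\<close>. It turns \<open>u (e - f)\<close> into \<open>u\<close>.\<close>

lemma antipode_theta_value:
  "lift3 D0 (reassoc H) (\<lambda>X1 X2 X3. lift3 D0 (reassoc_inv H) (\<lambda>x1 x2 x3. lift2 D0 (comult H x1) (\<lambda>x11 x12.
      \<sigma> (X2 \<otimes>\<^bsub>H\<^esub> x12) \<odot>\<^bsub>D0\<^esub> (\<iota> (antipode H (X1 \<otimes>\<^bsub>H\<^esub> x11 \<otimes>\<^bsub>H\<^esub> u) \<otimes>\<^bsub>H\<^esub> alpha H) \<otimes>\<^bsub>D0\<^esub> \<theta>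
         \<otimes>\<^bsub>D0\<^esub> \<iota> (X3 \<otimes>\<^bsub>H\<^esub> x2 \<otimes>\<^bsub>H\<^esub> beta H \<otimes>\<^bsub>H\<^esub> antipode H x3))))) = \<iota> u \<otimes>\<^bsub>D0\<^esub> \<theta>"
proof -
  note lin = linear_map_smult[OF kD0] linear_map_scale[OF kD0] linear_map_mult_left[OF kD0]
    linear_map_mult_right[OF kD0] linear_map_comp[OF _ alg_hom_linear[OF iota_hom]] linear_map_comp[OF _ alg_hom_linear[OF \<sigma>]]
    linear_map_comp[OF _ antipode_linear_map]
    linear_map_mult_left[OF k_alg] linear_map_mult_right[OF k_alg] linear_map_id antipode_linear_map
    D.m_closed i(1) theta_closed m_closed u_props(1) alpha_closed beta_closed antipode_simps(1) comult_simps(1)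
  let ?M = "\<lambda>X1 X2 X3 x2 x3 x11 x12. \<sigma> (X2 \<otimes>\<^bsub>H\<^esub> x12) \<odot>\<^bsub>D0\<^esub> (\<iota> (antipode H (X1 \<otimes>\<^bsub>H\<^esub> x11 \<otimes>\<^bsub>H\<^esub> u) \<otimes>\<^bsub>H\<^esub> alpha H) \<otimes>\<^bsub>D0\<^esub> \<theta>
         \<otimes>\<^bsub>D0\<^esub> \<iota> (X3 \<otimes>\<^bsub>H\<^esub> x2 \<otimes>\<^bsub>H\<^esub> beta H \<otimes>\<^bsub>H\<^esub> antipode H x3))"
  let ?G = "\<lambda>X1 X2 X3 x1 x2 x3. lift2 D0 (comult H x1) (?M X1 X2 X3 x2 x3)"
  let ?N = "\<lambda>X1 X3 p. \<iota> (antipode H (X1 \<otimes>\<^bsub>H\<^esub> p \<otimes>\<^bsub>H\<^esub> u) \<otimes>\<^bsub>H\<^esub> alpha H) \<otimes>\<^bsub>D0\<^esub> \<theta> \<otimes>\<^bsub>D0\<^esub> \<iota> (X3 \<otimes>\<^bsub>H\<^esub> p \<otimes>\<^bsub>H\<^esub> beta H \<otimes>\<^bsub>H\<^esub> antipode H p)"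
  let ?K = "\<lambda>X1 X2 X3. \<sigma> X2 \<odot>\<^bsub>D0\<^esub> ?N X1 X3 \<one>\<^bsub>H\<^esub> \<oplus>\<^bsub>D0\<^esub> (-2) \<odot>\<^bsub>D0\<^esub> (\<sigma> X2 \<odot>\<^bsub>D0\<^esub> ?N X1 X3 f)"
  have M: "bilinear H H D0 (?M X1 X2 X3 x2 x3)"
    if X: "X1 \<in> carrier H" "X2 \<in> carrier H" "X3 \<in> carrier H" "x2 \<in> carrier H" "x3 \<in> carrier H" for X1 X2 X3 x2 x3
    by (rule bilinearI; (rule lin X | assumption)+)
  have G: "trilinear H H H D0 (?G X1 X2 X3)" if X: "X1 \<in> carrier H" "X2 \<in> carrier H" "X3 \<in> carrier H" for X1 X2 X3
  proof (rule trilinearI)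
    have p: "linear_map H D0 (\<lambda>y. lift2 D0 (comult H a) (F y))"
      if "a \<in> carrier H" "\<And>b c. b \<in> carrier H \<Longrightarrow> c \<in> carrier H \<Longrightarrow> linear_map H D0 (\<lambda>y. F y b c)"
        "\<And>y. y \<in> carrier H \<Longrightarrow> bilinear H H D0 (F y)" for a F
      by (rule linear_map_lift2_param[OF k_alg k_alg kD0 _ that(2,3) k_alg]) (use comult_simps(1)[OF that(1)] in \<open>simp_all only: T2_def\<close>)
    show "linear_map H D0 (?G X1 X2 X3 a b)" if "a \<in> carrier H" "b \<in> carrier H" for a b
      by (rule p) (rule that lin X M | assumption)+
    show "linear_map H D0 (\<lambda>b. ?G X1 X2 X3 a b d)" if "a \<in> carrier H" "d \<in> carrier H" for a d
      by (rule p) (rule that lin X M | assumption)+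
    show "linear_map H D0 (\<lambda>a. ?G X1 X2 X3 a b d)" if "b \<in> carrier H" "d \<in> carrier H" for b d
      by (rule linear_map_comp[OF comult_linear P2.lift2_linear[OF kD0 M[OF X that]]])
  qed
  have GK: "?K X1 X2 X3 = lift3 D0 (reassoc_inv H) (?G X1 X2 X3)" if X: "X1 \<in> carrier H" "X2 \<in> carrier H" "X3 \<in> carrier H" for X1 X2 X3
  proof -
    note l = linear_mapD(2)[OF P2.lift2_linear[OF kD0 M[OF X]]] P2.lift2_tens[OF kD0 M[OF X]]
    have N: "?N X1 X3 p \<in> carrier D0" if "p \<in> carrier H" for p by (rule lin X that)+
    have g1: "?G X1 X2 X3 \<one>\<^bsub>H\<^esub> \<one>\<^bsub>H\<^esub> \<one>\<^bsub>H\<^esub> = \<sigma> (X2 \<otimes>\<^bsub>H\<^esub> \<one>\<^bsub>H\<^esub>) \<odot>\<^bsub>D0\<^esub> ?N X1 X3 \<one>\<^bsub>H\<^esub>"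
      unfolding comult_simps(5) t2_one by (rule l(2)) (rule one_closed)+
    have g2: "?G X1 X2 X3 f f f = ?M X1 X2 X3 f f e f \<oplus>\<^bsub>D0\<^esub> ?M X1 X2 X3 f f f e"
      unfolding comult_f l(1)[OF fc fc t2_closed[OF ec fc] t2_closed[OF fc ec]] l(2)[OF fc fc ec fc] l(2)[OF fc fc fc ec] ..
    have z: "\<sigma> (X2 \<otimes>\<^bsub>H\<^esub> f) = 0" "\<sigma> (X2 \<otimes>\<^bsub>H\<^esub> e) = \<sigma> X2" "\<sigma> (X2 \<otimes>\<^bsub>H\<^esub> \<one>\<^bsub>H\<^esub>) = \<sigma> X2"
      using X by (simp_all only: s(4,5) sf se ec fc one_closed mult_zero_right mult_1_right)
    have e': "\<iota> (antipode H (X1 \<otimes>\<^bsub>H\<^esub> e \<otimes>\<^bsub>H\<^esub> u) \<otimes>\<^bsub>H\<^esub> alpha H) \<otimes>\<^bsub>D0\<^esub> \<theta> \<otimes>\<^bsub>D0\<^esub> \<iota> (X3 \<otimes>\<^bsub>H\<^esub> f \<otimes>\<^bsub>H\<^esub> beta H \<otimes>\<^bsub>H\<^esub> antipode H f) \<in> carrier D0"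
      by (rule lin X ec fc)+
    show ?thesis
      unfolding reassoc_inv lift3_reassoc[OF kD0 G[OF X]] g1 g2 z
      using e' N[OF fc] N[OF one_closed] by simp
  qed
  have K: "trilinear H H H D0 ?K"
    by (rule trilinearI; (rule linear_map_add[OF kD0] alg_hom_linear[OF \<sigma>] lin one_closed fc | assumption)+)
  have uf: "antipode H (u \<otimes>\<^bsub>H\<^esub> \<one>\<^bsub>H\<^esub>) = u" "antipode H (f \<otimes>\<^bsub>H\<^esub> u) = f \<otimes>\<^bsub>H\<^esub> u"
    using u_props by (simp_all add: antipode_simps antipode_f)
  have N1: "?N \<one>\<^bsub>H\<^esub> \<one>\<^bsub>H\<^esub> \<one>\<^bsub>H\<^esub> = \<iota> (u \<otimes>\<^bsub>H\<^esub> (e \<ominus>\<^bsub>H\<^esub> f)) \<otimes>\<^bsub>D0\<^esub> \<theta>"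
    using u_props(1,8) theta_closed by (simp add: antipode_simps alpha beta i)
  have N2: "?N \<one>\<^bsub>H\<^esub> \<one>\<^bsub>H\<^esub> f = (-1) \<odot>\<^bsub>D0\<^esub> (\<iota> (u \<otimes>\<^bsub>H\<^esub> f) \<otimes>\<^bsub>D0\<^esub> \<theta>)"
  proof -
    have a: "antipode H (\<one>\<^bsub>H\<^esub> \<otimes>\<^bsub>H\<^esub> f \<otimes>\<^bsub>H\<^esub> u) \<otimes>\<^bsub>H\<^esub> alpha H = (-1) \<odot>\<^bsub>H\<^esub> (u \<otimes>\<^bsub>H\<^esub> f)"
      using u_props(1,4) by (simp add: uf alpha e_minus_f r_distr m_assoc)
        (simp add: m_assoc[symmetric] u_props(3,4)[symmetric], simp add: m_assoc)
    have b: "\<one>\<^bsub>H\<^esub> \<otimes>\<^bsub>H\<^esub> f \<otimes>\<^bsub>H\<^esub> beta H \<otimes>\<^bsub>H\<^esub> antipode H f = f"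
      by (simp add: beta antipode_f)
    have c: "\<iota> (u \<otimes>\<^bsub>H\<^esub> f) \<otimes>\<^bsub>D0\<^esub> \<theta> \<otimes>\<^bsub>D0\<^esub> \<iota> f = \<iota> (u \<otimes>\<^bsub>H\<^esub> f) \<otimes>\<^bsub>D0\<^esub> \<theta>"
    proof -
      have "\<iota> (u \<otimes>\<^bsub>H\<^esub> f) \<otimes>\<^bsub>D0\<^esub> \<theta> \<otimes>\<^bsub>D0\<^esub> \<iota> f = \<iota> (u \<otimes>\<^bsub>H\<^esub> f) \<otimes>\<^bsub>D0\<^esub> (\<iota> f \<otimes>\<^bsub>D0\<^esub> \<theta>)"
        unfolding theta_fixed[OF fc tau_gens(1)]
        using theta_closed i(1) u_props(1) by (simp only: D.m_assoc m_closed fc)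
      also have "\<dots> = \<iota> (u \<otimes>\<^bsub>H\<^esub> f \<otimes>\<^bsub>H\<^esub> f) \<otimes>\<^bsub>D0\<^esub> \<theta>"
        using theta_closed i(1) u_props(1) by (simp only: i(4) D.m_assoc D.m_closed m_closed fc)
      finally show ?thesis using u_props(1) by (simp only: m_assoc fc ff)
    qed
    show ?thesis unfolding a b i(3)[OF m_closed[OF u_props(1) fc]]
      using c theta_closed i(1)[OF m_closed[OF u_props(1) fc]] i(1)[OF fc] by (simp only: D.smult_mult D.m_closed)
  qed
  have "lift3 D0 (reassoc H) (\<lambda>X1 X2 X3. lift3 D0 (reassoc_inv H) (?G X1 X2 X3)) = \<iota> u \<otimes>\<^bsub>D0\<^esub> \<theta>"
  proof -
    let ?a = "\<iota> (u \<otimes>\<^bsub>H\<^esub> (e \<ominus>\<^bsub>H\<^esub> f))" and ?b = "\<iota> (u \<otimes>\<^bsub>H\<^esub> f)"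
    have cl: "?a \<in> carrier D0" "?b \<in> carrier D0" using u_props(1) by (simp_all add: i(1))
    have "u = u \<otimes>\<^bsub>H\<^esub> (e \<ominus>\<^bsub>H\<^esub> f) \<oplus>\<^bsub>H\<^esub> 2 \<odot>\<^bsub>H\<^esub> (u \<otimes>\<^bsub>H\<^esub> f)"
    proof -
      have "u \<otimes>\<^bsub>H\<^esub> (e \<ominus>\<^bsub>H\<^esub> f) \<oplus>\<^bsub>H\<^esub> 2 \<odot>\<^bsub>H\<^esub> (u \<otimes>\<^bsub>H\<^esub> f) = u \<otimes>\<^bsub>H\<^esub> e \<oplus>\<^bsub>H\<^esub> ((-1) \<odot>\<^bsub>H\<^esub> (u \<otimes>\<^bsub>H\<^esub> f) \<oplus>\<^bsub>H\<^esub> 2 \<odot>\<^bsub>H\<^esub> (u \<otimes>\<^bsub>H\<^esub> f))"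
        unfolding e_minus_f using u_props(1) by (simp only: r_distr mult_smult a_assoc m_closed smult_closed ec fc)
      also have "\<dots> = u \<otimes>\<^bsub>H\<^esub> (e \<oplus>\<^bsub>H\<^esub> f)"
        using u_props(1) by (simp only: smult_collect(1) m_closed fc ec r_distr) simp
      finally show ?thesis using u_props(1) by (simp only: ef_one r_one)
    qed
    then have "\<iota> u = \<iota> (u \<otimes>\<^bsub>H\<^esub> (e \<ominus>\<^bsub>H\<^esub> f) \<oplus>\<^bsub>H\<^esub> 2 \<odot>\<^bsub>H\<^esub> (u \<otimes>\<^bsub>H\<^esub> f))" by (rule arg_cong)
    also have "\<dots> = ?a \<oplus>\<^bsub>D0\<^esub> 2 \<odot>\<^bsub>D0\<^esub> ?b"
      using u_props(1) by (simp only: i(2,3) m_closed smult_closed minus_closed ec fc)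
    finally have iu: "\<iota> u \<otimes>\<^bsub>D0\<^esub> \<theta> = ?a \<otimes>\<^bsub>D0\<^esub> \<theta> \<oplus>\<^bsub>D0\<^esub> 2 \<odot>\<^bsub>D0\<^esub> (?b \<otimes>\<^bsub>D0\<^esub> \<theta>)"
      using cl theta_closed by (simp only: D.l_distr D.smult_mult D.smult_closed)
    have K': "trilinear H H H D0 (\<lambda>X1 X2 X3. lift3 D0 (reassoc_inv H) (?G X1 X2 X3))"
      by (rule trilinear_cong[OF K GK k_alg k_alg k_alg])
    have Nf: "?N f f p \<in> carrier D0" if "p \<in> carrier H" for p by (rule lin that fc)+
    show ?thesis
      unfolding lift3_reassoc[OF kD0 K']
        GK[OF one_closed one_closed one_closed, symmetric] GK[OF fc fc fc, symmetric] N1 N2 s(5) sf iu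
      using cl theta_closed Nf[OF fc] Nf[OF one_closed] by simp
  qed
  then show ?thesis .
qed

abbreviation "tc \<equiv> t2 D0 (\<iota> u) \<theta> \<oplus>\<^bsub>T2 D0\<^esub> t2 D0 \<theta> \<one>\<^bsub>D0\<^esub>"
abbreviation "iu \<equiv> \<iota> u \<otimes>\<^bsub>D0\<^esub> \<theta>"

lemma tau_fixed: "\<tau> \<one>\<^bsub>H\<^esub> = \<one>\<^bsub>H\<^esub>" "\<tau> (e \<otimes>\<^bsub>H\<^esub> x) = e \<otimes>\<^bsub>H\<^esub> x" "\<tau> (f \<otimes>\<^bsub>H\<^esub> x) = f \<otimes>\<^bsub>H\<^esub> x" "\<tau> (e \<oplus>\<^bsub>H\<^esub> c \<odot>\<^bsub>H\<^esub> f) = e \<oplus>\<^bsub>H\<^esub> c \<odot>\<^bsub>H\<^esub> f"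
  by (simp_all only: alg_homD[OF tau_hom] tau_gens tau_e ec fc xc smult_closed)

lemma u_commute: "(e \<oplus>\<^bsub>H\<^esub> c \<odot>\<^bsub>H\<^esub> f) \<otimes>\<^bsub>H\<^esub> u = u \<otimes>\<^bsub>H\<^esub> (e \<oplus>\<^bsub>H\<^esub> c \<odot>\<^bsub>H\<^esub> f)"
  using u_props(1) by (simp only: l_distr r_distr smult_mult mult_smult smult_closed ec fc u_props(3,4))

lemma tc_closed: "tc \<in> carrier (T2 D0)"
  using theta_closed i(1)[OF u_props(1)] by simp

lemma tc_square: "tc \<otimes>\<^bsub>T2 D0\<^esub> tc = \<zero>\<^bsub>T2 D0\<^esub>"
  using theta_closed i(1)[OF u_props(1)]
  by (simp add: D.T2.l_distr D.T2.r_distr theta_square theta_u D.t2_distrib D.T2.smult_collect)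

lemma tc_commute:
  assumes ab: "a \<in> carrier H" "b \<in> carrier H" and au: "a \<otimes>\<^bsub>H\<^esub> u = u \<otimes>\<^bsub>H\<^esub> a" and t: "\<tau> a = a" "\<tau> b = b"
  shows "t2 D0 (\<iota> a) (\<iota> b) \<otimes>\<^bsub>T2 D0\<^esub> tc = tc \<otimes>\<^bsub>T2 D0\<^esub> t2 D0 (\<iota> a) (\<iota> b)"
proof -
  have 1: "\<iota> a \<otimes>\<^bsub>D0\<^esub> \<iota> u = \<iota> u \<otimes>\<^bsub>D0\<^esub> \<iota> a" using ab u_props(1) by (simp only: i(4)[symmetric] au)
  note eqs = 1 theta_fixed[OF ab(1) t(1)] theta_fixed[OF ab(2) t(2)]
  show ?thesis
    using i(1)[OF ab(1)] i(1)[OF ab(2)] i(1)[OF u_props(1)] theta_closed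
    by (simp only: D.T2.l_distr D.T2.r_distr D.t2_mult D.t2_closed D.one_closed eqs D.l_one D.r_one)
qed

abbreviation "cm \<equiv> \<lambda>h. lift2 (T2 D0) (comult H h) (\<lambda>a b. t2 D0 (\<iota> a) (\<iota> b))"

lemma cm_hom: "cm \<in> alg_hom H (T2 D0)"
  by (rule alg_hom_comp[OF comult_hom T2_map(1)[OF k_alg kD0 iota_hom]])

lemmas cm_eval = linear_mapD(2,3)[OF alg_hom_linear[OF T2_map(1)[OF k_alg kD0 iota_hom]]] T2_map(2)[OF k_alg kD0 iota_hom]

lemma cm_tc:
  assumes h: "h \<in> carrier H"
  shows "cm h \<otimes>\<^bsub>T2 D0\<^esub> tc = tc \<otimes>\<^bsub>T2 D0\<^esub> cm (\<tau> h)"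
proof (rule intertwiner[OF k_alg D.k_algebra_T2 gen cm_hom alg_hom_comp[OF tau_hom cm_hom] tc_closed _ h])
  note cl = ec fc xc one_closed m_closed a_closed smult_closed t2_closed T2.a_closed u_props(1)
  have add: "(s \<oplus>\<^bsub>T2 D0\<^esub> s') \<otimes>\<^bsub>T2 D0\<^esub> tc = tc \<otimes>\<^bsub>T2 D0\<^esub> (s \<oplus>\<^bsub>T2 D0\<^esub> s')"
    if "s \<in> carrier (T2 D0)" "s' \<in> carrier (T2 D0)" "s \<otimes>\<^bsub>T2 D0\<^esub> tc = tc \<otimes>\<^bsub>T2 D0\<^esub> s" "s' \<otimes>\<^bsub>T2 D0\<^esub> tc = tc \<otimes>\<^bsub>T2 D0\<^esub> s'" for s s'
    using that tc_closed by (simp only: D.T2.l_distr D.T2.r_distr)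
  have cf: "cm f = t2 D0 (\<iota> e) (\<iota> f) \<oplus>\<^bsub>T2 D0\<^esub> t2 D0 (\<iota> f) (\<iota> e)"
    unfolding comult_f by (simp only: cm_eval cl)
  have cx: "cm x = t2 D0 (\<iota> x) (\<iota> (e \<oplus>\<^bsub>H\<^esub> q \<odot>\<^bsub>H\<^esub> f)) \<oplus>\<^bsub>T2 D0\<^esub> t2 D0 (\<iota> \<one>\<^bsub>H\<^esub>) (\<iota> (e \<otimes>\<^bsub>H\<^esub> x))
      \<oplus>\<^bsub>T2 D0\<^esub> t2 D0 (\<iota> (e \<oplus>\<^bsub>H\<^esub> (-1) \<odot>\<^bsub>H\<^esub> f)) (\<iota> (f \<otimes>\<^bsub>H\<^esub> x))"
    unfolding comult_x dx_def e_minus_f by (simp only: cm_eval cl)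
  have cu: "cm u = t2 D0 (\<iota> u) (\<iota> u)"
    unfolding u_props(6) by (simp only: cm_eval cl)
  have o: "\<one>\<^bsub>H\<^esub> \<otimes>\<^bsub>H\<^esub> u = u \<otimes>\<^bsub>H\<^esub> \<one>\<^bsub>H\<^esub>" using u_props(1) by simp
  note C = tc_commute[OF _ _ _ tau_e tau_gens(1)] tc_commute[OF _ _ _ tau_gens(1) tau_e]
    tc_commute[OF _ _ _ tau_gens(2) tau_fixed(4)] tc_commute[OF _ _ _ tau_fixed(1) tau_fixed(2)]
    tc_commute[OF _ _ _ tau_fixed(4) tau_fixed(3)]
  fix y assume "y \<in> {f, x, u}"
  then show "cm y \<otimes>\<^bsub>T2 D0\<^esub> tc = tc \<otimes>\<^bsub>T2 D0\<^esub> cm (\<tau> y)"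
  proof (elim insertE emptyE)
    assume y: "y = f"
    show ?thesis unfolding y tau_gens cf
      by (intro add C D.t2_closed i(1) cl) (simp_all only: u_props)
  next
    assume y: "y = x"
    show ?thesis unfolding y tau_gens cx
      by (intro add C D.T2.a_closed D.t2_closed i(1) cl) (simp_all only: u_props(5) u_commute o)
  next
    assume y: "y = u"
    note u' = i(1)[OF u_props(1)]
    have "cm (\<tau> u) = (-1) \<odot>\<^bsub>T2 D0\<^esub> t2 D0 (\<iota> u) (\<iota> u)"
      unfolding tau_gens alg_homD(3)[OF cm_hom u_props(1)] cu ..
    then show ?thesis unfolding y cu
      using u' theta_closed by (simp add: D.T2.l_distr D.T2.r_distr theta_u D.t2_distrib D.T2.smult_add_right)
  qed
qed

lemma iu_facts: "iu \<in> carrier D0" "iu \<otimes>\<^bsub>D0\<^esub> iu = \<zero>\<^bsub>D0\<^esub>" "iu \<otimes>\<^bsub>D0\<^esub> \<iota> u = (-1) \<odot>\<^bsub>D0\<^esub> (\<iota> u \<otimes>\<^bsub>D0\<^esub> iu)"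
  "a \<in> carrier H \<Longrightarrow> a \<otimes>\<^bsub>H\<^esub> u = u \<otimes>\<^bsub>H\<^esub> a \<Longrightarrow> \<tau> a = a \<Longrightarrow> iu \<otimes>\<^bsub>D0\<^esub> \<iota> a = \<iota> a \<otimes>\<^bsub>D0\<^esub> iu"
proof -
  note u' = i(1)[OF u_props(1)]
  show ic: "iu \<in> carrier D0" using u' theta_closed by simp
  have ti: "\<theta> \<otimes>\<^bsub>D0\<^esub> iu = \<zero>\<^bsub>D0\<^esub>"
    using u' theta_closed by (simp add: D.m_assoc[symmetric] theta_u) (simp add: D.m_assoc theta_square)
  show "iu \<otimes>\<^bsub>D0\<^esub> iu = \<zero>\<^bsub>D0\<^esub>"
    using u' theta_closed ti by (simp add: D.m_assoc)
  show "iu \<otimes>\<^bsub>D0\<^esub> \<iota> u = (-1) \<odot>\<^bsub>D0\<^esub> (\<iota> u \<otimes>\<^bsub>D0\<^esub> iu)"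
    using u' theta_closed by (simp add: D.m_assoc theta_u)
  assume a: "a \<in> carrier H" "a \<otimes>\<^bsub>H\<^esub> u = u \<otimes>\<^bsub>H\<^esub> a" "\<tau> a = a"
  note a' = i(1)[OF a(1)]
  have 1: "\<iota> a \<otimes>\<^bsub>D0\<^esub> \<iota> u = \<iota> u \<otimes>\<^bsub>D0\<^esub> \<iota> a" using a u_props(1) by (simp only: i(4)[symmetric])
  have "iu \<otimes>\<^bsub>D0\<^esub> \<iota> a = \<iota> u \<otimes>\<^bsub>D0\<^esub> (\<iota> a \<otimes>\<^bsub>D0\<^esub> \<theta>)"
    unfolding theta_fixed[OF a(1,3)] using u' a' theta_closed by (simp only: D.m_assoc)
  also have "\<dots> = \<iota> a \<otimes>\<^bsub>D0\<^esub> iu"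
    using u' a' theta_closed by (simp only: D.m_assoc[symmetric] 1)
  finally show "iu \<otimes>\<^bsub>D0\<^esub> \<iota> a = \<iota> a \<otimes>\<^bsub>D0\<^esub> iu" .
qed

abbreviation "sm \<equiv> \<lambda>h. \<iota> (antipode H h)"

lemma sm_hom: "sm \<in> alg_hom H (op_alg D0)"
  by (rule alg_hom_comp[OF antipode_hom alg_hom_op[OF iota_hom]])

lemma sm_iu:
  assumes h: "h \<in> carrier H"
  shows "sm h \<otimes>\<^bsub>op_alg D0\<^esub> \<ominus>\<^bsub>D0\<^esub> iu = \<ominus>\<^bsub>D0\<^esub> iu \<otimes>\<^bsub>op_alg D0\<^esub> sm (\<tau> h)"
proof (rule intertwiner[OF k_alg k_algebra_op[OF kD0] gen sm_hom alg_hom_comp[OF tau_hom sm_hom] _ _ h])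
  show "\<ominus>\<^bsub>D0\<^esub> iu \<in> carrier (op_alg D0)" using iu_facts(1) by simp
  have fixed: "\<ominus>\<^bsub>D0\<^esub> iu \<otimes>\<^bsub>D0\<^esub> \<iota> a = \<iota> a \<otimes>\<^bsub>D0\<^esub> \<ominus>\<^bsub>D0\<^esub> iu"
    if "a \<in> carrier H" "a \<otimes>\<^bsub>H\<^esub> u = u \<otimes>\<^bsub>H\<^esub> a" "\<tau> a = a" for a
    using iu_facts(1) iu_facts(4)[OF that] i(1)[OF that(1)] by (simp only: D.minus_smult D.smult_mult D.mult_smult)
  let ?y = "x \<otimes>\<^bsub>H\<^esub> (e \<oplus>\<^bsub>H\<^esub> q \<odot>\<^bsub>H\<^esub> f)"
  have y: "?y \<in> carrier H" "\<tau> ?y = ?y"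
    by (simp_all only: alg_homD[OF tau_hom] tau_gens tau_fixed ec fc xc smult_closed m_closed a_closed)
  have yu: "?y \<otimes>\<^bsub>H\<^esub> u = u \<otimes>\<^bsub>H\<^esub> ?y"
  proof -
    have "?y \<otimes>\<^bsub>H\<^esub> u = (x \<otimes>\<^bsub>H\<^esub> u) \<otimes>\<^bsub>H\<^esub> (e \<oplus>\<^bsub>H\<^esub> q \<odot>\<^bsub>H\<^esub> f)"
      using u_props(1) by (simp only: m_assoc u_commute ec fc xc smult_closed a_closed)
    then show ?thesis unfolding u_props(5) using u_props(1) by (simp only: m_assoc ec fc xc smult_closed a_closed)
  qed
  have Sx: "antipode H x = (-1) \<odot>\<^bsub>H\<^esub> ?y" unfolding antipode_x by (rule minus_smult[OF y(1)])
  fix w assume "w \<in> {f, x, u}"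
  then show "sm w \<otimes>\<^bsub>op_alg D0\<^esub> \<ominus>\<^bsub>D0\<^esub> iu = \<ominus>\<^bsub>D0\<^esub> iu \<otimes>\<^bsub>op_alg D0\<^esub> sm (\<tau> w)"
  proof (elim insertE emptyE)
    assume w: "w = f"
    show ?thesis unfolding w tau_gens antipode_f op_alg_simps
      by (rule fixed[OF fc u_props(4)[symmetric] tau_gens(1)])
  next
    assume w: "w = x"
    show ?thesis unfolding w tau_gens Sx op_alg_simps i(3)[OF y(1)]
      using fixed[OF y(1) yu y(2)] i(1)[OF y(1)] iu_facts(1) by (simp only: D.smult_mult D.mult_smult D.a_inv_closed)
  next
    assume w: "w = u"
    have "antipode H ((-1) \<odot>\<^bsub>H\<^esub> u) = (-1) \<odot>\<^bsub>H\<^esub> u" by (simp only: antipode_simps(3) u_props)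
    then show ?thesis unfolding w tau_gens u_props(8) op_alg_simps
      using iu_facts(1,3) i(1)[OF u_props(1)]
      by (simp only: i(3)[OF u_props(1)] D.minus_smult D.smult_mult D.mult_smult D.smult_closed)
  qed
qed

lemma theta_ext_structure:
  shows same_D: "same_algebra D D0" and pre_D: "pre_quasi_hopf D" and iota_D: "(\<lambda>h. \<iota> h) \<in> quasi_hopf_hom H D"
    and theta_D: "comult D \<theta> = t2 D (\<iota> u) \<theta> \<oplus>\<^bsub>T2 D\<^esub> t2 D \<theta> \<one>\<^bsub>D\<^esub>" "counit D \<theta> = 0" "antipode D \<theta> = \<ominus>\<^bsub>D\<^esub> (\<iota> u \<otimes>\<^bsub>D\<^esub> \<theta>)"
proof -
  let ?FD = "\<lambda>s. case s of
           Some h \<Rightarrow> lift2 (T2 D0) (comult H h) (\<lambda>a b. t2 D0 (\<iota> a) (\<iota> b))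
         | None \<Rightarrow> lift3 (T2 D0) (reassoc H) (\<lambda>X1 X2 X3. lift3 (T2 D0) (reassoc_inv H) (\<lambda>x1 x2 x3.
       \<sigma> (X2 \<otimes>\<^bsub>H\<^esub> x1) \<odot>\<^bsub>T2 D0\<^esub> t2 D0 (\<iota> (X1 \<otimes>\<^bsub>H\<^esub> u \<otimes>\<^bsub>H\<^esub> x2)) (\<theta> \<otimes>\<^bsub>D0\<^esub> \<iota> (X3 \<otimes>\<^bsub>H\<^esub> x3)))) \<oplus>\<^bsub>T2 D0\<^esub>
   lift3 (T2 D0) (reassoc_inv H) (\<lambda>x1 x2 x3. \<sigma> x1 \<odot>\<^bsub>T2 D0\<^esub> t2 D0 (\<theta> \<otimes>\<^bsub>D0\<^esub> \<iota> x2) (\<iota> x3))"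
  let ?FE = "\<lambda>s. case s of Some h \<Rightarrow> counit H h | None \<Rightarrow> 0"
  let ?FS = "\<lambda>s. case s of Some h \<Rightarrow> \<iota> (antipode H h)
         | None \<Rightarrow> \<ominus>\<^bsub>D0\<^esub> lift3 D0 (reassoc H) (\<lambda>X1 X2 X3. lift3 D0 (reassoc_inv H) (\<lambda>x1 x2 x3. lift2 D0 (comult H x1) (\<lambda>x11 x12.
      \<sigma> (X2 \<otimes>\<^bsub>H\<^esub> x12) \<odot>\<^bsub>D0\<^esub> (\<iota> (antipode H (X1 \<otimes>\<^bsub>H\<^esub> x11 \<otimes>\<^bsub>H\<^esub> u) \<otimes>\<^bsub>H\<^esub> alpha H) \<otimes>\<^bsub>D0\<^esub> \<theta>
         \<otimes>\<^bsub>D0\<^esub> \<iota> (X3 \<otimes>\<^bsub>H\<^esub> x2 \<otimes>\<^bsub>H\<^esub> beta H \<otimes>\<^bsub>H\<^esub> antipode H x3)))))"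
  let ?PD = "pres_lift (T2 D0) ?FD" and ?PE = "pres_lift scalars ?FE" and ?PS = "pres_lift (op_alg D0) ?FS"
  have eq: "D = with_structure D0 ?PD ?PE (lift3 (T3 D0) (reassoc H) (\<lambda>X1 X2 X3. t3 D0 (\<iota> X1) (\<iota> X2) (\<iota> X3))) ?PS (\<iota> (alpha H)) (\<iota> (beta H))"
    unfolding theta_ext_def Let_def ..
  have F: "?FD None = tc" "?FS None = \<ominus>\<^bsub>D0\<^esub> iu"
    unfolding option.case coproduct_theta_value antipode_theta_value by (rule refl)+
  have PD: "?PD \<in> alg_hom D0 (T2 D0)" "?PD \<theta> = tc" "\<And>h. h \<in> carrier H \<Longrightarrow> ?PD (\<iota> h) = cm h"
    by (rule theta_lift[where F = ?FD, OF D.k_algebra_T2 cm_hom tc_closed tc_square cm_tc F(1)]; simp only: option.case)+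
  have PE: "?PE \<in> alg_hom D0 scalars" "?PE \<theta> = 0" "\<And>h. h \<in> carrier H \<Longrightarrow> ?PE (\<iota> h) = counit H h"
    by (rule theta_lift[where F = ?FE and t = 0, OF k_algebra_scalars counit_hom]; simp)+
  have z: "\<ominus>\<^bsub>D0\<^esub> iu \<in> carrier (op_alg D0)" "\<ominus>\<^bsub>D0\<^esub> iu \<otimes>\<^bsub>op_alg D0\<^esub> \<ominus>\<^bsub>D0\<^esub> iu = \<zero>\<^bsub>op_alg D0\<^esub>"
    using iu_facts(1,2) by (simp_all only: op_alg_simps D.a_inv_closed D.minus_smult D.smult_mult D.mult_smult D.smult_closed D.smult_zero)
  have PS: "?PS \<in> alg_hom D0 (op_alg D0)" "?PS \<theta> = \<ominus>\<^bsub>D0\<^esub> iu" "\<And>h. h \<in> carrier H \<Longrightarrow> ?PS (\<iota> h) = sm h"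
    by (rule theta_lift[where F = ?FS, OF k_algebra_op[OF kD0] sm_hom z sm_iu F(2)]; simp only: option.case)+
  show s: "same_algebra D D0" unfolding eq by (rule same_algebra_structure)
  have s': "carrier D = carrier D0" "monoid.mult D = monoid.mult D0" "monoid.one D = monoid.one D0"
    "ring.zero D = ring.zero D0" "ring.add D = ring.add D0" "module.smult D = module.smult D0"
    using s by (simp_all add: same_algebra_def)
  have min: "\<ominus>\<^bsub>D\<^esub> a = \<ominus>\<^bsub>D0\<^esub> a" for a
    by (simp add: a_inv_def m_inv_def s')
  show "pre_quasi_hopf D" unfolding eq by (intro pre_quasi_hopf_structureI kD0 PD(1) PE(1) PS(1))
  note T = tensor_powers_same[OF s]
  show "comult D \<theta> = t2 D (\<iota> u) \<theta> \<oplus>\<^bsub>T2 D\<^esub> t2 D \<theta> \<one>\<^bsub>D\<^esub>"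
    unfolding T s' unfolding eq with_structure_simps by (rule PD)
  show "counit D \<theta> = 0" unfolding eq with_structure_simps by (rule PE)
  show "antipode D \<theta> = \<ominus>\<^bsub>D\<^esub> (\<iota> u \<otimes>\<^bsub>D\<^esub> \<theta>)" unfolding min s' unfolding eq with_structure_simps by (rule PS)
  have h: "comult D (\<iota> h) = lift2 (T2 D) (comult H h) (\<lambda>a b. t2 D (\<iota> a) (\<iota> b))" "counit D (\<iota> h) = counit H h"
    "antipode D (\<iota> h) = \<iota> (antipode H h)" if "h \<in> carrier H" for h
    unfolding T unfolding eq with_structure_simps using PD(3)[OF that] PE(3)[OF that] PS(3)[OF that] by blast+
  have r: "reassoc D = lift3 (T3 D) (reassoc H) (\<lambda>X1 X2 X3. t3 D (\<iota> X1) (\<iota> X2) (\<iota> X3))"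
    unfolding T unfolding eq with_structure_simps ..
  have ab: "alpha D = \<iota> (alpha H)" "beta D = \<iota> (beta H)" unfolding eq with_structure_simps by (rule refl)+
  have "(\<lambda>h. \<iota> h) \<in> alg_hom H D" using iota_hom alg_hom_same[OF same_algebra_refl s, of H] by blast
  then show "(\<lambda>h. \<iota> h) \<in> quasi_hopf_hom H D"
    unfolding quasi_hopf_hom_def mem_Collect_eq using h r ab by blast
qed

end

section \<open>Comparing two quasi-Hopf algebras of this kind\<close>

context qh_core
begin

text \<open>Both sides of each structural identity are algebra morphisms, and on \<open>f\<close>, \<open>x\<close>, \<open>u\<close>, \<open>\<theta>\<close> the same
  formulas hold in source and target.\<close>

lemma quasi_hopf_hom_on_generators:
  fixes K :: "('k, 'c) quasi_hopf"
  assumes K: "qh_core K (F e) (F f) (F x) q" and F: "F \<in> alg_hom H K"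
    and u: "group_elem u" "skew_elem u w" and gen: "generated_by H {f, x, u, w}"
    and Fu: "qh_core.group_elem K (F e) (F f) (F x) (F u)" "qh_core.skew_elem K (F e) (F f) (F x) (F u) (F w)"
  shows "F \<in> quasi_hopf_hom H K"
proof -
  interpret K: qh_core K "F e" "F f" "F x" q by (rule K)
  note l = alg_homD[OF F] linear_map_minus[OF k_alg K.k_alg alg_hom_linear[OF F]]
  note T = T2_map[OF k_alg K.k_alg F]
  note M = linear_mapD(2,3)[OF alg_hom_linear[OF T(1)]] T(2)
  have U: "u \<in> carrier H" "comult H u = t2 H u u" "counit H u = 1" "antipode H u = u"
    using u(1) unfolding group_elem_def by blast+
  have V: "w \<in> carrier H" "comult H w = t2 H u w \<oplus>\<^bsub>T2 H\<^esub> t2 H w \<one>\<^bsub>H\<^esub>" "counit H w = 0" "antipode H w = \<ominus>\<^bsub>H\<^esub> (u \<otimes>\<^bsub>H\<^esub> w)"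
    using u(2) unfolding skew_elem_def by blast+
  have U': "comult K (F u) = t2 K (F u) (F u)" "counit K (F u) = 1" "antipode K (F u) = F u"
    using Fu(1) unfolding K.group_elem_def by blast+
  have V': "comult K (F w) = t2 K (F u) (F w) \<oplus>\<^bsub>T2 K\<^esub> t2 K (F w) \<one>\<^bsub>K\<^esub>" "counit K (F w) = 0" "antipode K (F w) = \<ominus>\<^bsub>K\<^esub> (F u \<otimes>\<^bsub>K\<^esub> F w)"
    using Fu(2) unfolding K.skew_elem_def by blast+
  note cl = ec fc xc U(1) V(1) one_closed m_closed a_closed smult_closed minus_closed t2_closed T2.a_closed
  have 1: "comult K (F h) = lift2 (T2 K) (comult H h) (\<lambda>a b. t2 K (F a) (F b))" if "h \<in> carrier H" for h
  proof (rule alg_hom_eqI[OF k_alg gen alg_hom_comp[OF F K.comult_hom] alg_hom_comp[OF comult_hom T(1)] _ that])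
    fix y assume "y \<in> {f, x, u, w}"
    then show "comult K (F y) = lift2 (T2 K) (comult H y) (\<lambda>a b. t2 K (F a) (F b))"
    proof (elim insertE emptyE)
      assume y: "y = f"
      show ?thesis unfolding y comult_f K.comult_f by (simp only: M cl)
    next
      assume y: "y = x"
      show ?thesis unfolding y comult_x K.comult_x dx_def K.dx_def by (simp only: M l cl)
    next
      assume y: "y = u"
      show ?thesis unfolding y U U' by (simp only: M cl)
    next
      assume y: "y = w"
      show ?thesis unfolding y V V' by (simp only: M l cl)
    qed
  qed
  have 2: "counit K (F h) = counit H h" if "h \<in> carrier H" for h
    by (rule alg_hom_eqI[OF k_alg gen alg_hom_comp[OF F K.counit_hom] counit_hom _ that])
      (elim insertE emptyE; simp only: counit_f counit_x K.counit_f K.counit_x U U' V V')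
  have 3: "antipode K (F h) = F (antipode H h)" if "h \<in> carrier H" for h
    by (rule alg_hom_eqI[OF k_alg gen alg_hom_comp[OF F K.antipode_hom] alg_hom_comp[OF antipode_hom alg_hom_op[OF F]] _ that])
      (elim insertE emptyE; simp only: antipode_f antipode_x K.antipode_f K.antipode_x U U' V V' l cl)
  have 4: "reassoc K = lift3 (T3 K) (reassoc H) (\<lambda>X1 X2 X3. t3 K (F X1) (F X2) (F X3))"
    unfolding lift3_reassoc[OF K.k_algebra_T3 T3_map_trilinear[OF k_alg K.k_alg alg_hom_linear[OF F]]] l(5)
    by (rule K.reassoc')
  have 5: "alpha K = F (alpha H)" "beta K = F (beta H)"
    unfolding alpha beta K.alpha K.beta l(5) by (simp_all only: l cl)
  show ?thesis
    unfolding quasi_hopf_hom_def mem_Collect_eq using F 1 2 3 4 5 by blast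
qed

end

section \<open>The compatibility condition\<close>

context qh_core
begin

text \<open>A character has commutative image, so \<open>x e = f x\<close> with \<open>e f = 0\<close> and \<open>e + f = 1\<close> forces \<open>\<tau>(x) = 0\<close>.\<close>

lemma character_values:
  assumes t: "\<tau> \<in> alg_hom H scalars"
  shows "\<tau> e = 1 - \<tau> f" "\<tau> f = 0 \<or> \<tau> f = 1" "\<tau> x = 0"
proof -
  note t' = alg_homD[OF t, unfolded scalars_simps]
  have s: "\<tau> e + \<tau> f = 1" using t'(2)[OF ec fc] by (simp only: ef_one t'(5))
  then show 1: "\<tau> e = 1 - \<tau> f" by (simp add: eq_diff_eq)
  have "\<tau> f * \<tau> f = \<tau> f" using t'(4)[OF fc fc] by (simp only: ff)
  then show 2: "\<tau> f = 0 \<or> \<tau> f = 1" by (metis mult_cancel_left1)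
  have eq: "\<tau> x * \<tau> e = \<tau> f * \<tau> x" using t'(4)[OF xc ec] t'(4)[OF fc xc] by (simp only: xe)
  from 2 show "\<tau> x = 0"
  proof
    assume "\<tau> f = 0"
    then show ?thesis using eq unfolding 1 by simp
  next
    assume f1: "\<tau> f = 1"
    have "\<tau> x * (1 - \<tau> f) = \<tau> f * \<tau> x" using eq unfolding 1 .
    then show ?thesis unfolding f1 by simp
  qed
qed

context
  fixes \<tau> v
  assumes t: "\<tau> \<in> alg_hom H scalars" and v: "v \<in> carrier H"
begin

lemmas t' = alg_homD[OF t, unfolded scalars_simps]

text \<open>The summand in the compatibility condition on \<open>\<Delta>(v)\<close>, summed over one, two and three copies of the
  reassociator, which is its own inverse.\<close>

abbreviation "dg \<equiv> \<lambda>x1 x2 x3 y1 y2 y3 X1 X2 X3. \<tau> (y1 \<otimes>\<^bsub>H\<^esub> x3 \<otimes>\<^bsub>H\<^esub> X2) \<odot>\<^bsub>T2 H\<^esub>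
   t2 H (x1 \<otimes>\<^bsub>H\<^esub> X1 \<otimes>\<^bsub>H\<^esub> v \<otimes>\<^bsub>H\<^esub> y2) (x2 \<otimes>\<^bsub>H\<^esub> v \<otimes>\<^bsub>H\<^esub> X3 \<otimes>\<^bsub>H\<^esub> y3)"

abbreviation "dg1 \<equiv> \<lambda>x1 x2 x3 y1 y2 y3. lift3 (T2 H) (reassoc H) (dg x1 x2 x3 y1 y2 y3)"
abbreviation "dg2 \<equiv> \<lambda>x1 x2 x3. lift3 (T2 H) (reassoc H) (dg1 x1 x2 x3)"

lemma datum_trilinear:
  "x1 \<in> carrier H \<Longrightarrow> x2 \<in> carrier H \<Longrightarrow> x3 \<in> carrier H \<Longrightarrow> y1 \<in> carrier H \<Longrightarrow> y2 \<in> carrier H \<Longrightarrow> y3 \<in> carrier H \<Longrightarrow>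
     trilinear H H H (T2 H) (dg x1 x2 x3 y1 y2 y3)"
  "x1 \<in> carrier H \<Longrightarrow> x2 \<in> carrier H \<Longrightarrow> x3 \<in> carrier H \<Longrightarrow> trilinear H H H (T2 H) (dg1 x1 x2 x3)"
  "trilinear H H H (T2 H) dg2"
proof -
  note lin = linear_map_smult[OF k_algebra_T2] linear_map_scale[OF k_algebra_T2] linear_map_comp[OF _ t2_linear(1)] linear_map_comp[OF _ t2_linear(2)]
    linear_map_comp[OF _ alg_hom_linear[OF t]] linear_map_mult_left[OF k_alg] linear_map_mult_right[OF k_alg] linear_map_id
    t2_closed m_closed v
  have R: "reassoc H \<in> carrier (tensor_alg H (tensor_alg H H))"
    using reassoc_closed by (simp add: T3_def T2_def)
  note par = linear_map_lift3_param[OF k_alg k_alg k_alg k_algebra_T2 k_alg R]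
  show 1: "trilinear H H H (T2 H) (dg x1 x2 x3 y1 y2 y3)"
    if "x1 \<in> carrier H" "x2 \<in> carrier H" "x3 \<in> carrier H" "y1 \<in> carrier H" "y2 \<in> carrier H" "y3 \<in> carrier H"
    for x1 x2 x3 y1 y2 y3
    by (rule trilinearI; (rule lin that | assumption)+)
  show 2: "trilinear H H H (T2 H) (dg1 x1 x2 x3)"
    if "x1 \<in> carrier H" "x2 \<in> carrier H" "x3 \<in> carrier H" for x1 x2 x3
    by (rule trilinearI; rule par; (assumption | rule that | rule 1 | rule lin)+)
  show "trilinear H H H (T2 H) dg2"
    by (rule trilinearI; rule par; (assumption | rule 2 | rule 1 | rule par | rule lin)+)
qed

abbreviation "tt \<equiv> \<lambda>w. lift2 scalars w (\<lambda>a b. \<tau> a * \<tau> b)"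

lemma tt_hom: "tt \<in> alg_hom (T2 H) scalars" and tt_t2: "a \<in> carrier H \<Longrightarrow> b \<in> carrier H \<Longrightarrow> tt (t2 H a b) = \<tau> a * \<tau> b"
proof -
  have c: "\<tau> b \<otimes>\<^bsub>scalars\<^esub> \<tau> a = \<tau> a \<otimes>\<^bsub>scalars\<^esub> \<tau> b" for a b by simp
  note h = alg_hom_tensorI[OF k_alg k_alg k_algebra_scalars t t c, unfolded scalars_simps T2_def[symmetric]]
  show "tt \<in> alg_hom (T2 H) scalars" by (rule h(2))
  show "a \<in> carrier H \<Longrightarrow> b \<in> carrier H \<Longrightarrow> tt (t2 H a b) = \<tau> a * \<tau> b"
    by (rule P2.lift2_tens[OF k_algebra_scalars h(1)])
qed

text \<open>If the functional \<open>\<tau> \<otimes> \<tau>\<close> sees \<open>f \<otimes> f \<otimes> f\<close> as \<open>\<tau>(f)\<close>, the reassociator contributes the factor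
  \<open>1 - 2 \<tau>(f)\<close>; three copies give its cube.\<close>

lemma tt_lift3:
  assumes F: "trilinear H H H (T2 H) F" and eq: "tt (F f f f) = \<tau> f * tt (F \<one>\<^bsub>H\<^esub> \<one>\<^bsub>H\<^esub> \<one>\<^bsub>H\<^esub>)"
  shows "tt (lift3 (T2 H) (reassoc H) F) = (1 - 2 * \<tau> f) * tt (F \<one>\<^bsub>H\<^esub> \<one>\<^bsub>H\<^esub> \<one>\<^bsub>H\<^esub>)"
proof -
  have c: "F a b d \<in> carrier (T2 H)" if "a \<in> carrier H" "b \<in> carrier H" "d \<in> carrier H" for a b d
    using F that unfolding trilinear_def by (blast intro: linear_mapD(1))
  note l = alg_homD(2,3)[OF tt_hom, unfolded scalars_simps]
  have "tt (lift3 (T2 H) (reassoc H) F) = tt (F \<one>\<^bsub>H\<^esub> \<one>\<^bsub>H\<^esub> \<one>\<^bsub>H\<^esub>) + (-2) * tt (F f f f)"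
    unfolding lift3_reassoc[OF k_algebra_T2 F] by (simp only: l c one_closed fc T2.smult_closed)
  then show ?thesis unfolding eq by (simp add: algebra_simps)
qed

lemma tt_datum: "tt (lift3 (T2 H) (reassoc H) dg2) = (1 - 2 * \<tau> f) ^ 3 * (\<tau> v * \<tau> v)"
proof -
  define s where "s = 1 - 2 * \<tau> f"
  note cv = character_values(2)[OF t]
  have f3: "\<tau> f * (\<tau> f * z) = \<tau> f * z" for z using cv by auto
  note l = alg_homD(3)[OF tt_hom, unfolded scalars_simps]
  have g: "tt (dg x1 x2 x3 y1 y2 y3 X1 X2 X3) =
      \<tau> y1 * \<tau> x3 * \<tau> X2 * (\<tau> x1 * \<tau> X1 * \<tau> v * \<tau> y2 * (\<tau> x2 * \<tau> v * \<tau> X3 * \<tau> y3))"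
    if "x1 \<in> carrier H" "x2 \<in> carrier H" "x3 \<in> carrier H" "y1 \<in> carrier H" "y2 \<in> carrier H" "y3 \<in> carrier H"
      "X1 \<in> carrier H" "X2 \<in> carrier H" "X3 \<in> carrier H" for x1 x2 x3 y1 y2 y3 X1 X2 X3
    using that v by (simp only: l tt_t2 t'(4) t2_closed m_closed)
  have 1: "tt (dg1 x1 x2 x3 y1 y2 y3) = s * (\<tau> y1 * \<tau> x3 * (\<tau> x1 * \<tau> v * \<tau> y2 * (\<tau> x2 * \<tau> v * \<tau> y3)))"
    if c: "x1 \<in> carrier H" "x2 \<in> carrier H" "x3 \<in> carrier H" "y1 \<in> carrier H" "y2 \<in> carrier H" "y3 \<in> carrier H"
    for x1 x2 x3 y1 y2 y3
    by (subst tt_lift3[OF datum_trilinear(1)[OF c]]) (simp_all only: g c fc one_closed t'(5) s_def[symmetric] mult_1_left mult_1_right, simp add: f3 mult_ac)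
  have 2: "tt (dg2 x1 x2 x3) = s * (s * (\<tau> x3 * (\<tau> x1 * \<tau> v * (\<tau> x2 * \<tau> v))))"
    if c: "x1 \<in> carrier H" "x2 \<in> carrier H" "x3 \<in> carrier H" for x1 x2 x3
    by (subst tt_lift3[OF datum_trilinear(2)[OF c]]) (simp_all only: 1 c fc one_closed t'(5) s_def[symmetric] mult_1_left mult_1_right, simp add: f3 mult_ac)
  have "tt (lift3 (T2 H) (reassoc H) dg2) = s * (s * (s * (\<tau> v * \<tau> v)))"
    by (subst tt_lift3[OF datum_trilinear(3)]) (simp_all only: 2 fc one_closed t'(5) s_def[symmetric] mult_1_left mult_1_right, simp add: f3 mult_ac)
  then show ?thesis by (simp add: s_def power3_eq_cube mult_ac)
qed

text \<open>Every term with an \<open>f\<close> contains it inside the argument of \<open>\<tau>\<close>.\<close>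

lemma datum_collapse:
  assumes tf: "\<tau> f = 0"
  shows "lift3 (T2 H) (reassoc H) dg2 = t2 H v v"
proof -
  have z: "\<tau> (y1 \<otimes>\<^bsub>H\<^esub> x3 \<otimes>\<^bsub>H\<^esub> X2) = \<tau> y1 * \<tau> x3 * \<tau> X2" if "y1 \<in> carrier H" "x3 \<in> carrier H" "X2 \<in> carrier H" for y1 x3 X2
    using that by (simp only: t'(4) m_closed)
  have e1: "dg1 x1 x2 x3 y1 y2 y3 = (\<tau> y1 * \<tau> x3) \<odot>\<^bsub>T2 H\<^esub> t2 H (x1 \<otimes>\<^bsub>H\<^esub> v \<otimes>\<^bsub>H\<^esub> y2) (x2 \<otimes>\<^bsub>H\<^esub> v \<otimes>\<^bsub>H\<^esub> y3)"
    if c: "x1 \<in> carrier H" "x2 \<in> carrier H" "x3 \<in> carrier H" "y1 \<in> carrier H" "y2 \<in> carrier H" "y3 \<in> carrier H"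
    for x1 x2 x3 y1 y2 y3
    unfolding lift3_reassoc[OF k_algebra_T2 datum_trilinear(1)[OF c]] z[OF c(4,3) one_closed] z[OF c(4,3) fc] tf
    using c v by (simp add: t'(5))
  have e2: "dg2 x1 x2 x3 = \<tau> x3 \<odot>\<^bsub>T2 H\<^esub> t2 H (x1 \<otimes>\<^bsub>H\<^esub> v) (x2 \<otimes>\<^bsub>H\<^esub> v)"
    if c: "x1 \<in> carrier H" "x2 \<in> carrier H" "x3 \<in> carrier H" for x1 x2 x3
    unfolding lift3_reassoc[OF k_algebra_T2 datum_trilinear(2)[OF c]] e1[OF c one_closed one_closed one_closed] e1[OF c fc fc fc] tf
    using c v by (simp add: t'(5))
  show ?thesis
    unfolding lift3_reassoc[OF k_algebra_T2 datum_trilinear(3)] e2[OF one_closed one_closed one_closed] e2[OF fc fc fc] tf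
    using v by (simp add: t'(5))
qed

abbreviation "hitl \<equiv> \<lambda>h. lift2 H (comult H h) (\<lambda>a b. \<tau> a \<odot>\<^bsub>H\<^esub> b)"
abbreviation "hitr \<equiv> \<lambda>h. lift2 H (comult H h) (\<lambda>a b. \<tau> b \<odot>\<^bsub>H\<^esub> a)"

lemma hit_bilinear: "bilinear H H H (\<lambda>a b. \<tau> a \<odot>\<^bsub>H\<^esub> b)" "bilinear H H H (\<lambda>a b. \<tau> b \<odot>\<^bsub>H\<^esub> a)"
  by (rule bilinearI; (rule linear_map_smult linear_map_scale linear_map_id k_alg alg_hom_linear[OF t] | assumption)+)+

lemma hit_hom: "hitl \<in> alg_hom H H" "hitr \<in> alg_hom H H"
proof -
  have "(\<lambda>w. lift2 H w (\<lambda>a b. \<tau> a \<odot>\<^bsub>H\<^esub> b)) \<in> alg_hom (T2 H) H" "(\<lambda>w. lift2 H w (\<lambda>a b. \<tau> b \<odot>\<^bsub>H\<^esub> a)) \<in> alg_hom (T2 H) H"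
    by (rule P2.lift2_alg_hom[OF k_alg hit_bilinear(1)] P2.lift2_alg_hom[OF k_alg hit_bilinear(2)];
        simp only: t'(4,5) smult_mult mult_smult smult_smult smult_closed m_closed smult_1 one_closed mult.commute)+
  then show "hitl \<in> alg_hom H H" "hitr \<in> alg_hom H H"
    using alg_hom_comp[OF comult_hom] by blast+
qed

lemmas hit_eval = linear_mapD(2,3)[OF P2.lift2_linear[OF k_alg hit_bilinear(1)]] P2.lift2_tens[OF k_alg hit_bilinear(1)]
  linear_mapD(2,3)[OF P2.lift2_linear[OF k_alg hit_bilinear(2)]] P2.lift2_tens[OF k_alg hit_bilinear(2)]

lemma hit_f: "\<tau> f = 0 \<Longrightarrow> hitl f = f" "\<tau> f = 0 \<Longrightarrow> hitr f = f"
  and hit_x: "\<tau> f = 0 \<Longrightarrow> hitl x = x" "\<tau> f = 0 \<Longrightarrow> hitr x = x"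
  and hit_group: "group_elem u \<Longrightarrow> hitl u = \<tau> u \<odot>\<^bsub>H\<^esub> u" "group_elem u \<Longrightarrow> hitr u = \<tau> u \<odot>\<^bsub>H\<^esub> u"
proof -
  note cl = ec fc xc one_closed m_closed a_closed smult_closed t2_closed T2.a_closed T2.smult_closed
  note tx = character_values(3)[OF t]
  have f: "hitl f = \<tau> e \<odot>\<^bsub>H\<^esub> f \<oplus>\<^bsub>H\<^esub> \<tau> f \<odot>\<^bsub>H\<^esub> e" "hitr f = \<tau> f \<odot>\<^bsub>H\<^esub> e \<oplus>\<^bsub>H\<^esub> \<tau> e \<odot>\<^bsub>H\<^esub> f"
    unfolding comult_f by (simp_all only: hit_eval cl)
  have x: "hitl x = \<tau> x \<odot>\<^bsub>H\<^esub> (e \<oplus>\<^bsub>H\<^esub> q \<odot>\<^bsub>H\<^esub> f) \<oplus>\<^bsub>H\<^esub> \<tau> \<one>\<^bsub>H\<^esub> \<odot>\<^bsub>H\<^esub> (e \<otimes>\<^bsub>H\<^esub> x) \<oplus>\<^bsub>H\<^esub> \<tau> (e \<oplus>\<^bsub>H\<^esub> (-1) \<odot>\<^bsub>H\<^esub> f) \<odot>\<^bsub>H\<^esub> (f \<otimes>\<^bsub>H\<^esub> x)"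
    "hitr x = \<tau> (e \<oplus>\<^bsub>H\<^esub> q \<odot>\<^bsub>H\<^esub> f) \<odot>\<^bsub>H\<^esub> x \<oplus>\<^bsub>H\<^esub> \<tau> (e \<otimes>\<^bsub>H\<^esub> x) \<odot>\<^bsub>H\<^esub> \<one>\<^bsub>H\<^esub> \<oplus>\<^bsub>H\<^esub> \<tau> (f \<otimes>\<^bsub>H\<^esub> x) \<odot>\<^bsub>H\<^esub> (e \<oplus>\<^bsub>H\<^esub> (-1) \<odot>\<^bsub>H\<^esub> f)"
    unfolding comult_x dx_def e_minus_f by (simp_all only: hit_eval cl)
  have s: "e \<otimes>\<^bsub>H\<^esub> x \<oplus>\<^bsub>H\<^esub> f \<otimes>\<^bsub>H\<^esub> x = x" by (simp add: l_distr[symmetric] ef_one)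
  have te: "\<tau> e = 1" if "\<tau> f = 0" using character_values(1)[OF t] that by simp
  show "\<tau> f = 0 \<Longrightarrow> hitl f = f" "\<tau> f = 0 \<Longrightarrow> hitr f = f"
    unfolding f by (simp_all add: te)
  show "\<tau> f = 0 \<Longrightarrow> hitl x = x" "\<tau> f = 0 \<Longrightarrow> hitr x = x"
    unfolding x by (simp_all add: t'(2-5) te tx s)
  assume u: "group_elem u"
  have "u \<in> carrier H" "comult H u = t2 H u u" using u unfolding group_elem_def by blast+
  then show "hitl u = \<tau> u \<odot>\<^bsub>H\<^esub> u" "hitr u = \<tau> u \<odot>\<^bsub>H\<^esub> u" by (simp_all only: hit_eval)
qed

lemma datum_sides:
  assumes h: "h \<in> carrier H"
  shows "lift2 H (comult H h) (\<lambda>a b. \<tau> b \<odot>\<^bsub>H\<^esub> (a \<otimes>\<^bsub>H\<^esub> v)) = hitr h \<otimes>\<^bsub>H\<^esub> v"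
    and "lift2 H (comult H h) (\<lambda>a b. \<tau> a \<odot>\<^bsub>H\<^esub> (v \<otimes>\<^bsub>H\<^esub> b)) = v \<otimes>\<^bsub>H\<^esub> hitl h"
proof -
  have b: "bilinear H H H (\<lambda>a b. \<tau> b \<odot>\<^bsub>H\<^esub> (a \<otimes>\<^bsub>H\<^esub> v))" "bilinear H H H (\<lambda>a b. \<tau> a \<odot>\<^bsub>H\<^esub> (v \<otimes>\<^bsub>H\<^esub> b))"
    by (rule bilinearI; (rule linear_map_smult[OF k_alg] linear_map_scale[OF k_alg] linear_map_mult_left[OF k_alg]
        linear_map_mult_right[OF k_alg] linear_map_id alg_hom_linear[OF t] m_closed v | assumption)+)+
  note e = P2.lift2_tens[OF k_alg b(1)] P2.lift2_tens[OF k_alg b(2)] P2.lift2_tens[OF k_alg hit_bilinear(1)] P2.lift2_tens[OF k_alg hit_bilinear(2)]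
  show "lift2 H (comult H h) (\<lambda>a b. \<tau> b \<odot>\<^bsub>H\<^esub> (a \<otimes>\<^bsub>H\<^esub> v)) = hitr h \<otimes>\<^bsub>H\<^esub> v"
    by (rule T2_eqI[OF P2.lift2_linear[OF k_alg b(1)] linear_map_mult_left[OF k_alg P2.lift2_linear[OF k_alg hit_bilinear(2)] v] _ comult_simps(1)[OF h]])
      (use v in \<open>simp only: e smult_mult\<close>)
  show "lift2 H (comult H h) (\<lambda>a b. \<tau> a \<odot>\<^bsub>H\<^esub> (v \<otimes>\<^bsub>H\<^esub> b)) = v \<otimes>\<^bsub>H\<^esub> hitl h"
    by (rule T2_eqI[OF P2.lift2_linear[OF k_alg b(2)] linear_map_mult_right[OF k_alg P2.lift2_linear[OF k_alg hit_bilinear(1)] v] _ comult_simps(1)[OF h]])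
      (use v in \<open>simp only: e mult_smult\<close>)
qed

lemma theta_datum_iff:
  "theta_datum H \<tau> v \<longleftrightarrow> \<tau> v = - 1 \<and> counit H v = 1 \<and> comult H v = lift3 (T2 H) (reassoc H) dg2 \<and>
     (\<forall>h\<in>carrier H. hitr h \<otimes>\<^bsub>H\<^esub> v = v \<otimes>\<^bsub>H\<^esub> hitl h)"
  unfolding theta_datum_def reassoc_inv using datum_sides by simp

text \<open>On generators \<open>\<tau> \<tau> = \<epsilon>\<close> in the convolution sense, so applying \<open>\<tau> \<otimes> \<tau>\<close> to the coproduct condition gives
  \<open>\<epsilon>(v) = 1\<close> on the left and \<open>(1 - 2 \<tau>(f))\<^sup>3\<close> on the right; \<open>\<tau>(f) = 1\<close> would yield \<open>1 = -1\<close>.\<close>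

lemma theta_datum_consequences:
  assumes d: "theta_datum H \<tau> v" and u: "group_elem u" and gen: "generated_by H {f, x, u}" and two: "(2::'k) \<noteq> 0"
  shows "\<tau> f = 0" "\<tau> u = 1 \<or> \<tau> u = - 1" "comult H v = t2 H v v" "f \<otimes>\<^bsub>H\<^esub> v = v \<otimes>\<^bsub>H\<^esub> f" "x \<otimes>\<^bsub>H\<^esub> v = v \<otimes>\<^bsub>H\<^esub> x"
proof -
  note D = d[unfolded theta_datum_iff]
  note cv = character_values[OF t]
  have U: "u \<in> carrier H" "u \<otimes>\<^bsub>H\<^esub> u = \<one>\<^bsub>H\<^esub>" "comult H u = t2 H u u" "counit H u = 1"
    using u unfolding group_elem_def by blast+
  have uu: "\<tau> u * \<tau> u = 1" using t'(4)[OF U(1,1)] by (simp only: U(2) t'(5))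
  then show "\<tau> u = 1 \<or> \<tau> u = - 1" by (simp add: square_eq_1_iff)
  note cl = ec fc xc one_closed m_closed a_closed smult_closed t2_closed T2.a_closed U(1)
  note l = alg_homD(2,3)[OF tt_hom, unfolded scalars_simps] tt_t2
  have "tt (comult H v) = counit H v"
  proof (rule alg_hom_eqI[OF k_alg gen alg_hom_comp[OF comult_hom tt_hom] counit_hom _ v])
    fix y assume "y \<in> {f, x, u}"
    then show "tt (comult H y) = counit H y"
    proof (elim insertE emptyE)
      assume y: "y = f"
      have "tt (comult H f) = \<tau> e * \<tau> f + \<tau> f * \<tau> e" unfolding comult_f by (simp only: l cl)
      then show ?thesis unfolding y counit_f using cv(1,2) by auto
    next
      assume y: "y = x"
      have "tt (comult H x) = 0" unfolding comult_x dx_def e_minus_f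
        by (simp only: l cl t'(4) cv(3) mult_zero_left mult_zero_right add_0_left)
      then show ?thesis unfolding y counit_x .
    next
      assume y: "y = u"
      show ?thesis unfolding y U(3,4) using uu by (simp only: l cl)
    qed
  qed
  then have "(1 - 2 * \<tau> f) ^ 3 = 1" using D tt_datum by simp
  then show tf: "\<tau> f = 0"
  proof (rule contrapos_pp)
    assume "\<tau> f \<noteq> 0"
    then have "\<tau> f = 1" using cv(2) by simp
    moreover have "(1::'k) \<noteq> - 1" using two by (metis add.right_inverse one_add_one)
    ultimately show "(1 - 2 * \<tau> f) ^ 3 \<noteq> 1" by (simp add: power3_eq_cube)
  qed
  show "comult H v = t2 H v v" using D datum_collapse[OF tf] by simp
  show "f \<otimes>\<^bsub>H\<^esub> v = v \<otimes>\<^bsub>H\<^esub> f" "x \<otimes>\<^bsub>H\<^esub> v = v \<otimes>\<^bsub>H\<^esub> x"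
    using D fc xc by (metis hit_f[OF tf], metis hit_x[OF tf])
qed

end

lemma theta_datum_group_elem:
  assumes t: "\<tau> \<in> alg_hom H scalars" and u: "group_elem u" and gen: "generated_by H {f, x, u}"
    and tf: "\<tau> f = 0" and tu: "\<tau> u = - 1"
  shows "theta_datum H \<tau> u"
proof -
  have U: "u \<in> carrier H" "comult H u = t2 H u u" "counit H u = 1" "u \<otimes>\<^bsub>H\<^esub> f = f \<otimes>\<^bsub>H\<^esub> u" "x \<otimes>\<^bsub>H\<^esub> u = u \<otimes>\<^bsub>H\<^esub> x"
    using u unfolding group_elem_def by blast+
  note hits = hit_hom[OF t U(1)]
  have "hitr \<tau> h \<otimes>\<^bsub>H\<^esub> u = u \<otimes>\<^bsub>H\<^esub> hitl \<tau> h" if "h \<in> carrier H" for h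
  proof (rule intertwiner[OF k_alg k_alg gen hits(2,1) U(1) _ that])
    fix y assume "y \<in> {f, x, u}"
    then show "hitr \<tau> y \<otimes>\<^bsub>H\<^esub> u = u \<otimes>\<^bsub>H\<^esub> hitl \<tau> y"
      by (elim insertE emptyE)
        (simp_all only: hit_f[OF t U(1) tf] hit_x[OF t U(1) tf] hit_group[OF t U(1) u] U(1,4,5) smult_mult mult_smult)
  qed
  then show ?thesis
    unfolding theta_datum_iff[OF t U(1)] datum_collapse[OF t U(1) tf] using tu U by blast
qed

end

section \<open>Central grouplike elements of $H_q(8)$\<close>

context nil_alg
begin

lemma power_g: "x [^]\<^bsub>P\<^esub> (m::nat) \<otimes>\<^bsub>P\<^esub> g = (- 1) ^ m \<odot>\<^bsub>P\<^esub> (g \<otimes>\<^bsub>P\<^esub> x [^]\<^bsub>P\<^esub> m)"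
proof (induction m)
  case 0
  show ?case by simp
next
  case (Suc m)
  have "x [^]\<^bsub>P\<^esub> Suc m \<otimes>\<^bsub>P\<^esub> g = (-1) \<odot>\<^bsub>P\<^esub> (x [^]\<^bsub>P\<^esub> m \<otimes>\<^bsub>P\<^esub> g \<otimes>\<^bsub>P\<^esub> x)"
    by (simp add: m_assoc relations(3) minus_smult)
  also have "\<dots> = (- 1) ^ Suc m \<odot>\<^bsub>P\<^esub> (g \<otimes>\<^bsub>P\<^esub> x [^]\<^bsub>P\<^esub> Suc m)"
    unfolding Suc by (simp add: m_assoc)
  finally show ?case .
qed

lemma basis_closed: "basis i \<in> carrier P"
  by (cases i) (simp add: basis_def)

lemma coord_basis: "m < n \<Longrightarrow> j < n \<Longrightarrow> coord (a, j) (basis (b, m)) = (if a = b \<and> j = m then 1 else 0)"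
  using dual_basis_facts(4)[OF k_alg dual_basis_nil, of "(a, j)" "(b, m)"] by simp

text \<open>Moving \<open>g\<close> through \<open>x\<^sup>j\<close> produces the sign \<open>(-1)\<^sup>j\<close>.\<close>

lemma coord_right_g:
  assumes u: "u \<in> carrier P" and j: "j < n"
  shows "coord (a, j) (u \<otimes>\<^bsub>P\<^esub> g) = (- 1) ^ j * coord (\<not> a, j) u"
proof (rule dual_basis_linear_eqI[OF k_alg dual_basis_nil k_algebra_scalars
      linear_map_comp[OF linear_map_mult_left[OF k_alg linear_map_id closed(1)] coord_linear] linear_map_times(2)[OF coord_linear] _ u])
  fix i :: "bool \<times> nat" assume "i \<in> UNIV \<times> {..<n}"
  then obtain b m where i: "i = (b, m)" "m < n" by blast
  have "basis (b, m) \<otimes>\<^bsub>P\<^esub> g = (- 1) ^ m \<odot>\<^bsub>P\<^esub> basis (\<not> b, m)"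
    by (simp add: basis_def m_assoc power_g) (simp add: m_assoc[symmetric] relations(1))
  then show "coord (a, j) (basis i \<otimes>\<^bsub>P\<^esub> g) = (- 1) ^ j * coord (\<not> a, j) (basis i)"
    using linear_mapD(3)[OF coord_linear basis_closed] i j by (simp add: coord_basis)
qed

lemma coord_right_x:
  assumes u: "u \<in> carrier P" and j: "0 < j" "j < n"
  shows "coord (a, j) (u \<otimes>\<^bsub>P\<^esub> x) = coord (a, j - 1) u"
proof (rule dual_basis_linear_eqI[OF k_alg dual_basis_nil k_algebra_scalars
      linear_map_comp[OF linear_map_mult_left[OF k_alg linear_map_id closed(2)] coord_linear] coord_linear _ u])
  fix i :: "bool \<times> nat" assume "i \<in> UNIV \<times> {..<n}"
  then obtain b m where i: "i = (b, m)" "m < n" by blast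
  have s: "basis (b, m) \<otimes>\<^bsub>P\<^esub> x = basis (b, Suc m)"
    by (simp add: basis_def m_assoc)
  show "coord (a, j) (basis i \<otimes>\<^bsub>P\<^esub> x) = coord (a, j - 1) (basis i)"
  proof (cases "Suc m < n")
    case True
    then show ?thesis unfolding i s using i j by (auto simp: coord_basis)
  next
    case False
    then have m: "Suc m = n" using i by simp
    then have "basis (b, Suc m) = \<zero>\<^bsub>P\<^esub>" unfolding basis_def prod.case m relations(2) by simp
    moreover have "j - 1 \<noteq> m" using j m by linarith
    ultimately show ?thesis unfolding i s
      using linear_map_zero[OF k_alg k_algebra_scalars coord_linear] i j m by (simp add: coord_basis)
  qed
qed

end

context
  fixes q :: "'k::field"
  assumes q: "quartic q"
begin

interpretation N: nil_alg 4 "TYPE('k)" by unfold_locales simp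
interpretation E: qh_core "H8 q" e8 f8 x8 q by (rule H8_core[OF q])

text \<open>Comparing coordinates, commutation with \<open>g\<^sub>1\<close> kills the odd powers of \<open>x\<close>, and commutation with \<open>x\<close> then kills
  every monomial involving \<open>g\<^sub>1\<close>. There remains \<open>1 + d x\<^sup>2\<close>, and \<open>d = 0\<close> by the coefficient of
  \<open>x\<^sup>2 \<otimes> x\<^sup>2\<close>, which does not occur in \<open>\<Delta>(x\<^sup>2)\<close>.\<close>

lemma H8_central_grouplike:
  assumes u: "u \<in> carrier (H8 q)" and uf: "u \<otimes>\<^bsub>H8 q\<^esub> f8 = f8 \<otimes>\<^bsub>H8 q\<^esub> u" and ux: "u \<otimes>\<^bsub>H8 q\<^esub> x8 = x8 \<otimes>\<^bsub>H8 q\<^esub> u"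
    and du: "comult (H8 q) u = t2 (H8 q) u u" and eu: "counit (H8 q) u = 1"
  shows "u = \<one>\<^bsub>H8 q\<^esub>"
proof -
  have two: "(2::'k) \<noteq> 0" using q by (simp add: quartic_def)
  have s': "carrier (H8 q) = carrier P8" "monoid.mult (H8 q) = monoid.mult P8" "monoid.one (H8 q) = monoid.one P8"
    "ring.zero (H8 q) = ring.zero P8" "ring.add (H8 q) = ring.add P8" "module.smult (H8 q) = module.smult P8"
    using same_H8[OF q] by (simp_all add: same_algebra_def)
  note gdef = H8_e_minus_f[OF q, unfolded E.e_minus_f]
  have "u \<otimes>\<^bsub>H8 q\<^esub> (\<one>\<^bsub>H8 q\<^esub> \<oplus>\<^bsub>H8 q\<^esub> (-1) \<odot>\<^bsub>H8 q\<^esub> f8) = (\<one>\<^bsub>H8 q\<^esub> \<oplus>\<^bsub>H8 q\<^esub> (-1) \<odot>\<^bsub>H8 q\<^esub> f8) \<otimes>\<^bsub>H8 q\<^esub> u"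
    using u E.fc E.one_closed
    by (simp only: E.l_distr E.r_distr E.smult_mult E.mult_smult E.smult_closed uf E.l_one E.r_one)
  then have ue: "u \<otimes>\<^bsub>H8 q\<^esub> e8 = e8 \<otimes>\<^bsub>H8 q\<^esub> u" unfolding E.e_complement[symmetric] .
  have "u \<otimes>\<^bsub>H8 q\<^esub> (e8 \<oplus>\<^bsub>H8 q\<^esub> (-1) \<odot>\<^bsub>H8 q\<^esub> f8) = (e8 \<oplus>\<^bsub>H8 q\<^esub> (-1) \<odot>\<^bsub>H8 q\<^esub> f8) \<otimes>\<^bsub>H8 q\<^esub> u"
    using u E.fc E.ec by (simp only: E.l_distr E.r_distr E.smult_mult E.mult_smult E.smult_closed uf ue)
  then have ugH: "u \<otimes>\<^bsub>H8 q\<^esub> g8 = g8 \<otimes>\<^bsub>H8 q\<^esub> u" unfolding gdef .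
  have uP: "u \<in> carrier P8" using u s' by simp
  have ug: "u \<otimes>\<^bsub>P8\<^esub> g8 = g8 \<otimes>\<^bsub>P8\<^esub> u" and uxP: "u \<otimes>\<^bsub>P8\<^esub> x8 = x8 \<otimes>\<^bsub>P8\<^esub> u"
    using ugH ux by (simp_all only: s')
  let ?c = "\<lambda>i. N.coord i u"
  have dbl: "(z::'k) = 0" if "z = - z" for z
  proof -
    have "2 * z = 0" using that by (metis add.right_inverse mult_2)
    then show ?thesis using two by simp
  qed
  have odd: "?c (a, j) = 0" if "j < 4" "odd j" for a j
    using N.coord_right_g[OF uP that(1), of "\<not> a"] N.coord_mult(1)[OF uP, of "\<not> a" j] that(2)
    unfolding ug by (intro dbl) simp
  have gpart: "?c (True, m) = 0" if "m < 3" for m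
    using N.coord_right_x[OF uP, of "Suc m" True] N.coord_mult(2)[OF uP, of True "Suc m"] that
    unfolding uxP by (intro dbl) simp
  define d where "d = ?c (False, 2)"
  define w where "w = N.x \<otimes>\<^bsub>N.P\<^esub> N.x"
  have w: "w \<in> carrier P8" "w = x8 [^]\<^bsub>P8\<^esub> (2::nat)" unfolding w_def by (simp_all add: N.pow_2)
  have ueq: "u = ?c (False, 0) \<odot>\<^bsub>P8\<^esub> \<one>\<^bsub>P8\<^esub> \<oplus>\<^bsub>P8\<^esub> d \<odot>\<^bsub>P8\<^esub> w"
  proof (rule dual_basis_eqI[OF N.k_alg N.dual_basis_nil uP])
    show "?c (False, 0) \<odot>\<^bsub>P8\<^esub> \<one>\<^bsub>P8\<^esub> \<oplus>\<^bsub>P8\<^esub> d \<odot>\<^bsub>P8\<^esub> w \<in> carrier P8" using w by simp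
    fix i :: "bool \<times> nat" assume "i \<in> UNIV \<times> {..<4}"
    then obtain a m where i: "i = (a, m)" "m < 4" by blast
    have r: "N.coord i (?c (False, 0) \<odot>\<^bsub>P8\<^esub> \<one>\<^bsub>P8\<^esub> \<oplus>\<^bsub>P8\<^esub> d \<odot>\<^bsub>P8\<^esub> w) = ?c (False, 0) * (if i = (False, 0) then 1 else 0) + d * (if i = (False, 2) then 1 else 0)"
    proof -
      note L = linear_mapD(2,3)[OF N.coord_linear[of i], unfolded scalars_simps]
      have "N.coord i w = (if i = (False, 2) then 1 else 0)" unfolding w(2) by (rule N.coord_power) simp
      then show ?thesis by (simp only: L w(1) N.smult_closed N.one_closed N.coord_one)
    qed
    have "m = 0 \<or> m = 1 \<or> m = 2 \<or> m = 3" using i by linarith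
    then show "N.coord i u = N.coord i (?c (False, 0) \<odot>\<^bsub>P8\<^esub> \<one>\<^bsub>P8\<^esub> \<oplus>\<^bsub>P8\<^esub> d \<odot>\<^bsub>P8\<^esub> w)"
      unfolding r unfolding i by (cases a) (elim disjE; simp add: d_def gpart odd)+
  qed
  have ueqH: "u = ?c (False, 0) \<odot>\<^bsub>H8 q\<^esub> \<one>\<^bsub>H8 q\<^esub> \<oplus>\<^bsub>H8 q\<^esub> d \<odot>\<^bsub>H8 q\<^esub> (x8 \<otimes>\<^bsub>H8 q\<^esub> x8)"
    using ueq unfolding w_def s' .
  have "counit (H8 q) (?c (False, 0) \<odot>\<^bsub>H8 q\<^esub> \<one>\<^bsub>H8 q\<^esub> \<oplus>\<^bsub>H8 q\<^esub> d \<odot>\<^bsub>H8 q\<^esub> (x8 \<otimes>\<^bsub>H8 q\<^esub> x8)) = ?c (False, 0)"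
    by (simp only: E.counit_simps E.counit_x E.one_closed E.xc E.m_closed E.smult_closed mult_zero_right add_0_right mult_1_right)
  then have c0: "?c (False, 0) = 1" using eu ueqH by simp
  have u1: "u = \<one>\<^bsub>H8 q\<^esub> \<oplus>\<^bsub>H8 q\<^esub> d \<odot>\<^bsub>H8 q\<^esub> (x8 \<otimes>\<^bsub>H8 q\<^esub> x8)"
    using ueqH unfolding c0 E.smult_1[OF E.one_closed] .
  text \<open>The coefficient of \<open>x\<^sup>2 \<otimes> x\<^sup>2\<close> vanishes in the coproduct of \<open>1 + d x\<^sup>2\<close> and is the square of \<open>d\<close> in
    the tensor square.\<close>
  let ?k = "N.coord (False, 2)"
  have kl: "linear_map (H8 q) scalars ?k"
    using N.coord_linear[of "(False, 2)"] unfolding linear_map_def s' .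
  have bil: "bilinear (H8 q) (H8 q) scalars (\<lambda>a b. ?k a * ?k b)"
    by (rule bilinearI; rule linear_map_times; rule kl)
  let ?\<psi> = "\<lambda>t. lift2 scalars t (\<lambda>a b. ?k a * ?k b)"
  note pl = linear_mapD(2,3)[OF E.P2.lift2_linear[OF k_algebra_scalars bil], unfolded scalars_simps]
  note pt = E.P2.lift2_tens[OF k_algebra_scalars bil]
  have kv: "?k \<one>\<^bsub>H8 q\<^esub> = 0" "?k g8 = 0" "?k x8 = 0" "?k (x8 \<otimes>\<^bsub>H8 q\<^esub> g8) = 0"
  proof -
    have g1: "N.coord (a, j) g8 = (if a \<and> j = 0 then 1 else 0)" for a j
      using N.coord_mult(1)[OF N.one_closed, of a j] by (simp add: N.coord_one)
    show "?k \<one>\<^bsub>H8 q\<^esub> = 0" "?k g8 = 0" "?k x8 = 0" "?k (x8 \<otimes>\<^bsub>H8 q\<^esub> g8) = 0"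
      unfolding s' using N.coord_one[of "(False, 2)"] g1 N.coord_power[of 1 "(False, 2)"] N.coord_mult(2)[of g8 False 2] by simp_all
  qed
  let ?y = "e8 \<oplus>\<^bsub>H8 q\<^esub> q \<odot>\<^bsub>H8 q\<^esub> f8"
  let ?a = "t2 (H8 q) x8 ?y" and ?b1 = "t2 (H8 q) \<one>\<^bsub>H8 q\<^esub> (e8 \<otimes>\<^bsub>H8 q\<^esub> x8)" and ?b2 = "t2 (H8 q) g8 (f8 \<otimes>\<^bsub>H8 q\<^esub> x8)"
  let ?b = "?b1 \<oplus>\<^bsub>T2 (H8 q)\<^esub> ?b2"
  have gc: "g8 \<in> carrier (H8 q)" unfolding s' by simp
  note cl = E.ec E.fc E.xc gc E.one_closed E.m_closed E.a_closed E.smult_closed E.t2_closed E.T2.a_closed E.T2.m_closed E.T2.smult_closed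
  have "?y \<otimes>\<^bsub>H8 q\<^esub> ?y = e8 \<oplus>\<^bsub>H8 q\<^esub> (-1) \<odot>\<^bsub>H8 q\<^esub> f8"
    by (simp only: E.l_distr E.r_distr E.smult_mult E.mult_smult cl E.smult_smult E.ee E.ef E.fe E.ff E.smult_zero E.zero_closed E.l_zero E.r_zero E.qq)
  then have yy: "?y \<otimes>\<^bsub>H8 q\<^esub> ?y = g8" unfolding gdef .
  note parts = E.dx_parts(1,2)[OF E.qq, unfolded H8_e_minus_f[OF q]]
  have dxab: "comult (H8 q) x8 = ?a \<oplus>\<^bsub>T2 (H8 q)\<^esub> ?b"
    unfolding E.comult_x E.dx_def H8_e_minus_f[OF q] by (rule E.T2.a_assoc) (intro cl)+
  have ab: "?a \<otimes>\<^bsub>T2 (H8 q)\<^esub> ?b = t2 (H8 q) x8 (?y \<otimes>\<^bsub>H8 q\<^esub> (e8 \<otimes>\<^bsub>H8 q\<^esub> x8)) \<oplus>\<^bsub>T2 (H8 q)\<^esub> t2 (H8 q) (x8 \<otimes>\<^bsub>H8 q\<^esub> g8) (?y \<otimes>\<^bsub>H8 q\<^esub> (f8 \<otimes>\<^bsub>H8 q\<^esub> x8))"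
    by (simp only: E.T2.r_distr E.t2_mult cl E.r_one)
  have aa: "?a \<otimes>\<^bsub>T2 (H8 q)\<^esub> ?a = t2 (H8 q) (x8 \<otimes>\<^bsub>H8 q\<^esub> x8) g8"
    by (simp only: E.t2_mult cl yy)
  have pab: "?\<psi> (?a \<otimes>\<^bsub>T2 (H8 q)\<^esub> ?b) = 0"
    unfolding ab by (simp only: pl pt cl kv mult_zero_left add_0_left)
  define a where "a = ?a"
  define b where "b = ?b"
  have c: "a \<in> carrier (T2 (H8 q))" "b \<in> carrier (T2 (H8 q))" unfolding a_def b_def by (intro cl)+
  have \<psi>0: "?\<psi> (a \<otimes>\<^bsub>T2 (H8 q)\<^esub> a) = 0" "?\<psi> (a \<otimes>\<^bsub>T2 (H8 q)\<^esub> b) = 0" "?\<psi> (b \<otimes>\<^bsub>T2 (H8 q)\<^esub> b) = 0"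
    unfolding a_def b_def by (simp only: aa pt cl kv mult_zero_right, rule pab, simp only: parts pt cl kv mult_zero_left)
  have ba: "b \<otimes>\<^bsub>T2 (H8 q)\<^esub> a = q \<odot>\<^bsub>T2 (H8 q)\<^esub> (a \<otimes>\<^bsub>T2 (H8 q)\<^esub> b)"
    unfolding a_def b_def by (rule parts(1))
  have \<psi>ba: "?\<psi> (b \<otimes>\<^bsub>T2 (H8 q)\<^esub> a) = 0"
    unfolding ba by (simp only: pl E.T2.m_closed c \<psi>0 mult_zero_right)
  have pxx: "?\<psi> (comult (H8 q) (x8 \<otimes>\<^bsub>H8 q\<^esub> x8)) = 0"
    unfolding E.comult_simps(4)[OF E.xc E.xc] dxab[folded a_def b_def]
      E.T2.r_distr[OF c E.T2.a_closed[OF c]] E.T2.l_distr[OF c c(1)] E.T2.l_distr[OF c c(2)]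
    by (simp only: pl E.T2.m_closed E.T2.a_closed c \<psi>0 \<psi>ba add_0_left)
  have "comult (H8 q) (\<one>\<^bsub>H8 q\<^esub> \<oplus>\<^bsub>H8 q\<^esub> d \<odot>\<^bsub>H8 q\<^esub> (x8 \<otimes>\<^bsub>H8 q\<^esub> x8)) =
      t2 (H8 q) \<one>\<^bsub>H8 q\<^esub> \<one>\<^bsub>H8 q\<^esub> \<oplus>\<^bsub>T2 (H8 q)\<^esub> d \<odot>\<^bsub>T2 (H8 q)\<^esub> comult (H8 q) (x8 \<otimes>\<^bsub>H8 q\<^esub> x8)"
    by (simp only: E.comult_simps(2,3,5) E.t2_one cl)
  then have cu: "comult (H8 q) u = t2 (H8 q) \<one>\<^bsub>H8 q\<^esub> \<one>\<^bsub>H8 q\<^esub> \<oplus>\<^bsub>T2 (H8 q)\<^esub> d \<odot>\<^bsub>T2 (H8 q)\<^esub> comult (H8 q) (x8 \<otimes>\<^bsub>H8 q\<^esub> x8)"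
    unfolding u1[symmetric] .
  have xx: "comult (H8 q) (x8 \<otimes>\<^bsub>H8 q\<^esub> x8) \<in> carrier (T2 (H8 q))" by (rule E.comult_simps(1)[OF E.m_closed[OF E.xc E.xc]])
  have "?\<psi> (comult (H8 q) u) = 0"
    unfolding cu by (simp only: pl pt E.t2_closed E.one_closed E.T2.smult_closed xx kv pxx mult_zero_right add_0_left)
  then have "d * d = 0" unfolding du pt[OF u u] d_def .
  then have d0: "d = 0" by simp
  show ?thesis using u1 unfolding d0 E.smult_0[OF E.m_closed[OF E.xc E.xc]] E.r_zero[OF E.one_closed] .
qed

end

section \<open>Elements of the left tensor factor\<close>

context two_pre_qh
begin

lemma factors_commute:
  "h \<in> carrier H \<Longrightarrow> k \<in> carrier K \<Longrightarrow> tens H K \<one>\<^bsub>H\<^esub> k \<otimes>\<^bsub>Q\<^esub> tens H K h \<one>\<^bsub>K\<^esub> = tens H K h \<one>\<^bsub>K\<^esub> \<otimes>\<^bsub>Q\<^esub> tens H K \<one>\<^bsub>H\<^esub> k"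
  unfolding Q_simps by (simp only: HK.tens_mult H.one_closed K.one_closed H.l_one H.r_one K.l_one K.r_one)

lemma left_elems:
  assumes core: "qh_core Q (tens H K \<one>\<^bsub>H\<^esub> e) (tens H K \<one>\<^bsub>H\<^esub> f) (tens H K \<one>\<^bsub>H\<^esub> x) q" and efx: "e \<in> carrier K" "f \<in> carrier K" "x \<in> carrier K"
    and z: "z \<in> carrier H" "z \<otimes>\<^bsub>H\<^esub> z = \<one>\<^bsub>H\<^esub>" "comult H z = t2 H z z" "counit H z = 1" "antipode H z = z"
  shows left_group_elem: "qh_core.group_elem Q (tens H K \<one>\<^bsub>H\<^esub> e) (tens H K \<one>\<^bsub>H\<^esub> f) (tens H K \<one>\<^bsub>H\<^esub> x) (tens H K z \<one>\<^bsub>K\<^esub>)"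
    and left_skew_elem: "w \<in> carrier H \<Longrightarrow> w \<otimes>\<^bsub>H\<^esub> w = \<zero>\<^bsub>H\<^esub> \<Longrightarrow> w \<otimes>\<^bsub>H\<^esub> z = (-1) \<odot>\<^bsub>H\<^esub> (z \<otimes>\<^bsub>H\<^esub> w) \<Longrightarrow>
      comult H w = t2 H z w \<oplus>\<^bsub>T2 H\<^esub> t2 H w \<one>\<^bsub>H\<^esub> \<Longrightarrow> counit H w = 0 \<Longrightarrow> antipode H w = \<ominus>\<^bsub>H\<^esub> (z \<otimes>\<^bsub>H\<^esub> w) \<Longrightarrow>
      qh_core.skew_elem Q (tens H K \<one>\<^bsub>H\<^esub> e) (tens H K \<one>\<^bsub>H\<^esub> f) (tens H K \<one>\<^bsub>H\<^esub> x) (tens H K z \<one>\<^bsub>K\<^esub>) (tens H K w \<one>\<^bsub>K\<^esub>)"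
proof -
  note I = alg_homD[OF i_hom] linear_map_zero[OF H.k_alg k_algebra_Q alg_hom_linear[OF i_hom]]
    linear_map_minus(1)[OF H.k_alg k_algebra_Q alg_hom_linear[OF i_hom]]
  note M = linear_mapD(2)[OF alg_hom_linear[OF i2_hom]] T2_map(2)[OF H.k_alg k_algebra_Q i_hom]
  show "qh_core.group_elem Q (tens H K \<one>\<^bsub>H\<^esub> e) (tens H K \<one>\<^bsub>H\<^esub> f) (tens H K \<one>\<^bsub>H\<^esub> x) (tens H K z \<one>\<^bsub>K\<^esub>)"
    unfolding qh_core.group_elem_def[OF core]
    by (intro conjI) (simp_all only: I(1,5) I(4)[symmetric] structure_i z M factors_commute efx)
  assume w: "w \<in> carrier H" "w \<otimes>\<^bsub>H\<^esub> w = \<zero>\<^bsub>H\<^esub>" "w \<otimes>\<^bsub>H\<^esub> z = (-1) \<odot>\<^bsub>H\<^esub> (z \<otimes>\<^bsub>H\<^esub> w)"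
    "comult H w = t2 H z w \<oplus>\<^bsub>T2 H\<^esub> t2 H w \<one>\<^bsub>H\<^esub>" "counit H w = 0" "antipode H w = \<ominus>\<^bsub>H\<^esub> (z \<otimes>\<^bsub>H\<^esub> w)"
  have zw: "z \<otimes>\<^bsub>H\<^esub> w \<in> carrier H" using z w by simp
  show "qh_core.skew_elem Q (tens H K \<one>\<^bsub>H\<^esub> e) (tens H K \<one>\<^bsub>H\<^esub> f) (tens H K \<one>\<^bsub>H\<^esub> x) (tens H K z \<one>\<^bsub>K\<^esub>) (tens H K w \<one>\<^bsub>K\<^esub>)"
    unfolding qh_core.skew_elem_def[OF core]
  proof (intro conjI)
    show "comult Q (tens H K w \<one>\<^bsub>K\<^esub>) = t2 Q (tens H K z \<one>\<^bsub>K\<^esub>) (tens H K w \<one>\<^bsub>K\<^esub>) \<oplus>\<^bsub>T2 Q\<^esub> t2 Q (tens H K w \<one>\<^bsub>K\<^esub>) \<one>\<^bsub>Q\<^esub>"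
      unfolding structure_i(1)[OF w(1)] w(4) I(5)[symmetric]
      by (simp only: M z(1) w(1) H.t2_closed H.one_closed)
    show "antipode Q (tens H K w \<one>\<^bsub>K\<^esub>) = \<ominus>\<^bsub>Q\<^esub> (tens H K z \<one>\<^bsub>K\<^esub> \<otimes>\<^bsub>Q\<^esub> tens H K w \<one>\<^bsub>K\<^esub>)"
      unfolding structure_i(3)[OF w(1)] w(6) by (simp only: I(4)[symmetric] I(7) z(1) w(1) zw)
    show "tens H K w \<one>\<^bsub>K\<^esub> \<otimes>\<^bsub>Q\<^esub> tens H K z \<one>\<^bsub>K\<^esub> = (-1) \<odot>\<^bsub>Q\<^esub> (tens H K z \<one>\<^bsub>K\<^esub> \<otimes>\<^bsub>Q\<^esub> tens H K w \<one>\<^bsub>K\<^esub>)"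
      by (simp only: I(4)[symmetric] I(3)[symmetric] z(1) w(1,3) zw)
    show "tens H K w \<one>\<^bsub>K\<^esub> \<otimes>\<^bsub>Q\<^esub> tens H K w \<one>\<^bsub>K\<^esub> = \<zero>\<^bsub>Q\<^esub>"
      by (simp only: I(4)[symmetric] I(6) w(1,2))
    show "tens H K w \<one>\<^bsub>K\<^esub> \<in> carrier Q" by (rule I(1)[OF w(1)])
    show "counit Q (tens H K w \<one>\<^bsub>K\<^esub>) = 0" unfolding structure_i(2)[OF w(1)] by (rule w(5))
  qed (rule factors_commute[OF w(1), symmetric] efx)+
qed

end

section \<open>The algebra $H_q(16)$\<close>

context
  fixes q :: "'k::field"
  assumes q: "quartic q"
begin

interpretation N: nil_alg 4 "TYPE('k)" by unfold_locales simp
interpretation E: qh_core "H8 q" e8 f8 x8 q by (rule H8_core[OF q])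
interpretation B: two_pre_qh kC2 "H8 q" by unfold_locales (rule kC2_facts(1) E.pre)+

abbreviation (input) "H \<equiv> H8 q"
abbreviation (input) "A \<equiv> H16 q"
abbreviation "J k \<equiv> tens kC2 (H8 q) \<one>\<^bsub>kC2\<^esub> k"

lemma two: "(2::'k) \<noteq> 0" using q by (simp add: quartic_def)

lemma H16_Q: "A = B.Q"
  unfolding H16_def B.Q_def ..

lemma pre16: "pre_quasi_hopf A" unfolding H16_Q by (rule B.pre_Q)

lemma k16: "k_algebra A" unfolding H16_Q by (rule B.k_algebra_Q)

lemma J_hom: "(\<lambda>k. J k) \<in> quasi_hopf_hom H A"
  unfolding H16_Q by (rule B.right_factor_hom[OF kC2_facts(8-10) E.reassoc_closed])

lemma J_alg_hom: "(\<lambda>k. J k) \<in> alg_hom H A"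
  unfolding H16_Q by (rule B.j_hom)

lemmas Jh = alg_homD[OF J_alg_hom]

lemma core16: "qh_core A (J e8) (J f8) (J x8) q"
  by (rule E.core_transfer[OF pre16 J_hom])

lemma x16_J: "x16 q = J x8" and g1_J: "g1 q = J g8"
  unfolding x16_def g1_def H8_rels_nil N.x_def N.g_def by (rule refl)+

lemma g2_group: "qh_core.group_elem A (J e8) (J f8) (J x8) (g2 q)"
  unfolding g2_def H16_Q
  by (rule B.left_group_elem[OF core16[unfolded H16_Q] E.ec E.fc E.xc kC2_facts(2,3,5,6,7)])

lemma g2_props: "g2 q \<in> carrier A" "g2 q \<otimes>\<^bsub>A\<^esub> g2 q = \<one>\<^bsub>A\<^esub>" "comult A (g2 q) = t2 A (g2 q) (g2 q)" "counit A (g2 q) = 1"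
  using g2_group unfolding qh_core.group_elem_def[OF core16] by blast+

lemma J_g2: "k \<in> carrier H \<Longrightarrow> J k \<otimes>\<^bsub>A\<^esub> g2 q = g2 q \<otimes>\<^bsub>A\<^esub> J k"
  unfolding g2_def H16_Q by (rule B.factors_commute[OF kC2_facts(2)])

lemma gen16: "generated_by A {J f8, J x8, g2 q}"
proof -
  have "(\<lambda>a. tens kC2 H a \<one>\<^bsub>H\<^esub>) ` {mon 1} \<union> (\<lambda>b. J b) ` {f8, x8} = {J f8, J x8, g2 q}"
    unfolding g2_def image_insert image_empty by blast
  then show ?thesis using B.generated_Q[OF kC2_facts(4) H8_generated[OF q]] unfolding H16_Q by simp
qed

text \<open>The algebra \<open>H\<^sub>q(16)\<close> is a sum of two copies of \<open>H\<^sub>q(8)\<close>, one for each sign of \<open>g\<^sub>2\<close>.\<close>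

lemma projection:
  assumes s: "s * s = (1::'k)"
  shows "\<exists>p\<in>alg_hom A H. (\<forall>h\<in>carrier H. p (J h) = h) \<and> p (g2 q) = s \<odot>\<^bsub>H\<^esub> \<one>\<^bsub>H\<^esub>"
proof -
  let ?\<kappa> = "lin_ext H (\<lambda>m::int. if m = 0 then \<one>\<^bsub>H\<^esub> else s \<odot>\<^bsub>H\<^esub> \<one>\<^bsub>H\<^esub>)"
  have \<kappa>: "?\<kappa> \<in> alg_hom kC2 H" "?\<kappa> (mon 1) = s \<odot>\<^bsub>H\<^esub> \<one>\<^bsub>H\<^esub>"
    by (rule kC2_lift[OF E.k_alg]; simp add: s)+
  note k = alg_homD[OF \<kappa>(1)]
  have comm: "b \<otimes>\<^bsub>H\<^esub> ?\<kappa> a = ?\<kappa> a \<otimes>\<^bsub>H\<^esub> b" if a: "a \<in> carrier kC2" and b: "b \<in> carrier H" for a b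
  proof (rule intertwiner[OF B.H.k_alg E.k_alg kC2_facts(4) \<kappa>(1) \<kappa>(1) b _ a, symmetric])
    fix y :: "int \<Rightarrow>\<^sub>0 'k" assume "y \<in> {mon 1}"
    then have y: "y = mon 1" by blast
    show "?\<kappa> y \<otimes>\<^bsub>H\<^esub> b = b \<otimes>\<^bsub>H\<^esub> ?\<kappa> y" unfolding y \<kappa>(2) using b by simp
  qed
  have h: "bilinear kC2 H H (\<lambda>a b. ?\<kappa> a \<otimes>\<^bsub>H\<^esub> b)" "(\<lambda>t. lift2 H t (\<lambda>a b. ?\<kappa> a \<otimes>\<^bsub>H\<^esub> b)) \<in> alg_hom (tensor_alg kC2 H) H"
    by (rule alg_hom_tensorI[OF B.H.k_alg E.k_alg E.k_alg \<kappa>(1) alg_hom_id], rule comm, assumption, assumption)+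
  note v = B.HK.lift2_tens[OF E.k_alg h(1)]
  have p1: "(\<lambda>t. lift2 H t (\<lambda>a b. ?\<kappa> a \<otimes>\<^bsub>H\<^esub> b)) \<in> alg_hom A H"
    using h(2) alg_hom_same[OF B.same_Q same_algebra_refl, of H] unfolding H16_Q by blast
  have p2: "lift2 H (J h) (\<lambda>a b. ?\<kappa> a \<otimes>\<^bsub>H\<^esub> b) = h" if "h \<in> carrier H" for h
    unfolding v[OF B.H.one_closed that] k(5) using that by simp
  have p3: "lift2 H (g2 q) (\<lambda>a b. ?\<kappa> a \<otimes>\<^bsub>H\<^esub> b) = s \<odot>\<^bsub>H\<^esub> \<one>\<^bsub>H\<^esub>"
    unfolding g2_def v[OF kC2_facts(2) E.one_closed] \<kappa>(2) by simp
  show ?thesis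
  proof (rule bexI[OF _ p1], intro conjI ballI)
    show "lift2 H (J h) (\<lambda>a b. ?\<kappa> a \<otimes>\<^bsub>H\<^esub> b) = h" if "h \<in> carrier H" for h
      by (rule p2[OF that])
    show "lift2 H (g2 q) (\<lambda>a b. ?\<kappa> a \<otimes>\<^bsub>H\<^esub> b) = s \<odot>\<^bsub>H\<^esub> \<one>\<^bsub>H\<^esub>" by (rule p3)
  qed
qed

text \<open>Signs multiply under the coproduct because \<open>g\<^sub>2\<close> is grouplike.\<close>

lemma projection_comult:
  assumes p: "p1 \<in> alg_hom A H" "\<And>h. h \<in> carrier H \<Longrightarrow> p1 (J h) = h" "p1 (g2 q) = s1 \<odot>\<^bsub>H\<^esub> \<one>\<^bsub>H\<^esub>"
    and p': "p2 \<in> alg_hom A H" "\<And>h. h \<in> carrier H \<Longrightarrow> p2 (J h) = h" "p2 (g2 q) = s2 \<odot>\<^bsub>H\<^esub> \<one>\<^bsub>H\<^esub>"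
    and p'': "p3 \<in> alg_hom A H" "\<And>h. h \<in> carrier H \<Longrightarrow> p3 (J h) = h" "p3 (g2 q) = (s1 * s2) \<odot>\<^bsub>H\<^esub> \<one>\<^bsub>H\<^esub>"
    and v: "v \<in> carrier A" "comult A v = t2 A v v"
  shows "comult H (p3 v) = t2 H (p1 v) (p2 v)"
proof -
  let ?P = "\<lambda>t. lift2 (T2 H) t (\<lambda>a b. t2 H (p1 a) (p2 b))"
  note m = alg_hom_tensor_map[OF k16 k16 E.k_alg E.k_alg p(1) p'(1), folded T2_def t2_def]
  interpret A2: two_algebras A A using k16 by unfold_locales
  have v2: "?P (t2 A a b) = t2 H (p1 a) (p2 b)" if "a \<in> carrier A" "b \<in> carrier A" for a b
    using A2.lift2_tens[OF E.k_algebra_T2 m(1) that] by (simp only: t2_def)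
  have "?P (comult A v) = comult H (p3 v)"
  proof (rule alg_hom_eqI[OF k16 gen16 alg_hom_comp[OF _ m(2)] alg_hom_comp[OF p''(1) E.comult_hom] _ v(1)])
    show "comult A \<in> alg_hom A (T2 A)" using pre16 by (simp add: pre_quasi_hopf_def)
    have j: "?P (comult A (J h)) = comult H (p3 (J h))" if h: "h \<in> carrier H" for h
    proof -
      have "comult A (J h) = lift2 (T2 A) (comult H h) (\<lambda>a b. t2 A (J a) (J b))"
        using J_hom h unfolding quasi_hopf_hom_def by blast
      moreover have "?P (lift2 (T2 A) t (\<lambda>a b. t2 A (J a) (J b))) = t" if "t \<in> carrier (T2 H)" for t
        by (rule E.T2_eqI[OF linear_map_comp[OF alg_hom_linear[OF T2_map(1)[OF E.k_alg k16 J_alg_hom]] alg_hom_linear[OF m(2)]] linear_map_id _ that])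
          (simp only: T2_map(2)[OF E.k_alg k16 J_alg_hom] v2 Jh(1) p(2) p'(2))
      ultimately show ?thesis using E.comult_simps(1)[OF h] by (simp only: p''(2)[OF h])
    qed
    fix y assume "y \<in> {J f8, J x8, g2 q}"
    then show "?P (comult A y) = comult H (p3 y)"
    proof (elim insertE emptyE)
      assume y: "y = J f8"
      show ?thesis unfolding y by (rule j[OF E.fc])
    next
      assume y: "y = J x8"
      show ?thesis unfolding y by (rule j[OF E.xc])
    next
      assume y: "y = g2 q"
      show ?thesis
        unfolding y g2_props(3) v2[OF g2_props(1) g2_props(1)] p(3) p'(3) p''(3)
        by (simp only: E.comult_simps(3,5) E.one_closed E.smult_closed E.t2_distrib E.t2_one E.T2.smult_smult E.t2_closed mult.commute)
    qed
  qed
  then show ?thesis unfolding v(2) v2[OF v(1) v(1)] by (rule sym)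
qed

lemma H16_decompose:
  assumes "w \<in> carrier A"
  shows "\<exists>a\<in>carrier H. \<exists>b\<in>carrier H. w = J a \<oplus>\<^bsub>A\<^esub> g2 q \<otimes>\<^bsub>A\<^esub> J b"
proof -
  interpret A: kalg A using k16 by simp
  note g = g2_props(1)
  have Jz: "J \<zero>\<^bsub>H\<^esub> = \<zero>\<^bsub>A\<^esub>" by (rule linear_map_zero[OF E.k_alg k16 alg_hom_linear[OF J_alg_hom]])
  have j: "\<exists>a\<in>carrier H. \<exists>b\<in>carrier H. J h = J a \<oplus>\<^bsub>A\<^esub> g2 q \<otimes>\<^bsub>A\<^esub> J b" if "h \<in> carrier H" for h
    by (rule bexI[of _ h], rule bexI[of _ "\<zero>\<^bsub>H\<^esub>"]) (use that g Jh(1) in \<open>simp_all add: Jz\<close>)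
  show ?thesis
    using k16 gen16 assms
  proof (induction w rule: generated_induct)
    case (gen y)
    then show ?case
    proof (elim insertE emptyE)
      assume y: "y = J f8"
      show ?thesis unfolding y by (rule j[OF E.fc])
    next
      assume y: "y = J x8"
      show ?thesis unfolding y by (rule j[OF E.xc])
    next
      assume y: "y = g2 q"
      show ?thesis unfolding y
        by (rule bexI[of _ "\<zero>\<^bsub>H\<^esub>"], rule bexI[of _ "\<one>\<^bsub>H\<^esub>"]) (use g in \<open>simp_all add: Jz Jh(5)\<close>)
    qed
  next
    case one
    show ?case unfolding Jh(5)[symmetric] by (rule j[OF E.one_closed])
  next
    case (add a b)
    from add(3,4) obtain a0 a1 b0 b1 where c: "a0 \<in> carrier H" "a1 \<in> carrier H" "b0 \<in> carrier H" "b1 \<in> carrier H"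
      and e: "a = J a0 \<oplus>\<^bsub>A\<^esub> g2 q \<otimes>\<^bsub>A\<^esub> J a1" "b = J b0 \<oplus>\<^bsub>A\<^esub> g2 q \<otimes>\<^bsub>A\<^esub> J b1" by blast
    note c' = Jh(1)[OF c(1)] Jh(1)[OF c(2)] Jh(1)[OF c(3)] Jh(1)[OF c(4)]
    have "a \<oplus>\<^bsub>A\<^esub> b = J (a0 \<oplus>\<^bsub>H\<^esub> b0) \<oplus>\<^bsub>A\<^esub> g2 q \<otimes>\<^bsub>A\<^esub> J (a1 \<oplus>\<^bsub>H\<^esub> b1)"
      unfolding e Jh(2)[OF c(1,3)] Jh(2)[OF c(2,4)] using c' g by (simp add: A.r_distr A.a_ac)
    then show ?case using E.a_closed[OF c(1,3)] E.a_closed[OF c(2,4)] by blast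
  next
    case (smult r a)
    from smult(2) obtain a0 a1 where c: "a0 \<in> carrier H" "a1 \<in> carrier H"
      and e: "a = J a0 \<oplus>\<^bsub>A\<^esub> g2 q \<otimes>\<^bsub>A\<^esub> J a1" by blast
    note c' = Jh(1)[OF c(1)] Jh(1)[OF c(2)]
    have "r \<odot>\<^bsub>A\<^esub> a = J (r \<odot>\<^bsub>H\<^esub> a0) \<oplus>\<^bsub>A\<^esub> g2 q \<otimes>\<^bsub>A\<^esub> J (r \<odot>\<^bsub>H\<^esub> a1)"
      unfolding e Jh(3)[OF c(1)] Jh(3)[OF c(2)] using c' g by (simp add: A.smult_add_right)
    then show ?case using E.smult_closed[OF c(1)] E.smult_closed[OF c(2)] by blast
  next
    case (mult a b)
    from mult(3,4) obtain a0 a1 b0 b1 where c: "a0 \<in> carrier H" "a1 \<in> carrier H" "b0 \<in> carrier H" "b1 \<in> carrier H"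
      and e: "a = J a0 \<oplus>\<^bsub>A\<^esub> g2 q \<otimes>\<^bsub>A\<^esub> J a1" "b = J b0 \<oplus>\<^bsub>A\<^esub> g2 q \<otimes>\<^bsub>A\<^esub> J b1" by blast
    note c' = Jh(1)[OF c(1)] Jh(1)[OF c(2)] Jh(1)[OF c(3)] Jh(1)[OF c(4)]
    have l: "J k \<otimes>\<^bsub>A\<^esub> (g2 q \<otimes>\<^bsub>A\<^esub> w) = g2 q \<otimes>\<^bsub>A\<^esub> (J k \<otimes>\<^bsub>A\<^esub> w)" if "k \<in> carrier H" "w \<in> carrier A" for k w
      using that Jh(1)[OF that(1)] g by (simp only: A.m_assoc[symmetric] J_g2)
    have gg: "g2 q \<otimes>\<^bsub>A\<^esub> (g2 q \<otimes>\<^bsub>A\<^esub> w) = w" if "w \<in> carrier A" for w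
      using that g by (simp only: A.m_assoc[symmetric] g2_props(2) A.l_one)
    have "a \<otimes>\<^bsub>A\<^esub> b = J (a0 \<otimes>\<^bsub>H\<^esub> b0 \<oplus>\<^bsub>H\<^esub> a1 \<otimes>\<^bsub>H\<^esub> b1) \<oplus>\<^bsub>A\<^esub> g2 q \<otimes>\<^bsub>A\<^esub> J (a0 \<otimes>\<^bsub>H\<^esub> b1 \<oplus>\<^bsub>H\<^esub> a1 \<otimes>\<^bsub>H\<^esub> b0)"
      unfolding e using c c' g by (simp add: Jh(2,4) A.l_distr A.r_distr A.m_assoc l gg A.a_ac)
    then show ?case using c by (intro bexI[of _ "a0 \<otimes>\<^bsub>H\<^esub> b0 \<oplus>\<^bsub>H\<^esub> a1 \<otimes>\<^bsub>H\<^esub> b1"] bexI[of _ "a0 \<otimes>\<^bsub>H\<^esub> b1 \<oplus>\<^bsub>H\<^esub> a1 \<otimes>\<^bsub>H\<^esub> b0"]) simp_all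
  qed
qed

text \<open>The projections of \<open>v\<close> are \<open>1\<close> and \<open>-1\<close>. For the second, \<open>w\<^sub>- \<otimes> w\<^sub>- = 1 \<otimes> 1\<close> and \<open>\<epsilon>(w\<^sub>-) = -1\<close>. Since
  \<open>v = a + g\<^sub>2 b\<close> with projections \<open>a + b\<close> and \<open>a - b\<close>, it follows that \<open>a = 0\<close> and \<open>b = 1\<close>.\<close>

lemma datum_unique:
  assumes t: "\<tau> \<in> alg_hom A scalars" and v: "v \<in> carrier A" and d: "theta_datum A \<tau> v"
  shows "\<tau> (J f8) = 0" "\<tau> (g2 q) = - 1" "v = g2 q"
proof -
  interpret A: kalg A using k16 by simp
  note tx = qh_core.character_values(3)[OF core16 t]
  note c = qh_core.theta_datum_consequences[OF core16 t v d g2_group gen16 two]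
  have D: "\<tau> v = - 1" "counit A v = 1" using d unfolding theta_datum_def by blast+
  show tf: "\<tau> (J f8) = 0" by (rule c(1))
  obtain p where p: "p \<in> alg_hom A H" "\<And>h. h \<in> carrier H \<Longrightarrow> p (J h) = h" "p (g2 q) = 1 \<odot>\<^bsub>H\<^esub> \<one>\<^bsub>H\<^esub>"
    using projection[OF mult_1_left] by blast
  obtain m where m: "m \<in> alg_hom A H" "\<And>h. h \<in> carrier H \<Longrightarrow> m (J h) = h" "m (g2 q) = (-1) \<odot>\<^bsub>H\<^esub> \<one>\<^bsub>H\<^esub>"
    using projection[of "- 1"] by auto
  note ph = alg_homD[OF p(1)] and mh = alg_homD[OF m(1)]
  have cA: "counit A \<in> alg_hom A scalars" using pre16 by (simp add: pre_quasi_hopf_def)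
  have cJ: "counit A (J h) = counit H h" if "h \<in> carrier H" for h
    using J_hom that unfolding quasi_hopf_hom_def by blast
  have eps: "F v = counit H (r v)"
    if "F \<in> alg_hom A scalars" "r \<in> alg_hom A H" "\<And>h. h \<in> carrier H \<Longrightarrow> r (J h) = h" "r (g2 q) = s \<odot>\<^bsub>H\<^esub> \<one>\<^bsub>H\<^esub>"
      "F (J f8) = 0" "F (J x8) = 0" "F (g2 q) = s" for F r s
  proof (rule alg_hom_eqI[OF k16 gen16 that(1) alg_hom_comp[OF that(2) E.counit_hom] _ v])
    fix y assume "y \<in> {J f8, J x8, g2 q}"
    then show "F y = counit H (r y)"
      by (elim insertE emptyE) (simp_all only: that E.fc E.xc E.counit_f E.counit_x E.counit_simps E.one_closed mult_1_right)
  qed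
  let ?u = "p v" and ?w = "m v"
  have uc: "?u \<in> carrier H" "?w \<in> carrier H" by (rule ph(1)[OF v] mh(1)[OF v])+
  have "counit A v = counit H ?u"
    by (rule eps[OF cA p(1) _ p(3)]) (simp_all only: p(2) cJ[OF E.fc] cJ[OF E.xc] E.counit_f E.counit_x g2_props(4))
  then have eu: "counit H ?u = 1" using D(2) by simp
  have du: "comult H ?u = t2 H ?u ?u" by (rule projection_comult[OF p p _ _ _ v c(3)]) (use p in simp_all)
  have dw: "comult H ?u = t2 H ?w ?w" by (rule projection_comult[OF m m _ _ _ v c(3)]) (use p in simp_all)
  have u1: "?u = \<one>\<^bsub>H\<^esub>"
  proof (rule H8_central_grouplike[OF q uc(1) _ _ du eu])
    show "?u \<otimes>\<^bsub>H\<^esub> f8 = f8 \<otimes>\<^bsub>H\<^esub> ?u"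
      using ph(4)[OF v Jh(1)[OF E.fc]] ph(4)[OF Jh(1)[OF E.fc] v] by (simp only: c(4) p(2)[OF E.fc])
    show "?u \<otimes>\<^bsub>H\<^esub> x8 = x8 \<otimes>\<^bsub>H\<^esub> ?u"
      using ph(4)[OF v Jh(1)[OF E.xc]] ph(4)[OF Jh(1)[OF E.xc] v] by (simp only: c(5) p(2)[OF E.xc])
  qed
  have ne: "(1::'k) \<noteq> - 1" using two by (metis add.right_inverse one_add_one)
  have "\<tau> (g2 q) \<noteq> 1"
  proof
    assume "\<tau> (g2 q) = 1"
    then have "\<tau> v = counit H ?u" by (intro eps[OF t p(1) _ p(3) tf tx]) (rule p(2))
    then show False using D(1) eu ne by simp
  qed
  then show tg: "\<tau> (g2 q) = - 1" using c(2) by simp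
  have "\<tau> v = counit H ?w" by (rule eps[OF t m(1) _ m(3) tf tx tg]) (rule m(2))
  then have ew: "counit H ?w = - 1" using D(1) by simp
  have w1: "(-1) \<odot>\<^bsub>H\<^esub> ?w = \<one>\<^bsub>H\<^esub>"
  proof -
    have b: "bilinear H H H (\<lambda>a b. counit H a \<odot>\<^bsub>H\<^esub> b)" by (rule qh_core.hit_bilinear[OF H8_core[OF q] E.counit_hom E.one_closed])
    note l = E.P2.lift2_tens[OF E.k_alg b]
    have "t2 H ?w ?w = t2 H \<one>\<^bsub>H\<^esub> \<one>\<^bsub>H\<^esub>" using dw du unfolding u1 by simp
    then have "counit H ?w \<odot>\<^bsub>H\<^esub> ?w = counit H \<one>\<^bsub>H\<^esub> \<odot>\<^bsub>H\<^esub> \<one>\<^bsub>H\<^esub>"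
      using l[OF uc(2,2)] l[OF E.one_closed E.one_closed] by simp
    then show ?thesis unfolding ew E.counit_simps(5) by simp
  qed
  obtain a b where ab: "a \<in> carrier H" "b \<in> carrier H" and veq: "v = J a \<oplus>\<^bsub>A\<^esub> g2 q \<otimes>\<^bsub>A\<^esub> J b"
    using H16_decompose[OF v] by blast
  note cl = Jh(1)[OF ab(1)] Jh(1)[OF ab(2)] g2_props(1) A.m_closed[OF g2_props(1) Jh(1)[OF ab(2)]]
  have pv: "a \<oplus>\<^bsub>H\<^esub> b = \<one>\<^bsub>H\<^esub>"
  proof -
    have "p (J a \<oplus>\<^bsub>A\<^esub> g2 q \<otimes>\<^bsub>A\<^esub> J b) = a \<oplus>\<^bsub>H\<^esub> b"
      by (simp only: ph(2,4) cl p ab E.smult_1 E.one_closed E.l_one)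
    then show ?thesis using u1 unfolding veq by simp
  qed
  have "m (J a \<oplus>\<^bsub>A\<^esub> g2 q \<otimes>\<^bsub>A\<^esub> J b) = a \<oplus>\<^bsub>H\<^esub> (-1) \<odot>\<^bsub>H\<^esub> b"
    by (simp only: mh(2,4) cl m ab E.smult_mult E.one_closed E.l_one)
  then have mv: "b \<oplus>\<^bsub>H\<^esub> (-1) \<odot>\<^bsub>H\<^esub> a = \<one>\<^bsub>H\<^esub>"
    using w1 ab unfolding veq by (simp add: E.smult_add_right E.a_comm)
  have "2 \<odot>\<^bsub>H\<^esub> b = (a \<oplus>\<^bsub>H\<^esub> b) \<oplus>\<^bsub>H\<^esub> (b \<oplus>\<^bsub>H\<^esub> (-1) \<odot>\<^bsub>H\<^esub> a)"
  proof -
    have "(a \<oplus>\<^bsub>H\<^esub> b) \<oplus>\<^bsub>H\<^esub> (b \<oplus>\<^bsub>H\<^esub> (-1) \<odot>\<^bsub>H\<^esub> a) = (b \<oplus>\<^bsub>H\<^esub> b) \<oplus>\<^bsub>H\<^esub> (a \<oplus>\<^bsub>H\<^esub> (-1) \<odot>\<^bsub>H\<^esub> a)"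
      using ab by (simp only: E.a_ac E.smult_closed E.a_closed)
    also have "\<dots> = 2 \<odot>\<^bsub>H\<^esub> b" using ab by (simp add: E.smult_collect)
    finally show ?thesis ..
  qed
  also have "\<dots> = 2 \<odot>\<^bsub>H\<^esub> \<one>\<^bsub>H\<^esub>" unfolding pv mv by (rule E.smult_collect(4)[OF E.one_closed])
  finally have "(1 / 2) \<odot>\<^bsub>H\<^esub> (2 \<odot>\<^bsub>H\<^esub> b) = (1 / 2) \<odot>\<^bsub>H\<^esub> (2 \<odot>\<^bsub>H\<^esub> \<one>\<^bsub>H\<^esub>)" by simp
  then have b1: "b = \<one>\<^bsub>H\<^esub>" using ab(2) two by simp
  have "(a \<oplus>\<^bsub>H\<^esub> b) \<oplus>\<^bsub>H\<^esub> (-1) \<odot>\<^bsub>H\<^esub> b = a" using ab by (simp add: E.a_assoc E.smult_collect)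
  then have "\<one>\<^bsub>H\<^esub> \<oplus>\<^bsub>H\<^esub> (-1) \<odot>\<^bsub>H\<^esub> b = a" unfolding pv .
  then have "a = \<one>\<^bsub>H\<^esub> \<oplus>\<^bsub>H\<^esub> (-1) \<odot>\<^bsub>H\<^esub> \<one>\<^bsub>H\<^esub>" unfolding b1 by (rule sym)
  then have a0: "a = \<zero>\<^bsub>H\<^esub>" by (simp add: E.smult_collect)
  have Jz: "J \<zero>\<^bsub>H\<^esub> = \<zero>\<^bsub>A\<^esub>" by (rule linear_map_zero[OF E.k_alg k16 alg_hom_linear[OF J_alg_hom]])
  show "v = g2 q" unfolding veq a0 b1 Jz Jh(5) using g2_props(1) by simp
qed

lemma character_g1:
  assumes t: "\<tau> \<in> alg_hom A scalars"
  shows "\<tau> (g1 q) = 1 \<longleftrightarrow> \<tau> (J f8) = 0" "\<tau> (x16 q) = 0"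
proof -
  interpret A: kalg A using k16 by simp
  note l = alg_homD[OF t, unfolded scalars_simps]
  show "\<tau> (x16 q) = 0" unfolding x16_J by (rule qh_core.character_values(3)[OF core16 t])
  have "\<tau> (J (e8 \<oplus>\<^bsub>H\<^esub> (-1) \<odot>\<^bsub>H\<^esub> f8)) = \<tau> (J e8) + (-1) * \<tau> (J f8)"
    by (simp only: Jh l E.ec E.fc E.smult_closed A.smult_closed)
  moreover have arith: "1 - z + (-1) * z = 1 - 2 * z" for z :: 'k
    by ((algebra; fail) | (simp add: algebra_simps; fail))
  ultimately have v: "\<tau> (g1 q) = 1 - 2 * \<tau> (J f8)"
    unfolding g1_J H8_e_minus_f[OF q, unfolded E.e_minus_f] qh_core.character_values(1)[OF core16 t] by (rule trans)
  show "\<tau> (g1 q) = 1 \<longleftrightarrow> \<tau> (J f8) = 0"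
    unfolding v using two by ((simp add: diff_eq_eq; fail) | (auto; fail))
qed

lemma character_eqI:
  assumes "\<tau> \<in> characters A" "\<tau>' \<in> characters A" "\<tau> (J f8) = \<tau>' (J f8)" "\<tau> (g2 q) = \<tau>' (g2 q)"
  shows "\<tau> = \<tau>'"
proof -
  have t: "\<tau> \<in> alg_hom A scalars" "\<tau>' \<in> alg_hom A scalars" "\<tau> \<in> extensional (carrier A)" "\<tau>' \<in> extensional (carrier A)"
    using assms(1,2) by (simp_all add: characters_def)
  show ?thesis
  proof (rule extensionalityI[OF t(3,4)])
    fix h assume h: "h \<in> carrier A"
    show "\<tau> h = \<tau>' h"
    proof (rule alg_hom_eqI[OF k16 gen16 t(1,2) _ h])
      fix y assume "y \<in> {J f8, J x8, g2 q}"
      then show "\<tau> y = \<tau>' y"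
        by (elim insertE emptyE)
          (simp_all only: assms(3,4) qh_core.character_values(3)[OF core16 t(1)] qh_core.character_values(3)[OF core16 t(2)])
    qed
  qed
qed

lemma distinguished_character: "\<exists>\<sigma>\<in>characters A. \<sigma> (J f8) = 0 \<and> \<sigma> (g2 q) = - 1"
proof -
  obtain m where m: "m \<in> alg_hom A H" "\<And>h. h \<in> carrier H \<Longrightarrow> m (J h) = h" "m (g2 q) = (-1) \<odot>\<^bsub>H\<^esub> \<one>\<^bsub>H\<^esub>"
    using projection[of "- 1"] by auto
  let ?s = "restrict (\<lambda>h. counit H (m h)) (carrier A)"
  have "?s \<in> alg_hom A scalars"
    by (rule alg_hom_cong[OF alg_hom_comp[OF m(1) E.counit_hom] _ k16]) simp
  then have "?s \<in> characters A" by (simp add: characters_def)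
  moreover have "?s (J f8) = 0" using Jh(1)[OF E.fc] m(2)[OF E.fc] E.counit_f by simp
  moreover have "?s (g2 q) = - 1" using g2_props(1) m(3) E.counit_simps(3,5) by simp
  ultimately show ?thesis by blast
qed

lemma datum_iff:
  assumes \<sigma>: "\<sigma> \<in> characters A" "\<sigma> (J f8) = 0" "\<sigma> (g2 q) = - 1"
  shows "\<tau> \<in> characters A \<and> v \<in> carrier A \<and> theta_datum A \<tau> v \<longleftrightarrow> \<tau> = \<sigma> \<and> v = g2 q"
proof
  assume a: "\<tau> \<in> characters A \<and> v \<in> carrier A \<and> theta_datum A \<tau> v"
  then have av: "v \<in> carrier A" "theta_datum A \<tau> v" "\<tau> \<in> characters A" by blast+
  have "\<tau> \<in> alg_hom A scalars" using av(3) by (simp add: characters_def)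
  note u = datum_unique[OF this av(1,2)]
  have "\<tau> = \<sigma>" by (rule character_eqI[OF av(3) \<sigma>(1)]) (simp_all only: u(1,2) \<sigma>(2,3))
  with u(3) show "\<tau> = \<sigma> \<and> v = g2 q" by blast
next
  assume a: "\<tau> = \<sigma> \<and> v = g2 q"
  have s: "\<sigma> \<in> alg_hom A scalars" using \<sigma>(1) by (simp add: characters_def)
  show "\<tau> \<in> characters A \<and> v \<in> carrier A \<and> theta_datum A \<tau> v"
    using a \<sigma>(1) g2_props(1) qh_core.theta_datum_group_elem[OF core16 s g2_group gen16 \<sigma>(2,3)] by blast
qed

end

section \<open>The extension of $H_q(16)$ as a tensor product\<close>

context
  fixes q :: "'k::field" and \<sigma>
  assumes q: "quartic q" and s: "\<sigma> \<in> alg_hom (H16 q) scalars" and sf: "\<sigma> (J q f8) = 0" and sg: "\<sigma> (g2 q) = - 1"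
begin

interpretation N: nil_alg 4 "TYPE('k)" by unfold_locales simp
interpretation M: nil_alg 2 "TYPE('k)" by unfold_locales simp
interpretation E: qh_core "H8 q" e8 f8 x8 q by (rule H8_core[OF q])
interpretation W: two_pre_qh sweedler "H8 q" by unfold_locales (rule sweedler_facts(2) E.pre)+

abbreviation "V \<equiv> theta_gens (H16 q)"
abbreviation "R \<equiv> theta_rels (H16 q) \<sigma>"
abbreviation "D0 \<equiv> pres_alg V R"
abbreviation "\<iota> h \<equiv> pres_gen V R (Some h)"
abbreviation "\<theta> \<equiv> pres_gen V R None"
abbreviation "D \<equiv> theta_ext (H16 q) \<sigma> (g2 q)"
abbreviation (input) "g4 \<equiv> M.g"
abbreviation (input) "x4 \<equiv> M.x"
abbreviation "left a \<equiv> tens sweedler (H8 q) a \<one>\<^bsub>H8 q\<^esub>"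
abbreviation "right k \<equiv> tens sweedler (H8 q) \<one>\<^bsub>sweedler\<^esub> k"

lemma td: "theta_data (H16 q) (J q e8) (J q f8) (J q x8) q (g2 q) \<sigma>"
  by (intro theta_data.intro theta_data_axioms.intro core16[OF q] g2_group[OF q] gen16[OF q] s sf sg
      qh_core.character_values(3)[OF core16[OF q] s])

lemmas same_D = theta_data.same_D[OF td] and pre_D = theta_data.pre_D[OF td] and iota_D = theta_data.iota_D[OF td]
  and kD0 = theta_data.kD0[OF td] and iota_hom = theta_data.iota_hom[OF td]

lemmas i = alg_homD[OF iota_hom]
lemmas j = alg_homD[OF J_alg_hom[OF q]]

lemma iota_J: "(\<lambda>k. \<iota> (J q k)) \<in> alg_hom (H8 q) D0"
  by (rule alg_hom_comp[OF J_alg_hom[OF q] iota_hom])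

lemma core_D: "qh_core D (\<iota> (J q e8)) (\<iota> (J q f8)) (\<iota> (J q x8)) q"
  by (rule qh_core.core_transfer[OF core16[OF q] pre_D iota_D])

lemma group_D: "qh_core.group_elem D (\<iota> (J q e8)) (\<iota> (J q f8)) (\<iota> (J q x8)) (\<iota> (g2 q))"
  by (rule qh_core.group_elem_transfer[OF core16[OF q] pre_D iota_D g2_group[OF q]])

lemma skew_D: "qh_core.skew_elem D (\<iota> (J q e8)) (\<iota> (J q f8)) (\<iota> (J q x8)) (\<iota> (g2 q)) \<theta>"
proof -
  have s': "carrier D = carrier D0" "monoid.mult D = monoid.mult D0" "ring.zero D = ring.zero D0" "module.smult D = module.smult D0"
    using same_D by (simp_all add: same_algebra_def)
  show ?thesis
    unfolding qh_core.skew_elem_def[OF core_D]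
    by (intro conjI theta_data.theta_D[OF td], unfold s')
      (rule theta_data.theta_closed[OF td] theta_data.theta_square[OF td] theta_data.theta_u[OF td]
        theta_data.theta_fixed[OF td j(1)[OF E.ec] theta_data.tau_e[OF td], symmetric]
        theta_data.theta_fixed[OF td j(1)[OF E.fc] theta_data.tau_gens(1)[OF td], symmetric]
        theta_data.theta_fixed[OF td j(1)[OF E.xc] theta_data.tau_gens(2)[OF td], symmetric])+
qed

lemma gen_D: "generated_by D {\<iota> (J q f8), \<iota> (J q x8), \<iota> (g2 q), \<theta>}"
  by (rule generated_same[OF same_algebra_sym[OF same_D] theta_data.theta_generated[OF td]])

lemma extension_quasi_hopf: "quasi_hopf_algebra D"
  by (rule qh_core.quasi_hopf_algebra_generated[OF core_D group_D skew_D gen_D])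

lemma core_K: "qh_core W.Q (right e8) (right f8) (right x8) q"
  by (rule E.core_transfer[OF W.pre_Q W.right_factor_hom[OF sweedler_facts(10-12) E.reassoc_closed]])

lemma group_K: "qh_core.group_elem W.Q (right e8) (right f8) (right x8) (left g4)"
  by (rule W.left_group_elem[OF core_K E.ec E.fc E.xc sweedler_facts(13,15,4,6,8)])

lemma skew_K: "qh_core.skew_elem W.Q (right e8) (right f8) (right x8) (left g4) (left x4)"
  by (rule W.left_skew_elem[OF core_K E.ec E.fc E.xc sweedler_facts(13,15,4,6,8) sweedler_facts(14,16,17,5,7,9)])

text \<open>The morphism out of the extension sends \<open>g\<^sub>2\<close> and \<open>\<theta>\<close> to the generators of \<open>H\<^sub>4\<close>.\<close>

lemma forward:
  "\<exists>F\<in>alg_hom D0 W.Q. (\<forall>k\<in>carrier (H8 q). F (\<iota> (J q k)) = right k) \<and> F (\<iota> (g2 q)) = left g4 \<and> F \<theta> = left x4"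
proof -
  interpret Q: kalg W.Q using W.k_algebra_Q by simp
  have kC: "k_algebra (kC2 :: ('k, _) quasi_hopf)" using kC2_facts(1)[where ?'k = 'k] by (simp add: pre_quasi_hopf_def)
  have kC2_one: "\<one>\<^bsub>kC2\<^esub> \<in> carrier (kC2 :: ('k, _) quasi_hopf)"
    using kalg.k_alg kC unfolding k_algebra_def by (blast intro: ring.ring_simprules(6))
  interpret C: two_algebras "kC2 :: ('k, _) quasi_hopf" "H8 q" using kC E.k_alg by unfold_locales
  let ?\<gamma> = "lin_ext sweedler (\<lambda>m::int. if m = 0 then \<one>\<^bsub>sweedler\<^esub> else g4)"
  have \<gamma>: "?\<gamma> \<in> alg_hom kC2 sweedler" "?\<gamma> (mon 1) = g4"
    by (rule kC2_lift[OF W.H.k_alg sweedler_facts(13,15)]; simp)+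
  note I = alg_homD[OF W.i_hom] and g = alg_homD[OF \<gamma>(1)]
  have comm: "right b \<otimes>\<^bsub>W.Q\<^esub> left (?\<gamma> a) = left (?\<gamma> a) \<otimes>\<^bsub>W.Q\<^esub> right b" if "a \<in> carrier kC2" "b \<in> carrier (H8 q)" for a b
    by (rule W.factors_commute[OF g(1)[OF that(1)] that(2)])
  have h: "bilinear kC2 (H8 q) W.Q (\<lambda>a b. left (?\<gamma> a) \<otimes>\<^bsub>W.Q\<^esub> right b)"
    "(\<lambda>t. lift2 W.Q t (\<lambda>a b. left (?\<gamma> a) \<otimes>\<^bsub>W.Q\<^esub> right b)) \<in> alg_hom (tensor_alg kC2 (H8 q)) W.Q"
    by (rule alg_hom_tensorI[OF kC E.k_alg W.k_algebra_Q alg_hom_comp[OF \<gamma>(1) W.i_hom] W.j_hom], rule comm, assumption, assumption)+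
  note v = C.lift2_tens[OF W.k_algebra_Q h(1)]
  let ?\<phi> = "\<lambda>t. lift2 W.Q t (\<lambda>a b. left (?\<gamma> a) \<otimes>\<^bsub>W.Q\<^esub> right b)"
  have same: "same_algebra (H16 q) (tensor_alg kC2 (H8 q))"
    unfolding H16_def by (rule pre_quasi_hopf_tensor(2)[OF kC2_facts(1) E.pre])
  have \<phi>: "?\<phi> \<in> alg_hom (H16 q) W.Q" using h(2) alg_hom_same[OF same same_algebra_refl, of W.Q] by blast
  have \<phi>J: "?\<phi> (J q k) = right k" if "k \<in> carrier (H8 q)" for k
    unfolding v[OF kC2_one that] g(5) I(5) using alg_homD(1)[OF W.j_hom that] by (rule Q.l_one)
  have \<phi>g: "?\<phi> (g2 q) = left g4"
    unfolding g2_def v[OF kC2_facts(2) E.one_closed] \<gamma>(2) alg_homD(5)[OF W.j_hom] using I(1)[OF sweedler_facts(13)] by (rule Q.r_one)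
  let ?\<tau> = "theta_data.\<tau> (H16 q) \<sigma>"
  note tg = theta_data.tau_gens[OF td]
  have tc: "left x4 \<in> carrier W.Q" by (rule I(1)[OF sweedler_facts(14)])
  have tsq: "left x4 \<otimes>\<^bsub>W.Q\<^esub> left x4 = \<zero>\<^bsub>W.Q\<^esub>"
    unfolding I(4)[OF sweedler_facts(14,14), symmetric] sweedler_facts(16)
    by (rule linear_map_zero[OF W.H.k_alg W.k_algebra_Q alg_hom_linear[OF W.i_hom]])
  have comm': "?\<phi> h \<otimes>\<^bsub>W.Q\<^esub> left x4 = left x4 \<otimes>\<^bsub>W.Q\<^esub> ?\<phi> (?\<tau> h)" if "h \<in> carrier (H16 q)" for h
  proof (rule intertwiner[OF k16[OF q] W.k_algebra_Q gen16[OF q] \<phi> alg_hom_comp[OF theta_data.tau_hom[OF td] \<phi>] tc _ that])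
    fix y assume "y \<in> {J q f8, J q x8, g2 q}"
    then show "?\<phi> y \<otimes>\<^bsub>W.Q\<^esub> left x4 = left x4 \<otimes>\<^bsub>W.Q\<^esub> ?\<phi> (?\<tau> y)"
    proof (elim insertE emptyE)
      assume y: "y = J q f8"
      show ?thesis unfolding y tg \<phi>J[OF E.fc] by (rule W.factors_commute[OF sweedler_facts(14) E.fc])
    next
      assume y: "y = J q x8"
      show ?thesis unfolding y tg \<phi>J[OF E.xc] by (rule W.factors_commute[OF sweedler_facts(14) E.xc])
    next
      assume y: "y = g2 q"
      have gx: "g4 \<otimes>\<^bsub>sweedler\<^esub> x4 \<in> carrier sweedler" by (rule W.H.m_closed[OF sweedler_facts(13,14)])
      have xg: "left x4 \<otimes>\<^bsub>W.Q\<^esub> left g4 = (-1) \<odot>\<^bsub>W.Q\<^esub> (left g4 \<otimes>\<^bsub>W.Q\<^esub> left x4)"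
        unfolding I(4)[OF sweedler_facts(14,13), symmetric] I(4)[OF sweedler_facts(13,14), symmetric] sweedler_facts(17) by (rule I(3)[OF gx])
      show ?thesis unfolding y tg alg_homD(3)[OF \<phi> g2_props(1)[OF q]] \<phi>g
        using tc I(1)[OF sweedler_facts(13)] by (simp only: Q.mult_smult xg Q.smult_smult Q.m_closed) (simp del: W.Q_simps)
    qed
  qed
  let ?F = "pres_lift W.Q (case_option (left x4) ?\<phi>)"
  have F: "?F \<in> alg_hom D0 W.Q" "?F \<theta> = left x4" "\<And>h. h \<in> carrier (H16 q) \<Longrightarrow> ?F (\<iota> h) = ?\<phi> h"
    by (rule theta_data.theta_lift[OF td, where F = "case_option (left x4) ?\<phi>", OF W.k_algebra_Q \<phi> tc tsq comm']; simp only: option.case)+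
  show ?thesis
    by (intro bexI[OF _ F(1)] conjI ballI F(2)) (simp_all only: F(3) j(1) g2_props(1)[OF q] \<phi>J \<phi>g)
qed

text \<open>The elements \<open>g\<^sub>2\<close> and \<open>\<theta>\<close> satisfy the relations of \<open>H\<^sub>4\<close> and commute with \<open>H\<^sub>q(8)\<close>.\<close>

lemma backward:
  "\<exists>G\<in>alg_hom W.Q D0. (\<forall>k\<in>carrier (H8 q). G (right k) = \<iota> (J q k)) \<and> G (left g4) = \<iota> (g2 q) \<and> G (left x4) = \<theta>"
proof -
  interpret D: kalg D0 using kD0 by simp
  note g = g2_props[OF q]
  note ig = i(1)[OF g(1)] and tc = theta_data.theta_closed[OF td]
  let ?f = "case_gen (\<iota> (g2 q)) \<theta>"
  have r: "?f s \<in> carrier D0" "?f Gen_g \<otimes>\<^bsub>D0\<^esub> ?f Gen_g = \<one>\<^bsub>D0\<^esub>" "?f Gen_x [^]\<^bsub>D0\<^esub> (2::nat) = \<zero>\<^bsub>D0\<^esub>"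
    "?f Gen_g \<otimes>\<^bsub>D0\<^esub> ?f Gen_x \<oplus>\<^bsub>D0\<^esub> ?f Gen_x \<otimes>\<^bsub>D0\<^esub> ?f Gen_g = \<zero>\<^bsub>D0\<^esub>" for s
  proof -
    show "?f s \<in> carrier D0" using ig tc by (cases s) simp_all
    show "?f Gen_g \<otimes>\<^bsub>D0\<^esub> ?f Gen_g = \<one>\<^bsub>D0\<^esub>" unfolding gen.case i(4)[OF g(1,1), symmetric] g(2) by (rule i(5))
    show "?f Gen_x [^]\<^bsub>D0\<^esub> (2::nat) = \<zero>\<^bsub>D0\<^esub>" unfolding gen.case D.pow_2[OF tc] by (rule theta_data.theta_square[OF td])
    show "?f Gen_g \<otimes>\<^bsub>D0\<^esub> ?f Gen_x \<oplus>\<^bsub>D0\<^esub> ?f Gen_x \<otimes>\<^bsub>D0\<^esub> ?f Gen_g = \<zero>\<^bsub>D0\<^esub>"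
      unfolding gen.case theta_data.theta_u[OF td] using ig tc by (simp add: D.smult_collect)
  qed
  let ?c = "pres_lift D0 ?f"
  have c: "?c \<in> alg_hom sweedler D0" "?c g4 = \<iota> (g2 q)" "?c x4 = \<theta>"
    using M.lift[where f = ?f, OF kD0 r] alg_hom_same[OF sweedler_facts(1) same_algebra_refl, of D0] unfolding gen.case by blast+
  have gens: "\<iota> (J q b) \<otimes>\<^bsub>D0\<^esub> ?c y = ?c y \<otimes>\<^bsub>D0\<^esub> \<iota> (J q b)" if b: "b \<in> carrier (H8 q)" and y: "y \<in> {g4, x4}" for b y
  proof (rule intertwiner[OF E.k_alg kD0 H8_generated[OF q] iota_J iota_J _ _ b])
    show "?c y \<in> carrier D0" using y ig tc by (elim insertE emptyE) (simp_all only: c)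
    fix k :: "(gen list \<Rightarrow>\<^sub>0 'k) set" assume k: "k \<in> {f8, x8}"
    then have kc: "k \<in> carrier (H8 q)" using E.fc E.xc by blast
    have kt: "theta_data.\<tau> (H16 q) \<sigma> (J q k) = J q k"
      using k by (elim insertE emptyE) (simp_all only: theta_data.tau_gens[OF td])
    show "\<iota> (J q k) \<otimes>\<^bsub>D0\<^esub> ?c y = ?c y \<otimes>\<^bsub>D0\<^esub> \<iota> (J q k)"
      using y
    proof (elim insertE emptyE)
      assume y: "y = g4"
      show ?thesis unfolding y c i(4)[OF j(1)[OF kc] g(1), symmetric] i(4)[OF g(1) j(1)[OF kc], symmetric] J_g2[OF q kc] ..
    next
      assume y: "y = x4"
      show ?thesis unfolding y c by (rule theta_data.theta_fixed[OF td j(1)[OF kc] kt])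
    qed
  qed
  have comm: "\<iota> (J q b) \<otimes>\<^bsub>D0\<^esub> ?c a = ?c a \<otimes>\<^bsub>D0\<^esub> \<iota> (J q b)" if a: "a \<in> carrier sweedler" and b: "b \<in> carrier (H8 q)" for a b
    by (rule intertwiner[OF W.H.k_alg kD0 sweedler_facts(3) c(1) c(1) alg_homD(1)[OF iota_J b] gens[OF b, symmetric] a, symmetric])
  have h: "bilinear sweedler (H8 q) D0 (\<lambda>a b. ?c a \<otimes>\<^bsub>D0\<^esub> \<iota> (J q b))"
    "(\<lambda>t. lift2 D0 t (\<lambda>a b. ?c a \<otimes>\<^bsub>D0\<^esub> \<iota> (J q b))) \<in> alg_hom (tensor_alg sweedler (H8 q)) D0"
    by (rule alg_hom_tensorI[OF W.H.k_alg E.k_alg kD0 c(1) iota_J], rule comm, assumption, assumption)+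
  note v = W.HK.lift2_tens[OF kD0 h(1)]
  let ?G = "\<lambda>t. lift2 D0 t (\<lambda>a b. ?c a \<otimes>\<^bsub>D0\<^esub> \<iota> (J q b))"
  show ?thesis
  proof (intro bexI[of _ ?G] conjI ballI)
    show "?G \<in> alg_hom W.Q D0" using h(2) alg_hom_same[OF W.same_Q same_algebra_refl, of D0] by blast
    show "?G (right k) = \<iota> (J q k)" if "k \<in> carrier (H8 q)" for k
      unfolding v[OF W.H.one_closed that] alg_homD(5)[OF c(1)] using alg_homD(1)[OF iota_J that] by (rule D.l_one)
    show "?G (left g4) = \<iota> (g2 q)"
      unfolding v[OF sweedler_facts(13) E.one_closed] c(2) alg_homD(5)[OF iota_J] using ig by (rule D.r_one)
    show "?G (left x4) = \<theta>"
      unfolding v[OF sweedler_facts(14) E.one_closed] c(3) alg_homD(5)[OF iota_J] using tc by (rule D.r_one)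
  qed
qed

lemma extension_tensor_product:
  shows "quasi_hopf_isomorphic D (quasi_hopf_tensor sweedler (H8 q))" and "has_dimension D 32"
proof -
  obtain F where F: "F \<in> alg_hom D0 W.Q" "\<And>k. k \<in> carrier (H8 q) \<Longrightarrow> F (\<iota> (J q k)) = right k"
    "F (\<iota> (g2 q)) = left g4" "F \<theta> = left x4" using forward by blast
  obtain G where G: "G \<in> alg_hom W.Q D0" "\<And>k. k \<in> carrier (H8 q) \<Longrightarrow> G (right k) = \<iota> (J q k)"
    "G (left g4) = \<iota> (g2 q)" "G (left x4) = \<theta>" using backward by blast
  have GF: "G (F a) = a" if "a \<in> carrier D0" for a
  proof (rule alg_hom_eqI[OF kD0 theta_data.theta_generated[OF td] alg_hom_comp[OF F(1) G(1)] alg_hom_id _ that])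
    fix y assume "y \<in> {\<iota> (J q f8), \<iota> (J q x8), \<iota> (g2 q), \<theta>}"
    then show "G (F y) = y" by (elim insertE emptyE) (simp_all only: F(2-4) G(2-4) E.fc E.xc)
  qed
  have FG: "F (G a) = a" if "a \<in> carrier W.Q" for a
  proof (rule alg_hom_eqI[OF W.k_algebra_Q W.generated_Q[OF sweedler_facts(3) H8_generated[OF q]] alg_hom_comp[OF G(1) F(1)] alg_hom_id _ that])
    fix y assume "y \<in> (\<lambda>a. left a) ` {g4, x4} \<union> (\<lambda>b. right b) ` {f8, x8}"
    then have "y = left g4 \<or> y = left x4 \<or> y = right f8 \<or> y = right x8" by blast
    then show "F (G y) = y" by (elim disjE) (simp_all only: F(2-4) G(2-4) E.fc E.xc)
  qed
  have cD: "carrier D = carrier D0" using same_D by (simp add: same_algebra_def)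
  have FD: "F \<in> alg_hom D W.Q" using F(1) alg_hom_same[OF same_D same_algebra_refl, of W.Q] by blast
  have "F \<in> quasi_hopf_hom D W.Q"
  proof (rule qh_core.quasi_hopf_hom_on_generators[OF core_D _ FD group_D skew_D gen_D])
    show "qh_core W.Q (F (\<iota> (J q e8))) (F (\<iota> (J q f8))) (F (\<iota> (J q x8))) q"
      unfolding F(2)[OF E.ec] F(2)[OF E.fc] F(2)[OF E.xc] by (rule core_K)
    show "qh_core.group_elem W.Q (F (\<iota> (J q e8))) (F (\<iota> (J q f8))) (F (\<iota> (J q x8))) (F (\<iota> (g2 q)))"
      unfolding F(2)[OF E.ec] F(2)[OF E.fc] F(2)[OF E.xc] F(3) by (rule group_K)
    show "qh_core.skew_elem W.Q (F (\<iota> (J q e8))) (F (\<iota> (J q f8))) (F (\<iota> (J q x8))) (F (\<iota> (g2 q))) (F \<theta>)"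
      unfolding F(2)[OF E.ec] F(2)[OF E.fc] F(2)[OF E.xc] F(3,4) by (rule skew_K)
  qed
  moreover have "bij_betw F (carrier D) (carrier W.Q)"
    by (rule bij_betw_byWitness[where f' = G]) (use GF FG alg_homD(1)[OF F(1)] alg_homD(1)[OF G(1)] in \<open>unfold cD, blast+\<close>)
  ultimately show "quasi_hopf_isomorphic D (quasi_hopf_tensor sweedler (H8 q))"
    unfolding quasi_hopf_isomorphic_def W.Q_def[symmetric] using quasi_hopf_iso_iff by blast
  let ?T = "tensor_alg sweedler (H8 q)" and ?I = "((UNIV :: bool set) \<times> {..<2::nat}) \<times> ((UNIV :: bool set) \<times> {..<4::nat})"
  have kD: "k_algebra D" using pre_D by (simp add: pre_quasi_hopf_def)
  have l: "linear_map ?T D G" "linear_map D ?T F"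
    using G(1) F(1) alg_hom_same[OF W.same_Q same_algebra_sym[OF same_D]] alg_hom_same[OF same_algebra_sym[OF same_D] W.same_Q]
      alg_hom_linear[of G ?T D] alg_hom_linear[of F D ?T] by blast+
  have T: "tensor_alg M.P N.P = ?T"
    by (rule tensor_same(1)[OF sweedler_facts(1) same_H8[OF q], symmetric])
  note db = dual_basis_tensor[OF M.k_alg N.k_alg M.dual_basis_nil N.dual_basis_nil, unfolded T]
  have "has_dimension D (card ?I)"
    by (rule dual_basis_dimension[OF kD dual_basis_transport[OF W.HK.k_algebra_tensor kD db l]])
      (simp_all only: FG GF cD W.Q_simps)
  then show "has_dimension D 32" by (simp add: card_cartesian_product)
qed

end

theorem proposition5p2:
  fixes q :: "'k::field"
  assumes "q ^ 4 = 1" and "\<forall>m\<in>{1..<4}. q ^ m \<noteq> 1"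
  shows "\<exists>\<sigma>.
    {\<tau> \<in> characters (H16 q). \<tau> (g1 q) = 1 \<and> \<tau> (g2 q) = -1 \<and> \<tau> (x16 q) = 0} = {\<sigma>} \<and>
    {(\<tau>, v). \<tau> \<in> characters (H16 q) \<and> v \<in> carrier (H16 q) \<and> theta_datum (H16 q) \<tau> v}
      = {(\<sigma>, g2 q)} \<and>
    quasi_hopf_algebra (theta_ext (H16 q) \<sigma> (g2 q)) \<and>
    has_dimension (theta_ext (H16 q) \<sigma> (g2 q)) 32 \<and>
    quasi_hopf_isomorphic (theta_ext (H16 q) \<sigma> (g2 q)) (quasi_hopf_tensor sweedler (H8 q))"
proof -
  have q2: "q * q \<noteq> 1" using assms(2)[rule_format, of 2] by (simp add: power2_eq_square)
  have "(q * q) * (q * q) = 1" using assms(1) by (simp add: power4_eq_xxxx mult_ac)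
  then have qq: "q * q = - 1" using q2 square_eq_1_iff[of "q * q"] by simp
  have "(2::'k) \<noteq> 0"
  proof
    assume "(2::'k) = 0"
    then have "(1::'k) + 1 = 0" by simp
    then have "- 1 = (1::'k)" by (rule minus_unique)
    then show False using qq q2 by simp
  qed
  with qq have q: "quartic q" by (simp add: quartic_def)
  obtain \<sigma> where \<sigma>: "\<sigma> \<in> characters (H16 q)" "\<sigma> (J q f8) = 0" "\<sigma> (g2 q) = - 1"
    using distinguished_character[OF q] by blast
  have hom: "\<tau> \<in> alg_hom (H16 q) scalars" if "\<tau> \<in> characters (H16 q)" for \<tau>
    using that by (simp add: characters_def)
  have 1: "{\<tau> \<in> characters (H16 q). \<tau> (g1 q) = 1 \<and> \<tau> (g2 q) = -1 \<and> \<tau> (x16 q) = 0} = {\<sigma>}"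
  proof (intro Set.set_eqI iffI)
    fix \<tau> assume "\<tau> \<in> {\<tau> \<in> characters (H16 q). \<tau> (g1 q) = 1 \<and> \<tau> (g2 q) = -1 \<and> \<tau> (x16 q) = 0}"
    then have t: "\<tau> \<in> characters (H16 q)" "\<tau> (g1 q) = 1" "\<tau> (g2 q) = -1" by blast+
    have "\<tau> (J q f8) = 0" using character_g1(1)[OF q hom[OF t(1)]] t(2) by blast
    then have "\<tau> = \<sigma>" by (intro character_eqI[OF q t(1) \<sigma>(1)]) (simp_all only: \<sigma> t)
    then show "\<tau> \<in> {\<sigma>}" by blast
  next
    fix \<tau> assume "\<tau> \<in> {\<sigma>}"
    then have t: "\<tau> = \<sigma>" by blast
    show "\<tau> \<in> {\<tau> \<in> characters (H16 q). \<tau> (g1 q) = 1 \<and> \<tau> (g2 q) = -1 \<and> \<tau> (x16 q) = 0}"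
      unfolding t using \<sigma> character_g1[OF q hom[OF \<sigma>(1)]] by blast
  qed
  have 2: "{(\<tau>, v). \<tau> \<in> characters (H16 q) \<and> v \<in> carrier (H16 q) \<and> theta_datum (H16 q) \<tau> v} = {(\<sigma>, g2 q)}"
    unfolding datum_iff[OF q \<sigma>] by blast
  note e = hom[OF \<sigma>(1)] \<sigma>(2,3)
  show ?thesis
    using 1 2 extension_quasi_hopf[OF q e] extension_tensor_product[OF q e] by blast
qed

end
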